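(* Let $\mu,\sigma,M>0$, $c\in(0,1)$, $\omega_1,\omega_2>0$ with $\omega_1+\omega_2=1$, $0<\delta_1<\delta_2$, $\beta(t)=\sum_{i=1}^2\omega_i\mathrm{e}^{-\delta_it}$, $\theta_{i,3}=\frac{-\mu+\sqrt{\mu^2+2\delta_i\sigma^2}}{\sigma^2}$, $\theta_{i,4}=\frac{\mu+\sqrt{\mu^2+2\delta_i\sigma^2}}{\sigma^2}$. Let $x_2$ be the unique positive solution of $$\sum_{i=1}^2\omega_i\Big[-\frac{c}{\theta_{i,3}\mathrm{e}^{\theta_{i,3}x_2}+\theta_{i,4}\mathrm{e}^{-\theta_{i,4}x_2}}\big(\theta_{i,3}^2\mathrm{e}^{\theta_{i,3}x_2}-\theta_{i,4}^2\mathrm{e}^{-\theta_{i,4}x_2}\big)\Big]=0,$$ and suppose $$0<c\le\frac{1}{\sum_{i=1}^2\omega_i\frac{\theta_{i,3}+\theta_{i,4}}{\theta_{i,3}\mathrm{e}^{\theta_{i,3}x_2}+\theta_{i,4}\mathrm{e}^{-\theta_{i,4}x_2}}}.$$ For $i=1,2$ let $V_i(x)=\tilde A_{i,3}\mathrm{e}^{\theta_{i,3}x}+\tilde A_{i,4}\mathrm{e}^{-\theta_{i,4}x}$ for $x\in[0,x_2)$ and $V_i(x)=-cx+\tilde A_{i,5}$ for $x\ge x_2$, where $\tilde A_{i,3}=-\tilde A_{i,4}=-\frac{c}{\theta_{i,3}\mathrm{e}^{\theta_{i,3}x_2}+\theta_{i,4}\mathrm{e}^{-\theta_{i,4}x_2}}$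 and $\tilde A_{i,5}=cx_2+\tilde A_{i,3}\mathrm{e}^{\theta_{i,3}x_2}+\tilde A_{i,4}\mathrm{e}^{-\theta_{i,4}x_2}$. Then $$f(x,t,s)=\sum_{i=1}^2\omega_i\mathrm{e}^{-\delta_i(t-s)}V_i(x)\quad(x\ge0,\ t\ge0,\ s\in[0,t]),\qquad V(x)=\sum_{i=1}^2\omega_iV_i(x)\quad(x\ge 0)$$ are a solution to the extended HJB system (stated in the context) under the discount function $\beta$, and $V$ is decreasing and convex on $[0,+\infty)$. Furthermore, let $\hat\Pi(x,t):=0$ on $\tilde{\mathcal{Q}}=[0,\infty)^2$ and $\hat\Xi:=(W^{\hat\Xi},P^{\hat\Xi})$ with $W^{\hat\Xi}=\{(x,t)\in\tilde{\mathcal{Q}}:0\le x<x_2\}$, $P^{\hat\Xi}=\{(x,t)\in\tilde{\mathcal{Q}}:x\ge x_2\}$. Then $(\hat\Pi,\hat\Xi)$ is an equilibrium regular-singular control law and $V$ is the corresponding equilibrium value function for the objective $$J(x,t;\pi,\xi)=\mathbb{E}_{x,t}\Big[\int_t^{\tau_t^{x,t;\pi,\xi}}\beta(r-t)\pi_r\,\mathrm{d}r-c\int_t^{\tau_t^{x,t;\pi,\xi}}\beta(r-t)\,\mathrm{d}\xi_r\Big].$$ Besides, $(\hat\Pi,\hat\Xi)$ is a mild equilibrium.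
   Context: **Extended HJB system.** Let $\tilde{\mathcal{Q}}=[0,\infty)^2$ (points $(x,t)$), and regard $V(x)$ as $V(x,t)$ independent of $t$. With $\hat\Pi\equiv0$ as in the claim, $W:=\{(x,t)\in\tilde{\mathcal{Q}}:-c-V_x(x,t)>0\}$, $P:=\{(x,t)\in\tilde{\mathcal{Q}}:-c-V_x(x,t)=0\}$, the system consists of: - $\hat\Pi(x,t)\in\operatorname{argmin}_{u\in[0,M]}\{V_t(x,t)+(\mu+u)V_x(x,t)+\frac12\sigma^2V_{xx}(x,t)+u-f_s(x,t,t)\}$ for all $(x,t)\in\tilde{\mathcal{Q}}$; - $\min\{V_t+(\mu+\hat\Pi)V_x+\frac12\sigma^2V_{xx}+\hat\Pi-f_s(x,t,t),\ -c-V_x\}=0$ for all $(x,t)\in\tilde{\mathcal{Q}}$, and $V(0,t)=0$; - $f_t(x,t,s)+(\mu+\hat\Pi(x,t))f_x(x,t,s)+\frac12\sigma^2f_{xx}(x,t,s)+\beta(t-s)\hat\Pi(x,t)=0$ for $(x,t)\in\overline{W}$, $s\in[0,t]$; - $-\beta(t-s)c-f_x(x,t,s)=0$ for $(x,t)\in P$, $s\in[0,t]$, and $f(0,t,s)=0$. Convention: $f$ is $C^1$ but $f_{xx}$ may jump at $x_2$; at $x=x_2$ use $f_{xx}(x_2-,t,s)$. Derivatives at $x=0$ are one-sided. **Effort and dividend problem.** $(\Omega,\mathcal{F},\{\mathcal{F}_t\}_{t\ge0},\mathbb{P})$ is a filtered complete probability space satisfying the usual conditions with a standard one-dimensional Brownian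 motion $B$. $U=[0,M]$. For controls $\pi$ ($U$-valued, effort) and $\xi$ (nondecreasing càdlàg, cumulative dividends, $\xi_{t-}=0$; nothing depends on the initial level of $\xi$), the surplus solves (S) $\mathrm{d}X^{\pi,\xi}_r=(\mu+\pi_r)\mathrm{d}r+\sigma\mathrm{d}B_r-\mathrm{d}\xi_r$, $r\in[t,\tau_t^{x,t;\pi,\xi}]$, $X^{\pi,\xi}_{t-}=x$, with $\tau_t^{x,t;\pi,\xi}:=\inf\{r\ge t:X_r^{\pi,\xi}=0\}$ ($[t,\tau]$ means $[t,\infty)$ if $\tau=\infty$). The objective, to be minimized, is $J$ as in the claim, where the $\mathrm{d}\xi$-integral over $[t,\tau]$ includes all jumps $\Delta\xi_r=\xi_r-\xi_{r-}$, $r\in[t,\tau]$, also at $r=t$. **Integrability condition (b)** for $(\pi,\xi)$ with ruin time $\tau$: $\mathbb{E}_{x,t}\int_t^\tau\beta(r-t)|\pi_r|\mathrm{d}r<\infty$ and $\mathbb{E}_{x,t}\int_t^\tau\beta(r-t)\,c\,\mathrm{d}\xi_r<\infty$. **Admissible law.** $\Pi$: $U$-valued Borel function on $\tilde{\mathcal{Q}}$; $\Xi=(W^\Xi,P^\Xi)$: Borel division of $\tilde{\mathcal{Q}}$ into a waiting region $W^\Xi$ and its complement $P^\Xi$. $(\Pi,\Xi)$ is admissible if for every $(x,t)$ the Skorokhod reflection problem [$X$ solves (S) with $\pi_r=\Pi(X_r,r)$; $(X_r,r)\in\overline{W^\Xi}$; $\xi_r=\int_t^r1_{\{(X_l,l)\in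 P^\Xi\}}\mathrm{d}\xi_l$; for $r\in[t,\tau]$, $\tau$ the first zero of $X$; in particular if $x>x_2$ in the claim's law there is an initial jump to $x_2$] has a unique strong solution $(X^{x,t;\Pi,\Xi},\xi^{x,t;\Pi,\Xi})$ and, with $\pi^{x,t;\Pi,\Xi}_r:=\Pi(X_r^{x,t;\Pi,\Xi},r)$, (b) holds. Put $J(x,t;\Pi,\Xi):=J(x,t;\pi^{x,t;\Pi,\Xi},\xi^{x,t;\Pi,\Xi})$. **Admissible control pairs.** $\mathcal{D}^{x,t}$: pairs $(\pi,\xi)$, $\pi=\{\pi_r\}_{r\ge t}$ $U$-valued progressively measurable, $\xi=\{\xi_r\}_{r\ge t}$ nondecreasing càdlàg adapted, $\xi_{t-}=0$, $\Delta\xi_r\le X^{\pi,\xi}_{r-}$, (S) has a unique strong solution, and (b) holds. **Perturbed pair.** Given an admissible law $(\hat\Pi,\hat\Xi)$, controls $(u,\eta)$ with state $X^{u,\eta}$ and $\tau:=\tau_t^{x,t;u,\eta}$, and $h>0$: $(\pi^h,\xi^h)$ and its state equal $(u,\eta)$ and $X^{u,\eta}$ on $[t,\tau]$ if $\tau<t+h$ (and the process then ends), and on $[t,t+h)$ if $\tau\ge t+h$; in the latter case from time $t+h$ until ruin they equal the controls (with $\xi^h$ continuing from the value $\eta_{(t+h)-}$) and state generated by $(\hat\Pi,\hat\Xi)$ started at time $t+h$ from surplus $X^{u,\eta}_{(t+h)-}$. **Equilibrium.** $\tilde{\mathcal{D}}^{x,t;\hat\Pi,\hat\Xi}$ is the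 set of $(u,\eta)\in\mathcal{D}^{x,t}$ for which there are $\tilde h,\tilde M>0$ with $\eta_{(t+h)-}-\eta_t\le\tilde Mh$ a.s. and $(\pi^h,\xi^h)$ satisfying (b), for all $h\in(0,\tilde h)$. An admissible law $(\hat\Pi,\hat\Xi)$ is an equilibrium if for all $(x,t)\in\tilde{\mathcal{Q}}$ and $(u,\eta)\in\tilde{\mathcal{D}}^{x,t;\hat\Pi,\hat\Xi}$, (E) $\liminf_{h\downarrow0}\frac{J(x,t;\pi^h,\xi^h)-J(x,t;\hat\Pi,\hat\Xi)}{h}\ge0$. Its equilibrium value function is $(x,t)\mapsto J(x,t;\hat\Pi,\hat\Xi)$. **Mild equilibrium.** An admissible law $(\hat\Pi,\hat\Xi)$ is a mild equilibrium if for all $(x,t)\in\tilde{\mathcal{Q}}$: (a) (E) holds for every $(u,\eta)$ with $u$ $U$-valued progressively measurable such that the Skorokhod reflection problem above with $\Xi=\hat\Xi$ and $\pi=u$ has a unique strong solution $(X^{u,\hat\Xi},\xi^{u,\hat\Xi})$, $\eta:=\xi^{u,\hat\Xi}$, and $(\pi^h,\xi^h)$ satisfies (b) for all sufficiently small $h>0$; (b') (E) holds for every $(u,\eta)$ with $\eta$ nondecreasing càdlàg adapted, $\eta_{t-}=0$, $\eta_{(t+h)-}-\eta_t\le\tilde Mh$ a.s. for all $h\in(0,\tilde h)$ for some $\tilde h,\tilde M>0$, such that (S) with $\xi=\eta$ and $\pi_r=\hat\Pi(X_r,r)$ has a unique strong solution $X^{\hat\Pi,\eta}$ up to its first zero,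 $\Delta\eta_r\le X^{\hat\Pi,\eta}_{r-}$, $u_r:=\hat\Pi(X_r^{\hat\Pi,\eta},r)$, and $(\pi^h,\xi^h)$ satisfies (b) for all sufficiently small $h>0$. *)

theory Defs
  imports "HOL-Probability.Probability"
begin

type_synonym 'w process = "real \<Rightarrow> 'w \<Rightarrow> real"

locale brownian_filtered_space = prob_space \<Omega> + complete_measure \<Omega>
  for \<Omega> :: "'w measure" +
  fixes F :: "real \<Rightarrow> 'w measure"  \<comment> \<open>only the times \<open>t \<ge> 0\<close> matter\<close>
    and B :: "'w process"
  assumes F_subalgebra: "0 \<le> t \<Longrightarrow> subalgebra \<Omega> (F t)"
    and F_mono: "0 \<le> s \<Longrightarrow> s \<le> t \<Longrightarrow> sets (F s) \<subseteq> sets (F t)"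
    and F_null: "null_sets \<Omega> \<subseteq> sets (F 0)"
    and F_right_continuous: "0 \<le> t \<Longrightarrow> sets (F t) = (\<Inter>s\<in>{t<..}. sets (F s))"
    and B_adapted: "0 \<le> t \<Longrightarrow> B t \<in> borel_measurable (F t)"
    and B_zero: "AE \<omega> in \<Omega>. B 0 \<omega> = 0"
    and B_continuous: "AE \<omega> in \<Omega>. continuous_on {0..} (\<lambda>t. B t \<omega>)"
    and B_normal: "0 \<le> s \<Longrightarrow> s < t \<Longrightarrow>
      distributed \<Omega> lborel (\<lambda>\<omega>. B t \<omega> - B s \<omega>) (\<lambda>z. ennreal (normal_density 0 (sqrt (t - s)) z))"
    and B_independent: "0 \<le> s \<Longrightarrow> s < t \<Longrightarrow>
      indep_set (sets (F s)) {(\<lambda>\<omega>. B t \<omega> - B s \<omega>) -` A \<inter> space \<Omega> | A. A \<in> sets borel}"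

definition state_space :: "(real \<times> real) set" where
  "state_space = {0..} \<times> {0..}"

definition left_lim :: "(real \<Rightarrow> real) \<Rightarrow> real \<Rightarrow> real" where
  "left_lim g r = Lim (at_left r) g"

definition cadlag_from :: "real \<Rightarrow> (real \<Rightarrow> real) \<Rightarrow> bool" where
  "cadlag_from t g \<longleftrightarrow>
     (\<forall>r\<ge>t. (g \<longlongrightarrow> g r) (at_right r)) \<and> (\<forall>r>t. \<exists>l. (g \<longlongrightarrow> l) (at_left r))"

text \<open>Cumulative dividend paths live on \<open>[t, \<infinity>)\<close> and have the value \<open>0\<close> just before \<open>t\<close>; so
  \<open>g t\<close> is the size of the jump at \<open>t\<close>, and the Stieltjes measure has an atom of that size
  at \<open>t\<close>.\<close>

definition dividend_path :: "real \<Rightarrow> (real \<Rightarrow> real) \<Rightarrow> bool" where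
  "dividend_path t g \<longleftrightarrow> 0 \<le> g t \<and> mono_on {t..} g \<and> cadlag_from t g"

definition stieltjes :: "real \<Rightarrow> (real \<Rightarrow> real) \<Rightarrow> real measure" where
  "stieltjes t g = interval_measure (\<lambda>r. if r < t then 0 else g r)"

definition ruin_time :: "real \<Rightarrow> 'w process \<Rightarrow> 'w \<Rightarrow> ereal" where
  "ruin_time t X \<omega> = Inf (ereal ` {r. t \<le> r \<and> X r \<omega> = 0})"

text \<open>The interval \<open>[t, \<tau>]\<close>, read as \<open>[t, \<infinity>)\<close> if \<open>\<tau> = \<infinity>\<close>.\<close>

definition lifetime :: "real \<Rightarrow> 'w process \<Rightarrow> 'w \<Rightarrow> real set" where
  "lifetime t X \<omega> = {r. t \<le> r \<and> ereal r \<le> ruin_time t X \<omega>}"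

definition feedback :: "(real \<Rightarrow> real \<Rightarrow> real) \<Rightarrow> 'w process \<Rightarrow> 'w process" where
  "feedback \<Phi> X = (\<lambda>r \<omega>. \<Phi> (X r \<omega>) r)"

text \<open>A division \<open>\<Xi>\<close> of the state space is the pair of its waiting region \<open>fst \<Xi>\<close> and its
  payout region \<open>snd \<Xi>\<close>.\<close>

definition borel_division :: "(real \<times> real) set \<times> (real \<times> real) set \<Rightarrow> bool" where
  "borel_division \<Xi> \<longleftrightarrow> fst \<Xi> \<in> sets borel \<and> fst \<Xi> \<subseteq> state_space \<and> snd \<Xi> = state_space - fst \<Xi>"

locale effort_dividend = brownian_filtered_space \<Omega> F B
  for \<Omega> :: "'w measure" and F :: "real \<Rightarrow> 'w measure" and B :: "'w process" +
  fixes \<mu> \<sigma> M c :: real and \<beta> :: "real \<Rightarrow> real"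
begin

definition adapted_from :: "real \<Rightarrow> 'w process \<Rightarrow> bool" where
  "adapted_from t X \<longleftrightarrow> (\<forall>r\<ge>t. X r \<in> borel_measurable (F r))"

definition progressive_from :: "real \<Rightarrow> 'w process \<Rightarrow> bool" where
  "progressive_from t \<pi> \<longleftrightarrow>
     (\<forall>r\<ge>t. (\<lambda>(s, \<omega>). \<pi> s \<omega>) \<in> borel_measurable (restrict_space borel {t..r} \<Otimes>\<^sub>M F r))"

definition effort_process :: "real \<Rightarrow> 'w process \<Rightarrow> bool" where
  "effort_process t \<pi> \<longleftrightarrow>
     (\<forall>r\<ge>t. \<forall>\<omega>\<in>space \<Omega>. \<pi> r \<omega> \<in> {0..M}) \<and> progressive_from t \<pi>"

definition dividend_process :: "real \<Rightarrow> 'w process \<Rightarrow> bool" where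
  "dividend_process t \<xi> \<longleftrightarrow>
     adapted_from t \<xi> \<and> (AE \<omega> in \<Omega>. dividend_path t (\<lambda>r. \<xi> r \<omega>))"

text \<open>The right-hand side of the integrated surplus equation, with surplus \<open>y\<close> just before time
  \<open>t\<close>. The start \<open>y\<close> may be random, as is needed for restarting a control law at a later time.
  For given processes \<open>\<pi>\<close> and \<open>\<xi>\<close> this is itself the solution of the equation.\<close>

definition surplus :: "('w \<Rightarrow> real) \<Rightarrow> real \<Rightarrow> 'w process \<Rightarrow> 'w process \<Rightarrow> 'w process" where
  "surplus y t \<pi> \<xi> r \<omega> =
     y \<omega> + (LINT s:{t..r}|lborel. \<mu> + \<pi> s \<omega>) + \<sigma> * (B r \<omega> - B t \<omega>) - \<xi> r \<omega>"

text \<open>Solutions are only constrained up to their first zero; their values after it are an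
  irrelevant adapted right-continuous continuation with left limits.\<close>

definition strong_solution ::
    "('w \<Rightarrow> real) \<Rightarrow> real \<Rightarrow> 'w process \<Rightarrow> 'w process \<Rightarrow> 'w process \<Rightarrow> bool" where
  "strong_solution y t \<pi> \<xi> X \<longleftrightarrow>
     adapted_from t X \<and>
     (AE \<omega> in \<Omega>. cadlag_from t (\<lambda>r. X r \<omega>) \<and>
        (\<forall>r\<in>lifetime t X \<omega>. X r \<omega> = surplus y t \<pi> \<xi> r \<omega>))"

definition reflected_solution ::
    "(real \<times> real) set \<times> (real \<times> real) set \<Rightarrow> ('w \<Rightarrow> real) \<Rightarrow> real \<Rightarrow>
     'w process \<Rightarrow> 'w process \<Rightarrow> 'w process \<Rightarrow> bool" where
  "reflected_solution \<Xi> y t \<pi> X \<xi> \<longleftrightarrow>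
     dividend_process t \<xi> \<and> strong_solution y t \<pi> \<xi> X \<and>
     (AE \<omega> in \<Omega>. \<forall>r\<in>lifetime t X \<omega>.
        (X r \<omega>, r) \<in> closure (fst \<Xi>) \<and>
        \<xi> r \<omega> = (LINT l:{t..r}|stieltjes t (\<lambda>s. \<xi> s \<omega>). indicator (snd \<Xi>) (X l \<omega>, l)))"

definition uniquely_solvable :: "real \<Rightarrow> ('w process \<Rightarrow> 'w process \<Rightarrow> bool) \<Rightarrow> bool" where
  "uniquely_solvable t Q \<longleftrightarrow>
     (\<exists>X \<xi>. Q X \<xi>) \<and>
     (\<forall>X \<xi> Y \<zeta>. Q X \<xi> \<longrightarrow> Q Y \<zeta> \<longrightarrow>
        (AE \<omega> in \<Omega>. ruin_time t X \<omega> = ruin_time t Y \<omega> \<and>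
           (\<forall>r\<in>lifetime t X \<omega>. X r \<omega> = Y r \<omega> \<and> \<xi> r \<omega> = \<zeta> r \<omega>)))"

definition jumps_covered :: "real \<Rightarrow> real \<Rightarrow> 'w process \<Rightarrow> 'w process \<Rightarrow> bool" where
  "jumps_covered x t X \<xi> \<longleftrightarrow>
     (AE \<omega> in \<Omega>. \<xi> t \<omega> \<le> x \<and>
        (\<forall>r\<in>lifetime t X \<omega>. t < r \<longrightarrow>
           \<xi> r \<omega> - left_lim (\<lambda>s. \<xi> s \<omega>) r \<le> left_lim (\<lambda>s. X s \<omega>) r))"

definition integrable_pair :: "real \<Rightarrow> real \<Rightarrow> 'w process \<Rightarrow> 'w process \<Rightarrow> bool" where
  "integrable_pair x t \<pi> \<xi> \<longleftrightarrow>
     (let L = lifetime t (surplus (\<lambda>_. x) t \<pi> \<xi>) in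
       (\<integral>\<^sup>+\<omega>. (\<integral>\<^sup>+r\<in>L \<omega>. ennreal (\<beta> (r - t) * \<bar>\<pi> r \<omega>\<bar>) \<partial>lborel) \<partial>\<Omega>) < \<infinity> \<and>
       (\<integral>\<^sup>+\<omega>. (\<integral>\<^sup>+r\<in>L \<omega>. ennreal (\<beta> (r - t) * c) \<partial>stieltjes t (\<lambda>s. \<xi> s \<omega>)) \<partial>\<Omega>) < \<infinity>)"

definition J :: "real \<Rightarrow> real \<Rightarrow> 'w process \<Rightarrow> 'w process \<Rightarrow> real" where
  "J x t \<pi> \<xi> =
     (let L = lifetime t (surplus (\<lambda>_. x) t \<pi> \<xi>) in
       expectation (\<lambda>\<omega>. (LINT r:L \<omega>|lborel. \<beta> (r - t) * \<pi> r \<omega>)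
         - c * (LINT r:L \<omega>|stieltjes t (\<lambda>s. \<xi> s \<omega>). \<beta> (r - t))))"

text \<open>A choice of the solution generated by a feedback law; it is unique up to
  indistinguishability on \<open>[t, \<tau>]\<close> when the law is admissible.\<close>

definition law_solution ::
    "(real \<Rightarrow> real \<Rightarrow> real) \<Rightarrow> (real \<times> real) set \<times> (real \<times> real) set \<Rightarrow>
     ('w \<Rightarrow> real) \<Rightarrow> real \<Rightarrow> 'w process \<times> 'w process" where
  "law_solution \<Phi> \<Xi> y t = (SOME (X, \<xi>). reflected_solution \<Xi> y t (feedback \<Phi> X) X \<xi>)"

definition law_effort ::
    "(real \<Rightarrow> real \<Rightarrow> real) \<Rightarrow> (real \<times> real) set \<times> (real \<times> real) set \<Rightarrow>
     ('w \<Rightarrow> real) \<Rightarrow> real \<Rightarrow> 'w process" where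
  "law_effort \<Phi> \<Xi> y t = feedback \<Phi> (fst (law_solution \<Phi> \<Xi> y t))"

definition law_dividend ::
    "(real \<Rightarrow> real \<Rightarrow> real) \<Rightarrow> (real \<times> real) set \<times> (real \<times> real) set \<Rightarrow>
     ('w \<Rightarrow> real) \<Rightarrow> real \<Rightarrow> 'w process" where
  "law_dividend \<Phi> \<Xi> y t = snd (law_solution \<Phi> \<Xi> y t)"

definition J_law ::
    "(real \<Rightarrow> real \<Rightarrow> real) \<Rightarrow> (real \<times> real) set \<times> (real \<times> real) set \<Rightarrow> real \<Rightarrow> real \<Rightarrow> real" where
  "J_law \<Phi> \<Xi> x t = J x t (law_effort \<Phi> \<Xi> (\<lambda>_. x) t) (law_dividend \<Phi> \<Xi> (\<lambda>_. x) t)"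

definition admissible_law ::
    "(real \<Rightarrow> real \<Rightarrow> real) \<Rightarrow> (real \<times> real) set \<times> (real \<times> real) set \<Rightarrow> bool" where
  "admissible_law \<Phi> \<Xi> \<longleftrightarrow>
     (\<forall>(x, t)\<in>state_space. \<Phi> x t \<in> {0..M}) \<and>
     (\<lambda>(x, t). \<Phi> x t) \<in> borel_measurable (restrict_space borel state_space) \<and>
     borel_division \<Xi> \<and>
     (\<forall>(x, t)\<in>state_space.
        uniquely_solvable t (\<lambda>X \<xi>. reflected_solution \<Xi> (\<lambda>_. x) t (feedback \<Phi> X) X \<xi>) \<and>
        integrable_pair x t (law_effort \<Phi> \<Xi> (\<lambda>_. x) t) (law_dividend \<Phi> \<Xi> (\<lambda>_. x) t))"

definition admissible_pairs :: "real \<Rightarrow> real \<Rightarrow> ('w process \<times> 'w process) set" where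
  "admissible_pairs x t = {(\<pi>, \<xi>).
     effort_process t \<pi> \<and> dividend_process t \<xi> \<and>
     uniquely_solvable t (\<lambda>X \<zeta>. \<zeta> = \<xi> \<and> strong_solution (\<lambda>_. x) t \<pi> \<xi> X) \<and>
     jumps_covered x t (surplus (\<lambda>_. x) t \<pi> \<xi>) \<xi> \<and>
     integrable_pair x t \<pi> \<xi>}"

definition ruined_before :: "real \<Rightarrow> real \<Rightarrow> 'w process \<Rightarrow> 'w process \<Rightarrow> real \<Rightarrow> 'w \<Rightarrow> bool" where
  "ruined_before x t u \<eta> h \<omega> \<longleftrightarrow> ruin_time t (surplus (\<lambda>_. x) t u \<eta>) \<omega> < ereal (t + h)"

text \<open>The surplus from which the law is restarted at time \<open>t + h\<close>. On the event of ruin before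
  \<open>t + h\<close> the restarted solution is never used, and the value \<open>0\<close> is a placeholder.\<close>

definition restart_surplus :: "real \<Rightarrow> real \<Rightarrow> 'w process \<Rightarrow> 'w process \<Rightarrow> real \<Rightarrow> 'w \<Rightarrow> real" where
  "restart_surplus x t u \<eta> h \<omega> =
     (if ruined_before x t u \<eta> h \<omega> then 0
      else left_lim (\<lambda>r. surplus (\<lambda>_. x) t u \<eta> r \<omega>) (t + h))"

definition perturbed_effort ::
    "(real \<Rightarrow> real \<Rightarrow> real) \<Rightarrow> (real \<times> real) set \<times> (real \<times> real) set \<Rightarrow> real \<Rightarrow> real \<Rightarrow>
     'w process \<Rightarrow> 'w process \<Rightarrow> real \<Rightarrow> 'w process" where
  "perturbed_effort \<Phi> \<Xi> x t u \<eta> h r \<omega> =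
     (if ruined_before x t u \<eta> h \<omega> \<or> r < t + h then u r \<omega>
      else law_effort \<Phi> \<Xi> (restart_surplus x t u \<eta> h) (t + h) r \<omega>)"

definition perturbed_dividend ::
    "(real \<Rightarrow> real \<Rightarrow> real) \<Rightarrow> (real \<times> real) set \<times> (real \<times> real) set \<Rightarrow> real \<Rightarrow> real \<Rightarrow>
     'w process \<Rightarrow> 'w process \<Rightarrow> real \<Rightarrow> 'w process" where
  "perturbed_dividend \<Phi> \<Xi> x t u \<eta> h r \<omega> =
     (if ruined_before x t u \<eta> h \<omega> \<or> r < t + h then \<eta> r \<omega>
      else left_lim (\<lambda>s. \<eta> s \<omega>) (t + h) +
        law_dividend \<Phi> \<Xi> (restart_surplus x t u \<eta> h) (t + h) r \<omega>)"

definition perturbed_integrable ::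
    "(real \<Rightarrow> real \<Rightarrow> real) \<Rightarrow> (real \<times> real) set \<times> (real \<times> real) set \<Rightarrow> real \<Rightarrow> real \<Rightarrow>
     'w process \<Rightarrow> 'w process \<Rightarrow> real \<Rightarrow> bool" where
  "perturbed_integrable \<Phi> \<Xi> x t u \<eta> h \<longleftrightarrow>
     integrable_pair x t (perturbed_effort \<Phi> \<Xi> x t u \<eta> h) (perturbed_dividend \<Phi> \<Xi> x t u \<eta> h)"

definition growth_bounded :: "real \<Rightarrow> 'w process \<Rightarrow> real \<Rightarrow> real \<Rightarrow> bool" where
  "growth_bounded t \<eta> K h \<longleftrightarrow> (AE \<omega> in \<Omega>. left_lim (\<lambda>r. \<eta> r \<omega>) (t + h) - \<eta> t \<omega> \<le> K * h)"

definition no_first_order_gain ::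
    "(real \<Rightarrow> real \<Rightarrow> real) \<Rightarrow> (real \<times> real) set \<times> (real \<times> real) set \<Rightarrow> real \<Rightarrow> real \<Rightarrow>
     'w process \<Rightarrow> 'w process \<Rightarrow> bool" where
  "no_first_order_gain \<Phi> \<Xi> x t u \<eta> \<longleftrightarrow>
     Liminf (at_right 0) (\<lambda>h. ereal
       ((J x t (perturbed_effort \<Phi> \<Xi> x t u \<eta> h) (perturbed_dividend \<Phi> \<Xi> x t u \<eta> h)
          - J_law \<Phi> \<Xi> x t) / h)) \<ge> 0"

definition perturbation_pairs ::
    "(real \<Rightarrow> real \<Rightarrow> real) \<Rightarrow> (real \<times> real) set \<times> (real \<times> real) set \<Rightarrow> real \<Rightarrow> real \<Rightarrow>
     ('w process \<times> 'w process) set" where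
  "perturbation_pairs \<Phi> \<Xi> x t = {(u, \<eta>) \<in> admissible_pairs x t.
     \<exists>h0>0. \<exists>K>0. \<forall>h\<in>{0<..<h0}. growth_bounded t \<eta> K h \<and> perturbed_integrable \<Phi> \<Xi> x t u \<eta> h}"

definition equilibrium_law ::
    "(real \<Rightarrow> real \<Rightarrow> real) \<Rightarrow> (real \<times> real) set \<times> (real \<times> real) set \<Rightarrow> bool" where
  "equilibrium_law \<Phi> \<Xi> \<longleftrightarrow>
     admissible_law \<Phi> \<Xi> \<and>
     (\<forall>(x, t)\<in>state_space. \<forall>(u, \<eta>)\<in>perturbation_pairs \<Phi> \<Xi> x t. no_first_order_gain \<Phi> \<Xi> x t u \<eta>)"

definition mild_equilibrium_law ::
    "(real \<Rightarrow> real \<Rightarrow> real) \<Rightarrow> (real \<times> real) set \<times> (real \<times> real) set \<Rightarrow> bool" where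
  "mild_equilibrium_law \<Phi> \<Xi> \<longleftrightarrow>
     admissible_law \<Phi> \<Xi> \<and>
     (\<forall>(x, t)\<in>state_space.
       (\<forall>u X \<eta>.
          effort_process t u \<longrightarrow>
          uniquely_solvable t (\<lambda>Y \<zeta>. reflected_solution \<Xi> (\<lambda>_. x) t u Y \<zeta>) \<longrightarrow>
          reflected_solution \<Xi> (\<lambda>_. x) t u X \<eta> \<longrightarrow>
          (\<forall>\<^sub>F h in at_right 0. perturbed_integrable \<Phi> \<Xi> x t u \<eta> h) \<longrightarrow>
          no_first_order_gain \<Phi> \<Xi> x t u \<eta>) \<and>
       (\<forall>\<eta> X.
          dividend_process t \<eta> \<longrightarrow>
          (\<exists>h0>0. \<exists>K>0. \<forall>h\<in>{0<..<h0}. growth_bounded t \<eta> K h) \<longrightarrow>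
          uniquely_solvable t
            (\<lambda>Y \<zeta>. \<zeta> = \<eta> \<and> strong_solution (\<lambda>_. x) t (feedback \<Phi> Y) \<eta> Y) \<longrightarrow>
          strong_solution (\<lambda>_. x) t (feedback \<Phi> X) \<eta> X \<longrightarrow>
          jumps_covered x t X \<eta> \<longrightarrow>
          (\<forall>\<^sub>F h in at_right 0. perturbed_integrable \<Phi> \<Xi> x t (feedback \<Phi> X) \<eta> h) \<longrightarrow>
          no_first_order_gain \<Phi> \<Xi> x t (feedback \<Phi> X) \<eta>))"

end

text \<open>The extended HJB system, for functions of \<open>(x, t)\<close> and \<open>(x, t, s)\<close> with \<open>s \<le> t\<close>.
  All derivatives are taken within the domains \<open>x \<ge> 0\<close>, \<open>t \<ge> 0\<close> resp. \<open>t \<ge> s\<close>, and \<open>s \<le> t\<close>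
  (negative \<open>s\<close> included, so that \<open>f\<^sub>s(x,0,0)\<close> makes sense). They are unique, so the existential
  quantifier asserts precisely that they exist. At the point \<open>z\<close>, where \<open>f\<^sub>x\<^sub>x\<close> may jump, the value
  of \<open>fxx\<close> is the left limit.\<close>

definition extended_HJB ::
    "real \<Rightarrow> real \<Rightarrow> real \<Rightarrow> real \<Rightarrow> (real \<Rightarrow> real) \<Rightarrow> real \<Rightarrow> (real \<Rightarrow> real \<Rightarrow> real) \<Rightarrow>
     (real \<Rightarrow> real \<Rightarrow> real) \<Rightarrow> (real \<Rightarrow> real \<Rightarrow> real \<Rightarrow> real) \<Rightarrow> bool" where
  "extended_HJB \<mu> \<sigma> M c \<beta> z \<Phi> V f \<longleftrightarrow>
     (\<exists>Vt Vx Vxx ft fx fxx fs.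
       let D = {(x, t, s). 0 \<le> x \<and> 0 \<le> s \<and> s \<le> t};
           W = {(x, t)\<in>state_space. - c - Vx x t > 0};
           P = {(x, t)\<in>state_space. - c - Vx x t = 0}
       in
       (\<forall>(x, t)\<in>state_space.
          ((\<lambda>r. V x r) has_real_derivative Vt x t) (at t within {0..}) \<and>
          ((\<lambda>y. V y t) has_real_derivative Vx x t) (at x within {0..}) \<and>
          ((\<lambda>y. Vx y t) has_real_derivative Vxx x t) (at x within {0..})) \<and>
       (\<forall>(x, t, s)\<in>D.
          ((\<lambda>r. f x r s) has_real_derivative ft x t s) (at t within {s..}) \<and>
          ((\<lambda>y. f y t s) has_real_derivative fx x t s) (at x within {0..}) \<and>
          ((\<lambda>q. f x t q) has_real_derivative fs x t s) (at s within {..t}) \<and>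
          (x \<noteq> z \<longrightarrow> ((\<lambda>y. fx y t s) has_real_derivative fxx x t s) (at x within {0..})) \<and>
          ((\<lambda>y. fxx y t s) \<longlongrightarrow> fxx z t s) (at_left z)) \<and>
       continuous_on D (\<lambda>(x, t, s). ft x t s) \<and>
       continuous_on D (\<lambda>(x, t, s). fx x t s) \<and>
       continuous_on D (\<lambda>(x, t, s). fs x t s) \<and>
       (\<forall>(x, t)\<in>state_space.
          is_arg_min
            (\<lambda>u. Vt x t + (\<mu> + u) * Vx x t + 1/2 * \<sigma>\<^sup>2 * Vxx x t + u - fs x t t)
            (\<lambda>u. u \<in> {0..M}) (\<Phi> x t)) \<and>
       (\<forall>(x, t)\<in>state_space.
          min (Vt x t + (\<mu> + \<Phi> x t) * Vx x t + 1/2 * \<sigma>\<^sup>2 * Vxx x t + \<Phi> x t - fs x t t)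
              (- c - Vx x t) = 0) \<and>
       (\<forall>t\<ge>0. V 0 t = 0) \<and>
       (\<forall>(x, t)\<in>closure W. \<forall>s\<in>{0..t}.
          ft x t s + (\<mu> + \<Phi> x t) * fx x t s + 1/2 * \<sigma>\<^sup>2 * fxx x t s + \<beta> (t - s) * \<Phi> x t = 0) \<and>
       (\<forall>(x, t)\<in>P. \<forall>s\<in>{0..t}. - \<beta> (t - s) * c - fx x t s = 0) \<and>
       (\<forall>t\<ge>0. \<forall>s\<in>{0..t}. f 0 t s = 0))"

text \<open>In the following, \<open>d\<close> stands for one of the two discount rates \<open>\<delta> 1\<close>, \<open>\<delta> 2\<close>.\<close>

definition theta3 :: "real \<Rightarrow> real \<Rightarrow> real \<Rightarrow> real" where
  "theta3 \<mu> \<sigma> d = (- \<mu> + sqrt (\<mu>\<^sup>2 + 2 * d * \<sigma>\<^sup>2)) / \<sigma>\<^sup>2"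

definition theta4 :: "real \<Rightarrow> real \<Rightarrow> real \<Rightarrow> real" where
  "theta4 \<mu> \<sigma> d = (\<mu> + sqrt (\<mu>\<^sup>2 + 2 * d * \<sigma>\<^sup>2)) / \<sigma>\<^sup>2"

definition slope_term :: "real \<Rightarrow> real \<Rightarrow> real \<Rightarrow> real \<Rightarrow> real" where
  "slope_term \<mu> \<sigma> d x =
     theta3 \<mu> \<sigma> d * exp (theta3 \<mu> \<sigma> d * x) + theta4 \<mu> \<sigma> d * exp (- theta4 \<mu> \<sigma> d * x)"

definition barrier_equation ::
    "real \<Rightarrow> real \<Rightarrow> real \<Rightarrow> (nat \<Rightarrow> real) \<Rightarrow> (nat \<Rightarrow> real) \<Rightarrow> real \<Rightarrow> bool" where
  "barrier_equation \<mu> \<sigma> c w \<delta> x \<longleftrightarrow>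
     (\<Sum>i=1..2. w i * (- (c / slope_term \<mu> \<sigma> (\<delta> i) x) *
        ((theta3 \<mu> \<sigma> (\<delta> i))\<^sup>2 * exp (theta3 \<mu> \<sigma> (\<delta> i) * x)
         - (theta4 \<mu> \<sigma> (\<delta> i))\<^sup>2 * exp (- theta4 \<mu> \<sigma> (\<delta> i) * x)))) = 0"

definition coeff3 :: "real \<Rightarrow> real \<Rightarrow> real \<Rightarrow> real \<Rightarrow> real \<Rightarrow> real" where
  "coeff3 \<mu> \<sigma> c x2 d = - (c / slope_term \<mu> \<sigma> d x2)"

definition coeff4 :: "real \<Rightarrow> real \<Rightarrow> real \<Rightarrow> real \<Rightarrow> real \<Rightarrow> real" where
  "coeff4 \<mu> \<sigma> c x2 d = - coeff3 \<mu> \<sigma> c x2 d"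

definition coeff5 :: "real \<Rightarrow> real \<Rightarrow> real \<Rightarrow> real \<Rightarrow> real \<Rightarrow> real" where
  "coeff5 \<mu> \<sigma> c x2 d = c * x2 + coeff3 \<mu> \<sigma> c x2 d * exp (theta3 \<mu> \<sigma> d * x2)
     + coeff4 \<mu> \<sigma> c x2 d * exp (- theta4 \<mu> \<sigma> d * x2)"

definition exponential_value :: "real \<Rightarrow> real \<Rightarrow> real \<Rightarrow> real \<Rightarrow> real \<Rightarrow> real \<Rightarrow> real" where
  "exponential_value \<mu> \<sigma> c x2 d x =
     (if x < x2
      then coeff3 \<mu> \<sigma> c x2 d * exp (theta3 \<mu> \<sigma> d * x)
         + coeff4 \<mu> \<sigma> c x2 d * exp (- theta4 \<mu> \<sigma> d * x)
      else - c * x + coeff5 \<mu> \<sigma> c x2 d)"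

end

theory Submission
  imports Defs
begin

text \<open>
  Since \<open>\<beta>\<close> is a mixture of two exponentials, the payoff of the barrier law splits into two
  exponentially discounted ones. Each of them is \<open>V\<^sub>i\<close>: for the reflected surplus \<open>X\<close> the functions
  \<open>exp (- \<delta>\<^sub>i r + \<theta> X\<^sub>r)\<close> at the two characteristic exponents \<open>\<theta>\<close> are martingales up to the dividend
  payments, so no stochastic integral is needed: exact exponential moments of Brownian increments are
  summed over a dyadic grid, and the sums of the payments converge to Stieltjes integrals. The
  dominating function comes from Doob's maximal inequality.

  For a deviation on \<open>[t, t + h)\<close>, \<open>z = x - \<eta>\<^sub>t\<close> being the surplus after the initial payment, a second
  order expansion of \<open>V\<close> at \<open>z\<close> is used if the deviation neither leads to ruin before \<open>t + h\<close> nor pays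
  more than \<open>K h\<close> after time \<open>t\<close>, and convexity otherwise. As \<open>- 1 \<le> V' \<le> - c\<close> neither effort nor early dividends
  pay off, the first order term in the Brownian motion vanishes by optional stopping, and what is
  left in the limit \<open>h \<rightarrow> 0\<close> is the left-hand side of the HJB equation at \<open>z\<close>, which is nonnegative.
\<close>

section \<open>Increments of the Brownian motion\<close>

text \<open>The law is known only through a chosen solution of a reflection problem, and that
  solution only up to ruin. Every expectation is therefore moved to the explicit running-maximum
  solution, whose existence, uniqueness and adaptedness are shown pathwise; the completed filtration
  absorbs the null sets. This solution is allowed to start from a random level at time
  \<open>T\<close>, so the cost after a restart at \<open>t + h\<close> is the same identity
  integrated over that level, and no conditional expectation is formed. Of the two exponentials the
  difference \<open>exp (p x) - exp (- q x)\<close> is taken because it vanishes at 0: ruin then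
  contributes nothing. Only a lower bound for the perturbed objective is needed, so dividends paid
  before \<open>t + h\<close> may be counted undiscounted. The obstacle in the deviation estimate is
  that the event on which the expansion fails is not independent of the Brownian increment; the
  square of the increment on it is split by Young's inequality, with a parameter \<open>l\<close>
  that is fixed large before \<open>h\<close> tends to 0.\<close>

lemma (in complete_measure) borel_measurable_AE_cong:
  fixes f g :: "'a \<Rightarrow> 'b::topological_space"
  assumes f: "f \<in> borel_measurable M" and eq: "AE x in M. f x = g x"
  shows "g \<in> borel_measurable M"
proof (rule measurableI)
  fix A :: "'b set" assume "A \<in> sets borel"
  with f have "f -` A \<inter> space M \<in> sets M" by (rule measurable_sets)
  then show "g -` A \<inter> space M \<in> sets M"
    by (rule in_sets_AE[rotated]) (use eq in \<open>auto elim!: eventually_mono\<close>)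
qed simp

context brownian_filtered_space
begin

lemma space_F [simp]: "0 \<le> t \<Longrightarrow> space (F t) = space \<Omega>"
  using F_subalgebra by (auto simp: subalgebra_def)

lemma F_sets: "0 \<le> t \<Longrightarrow> A \<in> sets (F t) \<Longrightarrow> A \<in> sets \<Omega>"
  using F_subalgebra by (auto simp: subalgebra_def)

lemma F_measurable: "0 \<le> t \<Longrightarrow> f \<in> measurable (F t) N \<Longrightarrow> f \<in> measurable \<Omega> N"
  using F_subalgebra measurable_from_subalg by blast

lemma F_measurable_mono: "0 \<le> s \<Longrightarrow> s \<le> t \<Longrightarrow> f \<in> measurable (F s) N \<Longrightarrow> f \<in> measurable (F t) N"
  by (rule measurable_from_subalg[of "F t" "F s"]) (auto simp: subalgebra_def F_mono)

lemma F_null_subset: "0 \<le> t \<Longrightarrow> A \<in> null_sets \<Omega> \<Longrightarrow> A \<in> sets (F t)"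
  using F_null F_mono[of 0 t] by auto

text \<open>All null sets lie in \<open>F t\<close>, so \<open>C\<close> is \<open>A\<close>
  corrected by two null sets. Countable descriptions that match the intended event only along
  regular paths thus still give exact membership in \<open>F t\<close>.\<close>

lemma F_sets_AE_cong:
  assumes t: "0 \<le> t" and A: "A \<in> sets (F t)" and C: "C \<subseteq> space \<Omega>"
    and eq: "AE x in \<Omega>. x \<in> A \<longleftrightarrow> x \<in> C"
  shows "C \<in> sets (F t)"
proof -
  have CO: "C \<in> sets \<Omega>" using in_sets_AE[OF eq F_sets[OF t A] C] .
  have "AE x in \<Omega>. x \<notin> C - A \<and> x \<notin> A - C" using eq by eventually_elim auto
  then have "C - A \<in> null_sets \<Omega>" "A - C \<in> null_sets \<Omega>"
    unfolding null_sets_iff_AE using C sets.sets_into_space[OF A] t by auto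
  then have "A \<union> (C - A) - (A - C) \<in> sets (F t)" using A F_null_subset[OF t] by blast
  also have "A \<union> (C - A) - (A - C) = C" by auto
  finally show ?thesis .
qed

lemma F_measurable_AE_cong:
  fixes f g :: "'w \<Rightarrow> 'b::topological_space"
  assumes t: "0 \<le> t" and f: "f \<in> borel_measurable (F t)" and eq: "AE x in \<Omega>. f x = g x"
  shows "g \<in> borel_measurable (F t)"
proof (rule measurableI)
  fix A :: "'b set" assume "A \<in> sets borel"
  with f have "f -` A \<inter> space (F t) \<in> sets (F t)" by (rule measurable_sets)
  then show "g -` A \<inter> space (F t) \<in> sets (F t)"
    by (rule F_sets_AE_cong[OF t]) (use t eq in \<open>auto elim!: eventually_mono\<close>)
qed simp

lemma B_measurable: "0 \<le> t \<Longrightarrow> B t \<in> borel_measurable \<Omega>"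
  using B_adapted F_measurable by blast

lemma B_F_measurable: "0 \<le> s \<Longrightarrow> s \<le> t \<Longrightarrow> B s \<in> borel_measurable (F t)"
  using B_adapted F_measurable_mono by blast

lemma increment_indep_var:
  assumes st: "0 \<le> s" "s < t" and Z: "Z \<in> borel_measurable (F s)"
  shows "indep_var borel Z borel (\<lambda>\<omega>. B t \<omega> - B s \<omega>)"
proof -
  let ?D = "\<lambda>\<omega>. B t \<omega> - B s \<omega>"
  let ?I = "{?D -` A \<inter> space \<Omega> | A. A \<in> sets borel}"
  have D: "?D \<in> borel_measurable \<Omega>" using B_measurable st by auto
  have ZO: "Z \<in> borel_measurable \<Omega>" using F_measurable Z st by blast
  have sub1: "sigma_sets (space \<Omega>) {Z -` A \<inter> space \<Omega> | A. A \<in> sets borel} \<subseteq> sets (F s)"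
  proof -
    have "{Z -` A \<inter> space \<Omega> | A. A \<in> sets borel} \<subseteq> sets (F s)"
      using measurable_sets[OF Z] st by auto
    then show ?thesis using sets.sigma_sets_subset[of _ "F s"] st by simp
  qed
  \<comment> \<open>The preimages of Borel sets under one map already form a sigma algebra, so
    passing to the generated one adds nothing and \<open>B_independent\<close> applies as it
    stands.\<close>
  have sub2: "sigma_sets (space \<Omega>) ?I \<subseteq> ?I"
    using sets_vimage_algebra[of "space \<Omega>" ?D borel] sets_vimage_algebra2[of ?D "space \<Omega>" borel] by simp
  have "indep_set (sigma_sets (space \<Omega>) {Z -` A \<inter> space \<Omega> | A. A \<in> sets borel}) (sigma_sets (space \<Omega>) ?I)"
    unfolding indep_set_def
    by (rule indep_sets_mono_sets[OF B_independent[OF st, unfolded indep_set_def]])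
       (use sub1 sub2 in \<open>auto split: bool.splits\<close>)
  then show ?thesis using D ZO by (simp add: indep_var_eq)
qed

text \<open>Every use of independence passes through this lemma: a factor known at time
  \<open>s\<close> separates from a function of the later increment, whose mean \<open>m\<close> is
  computed from the normal density.\<close>

lemma increment_expectation:
  assumes st: "0 \<le> s" "s < t" and Z: "Z \<in> borel_measurable (F s)" "integrable \<Omega> Z"
    and \<phi>: "\<phi> \<in> borel_measurable borel"
    and I: "has_bochner_integral lborel (\<lambda>z. normal_density 0 (sqrt (t - s)) z * \<phi> z) (m::real)"
  shows "integrable \<Omega> (\<lambda>\<omega>. Z \<omega> * \<phi> (B t \<omega> - B s \<omega>))"
    and "expectation (\<lambda>\<omega>. Z \<omega> * \<phi> (B t \<omega> - B s \<omega>)) = expectation Z * m"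
proof -
  let ?D = "\<lambda>\<omega>. B t \<omega> - B s \<omega>"
  have ind: "indep_var borel Z borel (\<lambda>\<omega>. \<phi> (?D \<omega>))"
    using indep_var_compose[OF increment_indep_var[OF st Z(1)], of id borel \<phi> borel] \<phi>
    by (simp add: comp_def id_def)
  have int: "integrable \<Omega> (\<lambda>\<omega>. \<phi> (?D \<omega>))"
    using distributed_integrable[OF B_normal[OF st], of \<phi>] I \<phi>
    by (auto simp: has_bochner_integral_iff)
  have ex: "expectation (\<lambda>\<omega>. \<phi> (?D \<omega>)) = m"
    using distributed_integral[OF B_normal[OF st], of \<phi>] I \<phi>
    by (auto simp: has_bochner_integral_iff)
  show "integrable \<Omega> (\<lambda>\<omega>. Z \<omega> * \<phi> (?D \<omega>))"
    by (rule indep_var_integrable[OF ind Z(2) int])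
  show "expectation (\<lambda>\<omega>. Z \<omega> * \<phi> (?D \<omega>)) = expectation Z * m"
    using indep_var_lebesgue_integral[OF ind Z(2) int] ex by simp
qed

end

text \<open>Completing the square turns the integrand into a constant times the normal density with
  mean \<open>a * h\<close>.\<close>

lemma normal_exp_moment:
  assumes h: "0 < h"
  shows "has_bochner_integral lborel (\<lambda>z. normal_density 0 (sqrt h) z * exp (a * z)) (exp (a\<^sup>2 * h / 2))"
proof -
  have "normal_density 0 (sqrt h) z * exp (a * z) = exp (a\<^sup>2 * h / 2) * normal_density (a * h) (sqrt h) z" for z
  proof -
    have "- (z - 0)\<^sup>2 / (2 * h) + a * z = a\<^sup>2 * h / 2 + - (z - a * h)\<^sup>2 / (2 * h)"
      using h by (simp add: field_simps power2_eq_square)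
    then have "exp (- (z - 0)\<^sup>2 / (2 * h)) * exp (a * z) = exp (a\<^sup>2 * h / 2) * exp (- (z - a * h)\<^sup>2 / (2 * h))"
      by (simp add: exp_add[symmetric])
    then show ?thesis using h by (simp add: normal_density_def)
  qed
  moreover have "has_bochner_integral lborel (normal_density (a * h) (sqrt h)) 1"
    using h by (simp add: has_bochner_integral_iff)
  ultimately show ?thesis
    using has_bochner_integral_mult_right[of "exp (a\<^sup>2 * h / 2)" lborel "normal_density (a * h) (sqrt h)" 1]
    by simp
qed

lemma normal_moment_1: "0 < h \<Longrightarrow> has_bochner_integral lborel (\<lambda>z. normal_density 0 (sqrt h) z * z) 0"
  using normal_moment_odd[of "sqrt h" 0 0] by simp

lemma normal_moment_2: "0 < h \<Longrightarrow> has_bochner_integral lborel (\<lambda>z. normal_density 0 (sqrt h) z * z\<^sup>2) h"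
  using normal_moment_even[of "sqrt h" 0 1] by (simp add: eval_nat_numeral)

lemma normal_moment_4: "0 < h \<Longrightarrow> has_bochner_integral lborel (\<lambda>z. normal_density 0 (sqrt h) z * z^4) (3 * h\<^sup>2)"
  using normal_moment_even[of "sqrt h" 0 2] by (simp add: eval_nat_numeral field_simps)

section \<open>Doob's maximal inequality on dyadic grids\<close>

lemma pathwise_doob:
  fixes s m :: "nat \<Rightarrow> real"
  assumes m0: "m 0 = s 0" and mS: "\<And>k. m (Suc k) = max (m k) (s (Suc k))"
  shows "(m n)\<^sup>2 \<le> 4 * (s n)\<^sup>2 - 4 * (\<Sum>k<n. m k * (s (Suc k) - s k))"
proof -
  have *: "(m n)\<^sup>2 / 2 + (\<Sum>k<n. m k * (s (Suc k) - s k)) \<le> m n * s n"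
  proof (induction n)
    case 0
    then show ?case using m0 by (simp add: power2_eq_square)
  next
    case (Suc n)
    show ?case
    proof (cases "s (Suc n) \<le> m n")
      case True
      then have "m (Suc n) = m n" using mS by simp
      then show ?thesis using Suc by (simp add: algebra_simps)
    next
      case False
      then have "m (Suc n) = s (Suc n)" using mS by simp
      then show ?thesis using Suc zero_le_power2[of "s (Suc n) - m n"]
        by (simp add: algebra_simps power2_eq_square)
    qed
  qed
  \<comment> \<open>Young's inequality, weighted so that half of \<open>(m n)^2 / 2\<close>
    survives; clearing the remaining quarter produces Doob's constant 4.\<close>
  have "0 \<le> (m n / 2 - s n)\<^sup>2" by simp
  then have "m n * s n \<le> (m n)\<^sup>2 / 4 + (s n)\<^sup>2" by (simp add: power2_eq_square algebra_simps)
  with * show ?thesis by simp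
qed

definition dyadic :: "real \<Rightarrow> nat \<Rightarrow> nat \<Rightarrow> real" where
  "dyadic t n k = t + real k / 2 ^ n"

lemma dyadic_0 [simp]: "dyadic t n 0 = t"
  by (simp add: dyadic_def)

lemma dyadic_Suc: "dyadic t n (Suc k) = dyadic t n k + 1 / 2 ^ n"
  by (simp add: dyadic_def field_simps)

lemma dyadic_less_Suc: "dyadic t n k < dyadic t n (Suc k)"
  by (simp add: dyadic_Suc)

lemma dyadic_mono: "k \<le> l \<Longrightarrow> dyadic t n k \<le> dyadic t n l"
  by (simp add: dyadic_def divide_right_mono)

lemma dyadic_ge: "t \<le> dyadic t n k"
  by (simp add: dyadic_def)

lemma dyadic_end: "dyadic t n (N * 2 ^ n) = t + real N"
  by (simp add: dyadic_def)

lemma dyadic_refine: "dyadic t n k = dyadic t (Suc n) (2 * k)"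
  by (simp add: dyadic_def field_simps)

context brownian_filtered_space
begin

lemma exp_increment_expectation:
  assumes "0 \<le> s" "s < t" "Z \<in> borel_measurable (F s)" "integrable \<Omega> Z"
  shows "integrable \<Omega> (\<lambda>\<omega>. Z \<omega> * exp (a * (B t \<omega> - B s \<omega>)))"
    and "expectation (\<lambda>\<omega>. Z \<omega> * exp (a * (B t \<omega> - B s \<omega>))) = expectation Z * exp (a\<^sup>2 * (t - s) / 2)"
  using increment_expectation[OF assms, of "\<lambda>z. exp (a * z)"] normal_exp_moment[of "t - s" a] assms(2)
  by auto

lemma exp_increment_integrable:
  assumes "0 \<le> s" "s < t"
  shows "integrable \<Omega> (\<lambda>\<omega>. exp (a * (B t \<omega> - B s \<omega>)))"
    and "expectation (\<lambda>\<omega>. exp (a * (B t \<omega> - B s \<omega>))) = exp (a\<^sup>2 * (t - s) / 2)"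
proof -
  have 1: "(\<lambda>_. 1::real) \<in> borel_measurable (F s)" "integrable \<Omega> (\<lambda>_. 1::real)" by simp_all
  show "integrable \<Omega> (\<lambda>\<omega>. exp (a * (B t \<omega> - B s \<omega>)))"
    using exp_increment_expectation(1)[OF assms 1, of a] by (simp only: mult_1)
  show "expectation (\<lambda>\<omega>. exp (a * (B t \<omega> - B s \<omega>))) = exp (a\<^sup>2 * (t - s) / 2)"
    using exp_increment_expectation(2)[OF assms 1, of a] by (simp only: mult_1 lebesgue_integral_const prob_space scaleR_one)
qed

lemma increment_moments:
  assumes st: "0 \<le> s" "s < t"
  shows "integrable \<Omega> (\<lambda>\<omega>. B t \<omega> - B s \<omega>)" "integrable \<Omega> (\<lambda>\<omega>. (B t \<omega> - B s \<omega>)\<^sup>2)"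
    "integrable \<Omega> (\<lambda>\<omega>. (B t \<omega> - B s \<omega>)^4)" "expectation (\<lambda>\<omega>. (B t \<omega> - B s \<omega>)\<^sup>2) = t - s"
    "expectation (\<lambda>\<omega>. (B t \<omega> - B s \<omega>)^4) = 3 * (t - s)\<^sup>2"
proof -
  have 1: "(\<lambda>_. 1::real) \<in> borel_measurable (F s)" "integrable \<Omega> (\<lambda>_. 1::real)" by simp_all
  have h: "0 < t - s" using st by simp
  note * = increment_expectation[OF st 1, simplified]
  show "integrable \<Omega> (\<lambda>\<omega>. B t \<omega> - B s \<omega>)" by (rule *(1)[OF _ normal_moment_1[OF h]]) simp
  show "integrable \<Omega> (\<lambda>\<omega>. (B t \<omega> - B s \<omega>)\<^sup>2)" by (rule *(1)[OF _ normal_moment_2[OF h]]) simp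
  show "integrable \<Omega> (\<lambda>\<omega>. (B t \<omega> - B s \<omega>)^4)" by (rule *(1)[OF _ normal_moment_4[OF h]]) simp
  show "expectation (\<lambda>\<omega>. (B t \<omega> - B s \<omega>)\<^sup>2) = t - s"
    using *(2)[OF _ normal_moment_2[OF h]] by (simp add: prob_space)
  show "expectation (\<lambda>\<omega>. (B t \<omega> - B s \<omega>)^4) = 3 * (t - s)\<^sup>2"
    using *(2)[OF _ normal_moment_4[OF h]] by (simp add: prob_space)
qed

text \<open>With \<open>W\<close> the increment since \<open>T\<close>, the \<open>L^2\<close>
  inequality is applied to \<open>exp (a * W)\<close>, whose square is
  \<open>exp (2 * a * W)\<close>; hence the factor 2. This process is a submartingale because each
  Gaussian increment multiplies the mean by at least 1. What matters is that the bound does not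
  depend on the level \<open>n\<close>.\<close>

lemma exp_max_expectation:
  assumes T: "0 \<le> T" and N: "N > 0"
  shows "(\<integral>\<^sup>+\<omega>. (SUP k\<in>{..N * 2 ^ n}. ennreal (exp (2 * a * (B (dyadic T n k) \<omega> - B T \<omega>)))) \<partial>\<Omega>)
    \<le> ennreal (4 * exp (2 * a\<^sup>2 * real N))"
proof -
  let ?t = "dyadic T n"
  let ?K = "N * 2 ^ n"
  define s where "s k \<omega> = exp (a * (B (?t k) \<omega> - B T \<omega>))" for k \<omega>
  define m where "m k \<omega> = Max ((\<lambda>j. s j \<omega>) ` {..k})" for k \<omega>
  have tk: "0 \<le> ?t k" for k using T dyadic_ge[of T n k] by simp
  have sF: "s j \<in> borel_measurable (F (?t k))" if "j \<le> k" for j k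
  proof -
    have "B (?t j) \<in> borel_measurable (F (?t k))" "B T \<in> borel_measurable (F (?t k))"
      using B_F_measurable tk T dyadic_mono[OF that] dyadic_ge by auto
    then show ?thesis unfolding s_def by measurable
  qed
  have ssq: "s k \<omega> ^ 2 = exp (2 * a * (B (?t k) \<omega> - B T \<omega>))" for k \<omega>
    by (simp add: s_def power2_eq_square exp_add[symmetric] algebra_simps)
  have int2: "integrable \<Omega> (\<lambda>\<omega>. (s k \<omega>)\<^sup>2)" for k
  proof (cases "k = 0")
    case False
    then have "T < ?t k" by (simp add: dyadic_def)
    from exp_increment_integrable(1)[OF T this, of "2 * a"] show ?thesis by (simp only: ssq)
  qed (simp add: s_def)
  have E2: "expectation (\<lambda>\<omega>. (s ?K \<omega>)\<^sup>2) = exp (2 * a\<^sup>2 * real N)"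
  proof -
    have "T < ?t ?K" using N by (simp add: dyadic_def)
    from exp_increment_integrable(2)[OF T this, of "2 * a"] show ?thesis
      by (simp add: ssq dyadic_end power2_eq_square[of a])
  qed
  have mF: "m k \<in> borel_measurable (F (?t k))" for k
    unfolding m_def by (intro borel_measurable_Max) (auto intro: sF)
  have spos: "s k \<omega> > 0" for k \<omega> by (simp add: s_def)
  have m_le: "m k \<omega> \<le> (\<Sum>j\<le>k. s j \<omega>)" for k \<omega>
    unfolding m_def using spos by (subst Max_le_iff) (auto intro!: member_le_sum intro: less_imp_le)
  have m_pos: "0 \<le> m k \<omega>" for k \<omega>
    unfolding m_def using spos[of 0 \<omega>] by (subst Max_ge_iff) (auto intro!: bexI[of _ 0])
  have sO[measurable]: "s k \<in> borel_measurable \<Omega>" for k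
    using sF[of k k] F_measurable tk by blast
  have mO[measurable]: "m k \<in> borel_measurable \<Omega>" for k
    using mF[of k] F_measurable tk by blast
  \<comment> \<open>A maximum of positive numbers is at most their sum, and products are bounded by
    squares, so the second moments already known suffice.\<close>
  have ms_int: "integrable \<Omega> (\<lambda>\<omega>. m k \<omega> * s k \<omega>)" for k
  proof (rule Bochner_Integration.integrable_bound[where f="\<lambda>\<omega>. \<Sum>j\<le>k. (s j \<omega>)\<^sup>2 + (s k \<omega>)\<^sup>2"])
    show "integrable \<Omega> (\<lambda>\<omega>. \<Sum>j\<le>k. (s j \<omega>)\<^sup>2 + (s k \<omega>)\<^sup>2)" using int2 by simp
    show "AE \<omega> in \<Omega>. norm (m k \<omega> * s k \<omega>) \<le> norm (\<Sum>j\<le>k. (s j \<omega>)\<^sup>2 + (s k \<omega>)\<^sup>2)"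
    proof (rule AE_I2)
      fix \<omega>
      have "m k \<omega> * s k \<omega> \<le> (\<Sum>j\<le>k. s j \<omega>) * s k \<omega>"
        using m_le spos[of k \<omega>] by (intro mult_right_mono) auto
      also have "\<dots> = (\<Sum>j\<le>k. s j \<omega> * s k \<omega>)" by (simp add: sum_distrib_right)
      also have "\<dots> \<le> (\<Sum>j\<le>k. (s j \<omega>)\<^sup>2 + (s k \<omega>)\<^sup>2)"
      proof (rule sum_mono)
        fix j
        have "0 \<le> (s j \<omega> - s k \<omega>)\<^sup>2" "0 \<le> s j \<omega> * s k \<omega>" using spos[of j \<omega>] spos[of k \<omega>] by simp_all
        then show "s j \<omega> * s k \<omega> \<le> (s j \<omega>)\<^sup>2 + (s k \<omega>)\<^sup>2" by (simp add: power2_eq_square algebra_simps)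
      qed
      finally show "norm (m k \<omega> * s k \<omega>) \<le> norm (\<Sum>j\<le>k. (s j \<omega>)\<^sup>2 + (s k \<omega>)\<^sup>2)"
        using m_pos[of k \<omega>] spos[of k \<omega>] by (simp add: abs_mult)
    qed
  qed simp
  have sSuc: "s (Suc k) \<omega> = s k \<omega> * exp (a * (B (?t (Suc k)) \<omega> - B (?t k) \<omega>))" for k \<omega>
    by (simp add: s_def exp_add[symmetric] algebra_simps)
  have msF: "(\<lambda>\<omega>. m k \<omega> * s k \<omega>) \<in> borel_measurable (F (?t k))" for k
    using mF sF by (intro borel_measurable_times) auto
  \<comment> \<open>The submartingale step: \<open>m k * s k\<close> is nonnegative and known at the
    \<open>k\<close>-th grid time, and the exponential of the next increment has mean at least
    1.\<close>
  have int1: "integrable \<Omega> (\<lambda>\<omega>. m k \<omega> * s (Suc k) \<omega>)" and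
    E1: "expectation (\<lambda>\<omega>. m k \<omega> * s (Suc k) \<omega>) \<ge> expectation (\<lambda>\<omega>. m k \<omega> * s k \<omega>)" for k
  proof -
    note * = exp_increment_expectation[OF tk dyadic_less_Suc msF[of k] ms_int, of a]
    have eq: "m k \<omega> * s (Suc k) \<omega> = m k \<omega> * s k \<omega> * exp (a * (B (?t (Suc k)) \<omega> - B (?t k) \<omega>))" for \<omega>
      by (simp add: sSuc)
    show "integrable \<Omega> (\<lambda>\<omega>. m k \<omega> * s (Suc k) \<omega>)" using * by (simp add: eq)
    have nn: "0 \<le> expectation (\<lambda>\<omega>. m k \<omega> * s k \<omega>)"
      using m_pos spos by (intro Bochner_Integration.integral_nonneg mult_nonneg_nonneg) (auto intro: less_imp_le)
    have "1 \<le> exp (a\<^sup>2 * (?t (Suc k) - ?t k) / 2)" by (simp add: dyadic_Suc)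
    with nn have "expectation (\<lambda>\<omega>. m k \<omega> * s k \<omega>) * 1 \<le> expectation (\<lambda>\<omega>. m k \<omega> * s k \<omega>) * exp (a\<^sup>2 * (?t (Suc k) - ?t k) / 2)"
      by (rule mult_left_mono[rotated])
    then show "expectation (\<lambda>\<omega>. m k \<omega> * s (Suc k) \<omega>) \<ge> expectation (\<lambda>\<omega>. m k \<omega> * s k \<omega>)"
      using * by (simp add: eq)
  qed
  have doob: "(m ?K \<omega>)\<^sup>2 \<le> 4 * (s ?K \<omega>)\<^sup>2 - 4 * (\<Sum>k<?K. m k \<omega> * (s (Suc k) \<omega> - s k \<omega>))" for \<omega>
  proof (rule pathwise_doob)
    show "m 0 \<omega> = s 0 \<omega>" by (simp add: m_def)
    show "m (Suc k) \<omega> = max (m k \<omega>) (s (Suc k) \<omega>)" for k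
    proof -
      have "(\<lambda>j. s j \<omega>) ` {..Suc k} = insert (s (Suc k) \<omega>) ((\<lambda>j. s j \<omega>) ` {..k})"
        by (auto simp: atMost_Suc)
      then show ?thesis unfolding m_def by (simp only:) (subst Max_insert, auto simp: max.commute)
    qed
  qed
  have rhs_int: "integrable \<Omega> (\<lambda>\<omega>. 4 * (s ?K \<omega>)\<^sup>2 - 4 * (\<Sum>k<?K. m k \<omega> * (s (Suc k) \<omega> - s k \<omega>)))"
    using int1 int2 ms_int by (simp add: right_diff_distrib)
  have m2_int: "integrable \<Omega> (\<lambda>\<omega>. (m ?K \<omega>)\<^sup>2)"
    by (rule Bochner_Integration.integrable_bound[OF rhs_int])
       (use doob in \<open>auto intro!: AE_I2 order_trans[OF _ abs_ge_self]\<close>)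
  have "expectation (\<lambda>\<omega>. (m ?K \<omega>)\<^sup>2) \<le> expectation (\<lambda>\<omega>. 4 * (s ?K \<omega>)\<^sup>2 - 4 * (\<Sum>k<?K. m k \<omega> * (s (Suc k) \<omega> - s k \<omega>)))"
    by (rule integral_mono[OF m2_int rhs_int]) (rule doob)
  also have "\<dots> = 4 * exp (2 * a\<^sup>2 * real N) - 4 * (\<Sum>k<?K. expectation (\<lambda>\<omega>. m k \<omega> * s (Suc k) \<omega>) - expectation (\<lambda>\<omega>. m k \<omega> * s k \<omega>))"
    using int1 int2 ms_int by (simp add: right_diff_distrib E2)
  also have "\<dots> \<le> 4 * exp (2 * a\<^sup>2 * real N)"
    using E1 by (simp add: sum_nonneg)
  finally have E: "expectation (\<lambda>\<omega>. (m ?K \<omega>)\<^sup>2) \<le> 4 * exp (2 * a\<^sup>2 * real N)" .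
  have "(SUP k\<in>{..?K}. ennreal (exp (2 * a * (B (?t k) \<omega> - B T \<omega>)))) \<le> ennreal ((m ?K \<omega>)\<^sup>2)" for \<omega>
  proof (rule SUP_least)
    fix k assume "k \<in> {..?K}"
    then have "s k \<omega> \<le> m ?K \<omega>" unfolding m_def by (auto intro!: Max_ge)
    then show "ennreal (exp (2 * a * (B (?t k) \<omega> - B T \<omega>))) \<le> ennreal ((m ?K \<omega>)\<^sup>2)"
      using spos[of k \<omega>] by (auto simp: ssq[symmetric] intro!: ennreal_leI power_mono)
  qed
  then have "(\<integral>\<^sup>+\<omega>. (SUP k\<in>{..?K}. ennreal (exp (2 * a * (B (?t k) \<omega> - B T \<omega>)))) \<partial>\<Omega>) \<le> (\<integral>\<^sup>+\<omega>. ennreal ((m ?K \<omega>)\<^sup>2) \<partial>\<Omega>)"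
    by (intro nn_integral_mono) auto
  also have "\<dots> = ennreal (expectation (\<lambda>\<omega>. (m ?K \<omega>)\<^sup>2))"
    by (rule nn_integral_eq_integral[OF m2_int]) auto
  also have "\<dots> \<le> ennreal (4 * exp (2 * a\<^sup>2 * real N))" using E by (rule ennreal_leI)
  finally show ?thesis .
qed

end

lemma dyadic_floor_tendsto:
  "t \<le> r \<Longrightarrow> (\<lambda>n. dyadic t n (nat \<lfloor>(r - t) * 2 ^ n\<rfloor>)) \<longlonglongrightarrow> r"
proof (rule real_tendsto_sandwich[of "\<lambda>n. r - (1/2) ^ n" _ _ "\<lambda>_. r"])
  assume r: "t \<le> r"
  show "\<forall>\<^sub>F n in sequentially. r - (1/2) ^ n \<le> dyadic t n (nat \<lfloor>(r - t) * 2 ^ n\<rfloor>)"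
  proof (rule always_eventually, rule allI)
    fix n
    have "(r - t) * 2 ^ n - 1 \<le> real_of_int \<lfloor>(r - t) * 2 ^ n\<rfloor>" by linarith
    then have "((r - t) * 2 ^ n - 1) / 2 ^ n \<le> real_of_int \<lfloor>(r - t) * 2 ^ n\<rfloor> / 2 ^ n"
      by (rule divide_right_mono) simp
    then show "r - (1/2) ^ n \<le> dyadic t n (nat \<lfloor>(r - t) * 2 ^ n\<rfloor>)"
      using r by (simp add: dyadic_def diff_divide_distrib power_one_over)
  qed
  show "\<forall>\<^sub>F n in sequentially. dyadic t n (nat \<lfloor>(r - t) * 2 ^ n\<rfloor>) \<le> r"
  proof (rule always_eventually, rule allI)
    fix n
    have "real_of_int \<lfloor>(r - t) * 2 ^ n\<rfloor> \<le> (r - t) * 2 ^ n" by linarith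
    then have "real_of_int \<lfloor>(r - t) * 2 ^ n\<rfloor> / 2 ^ n \<le> (r - t) * 2 ^ n / 2 ^ n"
      by (rule divide_right_mono) simp
    then show "dyadic t n (nat \<lfloor>(r - t) * 2 ^ n\<rfloor>) \<le> r"
      using r by (simp add: dyadic_def)
  qed
  have "(\<lambda>n. (1/2::real) ^ n) \<longlonglongrightarrow> 0" by (rule LIMSEQ_realpow_zero) auto
  from tendsto_diff[OF tendsto_const this] show "(\<lambda>n. r - (1/2) ^ n) \<longlonglongrightarrow> r" by simp
qed simp

context brownian_filtered_space
begin

text \<open>The grids are nested and the bound of \<open>exp_max_expectation\<close> is uniform in
  the level, so monotone convergence makes the supremum over all dyadic times integrable; continuity
  of the paths carries it over to every \<open>r\<close>.\<close>

lemma exp_sup_dominated1: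
  assumes T: "0 \<le> T"
  shows "\<exists>D::'w \<Rightarrow> real. integrable \<Omega> D \<and> (AE \<omega> in \<Omega>. \<forall>r\<in>{T..T + real N}. exp (a * (B r \<omega> - B T \<omega>)) \<le> D \<omega>)"
proof (cases "N = 0")
  case False
  then have N: "N > 0" by simp
  define S where "S n \<omega> = (SUP k\<in>{..N * 2 ^ n}. ennreal (exp (2 * (a / 2) * (B (dyadic T n k) \<omega> - B T \<omega>))))" for n \<omega>
  have tk: "0 \<le> dyadic T n k" for n k using T dyadic_ge[of T n k] by simp
  have Sm[measurable]: "S n \<in> borel_measurable \<Omega>" for n
    unfolding S_def using B_measurable[OF tk] B_measurable[OF T] by (intro borel_measurable_SUP) auto
  have inc: "incseq S"
    unfolding incseq_Suc_iff le_fun_def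
  proof (intro allI)
    fix n \<omega>
    show "S n \<omega> \<le> S (Suc n) \<omega>"
      unfolding S_def
    proof (rule SUP_least)
      fix k assume "k \<in> {..N * 2 ^ n}"
      then have "2 * k \<in> {..N * 2 ^ Suc n}" by auto
      then show "ennreal (exp (2 * (a / 2) * (B (dyadic T n k) \<omega> - B T \<omega>)))
        \<le> (SUP k\<in>{..N * 2 ^ Suc n}. ennreal (exp (2 * (a / 2) * (B (dyadic T (Suc n) k) \<omega> - B T \<omega>))))"
        by (intro SUP_upper2[of "2 * k"]) (auto simp: dyadic_refine[of T n k])
    qed
  qed
  define D where "D \<omega> = (SUP n. S n \<omega>)" for \<omega>
  have Dm[measurable]: "D \<in> borel_measurable \<Omega>" unfolding D_def by (intro borel_measurable_SUP) auto
  have "(\<integral>\<^sup>+\<omega>. D \<omega> \<partial>\<Omega>) = (SUP n. \<integral>\<^sup>+\<omega>. S n \<omega> \<partial>\<Omega>)"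
    unfolding D_def by (rule nn_integral_monotone_convergence_SUP[OF inc]) simp
  also have "\<dots> \<le> ennreal (4 * exp (2 * (a / 2)\<^sup>2 * real N))"
    unfolding S_def by (intro SUP_least exp_max_expectation[OF T N])
  finally have fin: "(\<integral>\<^sup>+\<omega>. D \<omega> \<partial>\<Omega>) < \<infinity>" using le_less_trans by fastforce
  then have finAE: "AE \<omega> in \<Omega>. D \<omega> \<noteq> \<infinity>" by (intro nn_integral_PInf_AE) auto
  have "integrable \<Omega> (\<lambda>\<omega>. enn2real (D \<omega>))"
  proof (rule integrableI_nonneg)
    have "(\<integral>\<^sup>+\<omega>. ennreal (enn2real (D \<omega>)) \<partial>\<Omega>) = (\<integral>\<^sup>+\<omega>. D \<omega> \<partial>\<Omega>)"
      by (rule nn_integral_cong_AE) (use finAE in \<open>auto simp: ennreal_enn2real_if\<close>)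
    with fin show "(\<integral>\<^sup>+\<omega>. ennreal (enn2real (D \<omega>)) \<partial>\<Omega>) < \<infinity>" by simp
  qed auto
  moreover have "AE \<omega> in \<Omega>. \<forall>r\<in>{T..T + real N}. exp (a * (B r \<omega> - B T \<omega>)) \<le> enn2real (D \<omega>)"
    using finAE B_continuous
  proof eventually_elim
    case (elim \<omega>)
    show ?case
    proof
      fix r assume r: "r \<in> {T..T + real N}"
      define q where "q n = dyadic T n (nat \<lfloor>(r - T) * 2 ^ n\<rfloor>)" for n
      have q: "q \<longlonglongrightarrow> r" unfolding q_def using dyadic_floor_tendsto r by simp
      have "(\<lambda>n. B (q n) \<omega>) \<longlonglongrightarrow> B r \<omega>"
        by (rule continuous_on_tendsto_compose[OF elim(2) q]) (use r T tk q_def in auto)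
      then have lim: "(\<lambda>n. exp (a * (B (q n) \<omega> - B T \<omega>))) \<longlonglongrightarrow> exp (a * (B r \<omega> - B T \<omega>))"
        by (intro tendsto_intros)
      show "exp (a * (B r \<omega> - B T \<omega>)) \<le> enn2real (D \<omega>)"
      proof (rule LIMSEQ_le_const2[OF lim], intro exI[of _ 0] allI impI)
        fix n
        have "(r - T) * 2 ^ n \<le> real N * 2 ^ n" using r by (intro mult_right_mono) auto
        also have "\<dots> = of_int (int (N * 2 ^ n))" by simp
        finally have *: "(r - T) * 2 ^ n \<le> of_int (int (N * 2 ^ n))" .
        have "\<lfloor>(r - T) * 2 ^ n\<rfloor> \<le> int (N * 2 ^ n)"
          using floor_mono[OF *] by (simp only: floor_of_int)
        then have "nat \<lfloor>(r - T) * 2 ^ n\<rfloor> \<le> N * 2 ^ n" by (simp only: nat_le_iff)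
        then have "ennreal (exp (a * (B (q n) \<omega> - B T \<omega>))) \<le> S n \<omega>"
          unfolding S_def q_def by (intro SUP_upper2[of "nat \<lfloor>(r - T) * 2 ^ n\<rfloor>"]) auto
        also have "\<dots> \<le> D \<omega>" unfolding D_def by (rule SUP_upper) simp
        also have "\<dots> = ennreal (enn2real (D \<omega>))" using elim(1) by (simp add: ennreal_enn2real_if)
        finally show "exp (a * (B (q n) \<omega> - B T \<omega>)) \<le> enn2real (D \<omega>)"
          by (simp add: ennreal_le_iff)
      qed
    qed
  qed
  ultimately show ?thesis by blast
qed (auto intro!: exI[of _ "\<lambda>_. 1"])

lemma exp_sup_dominated:
  assumes T: "0 \<le> T" and a: "0 \<le> a"
  obtains D :: "'w \<Rightarrow> real" where "integrable \<Omega> D" "\<And>\<omega>. 0 \<le> D \<omega>"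
    "AE \<omega> in \<Omega>. \<forall>r\<in>{T..T + real N}. exp (a * \<bar>B r \<omega> - B T \<omega>\<bar>) \<le> D \<omega>"
proof -
  obtain D1 :: "'w \<Rightarrow> real" where D1: "integrable \<Omega> D1"
    "AE \<omega> in \<Omega>. \<forall>r\<in>{T..T + real N}. exp (a * (B r \<omega> - B T \<omega>)) \<le> D1 \<omega>"
    using exp_sup_dominated1[OF T, of N a] by blast
  obtain D2 :: "'w \<Rightarrow> real" where D2: "integrable \<Omega> D2"
    "AE \<omega> in \<Omega>. \<forall>r\<in>{T..T + real N}. exp (- a * (B r \<omega> - B T \<omega>)) \<le> D2 \<omega>"
    using exp_sup_dominated1[OF T, of N "- a"] by blast
  show thesis
  \<comment> \<open>One of the two signs realises the absolute value. The positive parts make the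
    majorant nonnegative at every point, not only almost surely.\<close>
  proof (rule that[of "\<lambda>\<omega>. max 0 (D1 \<omega>) + max 0 (D2 \<omega>)"])
    show "AE \<omega> in \<Omega>. \<forall>r\<in>{T..T + real N}. exp (a * \<bar>B r \<omega> - B T \<omega>\<bar>) \<le> max 0 (D1 \<omega>) + max 0 (D2 \<omega>)"
      using D1(2) D2(2)
    proof eventually_elim
      case (elim \<omega>)
      show ?case
      proof
        fix r assume r: "r \<in> {T..T + real N}"
        show "exp (a * \<bar>B r \<omega> - B T \<omega>\<bar>) \<le> max 0 (D1 \<omega>) + max 0 (D2 \<omega>)"
          using elim(1)[rule_format, OF r] elim(2)[rule_format, OF r]
          by (cases "B r \<omega> - B T \<omega> \<ge> 0") (auto simp: algebra_simps)
      qed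
    qed
  qed (use D1 D2 in auto)
qed

end

section \<open>Stieltjes measures of dividend paths\<close>

lemma dividend_path_ext_mono:
  assumes g: "dividend_path t g" and xy: "x \<le> y"
  shows "(if x < t then 0 else g x) \<le> (if y < t then 0 else g y)"
proof -
  have "g x \<le> g y" if "t \<le> x" using g that xy by (auto simp: dividend_path_def mono_on_def)
  moreover have "0 \<le> g y" if "t \<le> y"
  proof -
    have "g t \<le> g y" using g that by (auto simp: dividend_path_def mono_on_def)
    then show ?thesis using g by (auto simp: dividend_path_def)
  qed
  ultimately show ?thesis using xy by auto
qed

lemma dividend_path_mono: "dividend_path t g \<Longrightarrow> t \<le> x \<Longrightarrow> x \<le> y \<Longrightarrow> g x \<le> g y"
  by (auto simp: dividend_path_def mono_on_def)

lemma dividend_path_nonneg: "dividend_path t g \<Longrightarrow> t \<le> x \<Longrightarrow> 0 \<le> g x"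
  using dividend_path_ext_mono[of t g "t - 1" x] by simp

lemma dividend_path_ext_right_cont:
  assumes g: "dividend_path t g"
  shows "continuous (at_right a) (\<lambda>r. if r < t then 0 else g r)"
proof (cases "a < t")
  case True
  then have "\<forall>\<^sub>F r in at_right a. (if r < t then 0 else g r) = 0"
    unfolding eventually_at_right_field by (intro exI[of _ t]) auto
  then show ?thesis using True by (simp add: continuous_within tendsto_eventually)
next
  case False
  then have "(g \<longlongrightarrow> g a) (at_right a)" using g by (auto simp: dividend_path_def cadlag_from_def)
  moreover have "\<forall>\<^sub>F r in at_right a. g r = (if r < t then 0 else g r)"
    unfolding eventually_at_right_field using False by (intro exI[of _ "a + 1"]) auto
  ultimately have "((\<lambda>r. if r < t then 0 else g r) \<longlongrightarrow> g a) (at_right a)"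
    by (rule Lim_transform_eventually)
  then show ?thesis using False by (simp add: continuous_within)
qed

lemma sets_stieltjes [simp, measurable_cong]: "sets (stieltjes t g) = sets borel"
  by (simp add: stieltjes_def)

lemma space_stieltjes [simp]: "space (stieltjes t g) = UNIV"
  by (simp add: stieltjes_def)

lemma emeasure_stieltjes_Ioc:
  assumes g: "dividend_path t g" and ab: "a \<le> b"
  shows "emeasure (stieltjes t g) {a<..b} =
    ennreal ((if b < t then 0 else g b) - (if a < t then 0 else g a))"
  unfolding stieltjes_def
  by (rule emeasure_interval_measure_Ioc[OF ab]) (use dividend_path_ext_mono[OF g] dividend_path_ext_right_cont[OF g] in auto)

text \<open>The integrator is 0 before \<open>t\<close>, so an interval ending at \<open>b\<close>
  has its full mass as soon as it starts before \<open>t\<close>; the initial payment is thereby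
  counted as an atom at \<open>t\<close>.\<close>

lemma emeasure_stieltjes_atMost:
  assumes g: "dividend_path t g"
  shows "emeasure (stieltjes t g) {..b} = ennreal (if b < t then 0 else g b)"
proof -
  have "(\<lambda>n::nat. emeasure (stieltjes t g) {b - real n<..b}) \<longlonglongrightarrow> emeasure (stieltjes t g) (\<Union>n::nat. {b - real n<..b})"
    by (rule Lim_emeasure_incseq) (auto simp: incseq_def)
  also have "(\<Union>n::nat. {b - real n<..b}) = {..b}"
  proof -
    have "\<exists>n::nat. b - real n < x" for x using reals_Archimedean2[of "b - x"] by (auto simp: algebra_simps)
    then show ?thesis by auto
  qed
  finally have 1: "(\<lambda>n::nat. emeasure (stieltjes t g) {b - real n<..b}) \<longlonglongrightarrow> emeasure (stieltjes t g) {..b}" .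
  obtain m :: nat where m: "b - t < real m" using reals_Archimedean2 by blast
  have "\<forall>\<^sub>F n in sequentially. emeasure (stieltjes t g) {b - real n<..b} = ennreal (if b < t then 0 else g b)"
    using eventually_ge_at_top[of m]
  proof eventually_elim
    case (elim n)
    then have "real m \<le> real n" by simp
    then have "b - real n < t" using m by linarith
    then show ?case using emeasure_stieltjes_Ioc[OF g, of "b - real n" b] by simp
  qed
  then have "(\<lambda>n::nat. emeasure (stieltjes t g) {b - real n<..b}) \<longlonglongrightarrow> ennreal (if b < t then 0 else g b)"
    by (rule tendsto_eventually)
  with 1 show ?thesis by (rule LIMSEQ_unique)
qed

lemma emeasure_stieltjes_lessThan:
  "(\<lambda>n. emeasure (stieltjes t g) {..b - 1 / real (Suc n)}) \<longlonglongrightarrow> emeasure (stieltjes t g) {..<b}"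
proof -
  have "(\<lambda>n. emeasure (stieltjes t g) {..b - 1 / real (Suc n)}) \<longlonglongrightarrow> emeasure (stieltjes t g) (\<Union>n. {..b - 1 / real (Suc n)})"
    by (rule Lim_emeasure_incseq) (auto simp: incseq_def frac_le intro!: order_trans[of _ "b - 1 / real (Suc m)" for m] diff_left_mono)
  also have "(\<Union>n. {..b - 1 / real (Suc n)}) = {..<b}"
  proof -
    have "\<exists>n. x \<le> b - 1 / real (Suc n)" if "x < b" for x
      using reals_Archimedean[of "b - x"] that by (auto simp: inverse_eq_divide algebra_simps intro: less_imp_le)
    moreover have "x < b" if "x \<le> b - 1 / real (Suc n)" for x n
      using that by (auto intro: le_less_trans)
    ultimately show ?thesis by auto
  qed
  finally show ?thesis .
qed

lemma emeasure_stieltjes_lessThan_le: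
  assumes g: "dividend_path t g" and b: "\<And>l. t \<le> l \<Longrightarrow> l < b \<Longrightarrow> g l \<le> m" and m: "0 \<le> m"
  shows "emeasure (stieltjes t g) {..<b} \<le> ennreal m"
proof (rule LIMSEQ_le_const2[OF emeasure_stieltjes_lessThan], intro exI[of _ 0] allI impI)
  fix n
  show "emeasure (stieltjes t g) {..b - 1 / real (Suc n)} \<le> ennreal m"
    using b[of "b - 1 / real (Suc n)"] m by (auto simp: emeasure_stieltjes_atMost[OF g] intro!: ennreal_leI)
qed

text \<open>At a restart time the payments strictly before it must be separated from a possible jump
  at it; their total is the left limit.\<close>

lemma emeasure_stieltjes_lessThan_eq:
  assumes g: "dividend_path t g" and l: "(g \<longlongrightarrow> l) (at_left b)" and tb: "t < b"
  shows "emeasure (stieltjes t g) {..<b} = ennreal l"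
proof -
  have lim: "filterlim (\<lambda>n. b - 1 / real (Suc n)) (at_left b) sequentially"
    unfolding filterlim_at
  proof
    have "(\<lambda>n. b - 1 / real (Suc n)) \<longlonglongrightarrow> b - 0"
      by (intro tendsto_diff tendsto_const) (use LIMSEQ_inverse_real_of_nat in \<open>simp add: inverse_eq_divide\<close>)
    then show "(\<lambda>n. b - 1 / real (Suc n)) \<longlonglongrightarrow> b" by simp
  qed auto
  have "(\<lambda>n. ennreal (g (b - 1 / real (Suc n)))) \<longlonglongrightarrow> ennreal l"
    by (intro tendsto_ennrealI filterlim_compose[OF l lim])
  moreover have "\<forall>\<^sub>F n in sequentially. ennreal (g (b - 1 / real (Suc n))) = emeasure (stieltjes t g) {..b - 1 / real (Suc n)}"
  proof -
    have "\<forall>\<^sub>F r in at_left b. t < r" using tb eventually_at_left_field by blast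
    from eventually_compose_filterlim[OF this lim] show ?thesis
      by eventually_elim (simp add: emeasure_stieltjes_atMost[OF g])
  qed
  ultimately have "(\<lambda>n. emeasure (stieltjes t g) {..b - 1 / real (Suc n)}) \<longlonglongrightarrow> ennreal l"
    by (rule Lim_transform_eventually)
  with emeasure_stieltjes_lessThan show ?thesis by (rule LIMSEQ_unique)
qed

lemma stieltjes_before_null: "dividend_path t g \<Longrightarrow> emeasure (stieltjes t g) {..<t} = 0"
  using emeasure_stieltjes_lessThan_le[of t g t 0] by simp

lemma AE_stieltjes_ge: "dividend_path t g \<Longrightarrow> AE r in stieltjes t g. t \<le> r"
  by (rule AE_I[of _ _ "{..<t}"]) (auto simp: stieltjes_before_null)

lemma emeasure_stieltjes_point:
  assumes g: "dividend_path t g"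
  shows "emeasure (stieltjes t g) {t} = ennreal (g t)"
proof -
  have "emeasure (stieltjes t g) {t} = emeasure (stieltjes t g) {..t}"
    by (rule emeasure_eq_AE) (use AE_stieltjes_ge[OF g] in auto)
  then show ?thesis by (simp add: emeasure_stieltjes_atMost[OF g])
qed

lemma measure_eqI_Ioc:
  fixes M N :: "real measure"
  assumes sets: "sets M = sets borel" "sets N = sets borel"
    and eq: "\<And>a b. a \<le> b \<Longrightarrow> emeasure M {a<..b} = emeasure N {a<..b}"
    and fin: "\<And>a b. a \<le> b \<Longrightarrow> emeasure M {a<..b} \<noteq> \<infinity>"
  shows "M = N"
proof (rule measure_eqI_generator_eq[where E="range (\<lambda>(a, b). {a<..b})" and \<Omega>=UNIV and A="\<lambda>n::nat. {- real n<..real n}"])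
  show "Int_stable (range (\<lambda>(a::real, b). {a<..b}))"
  proof (rule Int_stableI)
    fix X Y :: "real set" assume "X \<in> range (\<lambda>(a, b). {a<..b})" "Y \<in> range (\<lambda>(a, b). {a<..b})"
    then obtain a b c d where "X = {a<..b}" "Y = {c<..d}" by auto
    then have "X \<inter> Y = {max a c<..min b d}" by auto
    then show "X \<inter> Y \<in> range (\<lambda>(a, b). {a<..b})" by auto
  qed
  show "emeasure M X = emeasure N X" if "X \<in> range (\<lambda>(a, b). {a<..b})" for X
  proof -
    from that obtain a b where X: "X = {a<..b}" by auto
    show ?thesis
    proof (cases "a \<le> b")
      case False
      then have "X = {}" using X by auto
      then show ?thesis by simp
    qed (simp add: X eq)
  qed
  show "(\<Union>i::nat. {- real i<..real i}) = UNIV"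
  proof -
    have "\<exists>i::nat. - real i < x \<and> x \<le> real i" for x
      using reals_Archimedean2[of "\<bar>x\<bar>"] by (metis abs_less_iff less_imp_le minus_less_iff)
    then show ?thesis by auto
  qed
  show "sets M = sigma_sets UNIV (range (\<lambda>(a, b). {a<..b}))"
    "sets N = sigma_sets UNIV (range (\<lambda>(a, b). {a<..b}))"
    using sets by (simp_all add: borel_sigma_sets_Ioc)
  show "emeasure M {- real i<..real i} \<noteq> \<infinity>" for i :: nat using fin[of "- real i" "real i"] by simp
qed auto

text \<open>The restrictions to \<open>I\<close> are compared as densities, so a check on half-open
  intervals suffices. The two starting times may differ, which is what comparing a concatenated path
  with the restarted one requires.\<close>

lemma nn_integral_stieltjes_cong:
  assumes g: "dividend_path t g" and k: "dividend_path s k" and I: "I \<in> sets borel"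
    and eq: "\<And>a b. a \<le> b \<Longrightarrow> emeasure (stieltjes t g) ({a<..b} \<inter> I) = emeasure (stieltjes s k) ({a<..b} \<inter> I)"
    and \<phi>: "\<phi> \<in> borel_measurable borel"
  shows "(\<integral>\<^sup>+r\<in>I. \<phi> r \<partial>stieltjes t g) = (\<integral>\<^sup>+r\<in>I. \<phi> r \<partial>stieltjes s k)"
proof -
  have \<phi>': "\<phi> \<in> borel_measurable (stieltjes t' g')" for t' g'
    using \<phi> by (simp add: measurable_cong_sets[OF sets_stieltjes refl])
  have I': "(indicator I :: real \<Rightarrow> ennreal) \<in> borel_measurable (stieltjes t' g')" for t' g'
    using I by simp
  have e: "emeasure (density (stieltjes t' g') (indicator I)) X = emeasure (stieltjes t' g') (X \<inter> I)"
    if "X \<in> sets borel" for X t' g'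
    using that I by (subst emeasure_density[OF I']) (auto simp: indicator_inter_arith[symmetric] Int_commute mult.commute)
  have "density (stieltjes t g) (indicator I) = density (stieltjes s k) (indicator I)"
  proof (rule measure_eqI_Ioc)
    fix a b :: real assume ab: "a \<le> b"
    show "emeasure (density (stieltjes t g) (indicator I)) {a<..b} = emeasure (density (stieltjes s k) (indicator I)) {a<..b}"
      using eq[OF ab] by (simp add: e)
    have "emeasure (stieltjes t g) ({a<..b} \<inter> I) \<le> emeasure (stieltjes t g) {a<..b}"
      by (rule emeasure_mono) auto
    also have "\<dots> < \<infinity>" using emeasure_stieltjes_Ioc[OF g ab] by (auto split: if_splits)
    finally show "emeasure (density (stieltjes t g) (indicator I)) {a<..b} \<noteq> \<infinity>" by (simp add: e)
  qed simp_all
  then have "(\<integral>\<^sup>+r. \<phi> r \<partial>density (stieltjes t g) (indicator I)) = (\<integral>\<^sup>+r. \<phi> r \<partial>density (stieltjes s k) (indicator I))"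
    by simp
  then show ?thesis
    by (simp add: nn_integral_density[OF I' \<phi>'] mult.commute)
qed

text \<open>A solution is determined up to ruin only. Its arbitrary continuation still enters the
  Stieltjes measure, but not the part carried by the lifetime.\<close>

lemma nn_integral_stieltjes_cong_until:
  assumes g: "dividend_path t g" and k: "dividend_path t k"
    and eq: "\<And>r. t \<le> r \<Longrightarrow> ereal r \<le> \<tau> \<Longrightarrow> g r = k r"
    and \<phi>: "\<phi> \<in> borel_measurable borel"
  shows "(\<integral>\<^sup>+r\<in>{r. t \<le> r \<and> ereal r \<le> \<tau>}. \<phi> r \<partial>stieltjes t g) = (\<integral>\<^sup>+r\<in>{r. t \<le> r \<and> ereal r \<le> \<tau>}. \<phi> r \<partial>stieltjes t k)"
proof (rule nn_integral_stieltjes_cong[OF g k _ _ \<phi>])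
  let ?I = "{r. t \<le> r \<and> ereal r \<le> \<tau>}"
  show "?I \<in> sets borel" by measurable
  fix a b :: real assume ab: "a \<le> b"
  have *: "emeasure (stieltjes t g') ({a<..b} \<inter> ?I) = emeasure (stieltjes t g') ({a<..b} \<inter> {r. ereal r \<le> \<tau>})"
    if "dividend_path t g'" for g'
    by (rule emeasure_eq_AE) (use AE_stieltjes_ge[OF that] in auto)
  show "emeasure (stieltjes t g) ({a<..b} \<inter> ?I) = emeasure (stieltjes t k) ({a<..b} \<inter> ?I)"
  proof (cases "\<tau> < ereal a")
    case True
    have "\<not> (a < r \<and> ereal r \<le> \<tau>)" for r
    proof
      assume "a < r \<and> ereal r \<le> \<tau>"
      then have "ereal a < ereal r" "ereal r \<le> \<tau>" by simp_all
      with True show False by (metis less_trans not_le)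
    qed
    then have "{a<..b} \<inter> {r. ereal r \<le> \<tau>} = {}" by auto
    then show ?thesis using *[OF g] *[OF k] by simp
  next
    case False
    \<comment> \<open>The lifetime is closed at \<open>\<tau>\<close>, so cutting
      \<open>{a<..b}\<close> there leaves a half-open interval of the same kind, with right end
      \<open>c\<close>.\<close>
    define c where "c = (if ereal b \<le> \<tau> then b else real_of_ereal \<tau>)"
    have c: "a \<le> c" "ereal c \<le> \<tau>" "{a<..b} \<inter> {r. ereal r \<le> \<tau>} = {a<..c}"
      using False ab unfolding c_def by (cases \<tau>; auto split: if_splits)+
    have "g c = k c" if "\<not> c < t" using eq[of c] c that by auto
    moreover have "g a = k a" if "\<not> a < t" using eq[of a] order_trans[of "ereal a" "ereal c" \<tau>] c(1,2) that by auto
    ultimately show ?thesis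
      unfolding *[OF g] *[OF k] c(3) emeasure_stieltjes_Ioc[OF g c(1)] emeasure_stieltjes_Ioc[OF k c(1)] by auto
  qed
qed

section \<open>Riemann sums for Stieltjes integrals\<close>

definition cell :: "real \<Rightarrow> nat \<Rightarrow> real \<Rightarrow> nat" where
  "cell t n r = nat (\<lceil>(r - t) * 2 ^ n\<rceil> - 1)"

text \<open>Cells are open on the left and closed on the right, like the intervals on which
  Stieltjes measures are given; this is why \<open>cell\<close> is a ceiling minus 1 and not a
  floor.\<close>

lemma cell_iff:
  assumes "t < r"
  shows "dyadic t n k < r \<and> r \<le> dyadic t n (Suc k) \<longleftrightarrow> k = cell t n r"
proof -
  have pos: "0 < (r - t) * 2 ^ n" using assms by simp
  have "dyadic t n k < r \<and> r \<le> dyadic t n (Suc k) \<longleftrightarrow> real k < (r - t) * 2 ^ n \<and> (r - t) * 2 ^ n \<le> real k + 1"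
    by (simp add: dyadic_def field_simps)
  also have "\<dots> \<longleftrightarrow> \<lceil>(r - t) * 2 ^ n\<rceil> = int k + 1"
    by (auto simp: ceiling_eq_iff)
  also have "\<dots> \<longleftrightarrow> k = cell t n r"
    unfolding cell_def using pos by (auto simp: nat_eq_iff) 
  finally show ?thesis .
qed

lemma cell_bounds:
  assumes "t < r"
  shows "dyadic t n (cell t n r) < r" "r \<le> dyadic t n (Suc (cell t n r))"
  using cell_iff[OF assms, of n "cell t n r"] by auto

lemma cell_less:
  assumes "t < r" "r \<le> t + real N"
  shows "cell t n r < N * 2 ^ n"
proof (rule ccontr)
  assume "\<not> cell t n r < N * 2 ^ n"
  then have "dyadic t n (N * 2 ^ n) \<le> dyadic t n (cell t n r)" by (intro dyadic_mono) simp
  then show False using cell_bounds(1)[OF assms(1), of n] assms(2) by (simp add: dyadic_end)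
qed

lemma cell_tendsto:
  assumes "t < r"
  shows "(\<lambda>n. dyadic t n (cell t n r)) \<longlonglongrightarrow> r" "(\<lambda>n. dyadic t n (Suc (cell t n r))) \<longlonglongrightarrow> r"
proof -
  have z: "(\<lambda>n. (1/2::real) ^ n) \<longlonglongrightarrow> 0" by (rule LIMSEQ_realpow_zero) auto
  have 1: "(\<lambda>n. r - (1/2) ^ n) \<longlonglongrightarrow> r" using tendsto_diff[OF tendsto_const z] by simp
  have 2: "(\<lambda>n. r + (1/2) ^ n) \<longlonglongrightarrow> r" using tendsto_add[OF tendsto_const z] by simp
  have e: "dyadic t n (Suc (cell t n r)) = dyadic t n (cell t n r) + (1/2) ^ n" for n
    by (simp add: dyadic_Suc power_one_over)
  show "(\<lambda>n. dyadic t n (cell t n r)) \<longlonglongrightarrow> r"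
  proof (rule real_tendsto_sandwich[OF _ _ 1 tendsto_const]; rule always_eventually; rule allI)
    fix n
    show "r - (1/2) ^ n \<le> dyadic t n (cell t n r)" using cell_bounds(2)[OF assms, of n] e[of n] by linarith
    show "dyadic t n (cell t n r) \<le> r" using cell_bounds(1)[OF assms, of n] by linarith
  qed
  show "(\<lambda>n. dyadic t n (Suc (cell t n r))) \<longlonglongrightarrow> r"
  proof (rule real_tendsto_sandwich[OF _ _ tendsto_const 2]; rule always_eventually; rule allI)
    fix n
    show "dyadic t n (Suc (cell t n r)) \<le> r + (1/2) ^ n" using cell_bounds(1)[OF assms, of n] e[of n] by linarith
    show "r \<le> dyadic t n (Suc (cell t n r))" using cell_bounds(2)[OF assms, of n] by linarith
  qed
qed

text \<open>The sum is exactly the integral of a step function, so bounded convergence applies. The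
  coefficients have to converge only almost everywhere for the Stieltjes measure itself; for a
  reflected path this means only at times spent at the barrier. The cells omit the atom at
  \<open>t\<close>.\<close>

lemma Riemann_Stieltjes_limit:
  assumes g: "dividend_path t g" and C: "\<And>n k. \<bar>c n k\<bar> \<le> C" and \<phi>: "\<phi> \<in> borel_measurable borel"
    and conv: "AE r in stieltjes t g. t < r \<longrightarrow> r \<le> t + real N \<longrightarrow> (\<lambda>n. c n (cell t n r)) \<longlonglongrightarrow> \<phi> r"
  shows "(\<lambda>n. \<Sum>k<N * 2 ^ n. c n k * (g (dyadic t n (Suc k)) - g (dyadic t n k)))
    \<longlonglongrightarrow> (LINT r:{t<..t + real N}|stieltjes t g. \<phi> r)"
proof -
  let ?M = "stieltjes t g"
  define \<Psi> where "\<Psi> n r = (\<Sum>k<N * 2 ^ n. c n k * indicator {dyadic t n k<..dyadic t n (Suc k)} r)" for n r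
  have ms: "f \<in> borel_measurable borel \<Longrightarrow> f \<in> borel_measurable ?M" for f :: "real \<Rightarrow> real"
    by (simp add: measurable_cong_sets[OF sets_stieltjes refl])
  have fin: "emeasure ?M {a<..b} < \<infinity>" if "a \<le> b" for a b
    using emeasure_stieltjes_Ioc[OF g that] by (auto split: if_splits)
  have mIoc: "measure ?M {dyadic t n k<..dyadic t n (Suc k)} = g (dyadic t n (Suc k)) - g (dyadic t n k)" for n k
    using emeasure_stieltjes_Ioc[OF g dyadic_mono, of k "Suc k" t n] dyadic_ge[of t n k] dyadic_ge[of t n "Suc k"]
      dividend_path_mono[OF g dyadic_ge dyadic_mono[of k "Suc k"], of n]
    by (simp add: measure_def not_less[symmetric] del: not_less) 
  have \<Psi>_int: "(LINT r|?M. \<Psi> n r) = (\<Sum>k<N * 2 ^ n. c n k * (g (dyadic t n (Suc k)) - g (dyadic t n k)))" for n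
    unfolding \<Psi>_def using fin[OF dyadic_mono[of _ "Suc _" t n]]
    by (subst Bochner_Integration.integral_sum)
       (auto intro!: integrable_mult_right integrable_real_indicator simp: mIoc less_imp_le dyadic_less_Suc dyadic_mono)
  have \<Psi>_cell: "\<Psi> n r = c n (cell t n r)" if "t < r" "r \<le> t + real N" for n r
  proof -
    have "\<Psi> n r = (\<Sum>k<N * 2 ^ n. if k = cell t n r then c n k else 0)"
      unfolding \<Psi>_def by (rule sum.cong) (use cell_iff[OF that(1), of n] in \<open>auto simp: indicator_def\<close>)
    then show ?thesis using cell_less[OF that, of n] by simp
  qed
  have \<Psi>_out: "\<Psi> n r = 0" if "\<not> (t < r \<and> r \<le> t + real N)" for n r
    unfolding \<Psi>_def
  proof (rule sum.neutral, intro ballI)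
    fix k assume "k \<in> {..<N * 2 ^ n}"
    then have "dyadic t n (Suc k) \<le> dyadic t n (N * 2 ^ n)" by (intro dyadic_mono) auto
    then have "r \<notin> {dyadic t n k<..dyadic t n (Suc k)}" using that dyadic_ge[of t n k] by (auto simp: dyadic_end)
    then show "c n k * indicator {dyadic t n k<..dyadic t n (Suc k)} r = 0" by simp
  qed
  have "(\<lambda>n. LINT r|?M. \<Psi> n r) \<longlonglongrightarrow> (LINT r|?M. indicator {t<..t + real N} r * \<phi> r)"
  proof (rule integral_dominated_convergence)
    show "(\<lambda>r. indicator {t<..t + real N} r * \<phi> r) \<in> borel_measurable ?M"
      by (intro ms borel_measurable_times \<phi>) simp
    show "\<Psi> n \<in> borel_measurable ?M" for n unfolding \<Psi>_def by (intro ms) measurable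
    show "integrable ?M (\<lambda>r. C * indicator {t<..t + real N} r)"
      using fin[of t "t + real N"] by (intro integrable_mult_right integrable_real_indicator) auto
    show "AE r in ?M. (\<lambda>n. \<Psi> n r) \<longlonglongrightarrow> indicator {t<..t + real N} r * \<phi> r"
      using conv
    proof eventually_elim
      case (elim r)
      show ?case
        by (cases "t < r \<and> r \<le> t + real N") (use elim in \<open>simp_all add: \<Psi>_cell \<Psi>_out\<close>)
    qed
    show "AE r in ?M. norm (\<Psi> n r) \<le> C * indicator {t<..t + real N} r" for n
    proof (rule AE_I2)
      fix r
      show "norm (\<Psi> n r) \<le> C * indicator {t<..t + real N} r"
        by (cases "t < r \<and> r \<le> t + real N") (use C in \<open>simp_all add: \<Psi>_cell \<Psi>_out\<close>)
    qed
  qed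
  then show ?thesis by (simp add: \<Psi>_int set_lebesgue_integral_def)
qed

section \<open>Reflection at an upper barrier\<close>

text \<open>For a monotone path \<open>A\<close> is an interval starting at \<open>t\<close>. Its
  supremum may fail to belong to it, for instance if the path jumps beyond \<open>m\<close> there;
  the mass is then governed by the values before the jump.\<close>

lemma measure_sublevel_le:
  assumes g: "dividend_path t g" and m: "0 \<le> m" and A: "A = {l. t \<le> l \<and> l \<le> r \<and> g l \<le> m}"
  shows "A \<in> sets borel" "emeasure (stieltjes t g) A \<le> ennreal m"
proof -
  have "A \<in> sets borel \<and> emeasure (stieltjes t g) A \<le> ennreal m"
  proof (cases "A = {}")
    case False
    define s where "s = Sup A"
    have bdd: "bdd_above A" using A by (auto intro!: bdd_aboveI[of _ r])
    have ub: "l \<le> s" if "l \<in> A" for l unfolding s_def using that bdd by (rule cSup_upper)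
    have below: "l \<in> A" if tl: "t \<le> l" "l < s" for l
    proof -
      obtain a where a: "a \<in> A" "l < a" using less_cSup_iff[OF False bdd, of l] tl s_def by auto
      then show ?thesis using tl A dividend_path_mono[OF g tl(1), of a] by auto
    qed
    have tA: "t \<le> l" "g l \<le> m" if "l \<in> A" for l using that A by auto
    show ?thesis
    proof (cases "s \<in> A")
      case True
      have "x \<in> A \<longleftrightarrow> x \<in> {t..s}" for x
        using ub[of x] below[of x] tA(1)[of x] True by (cases "x = s") auto
      then have "A = {t..s}" by blast
      moreover have "emeasure (stieltjes t g) {t..s} \<le> emeasure (stieltjes t g) {..s}"
        by (rule emeasure_mono) auto
      ultimately show ?thesis
        using tA[OF True] by (auto simp: emeasure_stieltjes_atMost[OF g] intro: order_trans ennreal_leI)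
    next
      case False
      have "x \<in> A \<longleftrightarrow> x \<in> {t..<s}" for x
        using ub[of x] below[of x] tA(1)[of x] False by (cases "x = s") auto
      then have "A = {t..<s}" by blast
      moreover have "emeasure (stieltjes t g) {t..<s} \<le> emeasure (stieltjes t g) {..<s}"
        by (rule emeasure_mono) auto
      moreover have "emeasure (stieltjes t g) {..<s} \<le> ennreal m"
        using below tA(2) m by (intro emeasure_stieltjes_lessThan_le[OF g]) auto
      ultimately show ?thesis by auto
    qed
  qed simp
  then show "A \<in> sets borel" "emeasure (stieltjes t g) A \<le> ennreal m" by auto
qed

text \<open>A path pushed only while it sits at the barrier pays the least amount that keeps it below the
  barrier: the Stieltjes measure is carried by the times at which the paid amount is still at most
  the running maximum of the excess, so it has at most this mass.\<close>

lemma reflection_minimal: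
  assumes g: "dividend_path t g" and r: "t \<le> r"
    and X: "\<And>l. t \<le> l \<Longrightarrow> l \<le> r \<Longrightarrow> X l \<le> b \<and> X l = Z l - g l"
    and carried: "g r = (LINT l:{t..r}|stieltjes t g. indicator {b..} (X l))"
    and m: "0 \<le> m" "\<And>l. t \<le> l \<Longrightarrow> l \<le> r \<Longrightarrow> Z l - b \<le> m"
  shows "g r \<le> m"
proof -
  let ?M = "stieltjes t g"
  let ?f = "\<lambda>l. indicator {t..r} l * indicator {b..} (X l) :: real"
  define A where "A = {l. t \<le> l \<and> l \<le> r \<and> g l \<le> m}"
  note A = measure_sublevel_le[OF g m(1) A_def]
  have gr: "g r = (LINT l|?M. ?f l)" using carried by (simp add: set_lebesgue_integral_def)
  show ?thesis
  proof (cases "integrable ?M ?f")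
    case True
    \<comment> \<open>Where the indicator of \<open>{b..}\<close> is 1 the path equals
      \<open>b\<close>, hence \<open>g l = Z l - b \<le> m\<close> and \<open>l\<close> lies in
      \<open>A\<close>.\<close>
    have "(LINT l|?M. ?f l) \<le> (LINT l|?M. indicator A l)"
    proof (rule integral_mono[OF True])
      show "integrable ?M (indicator A :: real \<Rightarrow> real)"
        using A by (intro integrable_real_indicator) (auto intro: le_less_trans)
      fix l
      show "?f l \<le> indicator A l"
        using X[of l] m(2)[of l] by (auto simp: indicator_def A_def)
    qed
    also have "\<dots> = measure ?M A" using A by simp
    also have "\<dots> \<le> m"
      unfolding measure_def using A(2) m(1) by (metis enn2real_leI)
    finally show ?thesis using gr by simp
  next
    case False
    \<comment> \<open>A non-integrable function has integral 0, so \<open>g r = 0\<close> here. The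
      case must be treated because \<open>X\<close> is not known to be measurable.\<close>
    then show ?thesis using gr m(1) by (simp add: not_integrable_integral_eq)
  qed
qed

text \<open>The regulator of the Skorokhod map for an upper barrier: the reflected path is
  \<open>Z - excess b t Z\<close>, and a start above \<open>b\<close> is corrected at once by a lump
  payment.\<close>

definition excess :: "real \<Rightarrow> real \<Rightarrow> (real \<Rightarrow> real) \<Rightarrow> real \<Rightarrow> real" where
  "excess b t Z r = max 0 (Sup (Z ` {t..r}) - b)"

text \<open>Describes the running maximum through its upper bounds; monotonicity, attainment and the
  estimate of increments follow from this without handling the supremum again.\<close>

lemma excess_le_iff:
  assumes Z: "continuous_on {t..} Z" and r: "t \<le> r"
  shows "excess b t Z r \<le> m \<longleftrightarrow> 0 \<le> m \<and> (\<forall>l\<in>{t..r}. Z l - b \<le> m)"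
proof -
  have "compact (Z ` {t..r})"
    by (intro compact_continuous_image continuous_on_subset[OF Z]) auto
  then have bdd: "bdd_above (Z ` {t..r})" by (simp add: bounded_imp_bdd_above compact_imp_bounded)
  have "Sup (Z ` {t..r}) \<le> m + b \<longleftrightarrow> (\<forall>l\<in>{t..r}. Z l \<le> m + b)"
    using r by (subst cSup_le_iff[OF _ bdd]) auto
  then show ?thesis unfolding excess_def by (auto simp: algebra_simps)
qed

lemma excess_ge:
  assumes "continuous_on {t..} Z" "t \<le> l" "l \<le> r"
  shows "0 \<le> excess b t Z r" "Z l - b \<le> excess b t Z r"
  using excess_le_iff[OF assms(1), of r b "excess b t Z r"] assms(2,3) by auto

lemma excess_mono:
  assumes Z: "continuous_on {t..} Z" and "t \<le> l" "l \<le> r"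
  shows "excess b t Z l \<le> excess b t Z r"
  using excess_le_iff[OF Z, of l b "excess b t Z r"] excess_ge[OF Z, of _ r b] assms by auto

lemma excess_attained:
  assumes Z: "continuous_on {t..} Z" and r: "t \<le> r" and pos: "0 < excess b t Z r"
  shows "\<exists>l\<in>{t..r}. Z l - b = excess b t Z r"
proof -
  have "\<exists>l\<in>{t..r}. \<forall>k\<in>{t..r}. Z k \<le> Z l"
    by (rule continuous_attains_sup) (use r continuous_on_subset[OF Z] in auto)
  then obtain l where l: "l \<in> {t..r}" "\<forall>k\<in>{t..r}. Z k \<le> Z l" by blast
  have "excess b t Z r \<le> max 0 (Z l - b)"
    using l by (subst excess_le_iff[OF Z r]) (auto simp: max_def)
  then have "excess b t Z r \<le> Z l - b" using pos by (simp add: max_def split: if_splits)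
  then show ?thesis using l(1) excess_ge(2)[OF Z, of l r b] by (auto intro!: bexI[of _ l] antisym)
qed

lemma excess_at_start: "excess b t Z t = max 0 (Z t - b)"
  by (simp add: excess_def)

text \<open>Only a rise of \<open>Z\<close> above its value at \<open>p\<close> can raise the
  running maximum. This gives both the continuity of the regulator and a bound on the dividends paid
  over an interval.\<close>

lemma excess_increment:
  assumes Z: "continuous_on {t..} Z" and p: "t \<le> p" "p \<le> q" and e: "\<And>l. p \<le> l \<Longrightarrow> l \<le> q \<Longrightarrow> Z l \<le> Z p + e"
    and e0: "0 \<le> e"
  shows "excess b t Z q \<le> excess b t Z p + e"
proof (subst excess_le_iff[OF Z])
  show "t \<le> q" using p by simp
  show "0 \<le> excess b t Z p + e \<and> (\<forall>l\<in>{t..q}. Z l - b \<le> excess b t Z p + e)"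
  proof (intro conjI ballI)
    show "0 \<le> excess b t Z p + e" using excess_ge(1)[OF Z, of p p b] p e0 by auto
    fix l assume l: "l \<in> {t..q}"
    show "Z l - b \<le> excess b t Z p + e"
    proof (cases "l \<le> p")
      case True
      then show ?thesis using excess_ge(2)[OF Z, of l p b] l e0 by auto
    next
      case False
      then show ?thesis using e[of l] excess_ge(2)[OF Z, of p p b] l p by auto
    qed
  qed
qed

lemma excess_continuous:
  assumes Z: "continuous_on {t..} Z"
  shows "continuous_on {t..} (excess b t Z)"
  unfolding continuous_on_iff
proof (intro ballI allI impI)
  fix r e :: real assume r: "r \<in> {t..}" and e: "0 < e"
  obtain d where d: "0 < d" "\<And>l. l \<in> {t..} \<Longrightarrow> dist l r < d \<Longrightarrow> dist (Z l) (Z r) < e / 4"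
    using Z r e unfolding continuous_on_iff by (metis divide_pos_pos zero_less_numeral)
  have *: "excess b t Z p \<le> excess b t Z q \<and> excess b t Z q \<le> excess b t Z p + e / 2"
    if pq: "t \<le> p" "p \<le> q" "dist p r < d" "dist q r < d" for p q
  proof
    show "excess b t Z p \<le> excess b t Z q" by (rule excess_mono[OF Z pq(1,2)])
    show "excess b t Z q \<le> excess b t Z p + e / 2"
    proof (rule excess_increment[OF Z pq(1,2)])
      fix l assume l: "p \<le> l" "l \<le> q"
      then have "dist l r < d" using pq by (auto simp: dist_real_def abs_if split: if_splits)
      then have "dist (Z l) (Z r) < e / 4" "dist (Z p) (Z r) < e / 4" using d(2) pq l by auto
      then show "Z l \<le> Z p + e / 2" by (auto simp: dist_real_def abs_if split: if_splits)
    qed (use e in simp)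
  qed
  show "\<exists>d>0. \<forall>x'\<in>{t..}. dist x' r < d \<longrightarrow> dist (excess b t Z x') (excess b t Z r) < e"
  proof (intro exI[of _ d] conjI ballI impI d(1))
    fix l assume "l \<in> {t..}" "dist l r < d"
    then show "dist (excess b t Z l) (excess b t Z r) < e"
      using *[of l r] *[of r l] r d(1) e by (cases "l \<le> r") (auto simp: dist_real_def)
  qed
qed

lemma mono_on_left_limit:
  fixes g :: "real \<Rightarrow> real"
  assumes "mono_on {t..} g" "t < r"
  shows "\<exists>l. (g \<longlongrightarrow> l) (at_left r)"
proof -
  define l where "l = Sup (g ` {t..<r})"
  have bdd: "bdd_above (g ` {t..<r})"
    using assms by (intro bdd_aboveI[of _ "g r"]) (auto simp: mono_on_def)
  have "(g \<longlongrightarrow> l) (at_left r)"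
  proof (rule increasing_tendsto)
    show "\<forall>\<^sub>F s in at_left r. g s \<le> l"
      unfolding eventually_at_left_field l_def using assms(2) bdd
      by (intro exI[of _ t]) (auto intro!: cSup_upper)
    fix x assume "x < l"
    then obtain s where s: "t \<le> s" "s < r" "x < g s"
      unfolding l_def using less_cSup_iff[OF _ bdd, of x] assms(2) by auto
    have "g s \<le> g q" if "s < q" for q using assms(1) s that by (auto simp: mono_on_def)
    then show "\<forall>\<^sub>F q in at_left r. x < g q"
      unfolding eventually_at_left_field using s by (intro exI[of _ s]) (auto intro: less_le_trans)
  qed
  then show ?thesis by blast
qed

lemma continuous_on_atLeast_at_right:
  fixes f :: "real \<Rightarrow> 'b::topological_space"
  assumes "continuous_on {t..} f" "t \<le> r"
  shows "(f \<longlongrightarrow> f r) (at_right r)"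
proof -
  have "(f \<longlongrightarrow> f r) (at r within {t..})" using assms by (auto simp: continuous_on)
  then show ?thesis by (rule tendsto_within_subset) (use assms in auto)
qed

lemma continuous_on_atLeast_at_left:
  fixes f :: "real \<Rightarrow> 'b::topological_space"
  assumes "continuous_on {t..} f" "t < r"
  shows "(f \<longlongrightarrow> f r) (at_left r)"
proof -
  have "(f \<longlongrightarrow> f r) (at r within {t..})" using assms by (auto simp: continuous_on)
  then have "(f \<longlongrightarrow> f r) (at r within {t..r})" by (rule tendsto_within_subset) auto
  then show ?thesis using assms(2) by (simp add: at_within_Icc_at_left)
qed

lemma cadlag_continuous: "continuous_on {t..} f \<Longrightarrow> cadlag_from t f"
  unfolding cadlag_from_def using continuous_on_atLeast_at_right continuous_on_atLeast_at_left by blast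

lemma excess_dividend_path:
  assumes Z: "continuous_on {t..} Z"
  shows "dividend_path t (excess b t Z)"
  unfolding dividend_path_def
  using excess_ge(1)[OF Z, of t t b] excess_mono[OF Z] cadlag_continuous[OF excess_continuous[OF Z]]
  by (auto simp: mono_on_def)

text \<open>If the reflected path is below \<open>b\<close> at \<open>l\<close>, it is so on a
  neighbourhood, and there the regulator is constant: a new maximum would be attained at a time when
  the reflected path equals \<open>b\<close>. So \<open>l\<close> lies in one of countably many
  rational intervals of constancy, each of measure 0.\<close>

lemma excess_carried:
  assumes Z: "continuous_on {t..} Z"
  shows "AE l in stieltjes t (excess b t Z). t \<le> l \<and> Z l - excess b t Z l = b"
proof -
  let ?g = "excess b t Z" and ?M = "stieltjes t (excess b t Z)"
  note g = excess_dividend_path[OF Z, of b]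
  have le: "Z l - ?g l \<le> b" if "t \<le> l" for l using excess_ge(2)[OF Z that, of l b] by simp
  define Pairs where "Pairs = {(p, q). t \<le> real_of_rat p \<and> p \<le> q \<and> ?g (real_of_rat p) = ?g (real_of_rat q)}"
  have flat: "AE l in ?M. \<forall>pq\<in>Pairs. l \<notin> {real_of_rat (fst pq)<..real_of_rat (snd pq)}"
    unfolding AE_ball_countable[OF countableI_type, of Pairs]
  proof
    fix pq assume pq: "pq \<in> Pairs"
    let ?p = "real_of_rat (fst pq)" and ?q = "real_of_rat (snd pq)"
    have *: "t \<le> ?p" "?p \<le> ?q" "?g ?p = ?g ?q" using pq by (auto simp: Pairs_def of_rat_less_eq)
    have "emeasure ?M {?p<..?q} = 0"
      unfolding emeasure_stieltjes_Ioc[OF g *(2)] using * by auto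
    then show "AE l in ?M. l \<notin> {?p<..?q}"
      by (intro AE_I[of _ _ "{?p<..?q}"]) auto
  qed
  \<comment> \<open>Rational intervals to the right of \<open>t\<close> do not cover
    \<open>t\<close> itself. Its atom has mass \<open>max 0 (Z t - b)\<close>, so either the mass is
    0 or the path is at the barrier after the lump payment.\<close>
  have atom: "AE l in ?M. l = t \<longrightarrow> Z t - ?g t = b"
  proof (cases "Z t - ?g t = b")
    case False
    then have "?g t = 0" using le[of t] by (auto simp: excess_at_start max_def split: if_splits)
    then show ?thesis using emeasure_stieltjes_point[OF g] by (intro AE_I[of _ _ "{t}"]) auto
  qed simp
  show ?thesis
    using flat atom AE_stieltjes_ge[OF g]
  proof eventually_elim
    case (elim l)
    have "Z l - ?g l = b"
    proof (rule ccontr)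
      assume ne: "Z l - ?g l \<noteq> b"
      with elim have l: "t < l" "Z l - ?g l < b" using le[of l] by (auto simp: less_le)
      have cont: "continuous_on {t..} (\<lambda>l. Z l - ?g l)" by (intro continuous_intros Z excess_continuous)
      have "\<forall>\<^sub>F s in at l within {t..}. Z s - ?g s < b"
        using cont l by (intro order_tendstoD(2)[of _ "Z l - ?g l"]) (auto simp: continuous_on)
      then obtain d where d: "0 < d" "\<And>s. t \<le> s \<Longrightarrow> s \<noteq> l \<Longrightarrow> dist s l < d \<Longrightarrow> Z s - ?g s < b"
        unfolding eventually_at by auto
      have d': "Z s - ?g s < b" if "t \<le> s" "\<bar>s - l\<bar> < d" for s
        using d(2)[of s] l that by (cases "s = l") (auto simp: dist_real_def)
      obtain p where p: "max t (l - d) < real_of_rat p" "real_of_rat p < l"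
        using of_rat_dense[of "max t (l - d)" l] l d(1) by auto
      obtain q where q: "l < real_of_rat q" "real_of_rat q < l + d" using of_rat_dense[of l "l + d"] d(1) by auto
      have tp: "t \<le> real_of_rat p" and pq: "real_of_rat p \<le> real_of_rat q" using p q by auto
      have "?g (real_of_rat p) = ?g (real_of_rat q)"
      proof (rule ccontr)
        assume "?g (real_of_rat p) \<noteq> ?g (real_of_rat q)"
        then have lt: "?g (real_of_rat p) < ?g (real_of_rat q)"
          using excess_mono[OF Z tp pq, of b] by simp
        moreover have "0 \<le> ?g (real_of_rat p)" using excess_ge(1)[OF Z, of t] tp by blast
        ultimately obtain k where k: "k \<in> {t..real_of_rat q}" "Z k - b = ?g (real_of_rat q)"
          using excess_attained[OF Z, of "real_of_rat q" b] tp pq by auto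
        have "\<not> k \<le> real_of_rat p"
        proof
          assume "k \<le> real_of_rat p"
          then have "Z k - b \<le> ?g (real_of_rat p)" using excess_ge(2)[OF Z, of k _ b] k by auto
          with lt k show False by simp
        qed
        then have "Z k - ?g k < b" using d'[of k] k p q by auto
        moreover have "?g k \<le> ?g (real_of_rat q)" using excess_mono[OF Z, of k _ b] k by auto
        ultimately show False using k(2) by linarith
      qed
      then have "(p, q) \<in> Pairs" using tp pq by (auto simp: Pairs_def of_rat_less_eq)
      then show False using elim(1) p q by fastforce
    qed
    then show ?case using elim by simp
  qed
qed

lemma excess_carried_integral:
  assumes Z: "continuous_on {t..} Z" and r: "t \<le> r"
  shows "excess b t Z r = (LINT l:{t..r}|stieltjes t (excess b t Z). indicator {b..} (Z l - excess b t Z l))"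
proof -
  let ?g = "excess b t Z" and ?M = "stieltjes t (excess b t Z)"
  note g = excess_dividend_path[OF Z, of b]
  have cont: "continuous_on {t..} (\<lambda>l. Z l - ?g l)" by (intro continuous_intros Z excess_continuous)
  have "(\<lambda>l. indicator {t..r} l * indicator {b..} (Z l - ?g l) :: real) \<in> borel_measurable borel"
  proof -
    \<comment> \<open>Continuity is known on \<open>{t..}\<close> only; multiplying by the indicator
      gives a function that is Borel on the whole line and unchanged where it matters.\<close>
    have "(\<lambda>l. indicator {t..} l * (Z l - ?g l)) \<in> borel_measurable borel"
      using borel_measurable_continuous_on_indicator[OF _ cont] by simp
    then have "(\<lambda>l. indicator {t..r} l * indicator {b..} (indicator {t..} l * (Z l - ?g l)) :: real) \<in> borel_measurable borel"
      by measurable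
    also have "(\<lambda>l. indicator {t..r} l * indicator {b..} (indicator {t..} l * (Z l - ?g l)) :: real)
      = (\<lambda>l. indicator {t..r} l * indicator {b..} (Z l - ?g l))"
      by (auto simp: fun_eq_iff indicator_def)
    finally show ?thesis .
  qed
  then have m: "(\<lambda>l. indicator {t..r} l * indicator {b..} (Z l - ?g l) :: real) \<in> borel_measurable ?M"
    by (simp add: measurable_cong_sets[OF sets_stieltjes refl])
  have "(LINT l|?M. indicator {t..r} l * indicator {b..} (Z l - ?g l) :: real) = (LINT l|?M. indicator {..r} l :: real)"
  proof (rule integral_cong_AE[OF m])
    show "(indicator {..r} :: real \<Rightarrow> real) \<in> borel_measurable ?M" by simp
    show "AE l in ?M. indicator {t..r} l * indicator {b..} (Z l - ?g l) = (indicator {..r} l :: real)"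
      using excess_carried[OF Z, of b] by eventually_elim (simp add: indicator_def)
  qed
  also have "\<dots> = measure ?M {..r}" by simp
  also have "\<dots> = ?g r"
    using r excess_ge(1)[OF Z, of r r b] by (simp add: measure_def emeasure_stieltjes_atMost[OF g])
  finally show ?thesis by (simp add: set_lebesgue_integral_def)
qed

section \<open>Ruin times\<close>

lemma ruin_time_ge: "ereal t \<le> ruin_time t X \<omega>"
  unfolding ruin_time_def by (rule Inf_greatest) auto

lemma ruin_time_greatest: "(\<And>r. t \<le> r \<Longrightarrow> X r \<omega> = 0 \<Longrightarrow> e \<le> r) \<Longrightarrow> ereal e \<le> ruin_time t X \<omega>"
  unfolding ruin_time_def by (rule Inf_greatest) auto

lemma ruin_time_le: "t \<le> r \<Longrightarrow> X r \<omega> = 0 \<Longrightarrow> ruin_time t X \<omega> \<le> ereal r"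
  unfolding ruin_time_def by (rule Inf_lower) auto

lemma before_ruin_nonzero: "t \<le> r \<Longrightarrow> ereal r < ruin_time t X \<omega> \<Longrightarrow> X r \<omega> \<noteq> 0"
  using ruin_time_le[of t r X \<omega>] by (auto simp: not_le)

lemma start_in_lifetime: "t \<in> lifetime t X \<omega>"
  using ruin_time_ge by (auto simp: lifetime_def)

text \<open>Right continuity: a path that is nonzero at the infimum would be nonzero slightly beyond
  it as well.\<close>

lemma ruin_time_attained:
  assumes X: "\<And>r. t \<le> r \<Longrightarrow> ((\<lambda>r. X r \<omega>) \<longlongrightarrow> X r \<omega>) (at_right r)" and \<tau>: "ruin_time t X \<omega> = ereal \<tau>"
  shows "t \<le> \<tau>" "X \<tau> \<omega> = 0"
proof -
  show t: "t \<le> \<tau>" using ruin_time_ge[of t X \<omega>] \<tau> by simp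
  show "X \<tau> \<omega> = 0"
  proof (rule ccontr)
    assume ne: "X \<tau> \<omega> \<noteq> 0"
    have "\<forall>\<^sub>F r in at_right \<tau>. X r \<omega> \<noteq> 0"
      using X[OF t] ne tendsto_imp_eventually_ne by fastforce
    then obtain b where b: "b > \<tau>" "\<And>r. \<tau> < r \<Longrightarrow> r < b \<Longrightarrow> X r \<omega> \<noteq> 0"
      unfolding eventually_at_right_field by auto
    have "ereal b \<le> ruin_time t X \<omega>"
    proof (rule ruin_time_greatest)
      fix r assume r: "t \<le> r" "X r \<omega> = 0"
      then have "\<tau> \<le> r" using ruin_time_le[of t r X \<omega>] \<tau> by simp
      then show "b \<le> r" using b(2)[of r] r(2) ne by (cases "r = \<tau>") (auto simp: not_less[symmetric])
    qed
    then show False using \<tau> b(1) by simp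
  qed
qed

text \<open>The lifetime of \<open>X\<close> includes its ruin time, where \<open>X\<close> vanishes
  by right continuity; so \<open>Y\<close> vanishes there too and has no earlier zero.\<close>

lemma ruin_time_cong:
  assumes X: "\<And>r. t \<le> r \<Longrightarrow> ((\<lambda>r. X r \<omega>) \<longlongrightarrow> X r \<omega>) (at_right r)"
    and eq: "\<And>r. r \<in> lifetime t X \<omega> \<Longrightarrow> X r \<omega> = Y r \<omega>"
  shows "ruin_time t Y \<omega> = ruin_time t X \<omega>"
proof (rule antisym)
  show "ruin_time t X \<omega> \<le> ruin_time t Y \<omega>"
    unfolding ruin_time_def[of t Y]
  proof (rule Inf_greatest)
    fix z assume "z \<in> ereal ` {r. t \<le> r \<and> Y r \<omega> = 0}"
    then obtain r where r: "z = ereal r" "t \<le> r" "Y r \<omega> = 0" by auto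
    show "ruin_time t X \<omega> \<le> z"
    proof (rule ccontr)
      assume "\<not> ruin_time t X \<omega> \<le> z"
      then have *: "ereal r < ruin_time t X \<omega>" using r by simp
      then have "X r \<omega> = Y r \<omega>" using eq[of r] r by (auto simp: lifetime_def)
      then show False using before_ruin_nonzero[OF r(2) *] r by simp
    qed
  qed
  show "ruin_time t Y \<omega> \<le> ruin_time t X \<omega>"
  proof (cases "ruin_time t X \<omega>")
    case (real \<tau>)
    note * = ruin_time_attained[OF X real]
    then have "Y \<tau> \<omega> = 0" using eq[of \<tau>] real by (auto simp: lifetime_def)
    then show ?thesis using ruin_time_le[OF *(1), of Y \<omega>] real by simp
  qed (use ruin_time_ge[of t X \<omega>] in auto)
qed

lemma lifetime_cong: "ruin_time t Y \<omega> = ruin_time t X \<omega> \<Longrightarrow> lifetime t Y \<omega> = lifetime t X \<omega>"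
  by (simp add: lifetime_def)

text \<open>Negative values can be reached only through 0, excluded by \<open>nz\<close>, or by a
  jump, excluded by \<open>jump\<close>. At the infimum \<open>s\<close> of the negative times the
  left limit is nonnegative, hence so is the value; it is not 0, and then right continuity
  contradicts the choice of \<open>s\<close>.\<close>

lemma nonneg_before_exit:
  fixes Y :: "real \<Rightarrow> real"
  assumes Y: "cadlag_from t Y" and start: "0 \<le> Y t"
    and nz: "\<And>r. t \<le> r \<Longrightarrow> r < b \<Longrightarrow> Y r \<noteq> 0"
    and jump: "\<And>r. t < r \<Longrightarrow> r \<le> b \<Longrightarrow> 0 \<le> left_lim Y r \<Longrightarrow> 0 \<le> Y r" and tb: "t \<le> b"
  shows "\<forall>r\<in>{t..b}. 0 \<le> Y r"
proof (rule ccontr)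
  assume "\<not> ?thesis"
  then obtain r where r: "t \<le> r" "r \<le> b" "Y r < 0" by auto
  define E where "E = {r. t \<le> r \<and> r \<le> b \<and> Y r < 0}"
  have bdd: "bdd_below E" by (auto simp: E_def intro!: bdd_belowI[of _ t])
  have ne: "E \<noteq> {}" using r by (auto simp: E_def)
  define s where "s = Inf E"
  have ts: "t \<le> s" unfolding s_def by (rule cInf_greatest[OF ne]) (auto simp: E_def)
  have sr: "s \<le> r" unfolding s_def using r by (intro cInf_lower[OF _ bdd]) (auto simp: E_def)
  have before: "0 \<le> Y q" if "t \<le> q" "q < s" for q
    using cInf_lower[OF _ bdd, of q] that sr r s_def by (force simp: E_def)
  have Ys: "0 \<le> Y s"
  proof (cases "t = s")
    case False
    with ts have ts': "t < s" by simp
    obtain l where l: "(Y \<longlongrightarrow> l) (at_left s)" using Y ts' by (auto simp: cadlag_from_def)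
    have "\<forall>\<^sub>F q in at_left s. 0 \<le> Y q"
      unfolding eventually_at_left_field using ts' before by (intro exI[of _ t]) auto
    then have "0 \<le> l" using tendsto_lowerbound[OF l] by simp
    moreover have "left_lim Y s = l" unfolding left_lim_def using tendsto_Lim[OF _ l] by simp
    ultimately show ?thesis using jump[OF ts'] sr r by simp
  qed (use start in auto)
  have "s < r" using sr Ys r by (cases "s = r") auto
  then have pos: "0 < Y s" using nz[of s] Ys ts r by simp
  have "(Y \<longlongrightarrow> Y s) (at_right s)" using Y ts by (auto simp: cadlag_from_def)
  then have "\<forall>\<^sub>F q in at_right s. 0 < Y q" using pos order_tendstoD(1) by blast
  then obtain d where d: "s < d" "\<And>q. s < q \<Longrightarrow> q < d \<Longrightarrow> 0 < Y q"
    unfolding eventually_at_right_field by auto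
  obtain e where e: "e \<in> E" "e < d" using cInf_less_iff[OF ne bdd, of d] d(1) s_def by auto
  have "s \<le> e" unfolding s_def using e by (intro cInf_lower[OF _ bdd])
  then show False using d(2)[of e] e pos by (cases "e = s") (auto simp: E_def)
qed

text \<open>Compactness for discontinuous paths: since jumps only go down, a positive value at a
  point also controls the left limit there, and the path has a positive lower bound on both sides of
  the point.\<close>

lemma positive_bounded_away:
  fixes Y :: "real \<Rightarrow> real"
  assumes Y: "\<And>r. t \<le> r \<Longrightarrow> (Y \<longlongrightarrow> Y r) (at_right r)"
    and left: "\<And>r. t < r \<Longrightarrow> r \<le> q \<Longrightarrow> \<exists>l\<ge>Y r. (Y \<longlongrightarrow> l) (at_left r)"
    and pos: "\<And>r. t \<le> r \<Longrightarrow> r \<le> q \<Longrightarrow> 0 < Y r" and tq: "t \<le> q"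
  shows "\<exists>e>0. \<forall>r\<in>{t..q}. e \<le> Y r"
proof -
  have "\<exists>e>0. \<forall>r. t \<le> r \<and> r \<le> q \<and> t \<le> r \<and> r \<le> q \<longrightarrow> e \<le> Y r"
  proof (rule Bolzano[of t q "\<lambda>a b. \<exists>e>0. \<forall>r. t \<le> r \<and> r \<le> q \<and> a \<le> r \<and> r \<le> b \<longrightarrow> e \<le> Y r"])
    fix a b c
    assume "\<exists>e>0. \<forall>r. t \<le> r \<and> r \<le> q \<and> a \<le> r \<and> r \<le> b \<longrightarrow> e \<le> Y r"
      "\<exists>e>0. \<forall>r. t \<le> r \<and> r \<le> q \<and> b \<le> r \<and> r \<le> c \<longrightarrow> e \<le> Y r"
    then obtain e1 e2 where "e1 > 0" "e2 > 0"
      "\<forall>r. t \<le> r \<and> r \<le> q \<and> a \<le> r \<and> r \<le> b \<longrightarrow> e1 \<le> Y r" "\<forall>r. t \<le> r \<and> r \<le> q \<and> b \<le> r \<and> r \<le> c \<longrightarrow> e2 \<le> Y r"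
      by blast
    then show "\<exists>e>0. \<forall>r. t \<le> r \<and> r \<le> q \<and> a \<le> r \<and> r \<le> c \<longrightarrow> e \<le> Y r"
      by (intro exI[of _ "min e1 e2"]) (auto simp: min_le_iff_disj, metis linear)
  next
    fix x assume x: "t \<le> x" "x \<le> q"
    define e where "e = Y x / 2"
    have e: "0 < e" "e < Y x" using pos[OF x] by (auto simp: e_def)
    obtain dr where dr: "x < dr" "\<And>r. x < r \<Longrightarrow> r < dr \<Longrightarrow> e < Y r"
      using order_tendstoD(1)[OF Y[OF x(1)] e(2)] unfolding eventually_at_right_field by auto
    have "\<exists>dl<x. \<forall>r. t \<le> r \<longrightarrow> dl < r \<longrightarrow> r < x \<longrightarrow> e < Y r"
    proof (cases "t = x")
      case False
      then obtain l where l: "Y x \<le> l" "(Y \<longlongrightarrow> l) (at_left x)" using left[of x] x by auto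
      then have "\<forall>\<^sub>F r in at_left x. e < Y r" using order_tendstoD(1)[OF l(2), of e] e by simp
      then show ?thesis unfolding eventually_at_left_field by auto
    qed (auto intro!: exI[of _ "t - 1"])
    then obtain dl where dl: "dl < x" "\<And>r. t \<le> r \<Longrightarrow> dl < r \<Longrightarrow> r < x \<Longrightarrow> e < Y r" by auto
    define d where "d = min (dr - x) (x - dl)"
    have "0 < d" using dr dl by (simp add: d_def)
    moreover have "\<exists>e>0. \<forall>r. t \<le> r \<and> r \<le> q \<and> a \<le> r \<and> r \<le> b \<longrightarrow> e \<le> Y r" if "a \<le> x \<and> x \<le> b \<and> b - a < d" for a b
    proof (intro exI[of _ e] conjI allI impI e(1))
      fix r assume "t \<le> r \<and> r \<le> q \<and> a \<le> r \<and> r \<le> b"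
      then show "e \<le> Y r"
        using that dr(2)[of r] dl(2)[of r] e by (cases r x rule: linorder_cases) (auto simp: d_def)
    qed
    ultimately show "\<exists>d>0. \<forall>a b. a \<le> x \<and> x \<le> b \<and> b - a < d \<longrightarrow> (\<exists>e>0. \<forall>r. t \<le> r \<and> r \<le> q \<and> a \<le> r \<and> r \<le> b \<longrightarrow> e \<le> Y r)"
      by blast
  qed (rule tq)
  then show ?thesis by auto
qed

text \<open>The regularity of a surplus whose only jumps are payments. Admitting only downward jumps
  is what keeps a path that is positive on a compact interval bounded away from 0 there.\<close>

definition down_cadlag :: "real \<Rightarrow> (real \<Rightarrow> real) \<Rightarrow> bool" where
  "down_cadlag t y \<longleftrightarrow>
     (\<forall>r\<ge>t. (y \<longlongrightarrow> y r) (at_right r)) \<and> (\<forall>r>t. \<exists>l\<ge>y r. (y \<longlongrightarrow> l) (at_left r))"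

lemma down_cadlag_continuous: "continuous_on {t..} y \<Longrightarrow> down_cadlag t y"
  unfolding down_cadlag_def using continuous_on_atLeast_at_right continuous_on_atLeast_at_left by blast

lemma down_cadlag_diff:
  assumes z: "continuous_on {t..} z" and g: "dividend_path t g"
  shows "down_cadlag t (\<lambda>r. z r - g r)"
  unfolding down_cadlag_def
proof (intro conjI allI impI)
  fix r assume r: "t \<le> r"
  show "((\<lambda>r. z r - g r) \<longlongrightarrow> z r - g r) (at_right r)"
    using g r by (intro tendsto_diff continuous_on_atLeast_at_right[OF z]) (auto simp: dividend_path_def cadlag_from_def)
next
  fix r assume r: "t < r"
  obtain l where l: "(g \<longlongrightarrow> l) (at_left r)" using g r by (auto simp: dividend_path_def cadlag_from_def)
  have "\<forall>\<^sub>F s in at_left r. g s \<le> g r"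
    unfolding eventually_at_left_field using r dividend_path_mono[OF g] by (intro exI[of _ t]) auto
  then have "l \<le> g r" using tendsto_upperbound[OF l] by simp
  then show "\<exists>l\<ge>z r - g r. ((\<lambda>r. z r - g r) \<longlongrightarrow> l) (at_left r)"
    using tendsto_diff[OF continuous_on_atLeast_at_left[OF z r] l] by (intro exI[of _ "z r - l"]) auto
qed

text \<open>The end point is added because values of a right-continuous path are recovered from
  later times, and for \<open>q\<close> there are none in the interval.\<close>

definition rational_times :: "real \<Rightarrow> real \<Rightarrow> real set" where
  "rational_times t q = insert q (range of_rat \<inter> {t..q})"

lemma countable_rational_times: "countable (rational_times t q)"
  by (simp add: rational_times_def)

lemma rational_times_bounds: "t \<le> q \<Longrightarrow> s \<in> rational_times t q \<Longrightarrow> t \<le> s \<and> s \<le> q"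
  by (auto simp: rational_times_def)

lemma right_cont_le_from_rationals:
  fixes f :: "real \<Rightarrow> real"
  assumes rc: "\<And>r. t \<le> r \<Longrightarrow> (f \<longlongrightarrow> f r) (at_right r)"
    and le: "\<And>s. s \<in> rational_times t q \<Longrightarrow> f s \<le> m" and r: "t \<le> r" "r \<le> q"
  shows "f r \<le> m"
proof (rule ccontr)
  assume "\<not> f r \<le> m"
  then have m: "m < f r" by simp
  then have rq: "r < q" using le[of q] r by (cases "r = q") (auto simp: rational_times_def)
  obtain d where d: "r < d" "\<And>s. r < s \<Longrightarrow> s < d \<Longrightarrow> m < f s"
    using order_tendstoD(1)[OF rc[OF r(1)] m] unfolding eventually_at_right_field by auto
  obtain p where p: "r < real_of_rat p" "real_of_rat p < min d q" using of_rat_dense[of r "min d q"] d rq by auto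
  then have "real_of_rat p \<in> rational_times t q" using r by (auto simp: rational_times_def)
  then show False using le d(2)[of "real_of_rat p"] p by fastforce
qed

context brownian_filtered_space
begin

text \<open>Ruin after \<open>q\<close> means that some \<open>1 / (m + 1)\<close> bounds the
  surplus from below on \<open>[t, q]\<close>, and by right continuity this can be read off at
  countably many times. So the first zero is a stopping time, with no appeal to general hitting
  times.\<close>

lemma ruin_time_adapted:
  assumes t: "0 \<le> t" "t \<le> q" and S: "\<And>r. t \<le> r \<Longrightarrow> S r \<in> borel_measurable (F r)"
    and reg: "AE \<omega> in \<Omega>. down_cadlag t (\<lambda>r. S r \<omega>) \<and> (\<forall>r\<in>lifetime t S \<omega>. 0 \<le> S r \<omega>)"
  shows "{\<omega> \<in> space \<Omega>. ereal q < ruin_time t S \<omega>} \<in> sets (F q)"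
proof (rule F_sets_AE_cong[where A="{\<omega> \<in> space (F q). \<exists>m::nat. \<forall>s\<in>rational_times t q. 1 / real (Suc m) \<le> S s \<omega>}"])
  show q0: "0 \<le> q" using t by simp
  show "{\<omega> \<in> space (F q). \<exists>m::nat. \<forall>s\<in>rational_times t q. 1 / real (Suc m) \<le> S s \<omega>} \<in> sets (F q)"
  proof (rule sets.sets_Collect_countable_Ex, rule sets.sets_Collect_countable_All'[OF _ countable_rational_times])
    fix m :: nat and s assume "s \<in> rational_times t q"
    then have "t \<le> s" "s \<le> q" using rational_times_bounds[OF t(2)] by blast+
    then have [measurable]: "S s \<in> borel_measurable (F q)" using S[of s] t F_measurable_mono[of s q] by auto
    show "{\<omega> \<in> space (F q). 1 / real (Suc m) \<le> S s \<omega>} \<in> sets (F q)" by measurable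
  qed
  have "AE \<omega> in \<Omega>. (\<exists>m::nat. \<forall>s\<in>rational_times t q. 1 / real (Suc m) \<le> S s \<omega>) \<longleftrightarrow> ereal q < ruin_time t S \<omega>"
    using reg
  proof eventually_elim
    case (elim \<omega>)
    then have rc: "\<And>r. t \<le> r \<Longrightarrow> ((\<lambda>r. S r \<omega>) \<longlongrightarrow> S r \<omega>) (at_right r)" by (auto simp: down_cadlag_def)
    show ?case
    proof
      assume "\<exists>m::nat. \<forall>s\<in>rational_times t q. 1 / real (Suc m) \<le> S s \<omega>"
      then obtain m :: nat where m: "\<And>s. s \<in> rational_times t q \<Longrightarrow> 1 / real (Suc m) \<le> S s \<omega>" by blast
      have pos: "1 / real (Suc m) \<le> S r \<omega>" if "t \<le> r" "r \<le> q" for r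
        using right_cont_le_from_rationals[of t "\<lambda>r. - S r \<omega>" q "- (1 / real (Suc m))" r, OF tendsto_minus[OF rc]] m that
        by auto
      show "ereal q < ruin_time t S \<omega>"
      proof (rule ccontr)
        assume "\<not> ereal q < ruin_time t S \<omega>"
        then obtain \<tau> where \<tau>: "ruin_time t S \<omega> = ereal \<tau>" "\<tau> \<le> q"
          using ruin_time_ge[of t S \<omega>] by (cases "ruin_time t S \<omega>") auto
        have "t \<le> \<tau>" "S \<tau> \<omega> = 0" using ruin_time_attained[OF rc \<tau>(1)] by auto
        moreover have "0 < 1 / real (Suc m)" by simp
        ultimately show False using pos[of \<tau>] \<tau>(2) by linarith
      qed
    next
      assume q: "ereal q < ruin_time t S \<omega>"
      have "\<exists>e>0. \<forall>r\<in>{t..q}. e \<le> S r \<omega>"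
      proof (rule positive_bounded_away[OF rc _ _ t(2)])
        fix r assume "t < r" "r \<le> q"
        then show "\<exists>l\<ge>S r \<omega>. ((\<lambda>r. S r \<omega>) \<longlongrightarrow> l) (at_left r)" using elim by (auto simp: down_cadlag_def)
      next
        fix r assume r: "t \<le> r" "r \<le> q"
        then have *: "ereal r < ruin_time t S \<omega>" using q by (auto intro: le_less_trans[of "ereal r" "ereal q"])
        then have "r \<in> lifetime t S \<omega>" using r by (auto simp: lifetime_def)
        then show "0 < S r \<omega>" using elim before_ruin_nonzero[OF r(1) *] by (simp add: less_le)
      qed
      then obtain e where e: "e > 0" "\<forall>r\<in>{t..q}. e \<le> S r \<omega>" by auto
      obtain m where "inverse (real (Suc m)) < e" using reals_Archimedean[OF e(1)] by auto
      then have "\<forall>s\<in>rational_times t q. 1 / real (Suc m) \<le> S s \<omega>"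
        using e(2) rational_times_bounds[OF t(2)] by (force simp: inverse_eq_divide)
      then show "\<exists>m::nat. \<forall>s\<in>rational_times t q. 1 / real (Suc m) \<le> S s \<omega>" by blast
    qed
  qed
  then show "AE \<omega> in \<Omega>. (\<omega> \<in> {\<omega> \<in> space (F q). \<exists>m::nat. \<forall>s\<in>rational_times t q. 1 / real (Suc m) \<le> S s \<omega>})
      = (\<omega> \<in> {\<omega> \<in> space \<Omega>. ereal q < ruin_time t S \<omega>})"
    using AE_space by eventually_elim (use q0 in auto)
qed simp

lemma measurable_AE_limit:
  fixes f :: "nat \<Rightarrow> 'w \<Rightarrow> real"
  assumes f: "\<And>n. f n \<in> borel_measurable \<Omega>" and lim: "AE \<omega> in \<Omega>. (\<lambda>n. f n \<omega>) \<longlonglongrightarrow> g \<omega>"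
  shows "g \<in> borel_measurable \<Omega>"
proof (rule borel_measurable_AE_cong)
  show "(\<lambda>\<omega>. lim (\<lambda>n. f n \<omega>)) \<in> borel_measurable \<Omega>" using f by (rule borel_measurable_lim_metric)
  show "AE \<omega> in \<Omega>. lim (\<lambda>n. f n \<omega>) = g \<omega>" using lim by eventually_elim (rule limI)
qed

end

section \<open>Optional stopping on the dyadic grid\<close>

definition grid_ceiling :: "real \<Rightarrow> nat \<Rightarrow> real \<Rightarrow> real" where
  "grid_ceiling t n s = (if s \<le> t then t else dyadic t n (Suc (cell t n s)))"

lemma grid_ceiling_bounds:
  assumes "t \<le> s" "s \<le> t + real N"
  shows "s \<le> grid_ceiling t n s" "grid_ceiling t n s \<le> t + real N"
proof -
  show "s \<le> grid_ceiling t n s"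
    using cell_bounds(2)[of t s n] by (auto simp: grid_ceiling_def)
  show "grid_ceiling t n s \<le> t + real N"
  proof (cases "s \<le> t")
    case False
    then have "Suc (cell t n s) \<le> N * 2 ^ n" using cell_less[of t s N n] assms by auto
    then have "dyadic t n (Suc (cell t n s)) \<le> dyadic t n (N * 2 ^ n)" by (rule dyadic_mono)
    then show ?thesis using False by (simp add: grid_ceiling_def dyadic_end)
  qed (simp add: grid_ceiling_def)
qed

lemma grid_ceiling_tendsto: "t \<le> s \<Longrightarrow> (\<lambda>n. grid_ceiling t n s) \<longlonglongrightarrow> s"
  using cell_tendsto(2)[of t s] by (cases "t = s") (auto simp: grid_ceiling_def)

text \<open>Whether a cell is entered before \<open>s\<close> is decided at its left end, so for a
  stopping time the sum is a martingale transform; pathwise it telescopes to the first grid time at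
  or after \<open>s\<close>.\<close>

lemma telescope_stopped:
  fixes G :: "real \<Rightarrow> real"
  assumes s: "t \<le> s" "s \<le> t + real N"
  shows "(\<Sum>k<N * 2 ^ n. if dyadic t n k < s then G (dyadic t n (Suc k)) - G (dyadic t n k) else 0)
    = G (grid_ceiling t n s) - G t"
proof (cases "s = t")
  case True
  then have "\<not> dyadic t n k < s" for k using dyadic_ge[of t n k] by simp
  then show ?thesis using True by (simp add: grid_ceiling_def)
next
  case False
  with s have ts: "t < s" by simp
  let ?m = "Suc (cell t n s)"
  have iff: "dyadic t n k < s \<longleftrightarrow> k < ?m" for k
  proof
    assume "k < ?m"
    then have "dyadic t n k \<le> dyadic t n (cell t n s)" by (intro dyadic_mono) simp
    then show "dyadic t n k < s" using cell_bounds(1)[OF ts, of n] by simp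
  next
    assume "dyadic t n k < s"
    show "k < ?m"
    proof (rule ccontr)
      assume "\<not> k < ?m"
      then have "dyadic t n ?m \<le> dyadic t n k" by (intro dyadic_mono) simp
      then show False using cell_bounds(2)[OF ts, of n] \<open>dyadic t n k < s\<close> by simp
    qed
  qed
  have m: "?m \<le> N * 2 ^ n" using cell_less[OF ts s(2), of n] by simp
  have "(\<Sum>k<N * 2 ^ n. if dyadic t n k < s then G (dyadic t n (Suc k)) - G (dyadic t n k) else 0)
    = (\<Sum>k<?m. G (dyadic t n (Suc k)) - G (dyadic t n k))"
    by (rule sum.mono_neutral_cong_right) (use m iff in auto)
  also have "\<dots> = G (dyadic t n ?m) - G (dyadic t n 0)" by (rule sum_lessThan_telescope)
  finally show ?thesis using False s by (simp add: grid_ceiling_def)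
qed

definition capped_ruin :: "real \<Rightarrow> real \<Rightarrow> 'w process \<Rightarrow> 'w \<Rightarrow> real" where
  "capped_ruin t h X \<omega> = (if ruin_time t X \<omega> < ereal (t + h) then real_of_ereal (ruin_time t X \<omega>) else t + h)"

lemma capped_ruin_iff:
  assumes "0 \<le> h" shows "q < capped_ruin t h X \<omega> \<longleftrightarrow> q < t + h \<and> ereal q < ruin_time t X \<omega>"
proof (cases "ruin_time t X \<omega> < ereal (t + h)")
  case True
  then obtain \<tau> where \<tau>: "ruin_time t X \<omega> = ereal \<tau>" using ruin_time_ge[of t X \<omega>] by (cases "ruin_time t X \<omega>") auto
  then show ?thesis using True by (auto simp: capped_ruin_def)
next
  case False
  then have "ereal (t + h) \<le> ruin_time t X \<omega>" by simp
  then show ?thesis using False by (auto simp: capped_ruin_def intro: less_le_trans[of "ereal q" "ereal (t + h)"])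
qed

lemma capped_ruin_bounds:
  assumes "0 \<le> h" shows "t \<le> capped_ruin t h X \<omega>" "capped_ruin t h X \<omega> \<le> t + h"
    "ereal (capped_ruin t h X \<omega>) \<le> ruin_time t X \<omega>"
proof -
  have "t \<le> capped_ruin t h X \<omega> \<and> capped_ruin t h X \<omega> \<le> t + h \<and> ereal (capped_ruin t h X \<omega>) \<le> ruin_time t X \<omega>"
    using ruin_time_ge[of t X \<omega>] assms by (cases "ruin_time t X \<omega>") (auto simp: capped_ruin_def)
  then show "t \<le> capped_ruin t h X \<omega>" "capped_ruin t h X \<omega> \<le> t + h"
    "ereal (capped_ruin t h X \<omega>) \<le> ruin_time t X \<omega>" by auto
qed

context brownian_filtered_space
begin

lemma increment_mean_zero:
  assumes st: "0 \<le> s" "s < t" and Z: "Z \<in> borel_measurable (F s)" "\<And>\<omega>. \<omega> \<in> space \<Omega> \<Longrightarrow> \<bar>Z \<omega>\<bar> \<le> K"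
  shows "integrable \<Omega> (\<lambda>\<omega>. Z \<omega> * (B t \<omega> - B s \<omega>))" "expectation (\<lambda>\<omega>. Z \<omega> * (B t \<omega> - B s \<omega>)) = 0"
proof -
  have "integrable \<Omega> Z"
    by (rule integrable_const_bound[of _ K]) (use Z F_measurable st in auto)
  note * = increment_expectation[OF st Z(1) this, of "\<lambda>z. z"]
  show "integrable \<Omega> (\<lambda>\<omega>. Z \<omega> * (B t \<omega> - B s \<omega>))"
    using *(1)[OF _ normal_moment_1] st by simp
  show "expectation (\<lambda>\<omega>. Z \<omega> * (B t \<omega> - B s \<omega>)) = 0"
    using *(2)[OF _ normal_moment_1] st by simp
qed

text \<open>Rounding the stopping time up to the grid gives a sum of terms with mean 0. As
  \<open>\<bar>v\<bar> \<le> exp \<bar>v\<bar>\<close>, the majorant of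
  \<open>exp_sup_dominated\<close> allows the mesh to tend to 0.\<close>

lemma stopped_increment_expectation:
  assumes t: "0 \<le> t" and Z: "Z \<in> borel_measurable (F t)" "\<And>\<omega>. \<omega> \<in> space \<Omega> \<Longrightarrow> \<bar>Z \<omega>\<bar> \<le> K"
    and s: "\<And>\<omega>. t \<le> s \<omega> \<and> s \<omega> \<le> t + real N"
    and stop: "\<And>q. t \<le> q \<Longrightarrow> {\<omega> \<in> space \<Omega>. q < s \<omega>} \<in> sets (F q)"
  shows "integrable \<Omega> (\<lambda>\<omega>. Z \<omega> * (B (s \<omega>) \<omega> - B t \<omega>))"
    and "expectation (\<lambda>\<omega>. Z \<omega> * (B (s \<omega>) \<omega> - B t \<omega>)) = 0"
proof -
  obtain D :: "'w \<Rightarrow> real" where D: "integrable \<Omega> D" "\<And>\<omega>. 0 \<le> D \<omega>"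
    "AE \<omega> in \<Omega>. \<forall>r\<in>{t..t + real N}. exp (1 * \<bar>B r \<omega> - B t \<omega>\<bar>) \<le> D \<omega>"
    using exp_sup_dominated[OF t, of 1 N] by auto
  define f where "f n \<omega> = (\<Sum>k<N * 2 ^ n. Z \<omega> * indicator {\<omega> \<in> space \<Omega>. dyadic t n k < s \<omega>} \<omega> *
      (B (dyadic t n (Suc k)) \<omega> - B (dyadic t n k) \<omega>))" for n \<omega>
  have tk: "0 \<le> dyadic t n k" for n k using t dyadic_ge[of t n k] by simp
  have ZI: "(\<lambda>\<omega>. Z \<omega> * indicator {\<omega> \<in> space \<Omega>. dyadic t n k < s \<omega>} \<omega>) \<in> borel_measurable (F (dyadic t n k))" for n k
    using F_measurable_mono[OF t dyadic_ge Z(1), of n k] stop[OF dyadic_ge, of n k]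
    by (intro borel_measurable_times borel_measurable_indicator) auto
  have "\<bar>Z \<omega> * indicator A \<omega>\<bar> \<le> K" if "\<omega> \<in> space \<Omega>" for \<omega> A
    using Z(2)[OF that] by (auto simp: indicator_def intro: order_trans[OF abs_ge_zero])
  note inc = increment_mean_zero[OF tk dyadic_less_Suc ZI this]
  have fi: "integrable \<Omega> (f n)" for n unfolding f_def using inc(1) by simp
  have fe: "expectation (f n) = 0" for n unfolding f_def using inc by simp
  have f_eq: "f n \<omega> = Z \<omega> * (B (grid_ceiling t n (s \<omega>)) \<omega> - B t \<omega>)" if "\<omega> \<in> space \<Omega>" for n \<omega>
  proof -
    have "f n \<omega> = Z \<omega> * (\<Sum>k<N * 2 ^ n. if dyadic t n k < s \<omega> then B (dyadic t n (Suc k)) \<omega> - B (dyadic t n k) \<omega> else 0)"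
      unfolding f_def sum_distrib_left using that by (intro sum.cong) (auto simp: indicator_def)
    then show ?thesis using telescope_stopped[of t "s \<omega>" N n "\<lambda>r. B r \<omega>"] s[of \<omega>] by simp
  qed
  have lim: "AE \<omega> in \<Omega>. (\<lambda>n. f n \<omega>) \<longlonglongrightarrow> Z \<omega> * (B (s \<omega>) \<omega> - B t \<omega>)"
    using B_continuous AE_space
  proof eventually_elim
    case (elim \<omega>)
    have "0 \<le> grid_ceiling t n (s \<omega>)" for n
      using s[of \<omega>] t grid_ceiling_bounds(1)[of t "s \<omega>" N n] by linarith
    then have "(\<lambda>n. B (grid_ceiling t n (s \<omega>)) \<omega>) \<longlonglongrightarrow> B (s \<omega>) \<omega>"
      using s[of \<omega>] t grid_ceiling_tendsto[of t "s \<omega>"] by (intro continuous_on_tendsto_compose[OF elim(1)]) auto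
    then show ?case using elim(2) by (simp add: f_eq) (intro tendsto_intros)
  qed
  have bound: "AE \<omega> in \<Omega>. norm (f n \<omega>) \<le> \<bar>K\<bar> * D \<omega>" for n
    using D(3) AE_space
  proof eventually_elim
    case (elim \<omega>)
    let ?r = "grid_ceiling t n (s \<omega>)"
    have "\<bar>B ?r \<omega> - B t \<omega>\<bar> \<le> exp (1 * \<bar>B ?r \<omega> - B t \<omega>\<bar>)" using exp_ge_add_one_self[of "\<bar>B ?r \<omega> - B t \<omega>\<bar>"] unfolding mult_1 by linarith
    also have "\<dots> \<le> D \<omega>" using elim(1) grid_ceiling_bounds[of t "s \<omega>" N n] s[of \<omega>] by auto
    finally have "\<bar>Z \<omega>\<bar> * \<bar>B ?r \<omega> - B t \<omega>\<bar> \<le> \<bar>K\<bar> * D \<omega>"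
      using Z(2)[OF elim(2)] by (intro mult_mono) auto
    then show ?case by (simp add: f_eq[OF elim(2)] abs_mult)
  qed
  have fm: "f n \<in> borel_measurable \<Omega>" for n using fi by (rule borel_measurable_integrable)
  have lm: "(\<lambda>\<omega>. Z \<omega> * (B (s \<omega>) \<omega> - B t \<omega>)) \<in> borel_measurable \<Omega>"
    by (rule measurable_AE_limit[OF fm lim])
  have KD: "integrable \<Omega> (\<lambda>\<omega>. \<bar>K\<bar> * D \<omega>)" using D(1) by simp
  note dct = integral_dominated_convergence[OF lm fm KD lim bound]
    integrable_dominated_convergence[OF lm fm KD lim bound]
  show "integrable \<Omega> (\<lambda>\<omega>. Z \<omega> * (B (s \<omega>) \<omega> - B t \<omega>))" by (rule dct(2))
  show "expectation (\<lambda>\<omega>. Z \<omega> * (B (s \<omega>) \<omega> - B t \<omega>)) = 0"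
    using LIMSEQ_unique[OF dct(1)] by (simp add: fe)
qed

end

section \<open>Stieltjes integrals with random integrators\<close>

lemma stieltjes_integral_lifetime:
  assumes g: "dividend_path t g" and \<tau>: "ereal t \<le> \<tau>"
    and \<phi>: "\<phi> \<in> borel_measurable borel" "\<And>r. t \<le> r \<Longrightarrow> 0 \<le> \<phi> r" "\<And>r. t \<le> r \<Longrightarrow> \<phi> r \<le> C"
  shows "(\<integral>\<^sup>+r\<in>{r. t \<le> r \<and> ereal r \<le> \<tau>}. ennreal (\<phi> r) \<partial>stieltjes t g)
    = ennreal (\<phi> t * g t) +
      (SUP N. ennreal (LINT r:{t<..t + real N}|stieltjes t g. \<phi> r * indicator {r. ereal r \<le> \<tau>} r))"
proof -
  let ?M = "stieltjes t g"
  let ?h = "\<lambda>N r. ennreal (\<phi> r) * indicator ({t<..t + real N} \<inter> {r. ereal r \<le> \<tau>}) r"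
  have ms: "f \<in> borel_measurable borel \<Longrightarrow> f \<in> borel_measurable ?M" for f :: "real \<Rightarrow> 'x::topological_space"
    by (simp add: measurable_cong_sets[OF sets_stieltjes refl])
  have hm: "?h N \<in> borel_measurable ?M" for N :: nat by (intro ms) (use \<phi>(1) in measurable)
  have C: "0 \<le> C" using \<phi>(2,3)[of t] by simp
  \<comment> \<open>The atom at \<open>t\<close> is split off because the grid cells miss it. The
    rest is exhausted by bounded horizons, on which the integral is finite and a limit of Riemann
    sums.\<close>
  have "ennreal (\<phi> r) * indicator {r. t \<le> r \<and> ereal r \<le> \<tau>} r = ennreal (\<phi> t) * indicator {t} r + (SUP N. ?h N r)" for r
  proof (cases "t < r")
    case True
    obtain m :: nat where m: "r - t \<le> real m" using real_arch_simple by blast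
    have "(SUP N. ?h N r) = ennreal (\<phi> r) * indicator {r. t \<le> r \<and> ereal r \<le> \<tau>} r"
    proof (rule antisym[OF SUP_least])
      show "?h N r \<le> ennreal (\<phi> r) * indicator {r. t \<le> r \<and> ereal r \<le> \<tau>} r" for N by (auto simp: indicator_def)
      have "ennreal (\<phi> r) * indicator {r. t \<le> r \<and> ereal r \<le> \<tau>} r \<le> ?h m r" using True m by (auto simp: indicator_def)
      then show "ennreal (\<phi> r) * indicator {r. t \<le> r \<and> ereal r \<le> \<tau>} r \<le> (SUP N. ?h N r)" by (rule SUP_upper2[rotated]) simp
    qed
    then show ?thesis using True by (simp add: indicator_def)
  qed (use \<tau> in \<open>auto simp: indicator_def\<close>)
  then have "(\<integral>\<^sup>+r\<in>{r. t \<le> r \<and> ereal r \<le> \<tau>}. ennreal (\<phi> r) \<partial>?M) = (\<integral>\<^sup>+r. ennreal (\<phi> t) * indicator {t} r + (SUP N. ?h N r) \<partial>?M)"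
    by simp
  also have "\<dots> = (\<integral>\<^sup>+r. ennreal (\<phi> t) * indicator {t} r \<partial>?M) + (\<integral>\<^sup>+r. (SUP N. ?h N r) \<partial>?M)"
    by (rule nn_integral_add) (auto intro: borel_measurable_SUP hm)
  also have "(\<integral>\<^sup>+r. ennreal (\<phi> t) * indicator {t} r \<partial>?M) = ennreal (\<phi> t * g t)"
    using \<phi>(2)[of t] by (simp add: nn_integral_cmult_indicator emeasure_stieltjes_point[OF g] ennreal_mult')
  also have "(\<integral>\<^sup>+r. (SUP N. ?h N r) \<partial>?M) = (SUP N. \<integral>\<^sup>+r. ?h N r \<partial>?M)"
    by (rule nn_integral_monotone_convergence_SUP[OF _ hm]) (auto simp: incseq_def le_fun_def indicator_def)
  also have "\<dots> = (SUP N. ennreal (LINT r:{t<..t + real N}|?M. \<phi> r * indicator {r. ereal r \<le> \<tau>} r))"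
  proof (intro SUP_cong refl)
    fix N :: nat
    let ?k = "\<lambda>r. indicator {t<..t + real N} r * (\<phi> r * indicator {r. ereal r \<le> \<tau>} r)"
    have "integrable ?M ?k"
    proof (rule Bochner_Integration.integrable_bound)
      show "integrable ?M (\<lambda>r. C * indicator {t<..t + real N} r)"
        using emeasure_stieltjes_Ioc[OF g, of t "t + real N"]
        by (intro integrable_mult_right integrable_real_indicator) auto
      show "?k \<in> borel_measurable ?M" by (intro ms) (use \<phi>(1) in measurable)
      show "AE r in ?M. norm (?k r) \<le> norm (C * indicator {t<..t + real N} r)"
        using \<phi>(2,3) C by (intro AE_I2) (auto simp: indicator_def)
    qed
    then have "ennreal (LINT r|?M. ?k r) = (\<integral>\<^sup>+r. ennreal (?k r) \<partial>?M)"
      by (intro nn_integral_eq_integral[symmetric]) (use \<phi>(2) in \<open>auto simp: indicator_def\<close>)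
    also have "\<dots> = (\<integral>\<^sup>+r. ?h N r \<partial>?M)" by (rule nn_integral_cong) (auto simp: indicator_def)
    finally show "(\<integral>\<^sup>+r. ?h N r \<partial>?M) = ennreal (LINT r:{t<..t + real N}|?M. \<phi> r * indicator {r. ereal r \<le> \<tau>} r)"
      by (simp add: set_lebesgue_integral_def)
  qed
  finally show ?thesis .
qed

context brownian_filtered_space
begin

text \<open>The measure itself depends on \<open>\<omega>\<close>, so measurability is inherited
  from the Riemann sums, which involve \<open>\<xi>\<close> at fixed times only.\<close>

lemma stieltjes_integral_measurable:
  assumes \<xi>: "\<And>r. t \<le> r \<Longrightarrow> \<xi> r \<in> borel_measurable \<Omega>" and g: "AE \<omega> in \<Omega>. dividend_path t (\<lambda>r. \<xi> r \<omega>)"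
    and \<tau>: "\<And>\<omega>. ereal t \<le> \<tau> \<omega>" and stop: "\<And>q. t \<le> q \<Longrightarrow> {\<omega> \<in> space \<Omega>. ereal q < \<tau> \<omega>} \<in> sets \<Omega>"
    and \<phi>: "continuous_on UNIV \<phi>" "\<And>r. t \<le> r \<Longrightarrow> 0 \<le> \<phi> r" "\<And>r. t \<le> r \<Longrightarrow> \<phi> r \<le> C"
  shows "(\<lambda>\<omega>. \<integral>\<^sup>+r\<in>{r. t \<le> r \<and> ereal r \<le> \<tau> \<omega>}. ennreal (\<phi> r) \<partial>stieltjes t (\<lambda>r. \<xi> r \<omega>)) \<in> borel_measurable \<Omega>"
proof -
  have \<phi>m: "\<phi> \<in> borel_measurable borel" by (rule borel_measurable_continuous_onI[OF \<phi>(1)])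
  define I where "I N \<omega> = (LINT r:{t<..t + real N}|stieltjes t (\<lambda>r. \<xi> r \<omega>). \<phi> r * indicator {r. ereal r \<le> \<tau> \<omega>} r)" for N \<omega>
  have C: "0 \<le> C" using \<phi>(2,3)[of t] by simp
  have I: "I N \<in> borel_measurable \<Omega>" for N
  proof (rule measurable_AE_limit)
    fix n
    show "(\<lambda>\<omega>. \<Sum>k<N * 2 ^ n. indicator {\<omega> \<in> space \<Omega>. ereal (dyadic t n k) < \<tau> \<omega>} \<omega> * \<phi> (dyadic t n (Suc k)) *
        (\<xi> (dyadic t n (Suc k)) \<omega> - \<xi> (dyadic t n k) \<omega>)) \<in> borel_measurable \<Omega>"
      by (intro borel_measurable_sum borel_measurable_times borel_measurable_diff borel_measurable_indicator stop \<xi> dyadic_ge) simp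
  next
    show "AE \<omega> in \<Omega>. (\<lambda>n. \<Sum>k<N * 2 ^ n. indicator {\<omega> \<in> space \<Omega>. ereal (dyadic t n k) < \<tau> \<omega>} \<omega> * \<phi> (dyadic t n (Suc k)) *
        (\<xi> (dyadic t n (Suc k)) \<omega> - \<xi> (dyadic t n k) \<omega>)) \<longlonglongrightarrow> I N \<omega>"
      using g AE_space
    proof eventually_elim
      case (elim \<omega>)
      show ?case
        unfolding I_def
      proof (rule Riemann_Stieltjes_limit[OF elim(1), where C=C])
        show "\<bar>indicator {\<omega> \<in> space \<Omega>. ereal (dyadic t n k) < \<tau> \<omega>} \<omega> * \<phi> (dyadic t n (Suc k))\<bar> \<le> C" for n k
          using \<phi>(2,3)[OF dyadic_ge, of n "Suc k"] C by (auto simp: indicator_def)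
        show "(\<lambda>r. \<phi> r * indicator {r. ereal r \<le> \<tau> \<omega>} r) \<in> borel_measurable borel"
          using \<phi>m by measurable
        show "AE r in stieltjes t (\<lambda>r. \<xi> r \<omega>). t < r \<longrightarrow> r \<le> t + real N \<longrightarrow>
          (\<lambda>n. indicator {\<omega> \<in> space \<Omega>. ereal (dyadic t n (cell t n r)) < \<tau> \<omega>} \<omega> * \<phi> (dyadic t n (Suc (cell t n r))))
            \<longlonglongrightarrow> \<phi> r * indicator {r. ereal r \<le> \<tau> \<omega>} r"
        proof (intro AE_I2 impI)
          fix r assume r: "t < r"
          have lim: "(\<lambda>n. \<phi> (dyadic t n (Suc (cell t n r)))) \<longlonglongrightarrow> \<phi> r"
            by (rule continuous_on_tendsto_compose[OF \<phi>(1) cell_tendsto(2)[OF r]]) auto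
          show "(\<lambda>n. indicator {\<omega> \<in> space \<Omega>. ereal (dyadic t n (cell t n r)) < \<tau> \<omega>} \<omega> * \<phi> (dyadic t n (Suc (cell t n r))))
            \<longlonglongrightarrow> \<phi> r * indicator {r. ereal r \<le> \<tau> \<omega>} r"
          proof (cases "ereal r \<le> \<tau> \<omega>")
            case True
            \<comment> \<open>The indicator is evaluated at the left end of the cell, strictly
              before \<open>r\<close>; so the time \<open>\<tau>\<close> itself survives in the
              limit and a payment at ruin is counted.\<close>
            then have "ereal (dyadic t n (cell t n r)) < \<tau> \<omega>" for n
              using cell_bounds(1)[OF r, of n] by (auto intro: less_le_trans[of _ "ereal r"])
            then show ?thesis using True lim elim(2) by simp
          next
            case False
            then obtain z where z: "\<tau> \<omega> = ereal z" "z < r" using \<tau>[of \<omega>] by (cases "\<tau> \<omega>") auto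
            have "\<forall>\<^sub>F n in sequentially. z < dyadic t n (cell t n r)"
              using order_tendstoD(1)[OF cell_tendsto(1)[OF r] z(2)] .
            then have "\<forall>\<^sub>F n in sequentially. indicator {\<omega> \<in> space \<Omega>. ereal (dyadic t n (cell t n r)) < \<tau> \<omega>} \<omega> * \<phi> (dyadic t n (Suc (cell t n r))) = 0"
              by eventually_elim (simp add: z(1))
            then show ?thesis using False by (simp add: tendsto_eventually)
          qed
        qed
      qed
    qed
  qed
  show ?thesis
  proof (rule borel_measurable_AE_cong)
    show "(\<lambda>\<omega>. ennreal (\<phi> t * \<xi> t \<omega>) + (SUP N. ennreal (I N \<omega>))) \<in> borel_measurable \<Omega>"
      using I \<xi>[of t] by measurable
    show "AE \<omega> in \<Omega>. ennreal (\<phi> t * \<xi> t \<omega>) + (SUP N. ennreal (I N \<omega>)) =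
      (\<integral>\<^sup>+r\<in>{r. t \<le> r \<and> ereal r \<le> \<tau> \<omega>}. ennreal (\<phi> r) \<partial>stieltjes t (\<lambda>r. \<xi> r \<omega>))"
      using g by eventually_elim (simp add: I_def stieltjes_integral_lifetime[OF _ \<tau> \<phi>m \<phi>(2,3)])
  qed
qed

end

abbreviation barrier_strip :: "real \<Rightarrow> (real \<times> real) set \<times> (real \<times> real) set" where
  "barrier_strip b \<equiv> ({0..<b} \<times> {0..}, {b..} \<times> {0..})"

lemma closure_barrier_strip: "0 < b \<Longrightarrow> closure (fst (barrier_strip b)) = {0..b} \<times> {0..}"
  by (simp add: closure_Times)

lemma left_lim_eq: "(g \<longlongrightarrow> l) (at_left r) \<Longrightarrow> left_lim g r = l" for r :: real
  unfolding left_lim_def by (rule tendsto_Lim) simp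

section \<open>Explicit solution of the reflection problem\<close>

context effort_dividend
begin

definition free_surplus :: "('w \<Rightarrow> real) \<Rightarrow> real \<Rightarrow> 'w process" where
  "free_surplus y T r \<omega> = y \<omega> + \<mu> * (r - T) + \<sigma> * (B r \<omega> - B T \<omega>)"

definition barrier_dividend :: "real \<Rightarrow> ('w \<Rightarrow> real) \<Rightarrow> real \<Rightarrow> 'w process" where
  "barrier_dividend b y T r \<omega> = excess b T (\<lambda>s. free_surplus y T s \<omega>) r"

definition barrier_surplus :: "real \<Rightarrow> ('w \<Rightarrow> real) \<Rightarrow> real \<Rightarrow> 'w process" where
  "barrier_surplus b y T r \<omega> = free_surplus y T r \<omega> - barrier_dividend b y T r \<omega>"

lemma surplus_no_effort:
  "T \<le> r \<Longrightarrow> surplus y T (feedback (\<lambda>x t. 0) X) \<xi> r \<omega> = free_surplus y T r \<omega> - \<xi> r \<omega>"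
  by (simp add: surplus_def free_surplus_def feedback_def set_lebesgue_integral_def mult.commute)

lemma free_surplus_continuous:
  "continuous_on {0..} (\<lambda>t. B t \<omega>) \<Longrightarrow> 0 \<le> T \<Longrightarrow> continuous_on {T..} (\<lambda>r. free_surplus y T r \<omega>)"
  unfolding free_surplus_def by (intro continuous_intros) (auto intro: continuous_on_subset)

lemma free_surplus_adapted:
  assumes "0 \<le> T" "T \<le> r" "y \<in> borel_measurable (F T)"
  shows "free_surplus y T r \<in> borel_measurable (F r)"
proof -
  have [measurable]: "y \<in> borel_measurable (F r)" "B r \<in> borel_measurable (F r)" "B T \<in> borel_measurable (F r)"
    using assms F_measurable_mono[of T r] B_F_measurable by auto
  show ?thesis unfolding free_surplus_def by measurable
qed

lemma barrier_dividend_adapted: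
  assumes T: "0 \<le> T" "T \<le> r" and y: "y \<in> borel_measurable (F T)"
  shows "barrier_dividend b y T r \<in> borel_measurable (F r)"
  unfolding borel_measurable_iff_le
proof
  fix m
  have r0: "0 \<le> r" using T by simp
  let ?A = "{\<omega> \<in> space (F r). 0 \<le> m \<and> (\<forall>s\<in>rational_times T r. free_surplus y T s \<omega> - b \<le> m)}"
  show "{\<omega> \<in> space (F r). barrier_dividend b y T r \<omega> \<le> m} \<in> sets (F r)"
  proof (rule F_sets_AE_cong[OF r0, where A="?A"])
    have "{\<omega> \<in> space (F r). free_surplus y T s \<omega> - b \<le> m} \<in> sets (F r)" if s: "s \<in> rational_times T r" for s
    proof -
      have "T \<le> s" "s \<le> r" using rational_times_bounds[OF T(2) s] by auto
      then have [measurable]: "free_surplus y T s \<in> borel_measurable (F r)"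
        using free_surplus_adapted[OF T(1) _ y, of s] F_measurable_mono[of s r] T by auto
      show ?thesis by measurable
    qed
    then show "?A \<in> sets (F r)"
      by (intro sets.sets_Collect_conj sets.sets_Collect_const sets.sets_Collect_countable_All' countable_rational_times)
    show "AE \<omega> in \<Omega>. \<omega> \<in> ?A \<longleftrightarrow> \<omega> \<in> {\<omega> \<in> space (F r). barrier_dividend b y T r \<omega> \<le> m}"
      using B_continuous
    proof eventually_elim
      case (elim \<omega>)
      note Z = free_surplus_continuous[OF elim T(1), of y]
      have "(\<forall>s\<in>rational_times T r. free_surplus y T s \<omega> - b \<le> m) \<longleftrightarrow> (\<forall>s\<in>{T..r}. free_surplus y T s \<omega> - b \<le> m)"
      proof
        assume *: "\<forall>s\<in>rational_times T r. free_surplus y T s \<omega> - b \<le> m"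
        show "\<forall>s\<in>{T..r}. free_surplus y T s \<omega> - b \<le> m"
        proof
          fix s assume s: "s \<in> {T..r}"
          show "free_surplus y T s \<omega> - b \<le> m"
            by (rule right_cont_le_from_rationals[of T "\<lambda>s. free_surplus y T s \<omega> - b" r])
               (use s * in \<open>auto intro!: tendsto_diff continuous_on_atLeast_at_right[OF Z]\<close>)
        qed
      qed (use rational_times_bounds[OF T(2)] in auto)
      then show ?case unfolding barrier_dividend_def by (auto simp: excess_le_iff[OF Z T(2)])
    qed
  qed (use r0 in auto)
qed

lemma barrier_surplus_adapted:
  assumes "0 \<le> T" "T \<le> r" "y \<in> borel_measurable (F T)"
  shows "barrier_surplus b y T r \<in> borel_measurable (F r)"
  unfolding barrier_surplus_def
  using free_surplus_adapted[OF assms] barrier_dividend_adapted[OF assms] by (rule borel_measurable_diff)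

lemma barrier_surplus_path:
  assumes B: "continuous_on {0..} (\<lambda>t. B t \<omega>)" and T: "0 \<le> T" and b: "0 < b" and y: "0 \<le> y \<omega>"
  shows "continuous_on {T..} (\<lambda>r. barrier_surplus b y T r \<omega>)"
    and "barrier_surplus b y T T \<omega> = min (y \<omega>) b"
    and "\<And>r. T \<le> r \<Longrightarrow> barrier_surplus b y T r \<omega> \<le> b"
    and "\<And>r. r \<in> lifetime T (barrier_surplus b y T) \<omega> \<Longrightarrow> 0 \<le> barrier_surplus b y T r \<omega>"
proof -
  let ?X = "\<lambda>r. barrier_surplus b y T r \<omega>"
  note Z = free_surplus_continuous[OF B T, of y]
  show cont: "continuous_on {T..} ?X"
    unfolding barrier_surplus_def barrier_dividend_def by (intro continuous_intros Z excess_continuous[OF Z])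
  show start: "?X T = min (y \<omega>) b"
    by (simp add: barrier_surplus_def barrier_dividend_def excess_at_start free_surplus_def min_def max_def)
  show "?X r \<le> b" if "T \<le> r" for r
    using excess_ge(2)[OF Z that, of r b] by (simp add: barrier_surplus_def barrier_dividend_def)
  fix r assume r: "r \<in> lifetime T (barrier_surplus b y T) \<omega>"
  have "\<forall>q\<in>{T..r}. 0 \<le> ?X q"
  proof (rule nonneg_before_exit)
    show "cadlag_from T ?X" by (rule cadlag_continuous[OF cont])
    show "?X q \<noteq> 0" if "T \<le> q" "q < r" for q
    proof -
      have "ereal q < ereal r" "ereal r \<le> ruin_time T (barrier_surplus b y T) \<omega>"
        using r that(2) by (auto simp: lifetime_def)
      then have "ereal q < ruin_time T (barrier_surplus b y T) \<omega>" by (rule less_le_trans)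
      then show ?thesis by (rule before_ruin_nonzero[OF that(1)])
    qed
    show "0 \<le> ?X q" if "T < q" "q \<le> r" "0 \<le> left_lim ?X q" for q
      using left_lim_eq[OF continuous_on_atLeast_at_left[OF cont that(1)]] that(3) by simp
  qed (use start b y r in \<open>auto simp: lifetime_def\<close>)
  then show "0 \<le> ?X r" using r by (auto simp: lifetime_def)
qed

text \<open>The starting level is an arbitrary nonnegative random variable known at time
  \<open>T\<close>, as the restart after a deviation requires.\<close>

lemma barrier_surplus_reflected:
  assumes b: "0 < b" and T: "0 \<le> T" and y: "y \<in> borel_measurable (F T)" "AE \<omega> in \<Omega>. 0 \<le> y \<omega>"
  shows "reflected_solution (barrier_strip b) y T (feedback (\<lambda>x t. 0) (barrier_surplus b y T))
    (barrier_surplus b y T) (barrier_dividend b y T)"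
  unfolding reflected_solution_def
proof (intro conjI)
  show "dividend_process T (barrier_dividend b y T)"
    unfolding dividend_process_def adapted_from_def
  proof (intro conjI allI impI)
    show "barrier_dividend b y T r \<in> borel_measurable (F r)" if "T \<le> r" for r
      by (rule barrier_dividend_adapted[OF T that y(1)])
    show "AE \<omega> in \<Omega>. dividend_path T (\<lambda>r. barrier_dividend b y T r \<omega>)"
      using B_continuous
      by eventually_elim (simp add: barrier_dividend_def excess_dividend_path free_surplus_continuous T)
  qed
  show "strong_solution y T (feedback (\<lambda>x t. 0) (barrier_surplus b y T)) (barrier_dividend b y T) (barrier_surplus b y T)"
    unfolding strong_solution_def adapted_from_def
  proof (intro conjI allI impI)
    show "barrier_surplus b y T r \<in> borel_measurable (F r)" if "T \<le> r" for r
      by (rule barrier_surplus_adapted[OF T that y(1)])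
    show "AE \<omega> in \<Omega>. cadlag_from T (\<lambda>r. barrier_surplus b y T r \<omega>) \<and>
      (\<forall>r\<in>lifetime T (barrier_surplus b y T) \<omega>. barrier_surplus b y T r \<omega> =
        surplus y T (feedback (\<lambda>x t. 0) (barrier_surplus b y T)) (barrier_dividend b y T) r \<omega>)"
      using B_continuous y(2)
      by eventually_elim
         (auto simp: surplus_no_effort lifetime_def barrier_surplus_def[abs_def] intro!: cadlag_continuous[OF barrier_surplus_path(1)[OF _ T b, unfolded barrier_surplus_def]])
  qed
  show "AE \<omega> in \<Omega>. \<forall>r\<in>lifetime T (barrier_surplus b y T) \<omega>.
      (barrier_surplus b y T r \<omega>, r) \<in> closure (fst (barrier_strip b)) \<and>
      barrier_dividend b y T r \<omega> = (LINT l:{T..r}|stieltjes T (\<lambda>s. barrier_dividend b y T s \<omega>).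
        indicator (snd (barrier_strip b)) (barrier_surplus b y T l \<omega>, l))"
    using B_continuous y(2)
  proof eventually_elim
    case (elim \<omega>)
    show ?case
    proof
      fix r assume r: "r \<in> lifetime T (barrier_surplus b y T) \<omega>"
      then have Tr: "T \<le> r" by (simp add: lifetime_def)
      have "(barrier_surplus b y T r \<omega>, r) \<in> closure (fst (barrier_strip b))"
        using barrier_surplus_path(3)[where y=y and \<omega>=\<omega>, OF elim(1) T b elim(2) Tr]
          barrier_surplus_path(4)[where y=y and \<omega>=\<omega>, OF elim(1) T b elim(2) r] T Tr
        by (simp only: closure_barrier_strip[OF b]) simp
      moreover have "barrier_dividend b y T r \<omega> = (LINT l:{T..r}|stieltjes T (\<lambda>s. barrier_dividend b y T s \<omega>).
        indicator {b..} (barrier_surplus b y T l \<omega>))"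
        using excess_carried_integral[OF free_surplus_continuous[OF elim(1) T, of y] Tr, of b]
        by (simp add: barrier_surplus_def barrier_dividend_def)
      moreover have "(LINT l:{T..r}|stieltjes T (\<lambda>s. barrier_dividend b y T s \<omega>). indicator {b..} (barrier_surplus b y T l \<omega>) :: real)
        = (LINT l:{T..r}|stieltjes T (\<lambda>s. barrier_dividend b y T s \<omega>).
        indicator (snd (barrier_strip b)) (barrier_surplus b y T l \<omega>, l))"
        unfolding set_lebesgue_integral_def using T by (intro Bochner_Integration.integral_cong refl) (auto simp: indicator_def)
      ultimately show "(barrier_surplus b y T r \<omega>, r) \<in> closure (fst (barrier_strip b)) \<and>
        barrier_dividend b y T r \<omega> = (LINT l:{T..r}|stieltjes T (\<lambda>s. barrier_dividend b y T s \<omega>).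
        indicator (snd (barrier_strip b)) (barrier_surplus b y T l \<omega>, l))" by simp
    qed
  qed
qed

text \<open>Two inequalities for the dividends up to ruin: \<open>reflection_minimal\<close> bounds
  them by the running excess, and staying below the barrier forces them to be at least that. The
  surplus and, by \<open>ruin_time_cong\<close>, the ruin time follow.\<close>

lemma reflected_solution_unique:
  assumes b: "0 < b" and T: "0 \<le> T"
    and R: "reflected_solution (barrier_strip b) y T (feedback (\<lambda>x t. 0) X) X \<xi>"
  shows "AE \<omega> in \<Omega>. ruin_time T X \<omega> = ruin_time T (barrier_surplus b y T) \<omega> \<and>
    (\<forall>r\<in>lifetime T X \<omega>. X r \<omega> = barrier_surplus b y T r \<omega> \<and> \<xi> r \<omega> = barrier_dividend b y T r \<omega>)"
proof -
  from R have D: "AE \<omega> in \<Omega>. dividend_path T (\<lambda>r. \<xi> r \<omega>)"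
    and S: "AE \<omega> in \<Omega>. cadlag_from T (\<lambda>r. X r \<omega>) \<and>
        (\<forall>r\<in>lifetime T X \<omega>. X r \<omega> = surplus y T (feedback (\<lambda>x t. 0) X) \<xi> r \<omega>)"
    and C: "AE \<omega> in \<Omega>. \<forall>r\<in>lifetime T X \<omega>. (X r \<omega>, r) \<in> closure (fst (barrier_strip b)) \<and>
        \<xi> r \<omega> = (LINT l:{T..r}|stieltjes T (\<lambda>s. \<xi> s \<omega>). indicator (snd (barrier_strip b)) (X l \<omega>, l))"
    by (auto simp: reflected_solution_def dividend_process_def strong_solution_def)
  show ?thesis
    using B_continuous D S C
  proof eventually_elim
    case (elim \<omega>)
    let ?Z = "\<lambda>r. free_surplus y T r \<omega>"
    note Z = free_surplus_continuous[OF elim(1) T, of y]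
    have X: "X r \<omega> = ?Z r - \<xi> r \<omega>" if "r \<in> lifetime T X \<omega>" for r
      using elim(3) that surplus_no_effort[of T r y X \<xi> \<omega>] by (auto simp: lifetime_def)
    have sub: "l \<in> lifetime T X \<omega>" if "r \<in> lifetime T X \<omega>" "T \<le> l" "l \<le> r" for l r
      using that by (auto simp: lifetime_def intro: order_trans[of "ereal l" "ereal r"])
    have Xb: "X r \<omega> \<le> b" if "r \<in> lifetime T X \<omega>" for r
    proof -
      have "(X r \<omega>, r) \<in> closure (fst (barrier_strip b))" using elim(4) that by blast
      then show ?thesis unfolding closure_barrier_strip[OF b] by simp
    qed
    have eq: "\<xi> r \<omega> = barrier_dividend b y T r \<omega>" if r: "r \<in> lifetime T X \<omega>" for r
    proof (rule antisym)
      have Tr: "T \<le> r" using r by (simp add: lifetime_def)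
      show "\<xi> r \<omega> \<le> barrier_dividend b y T r \<omega>"
      proof (rule reflection_minimal[OF elim(2) Tr, where X="\<lambda>r. X r \<omega>" and b=b and Z="?Z"])
        show "X l \<omega> \<le> b \<and> X l \<omega> = ?Z l - \<xi> l \<omega>" if "T \<le> l" "l \<le> r" for l
          using Xb[OF sub[OF r that]] X[OF sub[OF r that]] by simp
        have "(LINT l:{T..r}|stieltjes T (\<lambda>s. \<xi> s \<omega>). indicator {b..} (X l \<omega>) :: real)
          = (LINT l:{T..r}|stieltjes T (\<lambda>s. \<xi> s \<omega>). indicator (snd (barrier_strip b)) (X l \<omega>, l))"
          unfolding set_lebesgue_integral_def using T by (intro Bochner_Integration.integral_cong refl) (auto simp: indicator_def)
        then show "\<xi> r \<omega> = (LINT l:{T..r}|stieltjes T (\<lambda>s. \<xi> s \<omega>). indicator {b..} (X l \<omega>))"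
          using elim(4) r by simp
        show "0 \<le> barrier_dividend b y T r \<omega>" unfolding barrier_dividend_def by (rule excess_ge(1)[OF Z Tr order_refl])
        show "?Z l - b \<le> barrier_dividend b y T r \<omega>" if "T \<le> l" "l \<le> r" for l
          unfolding barrier_dividend_def by (rule excess_ge(2)[OF Z that])
      qed
      have "?Z l - b \<le> \<xi> r \<omega>" if l: "l \<in> {T..r}" for l
      proof -
        have "X l \<omega> \<le> b" "X l \<omega> = ?Z l - \<xi> l \<omega>" using Xb X sub[OF r, of l] l by auto
        moreover have "\<xi> l \<omega> \<le> \<xi> r \<omega>" using dividend_path_mono[OF elim(2), of l r] l by auto
        ultimately show ?thesis by simp
      qed
      then show "barrier_dividend b y T r \<omega> \<le> \<xi> r \<omega>"
        unfolding barrier_dividend_def using dividend_path_nonneg[OF elim(2) Tr] by (simp add: excess_le_iff[OF Z Tr])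
    qed
    have XX: "X r \<omega> = barrier_surplus b y T r \<omega>" if "r \<in> lifetime T X \<omega>" for r
      using X[OF that] eq[OF that] by (simp add: barrier_surplus_def)
    have "ruin_time T (barrier_surplus b y T) \<omega> = ruin_time T X \<omega>"
      by (rule ruin_time_cong) (use elim(3) XX in \<open>auto simp: cadlag_from_def\<close>)
    then show ?case using XX eq by auto
  qed
qed

text \<open>Existence turns the chosen \<open>law_solution\<close> into a genuine solution;
  uniqueness then transfers to it every computation made with the explicit one.\<close>

lemma law_solution_reflected:
  assumes b: "0 < b" and T: "0 \<le> T" and y: "y \<in> borel_measurable (F T)" "AE \<omega> in \<Omega>. 0 \<le> y \<omega>"
  shows "reflected_solution (barrier_strip b) y T (law_effort (\<lambda>x t. 0) (barrier_strip b) y T)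
    (fst (law_solution (\<lambda>x t. 0) (barrier_strip b) y T)) (law_dividend (\<lambda>x t. 0) (barrier_strip b) y T)"
proof -
  let ?P = "\<lambda>(X, \<xi>). reflected_solution (barrier_strip b) y T (feedback (\<lambda>x t. 0) X) X \<xi>"
  have "\<exists>z. ?P z" using barrier_surplus_reflected[OF assms] by (intro exI[of _ "(barrier_surplus b y T, barrier_dividend b y T)"]) simp
  then have "?P (SOME z. ?P z)" by (rule someI_ex)
  then show ?thesis
    unfolding law_effort_def law_dividend_def law_solution_def by (simp add: case_prod_unfold)
qed

lemma law_effort_zero [simp]: "law_effort (\<lambda>x t. 0) \<Xi> y T r \<omega> = 0"
  by (simp add: law_effort_def feedback_def)

lemma law_uniquely_solvable:
  assumes b: "0 < b" and T: "0 \<le> T" and y: "y \<in> borel_measurable (F T)" "AE \<omega> in \<Omega>. 0 \<le> y \<omega>"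
  shows "uniquely_solvable T (\<lambda>X \<xi>. reflected_solution (barrier_strip b) y T (feedback (\<lambda>x t. 0) X) X \<xi>)"
  unfolding uniquely_solvable_def
proof (intro conjI allI impI)
  show "\<exists>X \<xi>. reflected_solution (barrier_strip b) y T (feedback (\<lambda>x t. 0) X) X \<xi>"
    using barrier_surplus_reflected[OF assms] by blast
  fix X \<xi> Y \<zeta>
  assume "reflected_solution (barrier_strip b) y T (feedback (\<lambda>x t. 0) X) X \<xi>"
    "reflected_solution (barrier_strip b) y T (feedback (\<lambda>x t. 0) Y) Y \<zeta>"
  from this[THEN reflected_solution_unique[OF b T]]
  show "AE \<omega> in \<Omega>. ruin_time T X \<omega> = ruin_time T Y \<omega> \<and>
       (\<forall>r\<in>lifetime T X \<omega>. X r \<omega> = Y r \<omega> \<and> \<xi> r \<omega> = \<zeta> r \<omega>)"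
    by eventually_elim (auto simp: lifetime_def)
qed

end

section \<open>Expected discounted dividends of a barrier strategy\<close>

lemma excess_increment_nonneg:
  "continuous_on {T..} Z \<Longrightarrow> 0 \<le> excess b T Z (dyadic T n (Suc k)) - excess b T Z (dyadic T n k)"
  using excess_mono[OF _ dyadic_ge dyadic_mono[of k "Suc k"], of T Z b n] by simp

lemma mean_value_between:
  fixes g g' :: "real \<Rightarrow> real"
  assumes g: "\<And>x. (g has_real_derivative g' x) (at x)" and e: "0 \<le> e"
  shows "\<exists>z. x \<le> z \<and> z \<le> x + e \<and> g (x + e) - g x = g' z * e"
proof (cases "e = 0")
  case False
  with e have "x < x + e" by simp
  from MVT2[OF this, of g g'] g obtain z where "x < z" "z < x + e" "g (x + e) - g x = (x + e - x) * g' z" by auto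
  then show ?thesis by (intro exI[of _ z]) (simp add: mult.commute)
qed auto

lemma continuous_on_Icc_bounded:
  fixes f :: "real \<Rightarrow> real"
  assumes "continuous_on {a..b} f"
  obtains L where "\<And>r. r \<in> {a..b} \<Longrightarrow> \<bar>f r\<bar> \<le> L"
proof -
  have "bounded (f ` {a..b})" using compact_continuous_image[OF assms] compact_imp_bounded by blast
  then obtain L where "\<forall>x\<in>f ` {a..b}. \<bar>x\<bar> \<le> L" unfolding bounded_real by blast
  then show thesis using that[of L] by blast
qed

text \<open>In each cell \<open>g\<close> is compared just before and just after the payment made in
  that cell. By the mean value theorem the difference is \<open>g'\<close> at an intermediate point
  times the payment; payments occur only at the barrier, so almost everywhere that point tends to
  \<open>b\<close>.\<close>

lemma barrier_Riemann_limit: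
  fixes g g' \<psi> :: "real \<Rightarrow> real"
  assumes Z: "continuous_on {T..} Z" and s: "T \<le> s" "s \<le> T + real N"
    and g: "\<And>x. (g has_real_derivative g' x) (at x)" "continuous_on UNIV g'" and \<psi>: "continuous_on UNIV \<psi>"
  shows "(\<lambda>n. \<Sum>k<N * 2 ^ n. if dyadic T n k < s then \<psi> (dyadic T n (Suc k)) *
      (g (Z (dyadic T n (Suc k)) - excess b T Z (dyadic T n k)) -
       g (Z (dyadic T n (Suc k)) - excess b T Z (dyadic T n (Suc k)))) else 0)
    \<longlonglongrightarrow> (LINT r:{T<..T + real N}|stieltjes T (excess b T Z). g' b * (\<psi> r * indicator {..s} r))"
proof -
  let ?\<xi> = "excess b T Z"
  let ?t = "dyadic T"
  let ?X = "\<lambda>r. Z r - ?\<xi> r"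
  define \<Delta> where "\<Delta> n k = ?\<xi> (?t n (Suc k)) - ?\<xi> (?t n k)" for n k
  have \<Delta>0: "0 \<le> \<Delta> n k" for n k unfolding \<Delta>_def by (rule excess_increment_nonneg[OF Z])
  have "\<forall>n k. \<exists>z. ?X (?t n (Suc k)) \<le> z \<and> z \<le> ?X (?t n (Suc k)) + \<Delta> n k \<and>
      g (?X (?t n (Suc k)) + \<Delta> n k) - g (?X (?t n (Suc k))) = g' z * \<Delta> n k"
    using mean_value_between[OF g(1) \<Delta>0] by blast
  then obtain z where z: "\<And>n k. ?X (?t n (Suc k)) \<le> z n k" "\<And>n k. z n k \<le> ?X (?t n (Suc k)) + \<Delta> n k"
    "\<And>n k. g (?X (?t n (Suc k)) + \<Delta> n k) - g (?X (?t n (Suc k))) = g' (z n k) * \<Delta> n k"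
    by metis
  \<comment> \<open>Set to 0 beyond the horizon, so that a single constant bounds all
    coefficients.\<close>
  define c where "c n k = (if k < N * 2 ^ n \<and> ?t n k < s then \<psi> (?t n (Suc k)) * g' (z n k) else 0)" for n k
  have Xc: "continuous_on {T..} ?X" by (intro continuous_intros Z excess_continuous[OF Z])
  have tN: "T \<le> ?t n k \<and> ?t n k \<le> T + real N" if "k \<le> N * 2 ^ n" for n k
    using dyadic_mono[OF that, of T n] dyadic_ge[of T n k] by (simp add: dyadic_end)
  have "continuous_on {T..T + real N} ?X" by (rule continuous_on_subset[OF Xc]) auto
  then obtain L where L: "\<And>r. r \<in> {T..T + real N} \<Longrightarrow> \<bar>?X r\<bar> \<le> L"
    by (rule continuous_on_Icc_bounded) blast
  let ?I = "{- L..L + ?\<xi> (T + real N)}"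
  have zI: "z n k \<in> ?I" if k: "k < N * 2 ^ n" for n k
  proof -
    have "?\<xi> (?t n (Suc k)) \<le> ?\<xi> (T + real N)" by (rule excess_mono[OF Z]) (use tN[of "Suc k" n] k in simp_all)
    moreover have "0 \<le> ?\<xi> (?t n k)" using excess_ge(1)[OF Z dyadic_ge order_refl] by blast
    ultimately have "\<Delta> n k \<le> ?\<xi> (T + real N)" by (simp add: \<Delta>_def)
    moreover have "\<bar>?X (?t n (Suc k))\<bar> \<le> L" by (rule L) (use tN[of "Suc k" n] k in simp)
    ultimately have "- L \<le> z n k" "z n k \<le> L + ?\<xi> (T + real N)" using z(1,2)[of n k] by linarith+
    then show ?thesis by simp
  qed
  obtain K1 where K1: "\<And>x. x \<in> ?I \<Longrightarrow> \<bar>g' x\<bar> \<le> K1"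
    using continuous_on_Icc_bounded[OF continuous_on_subset[OF g(2) subset_UNIV], of "- L" "L + ?\<xi> (T + real N)"] by blast
  obtain K2 where K2: "\<And>x. x \<in> {T..T + real N} \<Longrightarrow> \<bar>\<psi> x\<bar> \<le> K2"
    using continuous_on_Icc_bounded[OF continuous_on_subset[OF \<psi> subset_UNIV], of T "T + real N"] by blast
  have K20: "0 \<le> K2" using K2[of T] by auto
  have sum_eq: "(\<Sum>k<N * 2 ^ n. if ?t n k < s then \<psi> (?t n (Suc k)) * (g (Z (?t n (Suc k)) - ?\<xi> (?t n k)) - g (?X (?t n (Suc k)))) else 0)
    = (\<Sum>k<N * 2 ^ n. c n k * (?\<xi> (?t n (Suc k)) - ?\<xi> (?t n k)))" for n
  proof (rule sum.cong[OF refl])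
    fix k assume "k \<in> {..<N * 2 ^ n}"
    moreover have "Z (?t n (Suc k)) - ?\<xi> (?t n k) = ?X (?t n (Suc k)) + \<Delta> n k" by (simp add: \<Delta>_def)
    ultimately show "(if ?t n k < s then \<psi> (?t n (Suc k)) * (g (Z (?t n (Suc k)) - ?\<xi> (?t n k)) - g (?X (?t n (Suc k)))) else 0)
      = c n k * (?\<xi> (?t n (Suc k)) - ?\<xi> (?t n k))"
      using z(3)[of n k] by (simp add: c_def \<Delta>_def)
  qed
  show ?thesis
    unfolding sum_eq
  proof (rule Riemann_Stieltjes_limit[OF excess_dividend_path[OF Z], where C="K2 * \<bar>K1\<bar>"])
    show "\<bar>c n k\<bar> \<le> K2 * \<bar>K1\<bar>" for n k
    proof (cases "k < N * 2 ^ n")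
      case True
      have "\<bar>\<psi> (?t n (Suc k))\<bar> \<le> K2" using K2 tN[of "Suc k" n] True by auto
      moreover have "\<bar>g' (z n k)\<bar> \<le> \<bar>K1\<bar>" using K1[OF zI[OF True]] by linarith
      ultimately show ?thesis using K20 by (auto simp: c_def abs_mult intro: mult_mono)
    qed (use K20 in \<open>simp add: c_def\<close>)
    have "\<psi> \<in> borel_measurable borel" by (rule borel_measurable_continuous_onI[OF \<psi>])
    then show "(\<lambda>r. g' b * (\<psi> r * indicator {..s} r)) \<in> borel_measurable borel" by measurable
    show "AE r in stieltjes T ?\<xi>. T < r \<longrightarrow> r \<le> T + real N \<longrightarrow> (\<lambda>n. c n (cell T n r)) \<longlonglongrightarrow> g' b * (\<psi> r * indicator {..s} r)"
      using excess_carried[OF Z, of b]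
    proof (eventually_elim, intro impI)
      fix r assume b: "T \<le> r \<and> Z r - ?\<xi> r = b" and r: "T < r" "r \<le> T + real N"
      let ?k = "\<lambda>n. cell T n r"
      have tge: "?t n j \<in> {T..}" for n j using dyadic_ge by simp
      have 1: "(\<lambda>n. ?X (?t n (Suc (?k n)))) \<longlonglongrightarrow> b"
        using continuous_on_tendsto_compose[OF Xc cell_tendsto(2)[OF r(1)]] b tge by (auto simp del: diff_eq_eq)
      have \<xi>c: "continuous_on {T..} ?\<xi>" by (rule excess_continuous[OF Z])
      have "(\<lambda>n. \<Delta> n (?k n)) \<longlonglongrightarrow> ?\<xi> r - ?\<xi> r"
        unfolding \<Delta>_def
        by (intro tendsto_diff continuous_on_tendsto_compose[OF \<xi>c cell_tendsto(2)[OF r(1)]] continuous_on_tendsto_compose[OF \<xi>c cell_tendsto(1)[OF r(1)]])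
           (use r tge in auto)
      from tendsto_add[OF 1 this] have 2: "(\<lambda>n. ?X (?t n (Suc (?k n))) + \<Delta> n (?k n)) \<longlonglongrightarrow> b" by simp
      have zb: "(\<lambda>n. z n (?k n)) \<longlonglongrightarrow> b"
        by (rule real_tendsto_sandwich[OF _ _ 1 2]) (use z in auto)
      have g'b: "(\<lambda>n. g' (z n (?k n))) \<longlonglongrightarrow> g' b"
        by (rule continuous_on_tendsto_compose[OF g(2) zb]) auto
      have \<psi>r: "(\<lambda>n. \<psi> (?t n (Suc (?k n)))) \<longlonglongrightarrow> \<psi> r"
        by (rule continuous_on_tendsto_compose[OF \<psi> cell_tendsto(2)[OF r(1)]]) auto
      show "(\<lambda>n. c n (?k n)) \<longlonglongrightarrow> g' b * (\<psi> r * indicator {..s} r)"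
      proof (cases "r \<le> s")
        case True
        have "c n (?k n) = \<psi> (?t n (Suc (?k n))) * g' (z n (?k n))" for n
          using cell_bounds(1)[OF r(1), of n] cell_less[OF r, of n] True by (simp add: c_def)
        then show ?thesis using True tendsto_mult[OF \<psi>r g'b] by (simp add: mult.commute)
      next
        case False
        then have "\<forall>\<^sub>F n in sequentially. s < ?t n (?k n)" using order_tendstoD(1)[OF cell_tendsto(1)[OF r(1)]] by simp
        then have "\<forall>\<^sub>F n in sequentially. c n (?k n) = 0" by eventually_elim (simp add: c_def)
        then show ?thesis using False by (simp add: tendsto_eventually)
      qed
    qed
  qed
qed

text \<open>A bound independent of the mesh: the payments in the cells telescope to the total
  payment, and \<open>K\<close> bounds \<open>g'\<close> at all intermediate points, which lie
  between the lowest surplus and the barrier plus the total payment.\<close>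

lemma barrier_Riemann_bound:
  fixes g g' \<psi> :: "real \<Rightarrow> real"
  assumes Z: "continuous_on {T..} Z"
    and g: "\<And>x. (g has_real_derivative g' x) (at x)" and \<psi>: "\<And>r. T \<le> r \<Longrightarrow> 0 \<le> \<psi> r \<and> \<psi> r \<le> 1"
    and X: "\<And>r. T \<le> r \<Longrightarrow> r \<le> T + real N \<Longrightarrow> l \<le> Z r - excess b T Z r"
    and u: "b + (excess b T Z (T + real N) - excess b T Z T) \<le> u"
    and K: "\<And>x. l \<le> x \<Longrightarrow> x \<le> u \<Longrightarrow> \<bar>g' x\<bar> \<le> K"
  shows "\<bar>\<Sum>k<N * 2 ^ n. if dyadic T n k < s then \<psi> (dyadic T n (Suc k)) *
      (g (Z (dyadic T n (Suc k)) - excess b T Z (dyadic T n k)) -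
       g (Z (dyadic T n (Suc k)) - excess b T Z (dyadic T n (Suc k)))) else 0\<bar>
    \<le> K * (excess b T Z (T + real N) - excess b T Z T)"
proof -
  let ?\<xi> = "excess b T Z" and ?t = "dyadic T n"
  let ?f = "\<lambda>k. if ?t k < s then \<psi> (?t (Suc k)) * (g (Z (?t (Suc k)) - ?\<xi> (?t k)) - g (Z (?t (Suc k)) - ?\<xi> (?t (Suc k)))) else 0"
  have "\<bar>?f k\<bar> \<le> K * (?\<xi> (?t (Suc k)) - ?\<xi> (?t k))" if k: "k < N * 2 ^ n" for k
  proof -
    let ?d = "?\<xi> (?t (Suc k)) - ?\<xi> (?t k)" and ?x = "Z (?t (Suc k)) - ?\<xi> (?t (Suc k))"
    have d0: "0 \<le> ?d" by (rule excess_increment_nonneg[OF Z])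
    obtain z where z: "?x \<le> z" "z \<le> ?x + ?d" "g (?x + ?d) - g ?x = g' z * ?d"
      using mean_value_between[OF g d0] by blast
    have tk: "T \<le> ?t (Suc k)" "?t (Suc k) \<le> T + real N"
      using dyadic_mono[of "Suc k" "N * 2 ^ n" T n] k dyadic_ge[of T n "Suc k"] by (auto simp: dyadic_end)
    have "?\<xi> T \<le> ?\<xi> (?t k)" by (rule excess_mono[OF Z order_refl dyadic_ge])
    moreover have "?\<xi> (?t (Suc k)) \<le> ?\<xi> (T + real N)" by (rule excess_mono[OF Z tk])
    moreover have "?x \<le> b" using excess_ge(2)[OF Z tk(1) order_refl, of b] by simp
    ultimately have "z \<le> u" using z(2) u by linarith
    moreover have "l \<le> z" using X[OF tk] z(1) by linarith
    ultimately have g'z: "\<bar>g' z\<bar> \<le> K" using K by blast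
    have "\<bar>?f k\<bar> \<le> \<bar>g' z\<bar> * ?d"
    proof (cases "?t k < s")
      case True
      have "Z (?t (Suc k)) - ?\<xi> (?t k) = ?x + ?d" by simp
      then have "\<bar>?f k\<bar> = \<psi> (?t (Suc k)) * (\<bar>g' z\<bar> * ?d)" using True z(3) \<psi>[OF tk(1)] d0 by (simp add: abs_mult)
      also have "\<dots> \<le> 1 * (\<bar>g' z\<bar> * ?d)" using \<psi>[OF tk(1)] d0 by (intro mult_right_mono) auto
      finally show ?thesis by simp
    qed (use d0 in simp)
    also have "\<dots> \<le> K * ?d" using g'z d0 by (rule mult_right_mono)
    finally show ?thesis .
  qed
  then have "\<bar>\<Sum>k<N * 2 ^ n. ?f k\<bar> \<le> (\<Sum>k<N * 2 ^ n. K * (?\<xi> (?t (Suc k)) - ?\<xi> (?t k)))"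
    by (intro order_trans[OF sum_abs] sum_mono) auto
  also have "\<dots> = K * (?\<xi> (T + real N) - ?\<xi> T)"
    unfolding sum_distrib_left[symmetric] sum_lessThan_telescope[of "\<lambda>k. ?\<xi> (?t k)"] by (simp add: dyadic_end)
  finally show ?thesis .
qed

context effort_dividend
begin

lemma barrier_ruin_adapted:
  assumes b: "0 < b" and T: "0 \<le> T" "T \<le> q" and y: "y \<in> borel_measurable (F T)" "AE \<omega> in \<Omega>. 0 \<le> y \<omega>"
  shows "{\<omega> \<in> space \<Omega>. ereal q < ruin_time T (barrier_surplus b y T) \<omega>} \<in> sets (F q)"
proof (rule ruin_time_adapted[OF T])
  show "barrier_surplus b y T r \<in> borel_measurable (F r)" if "T \<le> r" for r
    by (rule barrier_surplus_adapted[OF T(1) that y(1)])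
  show "AE \<omega> in \<Omega>. down_cadlag T (\<lambda>r. barrier_surplus b y T r \<omega>) \<and>
    (\<forall>r\<in>lifetime T (barrier_surplus b y T) \<omega>. 0 \<le> barrier_surplus b y T r \<omega>)"
    using B_continuous y(2)
    by eventually_elim (use b T(1) in \<open>blast intro: down_cadlag_continuous barrier_surplus_path(1,4)\<close>)
qed

lemma capped_ruin_adapted:
  assumes h: "0 \<le> h" and T: "0 \<le> T" and q: "T \<le> q"
    and A: "{\<omega> \<in> space \<Omega>. ereal q < ruin_time T X \<omega>} \<in> sets (F q)"
  shows "{\<omega> \<in> space \<Omega>. q < capped_ruin T h X \<omega>} \<in> sets (F q)"
proof -
  have "{\<omega> \<in> space \<Omega>. q < capped_ruin T h X \<omega>} = (if q < T + h then {\<omega> \<in> space \<Omega>. ereal q < ruin_time T X \<omega>} else {})"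
    by (auto simp: capped_ruin_iff[OF h])
  then show ?thesis using A by simp
qed

text \<open>The grid sums run up to one cell past ruin, where the reflected path may be negative, so
  the bounds must hold on the whole interval. The factor 2 bounds the fall of the scaled Brownian
  path from its running maximum; a nonnegative drift only raises the surplus.\<close>

lemma barrier_path_bounds:
  assumes B: "continuous_on {0..} (\<lambda>t. B t \<omega>)" and T: "0 \<le> T" and b: "0 < b" and y: "0 \<le> y \<omega>"
    and \<mu>: "0 \<le> \<mu>" and \<sigma>: "0 \<le> \<sigma>" and m: "\<And>r. T \<le> r \<Longrightarrow> r \<le> T + L \<Longrightarrow> \<bar>B r \<omega> - B T \<omega>\<bar> \<le> m" and L: "0 \<le> L"
  shows "\<And>r. T \<le> r \<Longrightarrow> r \<le> T + L \<Longrightarrow> - (2 * \<sigma> * m) \<le> barrier_surplus b y T r \<omega>"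
    and "barrier_dividend b y T (T + L) \<omega> - barrier_dividend b y T T \<omega> \<le> \<mu> * L + \<sigma> * m"
proof -
  note Z = free_surplus_continuous[OF B T, of y]
  have m0: "0 \<le> m" using m[of T] L by simp
  have Bm: "\<sigma> * (B r \<omega> - B T \<omega>) \<le> \<sigma> * m \<and> - (\<sigma> * m) \<le> \<sigma> * (B r \<omega> - B T \<omega>)" if "T \<le> r" "r \<le> T + L" for r
  proof -
    have "\<bar>\<sigma> * (B r \<omega> - B T \<omega>)\<bar> \<le> \<sigma> * m" using m[OF that] \<sigma> by (simp add: abs_mult mult_left_mono)
    then show ?thesis by linarith
  qed
  show "- (2 * \<sigma> * m) \<le> barrier_surplus b y T r \<omega>" if r: "T \<le> r" "r \<le> T + L" for r
  proof -
    have "0 \<le> \<mu> * (r - T)" using \<mu> r by simp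
    then have 1: "0 \<le> free_surplus y T r \<omega> + 2 * \<sigma> * m"
      using Bm[OF r] y \<sigma> m0 mult_nonneg_nonneg[OF \<sigma> m0] by (simp add: free_surplus_def)
    moreover have "free_surplus y T l \<omega> - b \<le> free_surplus y T r \<omega> + 2 * \<sigma> * m" if l: "T \<le> l" "l \<le> r" for l
    proof -
      have "\<mu> * (l - T) \<le> \<mu> * (r - T)" using \<mu> l by (intro mult_left_mono) auto
      then show ?thesis using Bm[OF r] Bm[of l] l r b unfolding free_surplus_def by linarith
    qed
    ultimately have "barrier_dividend b y T r \<omega> \<le> free_surplus y T r \<omega> + 2 * \<sigma> * m"
      unfolding barrier_dividend_def by (subst excess_le_iff[OF Z r(1)]) auto
    then show ?thesis by (simp add: barrier_surplus_def)
  qed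
  have "barrier_dividend b y T (T + L) \<omega> \<le> barrier_dividend b y T T \<omega> + (\<mu> * L + \<sigma> * m)"
    unfolding barrier_dividend_def
  proof (rule excess_increment[OF Z])
    show "free_surplus y T l \<omega> \<le> free_surplus y T T \<omega> + (\<mu> * L + \<sigma> * m)" if l: "T \<le> l" "l \<le> T + L" for l
    proof -
      have "\<mu> * (l - T) \<le> \<mu> * L" using \<mu> l by (intro mult_left_mono) auto
      then show ?thesis using Bm[OF l] unfolding free_surplus_def by simp
    qed
    show "0 \<le> \<mu> * L + \<sigma> * m" using \<mu> \<sigma> L m0 by simp
  qed (use L in auto)
  then show "barrier_dividend b y T (T + L) \<omega> - barrier_dividend b y T T \<omega> \<le> \<mu> * L + \<sigma> * m" by simp
qed

text \<open>The discount rate \<open>d\<close> and the exponent \<open>\<theta>\<close> are matched so that \<open>exp (- d r + \<theta> X\<^sub>r)\<close>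
  is a martingale while no dividends are paid.\<close>

lemma one_step_exponential:
  assumes b: "0 < b" and T: "0 \<le> T" and y: "y \<in> borel_measurable (F T)" "AE \<omega> in \<Omega>. 0 \<le> y \<omega>"
    and root: "\<sigma>\<^sup>2 * \<theta>\<^sup>2 / 2 + \<mu> * \<theta> = d" and d: "0 \<le> d" and q: "T \<le> q" and h: "0 < h"
    and A: "A \<in> sets (F q)" "\<And>\<omega>. \<omega> \<in> A \<Longrightarrow> ereal q < ruin_time T (barrier_surplus b y T) \<omega>"
  shows "integrable \<Omega> (\<lambda>\<omega>. indicator A \<omega> * exp (- d * (q + h - T)) * exp (\<theta> * (free_surplus y T (q + h) \<omega> - barrier_dividend b y T q \<omega>)))"
    "integrable \<Omega> (\<lambda>\<omega>. indicator A \<omega> * exp (- d * (q - T)) * exp (\<theta> * barrier_surplus b y T q \<omega>))"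
    "expectation (\<lambda>\<omega>. indicator A \<omega> * exp (- d * (q + h - T)) * exp (\<theta> * (free_surplus y T (q + h) \<omega> - barrier_dividend b y T q \<omega>)))
     = expectation (\<lambda>\<omega>. indicator A \<omega> * exp (- d * (q - T)) * exp (\<theta> * barrier_surplus b y T q \<omega>))"
proof -
  define Z where "Z \<omega> = indicator A \<omega> * exp (- d * (q - T)) * exp (\<theta> * barrier_surplus b y T q \<omega>)" for \<omega>
  have q0: "0 \<le> q" using T q by simp
  have Zm: "Z \<in> borel_measurable (F q)"
    using A(1) barrier_surplus_adapted[OF T q y(1), of b] unfolding Z_def by measurable
  \<comment> \<open>Before ruin the reflected surplus lies in \<open>[0, b]\<close>, so the factor
    known at time \<open>q\<close> is bounded.\<close>
  have Zi: "integrable \<Omega> Z"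
  proof (rule integrable_const_bound[of _ "exp (\<bar>\<theta>\<bar> * b)"])
    show "AE \<omega> in \<Omega>. norm (Z \<omega>) \<le> exp (\<bar>\<theta>\<bar> * b)"
      using B_continuous y(2)
    proof eventually_elim
      case (elim \<omega>)
      show ?case
      proof (cases "\<omega> \<in> A")
        case True
        let ?x = "barrier_surplus b y T q \<omega>"
        have "q \<in> lifetime T (barrier_surplus b y T) \<omega>" using A(2)[OF True] q by (auto simp: lifetime_def)
        then have x: "0 \<le> ?x" "?x \<le> b"
          using barrier_surplus_path(3)[where y=y and \<omega>=\<omega>, OF elim(1) T b elim(2) q]
            barrier_surplus_path(4)[where y=y and \<omega>=\<omega> and r=q, OF elim(1) T b elim(2)] by auto
        have "\<theta> * ?x \<le> \<bar>\<theta>\<bar> * b" using x by (intro mult_mono) auto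
        moreover have "- d * (q - T) \<le> 0" using d q by simp
        ultimately have "exp (- d * (q - T)) * exp (\<theta> * ?x) \<le> 1 * exp (\<bar>\<theta>\<bar> * b)"
          by (intro mult_mono) auto
        then show ?thesis using True by (simp add: Z_def)
      qed (simp add: Z_def)
    qed
    show "Z \<in> borel_measurable \<Omega>" using F_measurable[OF q0 Zm] .
  qed
  note E = exp_increment_expectation[OF q0 _ Zm Zi, of "q + h" "\<theta> * \<sigma>"]
  have eq: "indicator A \<omega> * exp (- d * (q + h - T)) * exp (\<theta> * (free_surplus y T (q + h) \<omega> - barrier_dividend b y T q \<omega>))
    = exp (- d * h + \<theta> * \<mu> * h) * (Z \<omega> * exp (\<theta> * \<sigma> * (B (q + h) \<omega> - B q \<omega>)))" for \<omega>
    by (simp add: Z_def barrier_surplus_def free_surplus_def exp_add[symmetric] indicator_def algebra_simps)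
  show "integrable \<Omega> (\<lambda>\<omega>. indicator A \<omega> * exp (- d * (q + h - T)) * exp (\<theta> * (free_surplus y T (q + h) \<omega> - barrier_dividend b y T q \<omega>)))"
    unfolding eq using E(1) h by simp
  show "integrable \<Omega> (\<lambda>\<omega>. indicator A \<omega> * exp (- d * (q - T)) * exp (\<theta> * barrier_surplus b y T q \<omega>))"
    using Zi unfolding Z_def .
  have "- d * h + \<theta> * \<mu> * h + (\<theta> * \<sigma>)\<^sup>2 * h / 2 = h * ((\<sigma>\<^sup>2 * \<theta>\<^sup>2 / 2 + \<mu> * \<theta>) - d)"
    by (simp add: algebra_simps power_mult_distrib)
  also have "\<dots> = 0" using root by simp
  finally have *: "exp (- d * h + \<theta> * \<mu> * h) * exp ((\<theta> * \<sigma>)\<^sup>2 * h / 2) = 1" by (simp add: exp_add[symmetric])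
  have "exp (- d * h + \<theta> * \<mu> * h) * (expectation Z * exp ((\<theta> * \<sigma>)\<^sup>2 * h / 2))
    = expectation Z * (exp (- d * h + \<theta> * \<mu> * h) * exp ((\<theta> * \<sigma>)\<^sup>2 * h / 2))" by (simp only: ac_simps)
  then have "exp (- d * h + \<theta> * \<mu> * h) * (expectation Z * exp ((\<theta> * \<sigma>)\<^sup>2 * h / 2)) = expectation Z"
    by (simp only: * mult_1_right)
  moreover have "expectation (\<lambda>\<omega>. indicator A \<omega> * exp (- d * (q + h - T)) * exp (\<theta> * (free_surplus y T (q + h) \<omega> - barrier_dividend b y T q \<omega>)))
    = exp (- d * h + \<theta> * \<mu> * h) * (expectation Z * exp ((\<theta> * \<sigma>)\<^sup>2 * h / 2))"
    unfolding eq using E(2) h by simp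
  ultimately show "expectation (\<lambda>\<omega>. indicator A \<omega> * exp (- d * (q + h - T)) * exp (\<theta> * (free_surplus y T (q + h) \<omega> - barrier_dividend b y T q \<omega>)))
     = expectation (\<lambda>\<omega>. indicator A \<omega> * exp (- d * (q - T)) * exp (\<theta> * barrier_surplus b y T q \<omega>))"
    unfolding Z_def by simp
qed

text \<open>Each cell is split into a move without payments, with mean 0 for the discounted
  \<open>g\<close>, and a loss of \<open>g\<close> through the payment. So the expected losses
  \<open>R\<close> equal the initial value of \<open>g\<close> minus its discounted value at the
  grid time after stopping. As the mesh tends to 0 the losses become \<open>g' b * I\<close>; the
  final value vanishes at ruin and is otherwise at most
  \<open>exp (- d * real N) * g b\<close>.\<close>

lemma barrier_dividends_until:
  assumes b: "0 < b" and T: "0 \<le> T" and y: "y \<in> borel_measurable (F T)" "AE \<omega> in \<Omega>. 0 \<le> y \<omega>"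
    and pq: "0 < p" "0 < q" "\<sigma>\<^sup>2 * p\<^sup>2 / 2 + \<mu> * p = d" "\<sigma>\<^sup>2 * q\<^sup>2 / 2 - \<mu> * q = d" and d: "0 < d"
    and \<mu>: "0 \<le> \<mu>" and \<sigma>: "0 \<le> \<sigma>"
    and g_def: "g = (\<lambda>x. exp (p * x) - exp (- q * x))" and g'_def: "g' = (\<lambda>x. p * exp (p * x) + q * exp (- q * x))"
    and I_def: "I = (\<lambda>\<omega>. LINT r:{T<..T + real N}|stieltjes T (\<lambda>r. barrier_dividend b y T r \<omega>).
      exp (- d * (r - T)) * indicator {r. ereal r \<le> ruin_time T (barrier_surplus b y T) \<omega>} r)"
  shows "integrable \<Omega> I"
    and "\<bar>g' b * expectation I - expectation (\<lambda>\<omega>. g (min (y \<omega>) b))\<bar> \<le> exp (- d * real N) * g b"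
proof -
  let ?X = "barrier_surplus b y T" and ?\<xi> = "barrier_dividend b y T" and ?t = "dyadic T"
  let ?P = "\<lambda>n k. {\<omega> \<in> space \<Omega>. ?t n k < capped_ruin T (real N) ?X \<omega>}"
  define s where "s = capped_ruin T (real N) ?X"
  have sb: "T \<le> s \<omega>" "s \<omega> \<le> T + real N" "ereal (s \<omega>) \<le> ruin_time T ?X \<omega>" for \<omega>
    unfolding s_def by (rule capped_ruin_bounds; simp)+
  have tk: "0 \<le> ?t n k" for n k using T dyadic_ge[of T n k] by simp
  have PF: "?P n k \<in> sets (F (?t n k))" for n k
    by (rule capped_ruin_adapted[OF _ T dyadic_ge barrier_ruin_adapted[OF b T dyadic_ge y]]) simp
  have PF': "ereal (?t n k) < ruin_time T ?X \<omega>" if "\<omega> \<in> ?P n k" for n k \<omega>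
    using that by (simp add: capped_ruin_iff)
  have dg: "(g has_real_derivative g' x) (at x)" for x
    unfolding g_def g'_def by (auto intro!: derivative_eq_intros)
  have g'c: "continuous_on UNIV g'" unfolding g'_def by (intro continuous_intros)
  have gc: "continuous_on UNIV g" unfolding g_def by (intro continuous_intros)
  have g0: "g 0 = 0" by (simp add: g_def)
  have g'pos: "0 < g' x" for x unfolding g'_def using pq by (intro add_pos_pos mult_pos_pos) auto
  have gmono: "g x \<le> g z" if "x \<le> z" for x z
    by (rule DERIV_nonneg_imp_nondecreasing[OF that]) (use dg g'pos in \<open>auto intro: less_imp_le\<close>)
  define G where "G r \<omega> = exp (- d * (r - T)) * g (?X r \<omega>)" for r \<omega>
  define U where "U n k \<omega> = indicator (?P n k) \<omega> * exp (- d * (?t n (Suc k) - T)) * g (free_surplus y T (?t n (Suc k)) \<omega> - ?\<xi> (?t n k) \<omega>)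
     - indicator (?P n k) \<omega> * exp (- d * (?t n k - T)) * g (?X (?t n k) \<omega>)" for n k \<omega>
  have U: "integrable \<Omega> (U n k)" "expectation (U n k) = 0" for n k
  proof -
    \<comment> \<open>\<open>- q\<close> is the second root of the same characteristic equation, so
      \<open>one_step_exponential\<close> applies to both exponentials in \<open>g\<close>.\<close>
    have rq: "\<sigma>\<^sup>2 * (- q)\<^sup>2 / 2 + \<mu> * (- q) = d" using pq(4) by simp
    note 1 = one_step_exponential[OF b T y pq(3) less_imp_le[OF d] dyadic_ge[of T n k] _ PF[of n k] PF'[of _ n k], of "1 / 2 ^ n", folded dyadic_Suc]
    note 2 = one_step_exponential[OF b T y rq less_imp_le[OF d] dyadic_ge[of T n k] _ PF[of n k] PF'[of _ n k], of "1 / 2 ^ n", folded dyadic_Suc]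
    have eq: "U n k = (\<lambda>\<omega>. (indicator (?P n k) \<omega> * exp (- d * (?t n (Suc k) - T)) * exp (p * (free_surplus y T (?t n (Suc k)) \<omega> - ?\<xi> (?t n k) \<omega>))
       - indicator (?P n k) \<omega> * exp (- d * (?t n (Suc k) - T)) * exp (- q * (free_surplus y T (?t n (Suc k)) \<omega> - ?\<xi> (?t n k) \<omega>)))
       - (indicator (?P n k) \<omega> * exp (- d * (?t n k - T)) * exp (p * ?X (?t n k) \<omega>)
       - indicator (?P n k) \<omega> * exp (- d * (?t n k - T)) * exp (- q * ?X (?t n k) \<omega>)))"
      unfolding U_def g_def right_diff_distrib by simp
    have i: "0 < 1 / (2::real) ^ n" by simp
    show "integrable \<Omega> (U n k)" unfolding eq
      by (intro Bochner_Integration.integrable_diff 1(1,2)[OF i] 2(1,2)[OF i])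
    show "expectation (U n k) = 0" unfolding eq
      by (simp only: Bochner_Integration.integral_diff Bochner_Integration.integrable_diff 1(1,2)[OF i] 2(1,2)[OF i] 1(3)[OF i] 2(3)[OF i] diff_self)
  qed
  define R where "R n \<omega> = (\<Sum>k<N * 2 ^ n. if ?t n k < s \<omega> then exp (- d * (?t n (Suc k) - T)) *
      (g (free_surplus y T (?t n (Suc k)) \<omega> - ?\<xi> (?t n k) \<omega>) - g (?X (?t n (Suc k)) \<omega>)) else 0)" for n \<omega>
  have R_eq: "R n \<omega> = (\<Sum>k<N * 2 ^ n. U n k \<omega>) - (G (grid_ceiling T n (s \<omega>)) \<omega> - G T \<omega>)" if "\<omega> \<in> space \<Omega>" for n \<omega>
  proof -
    have "R n \<omega> + (\<Sum>k<N * 2 ^ n. if ?t n k < s \<omega> then G (?t n (Suc k)) \<omega> - G (?t n k) \<omega> else 0) = (\<Sum>k<N * 2 ^ n. U n k \<omega>)"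
      unfolding R_def sum.distrib[symmetric]
      by (rule sum.cong[OF refl]) (use that in \<open>simp add: U_def G_def s_def algebra_simps\<close>)
    then show ?thesis using telescope_stopped[of T "s \<omega>" N n "\<lambda>r. G r \<omega>"] sb by simp
  qed
  \<comment> \<open>\<open>exp (m * u)\<close> bounds both exponentials on \<open>[- u, u]\<close>,
    where \<open>u\<close>, containing three times the Brownian maximum, covers the surplus together
    with the payment of a cell. One more \<open>exp (\<mu> * real N + \<sigma> * \<beta>m)\<close>
    dominates the total payment; collecting the exponents gives \<open>3 * m + 1\<close> in
    \<open>a\<close>. In \<open>C\<close>, \<open>p + q\<close> comes from \<open>g'\<close> and 2
    from \<open>g\<close>.\<close>
  define m where "m = p + q"
  define a where "a = (3 * m + 1) * \<sigma>"
  define C where "C = (p + q + 2) * exp (m * (b + \<mu> * real N) + \<mu> * real N)"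
  have m0: "0 < m" using pq by (simp add: m_def)
  have a0: "0 \<le> a" using m0 \<sigma> by (simp add: a_def)
  have C0: "0 \<le> C" using pq by (simp add: C_def)
  obtain D :: "'w \<Rightarrow> real" where D: "integrable \<Omega> D" "\<And>\<omega>. 0 \<le> D \<omega>"
    "AE \<omega> in \<Omega>. \<forall>r\<in>{T..T + real N}. exp (a * \<bar>B r \<omega> - B T \<omega>\<bar>) \<le> D \<omega>"
    using exp_sup_dominated[OF T a0, where N=N] by blast
  have bounds: "AE \<omega> in \<Omega>. (\<forall>r\<in>{T..T + real N}. \<bar>G r \<omega>\<bar> \<le> C * D \<omega>) \<and> (\<forall>n. \<bar>R n \<omega>\<bar> \<le> C * D \<omega>)"
    using B_continuous y(2) D(3)
  proof eventually_elim
    case (elim \<omega>)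
    note path = barrier_surplus_path[where y=y and \<omega>=\<omega>, OF elim(1) T b elim(2)]
    have Z: "continuous_on {T..} (\<lambda>r. free_surplus y T r \<omega>)" by (rule free_surplus_continuous[OF elim(1) T])
    have "continuous_on {T..T + real N} (\<lambda>r. \<bar>B r \<omega> - B T \<omega>\<bar>)"
      using T by (intro continuous_intros continuous_on_subset[OF elim(1)]) auto
    then obtain l where l: "l \<in> {T..T + real N}" "\<And>r. r \<in> {T..T + real N} \<Longrightarrow> \<bar>B r \<omega> - B T \<omega>\<bar> \<le> \<bar>B l \<omega> - B T \<omega>\<bar>"
      using continuous_attains_sup[of "{T..T + real N}" "\<lambda>r. \<bar>B r \<omega> - B T \<omega>\<bar>"] by auto
    define \<beta>m where "\<beta>m = \<bar>B l \<omega> - B T \<omega>\<bar>"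
    have \<beta>0: "0 \<le> \<beta>m" by (simp add: \<beta>m_def)
    have Db: "exp (a * \<beta>m) \<le> D \<omega>" using elim(3) l(1) by (simp add: \<beta>m_def)
    have lB: "\<bar>B r \<omega> - B T \<omega>\<bar> \<le> \<beta>m" if "T \<le> r" "r \<le> T + real N" for r using l(2)[of r] that by (simp add: \<beta>m_def)
    have Xl: "- (2 * \<sigma> * \<beta>m) \<le> ?X r \<omega>" if "T \<le> r" "r \<le> T + real N" for r
      by (rule barrier_path_bounds(1)[where y=y and \<omega>=\<omega> and L="real N", OF elim(1) T b elim(2) \<mu> \<sigma> lB _ that]) auto
    have \<xi>l: "?\<xi> (T + real N) \<omega> - ?\<xi> T \<omega> \<le> \<mu> * real N + \<sigma> * \<beta>m"
      by (rule barrier_path_bounds(2)[where y=y and \<omega>=\<omega> and L="real N", OF elim(1) T b elim(2) \<mu> \<sigma> lB]) auto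
    have \<sigma>\<beta>: "0 \<le> \<sigma> * \<beta>m" using \<sigma> \<beta>0 by simp
    have \<mu>N: "0 \<le> \<mu> * real N" using \<mu> by simp
    define u where "u = b + \<mu> * real N + 3 * (\<sigma> * \<beta>m)"
    have expb: "exp (p * x) \<le> exp (m * u)" "exp (- q * x) \<le> exp (m * u)" if "\<bar>x\<bar> \<le> u" for x
    proof -
      have u0: "0 \<le> u" using that by linarith
      have "p * x \<le> p * u" "- q * x \<le> q * u" using that pq by (auto simp: abs_le_iff intro: mult_left_mono)
         (metis mult_left_mono less_imp_le mult_minus_right)
      moreover have "p * u \<le> m * u" "q * u \<le> m * u" using u0 pq by (auto simp: m_def intro!: mult_right_mono)
      ultimately show "exp (p * x) \<le> exp (m * u)" "exp (- q * x) \<le> exp (m * u)" by simp_all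
    qed
    have ebig: "(p + q + 2) * exp (m * u) * exp (\<mu> * real N + \<sigma> * \<beta>m) = C * exp (a * \<beta>m)"
      by (simp add: C_def a_def u_def exp_add[symmetric] algebra_simps)
    have CD: "C * exp (a * \<beta>m) \<le> C * D \<omega>" using Db C0 by (rule mult_left_mono)
    have "\<forall>r\<in>{T..T + real N}. \<bar>G r \<omega>\<bar> \<le> C * D \<omega>"
    proof
      fix r assume r: "r \<in> {T..T + real N}"
      have "\<bar>?X r \<omega>\<bar> \<le> u" using Xl[of r] path(3)[of r] r \<sigma>\<beta> \<mu>N b unfolding u_def by (auto simp: abs_le_iff)
      note e = expb[OF this]
      have "\<bar>g (?X r \<omega>)\<bar> \<le> exp (p * ?X r \<omega>) + exp (- q * ?X r \<omega>)" unfolding g_def by (simp add: abs_le_iff)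
      also have "\<dots> \<le> 2 * exp (m * u)" using e by linarith
      finally have "\<bar>g (?X r \<omega>)\<bar> \<le> 2 * exp (m * u)" .
      moreover have "exp (- d * (r - T)) \<le> 1" using d r by simp
      ultimately have "exp (- d * (r - T)) * \<bar>g (?X r \<omega>)\<bar> \<le> 1 * (2 * exp (m * u))" by (intro mult_mono) auto
      also have "\<dots> \<le> (p + q + 2) * exp (m * u)" using pq by (simp add: mult_right_mono)
      also have "\<dots> = (p + q + 2) * exp (m * u) * 1" by simp
      also have "\<dots> \<le> (p + q + 2) * exp (m * u) * exp (\<mu> * real N + \<sigma> * \<beta>m)"
        using pq \<mu>N \<sigma>\<beta> by (intro mult_left_mono) auto
      finally show "\<bar>G r \<omega>\<bar> \<le> C * D \<omega>" using ebig CD by (simp add: G_def abs_mult)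
    qed
    moreover have "\<bar>R n \<omega>\<bar> \<le> C * D \<omega>" for n
    proof -
      have "\<bar>R n \<omega>\<bar> \<le> (p + q) * exp (m * u) * (?\<xi> (T + real N) \<omega> - ?\<xi> T \<omega>)"
        unfolding R_def barrier_surplus_def barrier_dividend_def
      proof (rule barrier_Riemann_bound[where g=g and g'=g' and \<psi>="\<lambda>r. exp (- d * (r - T))", OF Z dg])
        show "0 \<le> exp (- d * (r - T)) \<and> exp (- d * (r - T)) \<le> 1" if "T \<le> r" for r using d that by simp
        show "- (2 * \<sigma> * \<beta>m) \<le> free_surplus y T r \<omega> - excess b T (\<lambda>s. free_surplus y T s \<omega>) r" if "T \<le> r" "r \<le> T + real N" for r
          using Xl[OF that] by (simp add: barrier_surplus_def barrier_dividend_def)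
        show "b + (excess b T (\<lambda>s. free_surplus y T s \<omega>) (T + real N) - excess b T (\<lambda>s. free_surplus y T s \<omega>) T) \<le> u"
          using \<xi>l \<sigma>\<beta> by (simp add: barrier_dividend_def u_def)
        fix x assume "- (2 * \<sigma> * \<beta>m) \<le> x" "x \<le> u"
        then have "\<bar>x\<bar> \<le> u" using \<sigma>\<beta> \<mu>N b unfolding u_def by (auto simp: abs_le_iff)
        note e = expb[OF this]
        have "p * exp (p * x) \<le> p * exp (m * u)" "q * exp (- q * x) \<le> q * exp (m * u)"
          using e pq by (auto intro: mult_left_mono)
        then show "\<bar>g' x\<bar> \<le> (p + q) * exp (m * u)" using g'pos[of x] by (simp add: g'_def algebra_simps)
      qed
      also have "\<dots> \<le> (p + q + 2) * exp (m * u) * exp (\<mu> * real N + \<sigma> * \<beta>m)"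
      proof (rule mult_mono)
        show "?\<xi> (T + real N) \<omega> - ?\<xi> T \<omega> \<le> exp (\<mu> * real N + \<sigma> * \<beta>m)"
          using \<xi>l exp_ge_add_one_self[of "\<mu> * real N + \<sigma> * \<beta>m"] by linarith
        show "0 \<le> ?\<xi> (T + real N) \<omega> - ?\<xi> T \<omega>"
          unfolding barrier_dividend_def using excess_mono[OF Z order_refl, of "T + real N" b] by simp
      qed (use pq in \<open>auto intro: mult_right_mono\<close>)
      finally show ?thesis using ebig CD by simp
    qed
    ultimately show ?case by blast
  qed
  have Xm: "?X r \<in> borel_measurable \<Omega>" if "T \<le> r" for r
    using barrier_surplus_adapted[OF T that y(1)] F_measurable[of r] T that by auto
  have gm: "g \<in> borel_measurable borel" by (rule borel_measurable_continuous_onI[OF gc])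
  have Gm: "G r \<in> borel_measurable \<Omega>" if "T \<le> r" for r
    unfolding G_def using measurable_compose[OF Xm[OF that] gm] by (intro borel_measurable_times) auto
  have tm: "{\<omega> \<in> space \<Omega>. ?t n k < s \<omega>} \<in> sets \<Omega>" for n k using PF F_sets[OF tk] unfolding s_def by blast
  \<comment> \<open>A process at a random time: on the grid it is a finite sum over deterministic
    times with measurable indicators.\<close>
  have Gcm: "(\<lambda>\<omega>. G (grid_ceiling T n (s \<omega>)) \<omega>) \<in> borel_measurable \<Omega>" for n
  proof -
    have "(\<lambda>\<omega>. G T \<omega> + (\<Sum>k<N * 2 ^ n. indicator {\<omega> \<in> space \<Omega>. ?t n k < s \<omega>} \<omega> * (G (?t n (Suc k)) \<omega> - G (?t n k) \<omega>))) \<in> borel_measurable \<Omega>"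
      using tm Gm dyadic_ge by (intro borel_measurable_add borel_measurable_sum borel_measurable_times borel_measurable_diff) auto
    then show ?thesis
    proof (rule measurable_cong[THEN iffD1, rotated])
      fix \<omega> assume "\<omega> \<in> space \<Omega>"
      then have "(\<Sum>k<N * 2 ^ n. indicator {\<omega> \<in> space \<Omega>. ?t n k < s \<omega>} \<omega> * (G (?t n (Suc k)) \<omega> - G (?t n k) \<omega>))
        = (\<Sum>k<N * 2 ^ n. if ?t n k < s \<omega> then G (?t n (Suc k)) \<omega> - G (?t n k) \<omega> else 0)"
        by (intro sum.cong) auto
      then show "G T \<omega> + (\<Sum>k<N * 2 ^ n. indicator {\<omega> \<in> space \<Omega>. ?t n k < s \<omega>} \<omega> * (G (?t n (Suc k)) \<omega> - G (?t n k) \<omega>)) = G (grid_ceiling T n (s \<omega>)) \<omega>"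
        using telescope_stopped[of T "s \<omega>" N n "\<lambda>r. G r \<omega>"] sb by simp
    qed
  qed
  have CDi: "integrable \<Omega> (\<lambda>\<omega>. C * D \<omega>)" using D(1) by simp
  have Gci: "integrable \<Omega> (\<lambda>\<omega>. G (grid_ceiling T n (s \<omega>)) \<omega>)" for n
  proof (rule Bochner_Integration.integrable_bound[OF CDi Gcm])
    show "AE \<omega> in \<Omega>. norm (G (grid_ceiling T n (s \<omega>)) \<omega>) \<le> norm (C * D \<omega>)"
      using bounds
    proof eventually_elim
      case (elim \<omega>)
      have "T \<le> grid_ceiling T n (s \<omega>)" "grid_ceiling T n (s \<omega>) \<le> T + real N"
        using grid_ceiling_bounds[of T "s \<omega>" N n] sb[of \<omega>] by linarith+
      then show ?case using elim C0 D(2)[of \<omega>] by simp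
    qed
  qed
  have GTi: "integrable \<Omega> (G T)"
    by (rule Bochner_Integration.integrable_bound[OF CDi Gm]) (use bounds C0 D(2) in \<open>auto elim!: eventually_mono\<close>)
  have Rm: "R n \<in> borel_measurable \<Omega>" for n
  proof (rule measurable_cong[THEN iffD2, OF R_eq])
    show "(\<lambda>\<omega>. (\<Sum>k<N * 2 ^ n. U n k \<omega>) - (G (grid_ceiling T n (s \<omega>)) \<omega> - G T \<omega>)) \<in> borel_measurable \<Omega>"
      using U(1) Gcm Gm by (intro borel_measurable_diff borel_measurable_sum) auto
  qed
  have ER: "expectation (R n) = expectation (G T) - expectation (\<lambda>\<omega>. G (grid_ceiling T n (s \<omega>)) \<omega>)" for n
  proof -
    have "expectation (R n) = expectation (\<lambda>\<omega>. (\<Sum>k<N * 2 ^ n. U n k \<omega>) - (G (grid_ceiling T n (s \<omega>)) \<omega> - G T \<omega>))"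
      by (rule Bochner_Integration.integral_cong[OF refl R_eq])
    also have "\<dots> = (\<Sum>k<N * 2 ^ n. expectation (U n k)) - (expectation (\<lambda>\<omega>. G (grid_ceiling T n (s \<omega>)) \<omega>) - expectation (G T))"
      using U(1) Gci GTi by simp
    finally show ?thesis by (simp add: U(2))
  qed
  have Rlim: "AE \<omega> in \<Omega>. (\<lambda>n. R n \<omega>) \<longlonglongrightarrow> g' b * I \<omega>"
    using B_continuous
  proof eventually_elim
    case (elim \<omega>)
    have Z: "continuous_on {T..} (\<lambda>r. free_surplus y T r \<omega>)" by (rule free_surplus_continuous[OF elim(1) T])
    have "(\<lambda>n. R n \<omega>) \<longlonglongrightarrow> (LINT r:{T<..T + real N}|stieltjes T (excess b T (\<lambda>r. free_surplus y T r \<omega>)). g' b * (exp (- d * (r - T)) * indicator {..s \<omega>} r))"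
      unfolding R_def barrier_surplus_def barrier_dividend_def
      by (rule barrier_Riemann_limit[OF Z sb(1,2) dg g'c]) (intro continuous_intros)
    also have "(LINT r:{T<..T + real N}|stieltjes T (excess b T (\<lambda>r. free_surplus y T r \<omega>)). g' b * (exp (- d * (r - T)) * indicator {..s \<omega>} r))
      = (LINT r:{T<..T + real N}|stieltjes T (excess b T (\<lambda>r. free_surplus y T r \<omega>)). g' b * (exp (- d * (r - T)) * indicator {r. ereal r \<le> ruin_time T ?X \<omega>} r))"
      unfolding set_lebesgue_integral_def
    proof (intro Bochner_Integration.integral_cong refl)
      fix r
      have "r \<le> s \<omega> \<longleftrightarrow> ereal r \<le> ruin_time T ?X \<omega>" if r: "T < r" "r \<le> T + real N"
      proof
        assume "r \<le> s \<omega>"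
        then show "ereal r \<le> ruin_time T ?X \<omega>" using sb(3)[of \<omega>] by (auto intro: order_trans[of "ereal r" "ereal (s \<omega>)"])
      next
        assume *: "ereal r \<le> ruin_time T ?X \<omega>"
        show "r \<le> s \<omega>"
        proof (rule ccontr)
          assume "\<not> r \<le> s \<omega>"
          then have "s \<omega> < T + real N \<and> ereal (s \<omega>) < ruin_time T ?X \<omega>"
            using * r by (auto intro: less_le_trans[of "ereal (s \<omega>)" "ereal r"])
          then have "s \<omega> < capped_ruin T (real N) ?X \<omega>" by (subst capped_ruin_iff) auto
          then show False by (simp add: s_def)
        qed
      qed
      then show "indicator {T<..T + real N} r *\<^sub>R (g' b * (exp (- d * (r - T)) * indicator {..s \<omega>} r))
        = indicator {T<..T + real N} r *\<^sub>R (g' b * (exp (- d * (r - T)) * indicator {r. ereal r \<le> ruin_time T ?X \<omega>} r))"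
        by (auto simp: indicator_def)
    qed
    also have "\<dots> = g' b * I \<omega>" unfolding I_def barrier_dividend_def by simp
    finally show ?case .
  qed
  have Rbd: "AE \<omega> in \<Omega>. norm (R n \<omega>) \<le> C * D \<omega>" for n using bounds by eventually_elim simp
  have g'Im: "(\<lambda>\<omega>. g' b * I \<omega>) \<in> borel_measurable \<Omega>" by (rule measurable_AE_limit[OF Rm Rlim])
  have R1: "integrable \<Omega> (\<lambda>\<omega>. g' b * I \<omega>)" by (rule integrable_dominated_convergence[OF g'Im Rm CDi Rlim Rbd])
  have R2: "(\<lambda>n. expectation (R n)) \<longlonglongrightarrow> expectation (\<lambda>\<omega>. g' b * I \<omega>)" by (rule integral_dominated_convergence[OF g'Im Rm CDi Rlim Rbd])
  have "integrable \<Omega> (\<lambda>\<omega>. inverse (g' b) * (g' b * I \<omega>))" using R1 by (rule integrable_mult_right)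
  moreover have "inverse (g' b) * (g' b * I \<omega>) = I \<omega>" for \<omega> using g'pos[of b] by simp
  ultimately show "integrable \<Omega> I" by simp
  have Glim: "AE \<omega> in \<Omega>. (\<lambda>n. G (grid_ceiling T n (s \<omega>)) \<omega>) \<longlonglongrightarrow> G (s \<omega>) \<omega>"
    using B_continuous y(2)
  proof eventually_elim
    case (elim \<omega>)
    note Xc = barrier_surplus_path(1)[where y=y and \<omega>=\<omega>, OF elim(1) T b elim(2)]
    have Gc: "continuous_on {T..} (\<lambda>r. G r \<omega>)"
      unfolding G_def by (intro continuous_intros continuous_on_compose2[OF gc Xc]) auto
    show ?case
    proof (rule continuous_on_tendsto_compose[OF Gc grid_ceiling_tendsto[OF sb(1)]])
      show "s \<omega> \<in> {T..}" using sb by simp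
      show "\<forall>\<^sub>F n in sequentially. grid_ceiling T n (s \<omega>) \<in> {T..}"
        using grid_ceiling_bounds(1)[OF sb(1,2)] sb(1) by (intro always_eventually allI) (metis atLeast_iff order_trans)
    qed
  qed
  have Gbd: "AE \<omega> in \<Omega>. norm (G (grid_ceiling T n (s \<omega>)) \<omega>) \<le> C * D \<omega>" for n
    using bounds
  proof eventually_elim
    case (elim \<omega>)
    have "T \<le> grid_ceiling T n (s \<omega>)" "grid_ceiling T n (s \<omega>) \<le> T + real N"
      using grid_ceiling_bounds[of T "s \<omega>" N n] sb[of \<omega>] by linarith+
    then show ?case using elim by simp
  qed
  have Gsm: "(\<lambda>\<omega>. G (s \<omega>) \<omega>) \<in> borel_measurable \<Omega>" by (rule measurable_AE_limit[OF Gcm Glim])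
  have G2: "(\<lambda>n. expectation (\<lambda>\<omega>. G (grid_ceiling T n (s \<omega>)) \<omega>)) \<longlonglongrightarrow> expectation (\<lambda>\<omega>. G (s \<omega>) \<omega>)"
    by (rule integral_dominated_convergence[OF Gsm Gcm CDi Glim Gbd])
  have "(\<lambda>n. expectation (R n)) \<longlonglongrightarrow> expectation (G T) - expectation (\<lambda>\<omega>. G (s \<omega>) \<omega>)"
    unfolding ER by (intro tendsto_diff tendsto_const G2)
  from LIMSEQ_unique[OF R2 this] have E: "g' b * expectation I = expectation (G T) - expectation (\<lambda>\<omega>. G (s \<omega>) \<omega>)" by simp
  have GT: "expectation (G T) = expectation (\<lambda>\<omega>. g (min (y \<omega>) b))"
  proof (rule integral_cong_AE)
    show "G T \<in> borel_measurable \<Omega>" by (rule Gm) simp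
    have "y \<in> borel_measurable \<Omega>" using F_measurable[OF T y(1)] .
    then show "(\<lambda>\<omega>. g (min (y \<omega>) b)) \<in> borel_measurable \<Omega>" using gm by measurable
    show "AE \<omega> in \<Omega>. G T \<omega> = g (min (y \<omega>) b)"
      using B_continuous y(2)
    proof eventually_elim
      case (elim \<omega>)
      show ?case using barrier_surplus_path(2)[where y=y and \<omega>=\<omega>, OF elim(1) T b elim(2)] by (simp add: G_def)
    qed
  qed
  \<comment> \<open>Either ruin has occurred and \<open>g 0 = 0\<close>, or the horizon is reached
    with a surplus in \<open>[0, b]\<close> and the discount factor gives the bound.\<close>
  have Gs: "AE \<omega> in \<Omega>. norm (G (s \<omega>) \<omega>) \<le> exp (- d * real N) * g b"
    using B_continuous y(2)
  proof eventually_elim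
    case (elim \<omega>)
    note path = barrier_surplus_path[where y=y and \<omega>=\<omega>, OF elim(1) T b elim(2)]
    have gb: "0 \<le> g b" using gmono[of 0 b] g0 b by simp
    show ?case
    proof (cases "ruin_time T ?X \<omega> < ereal (T + real N)")
      case True
      then obtain \<tau> where \<tau>: "ruin_time T ?X \<omega> = ereal \<tau>" using ruin_time_ge[of T ?X \<omega>] by (cases "ruin_time T ?X \<omega>") auto
      then have "s \<omega> = \<tau>" using True by (simp add: s_def capped_ruin_def)
      moreover have "?X \<tau> \<omega> = 0"
        by (rule ruin_time_attained(2)[OF _ \<tau>]) (rule continuous_on_atLeast_at_right[OF path(1)])
      ultimately show ?thesis using g0 gb by (simp add: G_def)
    next
      case False
      then have s: "s \<omega> = T + real N" by (simp add: s_def capped_ruin_def)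
      have "s \<omega> \<in> lifetime T ?X \<omega>" using sb[of \<omega>] by (simp add: lifetime_def)
      then have "0 \<le> ?X (s \<omega>) \<omega>" "?X (s \<omega>) \<omega> \<le> b" using path(3)[of "s \<omega>"] path(4)[of "s \<omega>"] sb(1)[of \<omega>] by auto
      then have "0 \<le> g (?X (s \<omega>) \<omega>)" "g (?X (s \<omega>) \<omega>) \<le> g b" using gmono g0 by (metis, blast)
      then show ?thesis by (simp add: G_def s)
    qed
  qed
  have Gsi: "integrable \<Omega> (\<lambda>\<omega>. G (s \<omega>) \<omega>)" by (rule integrable_const_bound[OF Gs Gsm])
  have "\<bar>expectation (\<lambda>\<omega>. G (s \<omega>) \<omega>)\<bar> \<le> expectation (\<lambda>\<omega>. norm (G (s \<omega>) \<omega>))"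
    using integral_norm_bound[of \<Omega> "\<lambda>\<omega>. G (s \<omega>) \<omega>"] by simp
  also have "\<dots> \<le> expectation (\<lambda>\<omega>. exp (- d * real N) * g b)"
    by (rule integral_mono_AE[OF integrable_norm[OF Gsi] _ Gs]) simp
  finally show "\<bar>g' b * expectation I - expectation (\<lambda>\<omega>. g (min (y \<omega>) b))\<bar> \<le> exp (- d * real N) * g b"
    using E GT by (simp add: prob_space)
qed

end

section \<open>The candidate value function\<close>

lemma DERIV_piecewise:
  fixes g k :: "real \<Rightarrow> real"
  assumes g: "\<And>x. (g has_real_derivative g' x) (at x)" and k: "\<And>x. (k has_real_derivative k' x) (at x)"
    and eq: "g z = k z" "g' z = k' z"
  shows "((\<lambda>x. if x < z then g x else k x) has_real_derivative (if x < z then g' x else k' x)) (at x)"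
proof (cases x z rule: linorder_cases)
  case less
  have "((\<lambda>x. if x < z then g x else k x) has_real_derivative g' x) (at x)"
    by (rule has_field_derivative_transform_within_open[OF g, where S="{..<z}"]) (use less in auto)
  then show ?thesis using less by simp
next
  case greater
  have "((\<lambda>x. if x < z then g x else k x) has_real_derivative k' x) (at x)"
    by (rule has_field_derivative_transform_within_open[OF k, where S="{z<..}"]) (use greater in auto)
  then show ?thesis using greater by simp
next
  case equal
  let ?f = "\<lambda>x. if x < z then g x else k x"
  have "((\<lambda>y. (?f y - ?f z) / (y - z)) \<longlongrightarrow> k' z) (at z)"
  proof (rule filterlim_split_at)
    have "((\<lambda>y. (g y - g z) / (y - z)) \<longlongrightarrow> k' z) (at_left z)"
      using g[of z] eq unfolding has_field_derivative_iff by (auto intro: filterlim_at_split[THEN iffD1, THEN conjunct1])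
    moreover have "\<forall>\<^sub>F y in at_left z. (g y - g z) / (y - z) = (?f y - ?f z) / (y - z)"
      unfolding eventually_at_left_field using eq by (intro exI[of _ "z - 1"]) auto
    ultimately show "((\<lambda>y. (?f y - ?f z) / (y - z)) \<longlongrightarrow> k' z) (at_left z)"
      by (rule Lim_transform_eventually)
    have "((\<lambda>y. (k y - k z) / (y - z)) \<longlongrightarrow> k' z) (at_right z)"
      using k[of z] unfolding has_field_derivative_iff by (auto intro: filterlim_at_split[THEN iffD1, THEN conjunct2])
    moreover have "\<forall>\<^sub>F y in at_right z. (k y - k z) / (y - z) = (?f y - ?f z) / (y - z)"
      unfolding eventually_at_right_field by (intro exI[of _ "z + 1"]) auto
    ultimately show "((\<lambda>y. (?f y - ?f z) / (y - z)) \<longlongrightarrow> k' z) (at_right z)"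
      by (rule Lim_transform_eventually)
  qed
  then show ?thesis using equal by (simp add: has_field_derivative_iff)
qed

text \<open>\<open>theta3\<close> and \<open>- theta4\<close> are the two roots of the
  characteristic equation with rate \<open>d\<close>. That the second is larger in absolute value is
  due to the positive drift, and makes \<open>curvature_ratio\<close> negative at 0.\<close>

lemma theta_roots:
  assumes "0 < \<sigma>" "0 < \<mu>" "0 < d"
  shows "0 < theta3 \<mu> \<sigma> d" "0 < theta4 \<mu> \<sigma> d"
    "\<sigma>\<^sup>2 * (theta3 \<mu> \<sigma> d)\<^sup>2 / 2 + \<mu> * theta3 \<mu> \<sigma> d = d"
    "\<sigma>\<^sup>2 * (theta4 \<mu> \<sigma> d)\<^sup>2 / 2 - \<mu> * theta4 \<mu> \<sigma> d = d"
    "theta3 \<mu> \<sigma> d < theta4 \<mu> \<sigma> d"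
proof -
  define R where "R = sqrt (\<mu>\<^sup>2 + 2 * d * \<sigma>\<^sup>2)"
  have R2: "R\<^sup>2 = \<mu>\<^sup>2 + 2 * d * \<sigma>\<^sup>2" unfolding R_def using assms by (intro real_sqrt_pow2) auto
  have "\<mu> < R" unfolding R_def using assms by (intro real_less_rsqrt) auto
  then show "0 < theta3 \<mu> \<sigma> d" "0 < theta4 \<mu> \<sigma> d" "theta3 \<mu> \<sigma> d < theta4 \<mu> \<sigma> d"
    using assms by (auto simp: theta3_def theta4_def R_def[symmetric] divide_strict_right_mono)
  have s2: "\<sigma>\<^sup>2 \<noteq> 0" using assms by simp
  have "\<sigma>\<^sup>2 * ((- \<mu> + R) / \<sigma>\<^sup>2)\<^sup>2 / 2 + \<mu> * ((- \<mu> + R) / \<sigma>\<^sup>2) = (R\<^sup>2 - \<mu>\<^sup>2) / (2 * \<sigma>\<^sup>2)"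
    using s2 by (simp add: field_simps power2_eq_square)
  then show "\<sigma>\<^sup>2 * (theta3 \<mu> \<sigma> d)\<^sup>2 / 2 + \<mu> * theta3 \<mu> \<sigma> d = d"
    unfolding theta3_def R_def[symmetric] R2 using s2 by simp
  have "\<sigma>\<^sup>2 * ((\<mu> + R) / \<sigma>\<^sup>2)\<^sup>2 / 2 - \<mu> * ((\<mu> + R) / \<sigma>\<^sup>2) = (R\<^sup>2 - \<mu>\<^sup>2) / (2 * \<sigma>\<^sup>2)"
    using s2 by (simp add: field_simps power2_eq_square)
  then show "\<sigma>\<^sup>2 * (theta4 \<mu> \<sigma> d)\<^sup>2 / 2 - \<mu> * theta4 \<mu> \<sigma> d = d"
    unfolding theta4_def R_def[symmetric] R2 using s2 by simp
qed

section \<open>The barrier level\<close>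

lemma slope_term_pos: "0 < \<sigma> \<Longrightarrow> 0 < \<mu> \<Longrightarrow> 0 < d \<Longrightarrow> 0 < slope_term \<mu> \<sigma> d x"
  unfolding slope_term_def using theta_roots(1,2)[of \<sigma> \<mu> d] by (intro add_pos_pos mult_pos_pos) auto

text \<open>The second derivative of \<open>exp (p x) - exp (- q x)\<close> divided by the first,
  for the two exponents belonging to \<open>d\<close>. For a multiple with slope \<open>- c\<close>
  at \<open>x\<close> the second derivative there is \<open>- c\<close> times this ratio, so the
  barrier equation makes a weighted sum of ratios vanish.\<close>

definition curvature_ratio :: "real \<Rightarrow> real \<Rightarrow> real \<Rightarrow> real \<Rightarrow> real" where
  "curvature_ratio \<mu> \<sigma> d x =
     ((theta3 \<mu> \<sigma> d)\<^sup>2 * exp (theta3 \<mu> \<sigma> d * x) - (theta4 \<mu> \<sigma> d)\<^sup>2 * exp (- theta4 \<mu> \<sigma> d * x)) / slope_term \<mu> \<sigma> d x"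

text \<open>In the numerator of the derivative the pure squares cancel, and the mixed terms add up
  to a positive multiple of \<open>p * q * (p + q)^2\<close>.\<close>

lemma curvature_ratio_strict_mono:
  assumes "0 < \<sigma>" "0 < \<mu>" "0 < d" "x < y"
  shows "curvature_ratio \<mu> \<sigma> d x < curvature_ratio \<mu> \<sigma> d y"
proof -
  define p q where "p = theta3 \<mu> \<sigma> d" and "q = theta4 \<mu> \<sigma> d"
  have pq: "0 < p" "0 < q" using theta_roots assms by (auto simp: p_def q_def)
  define n where "n x = p\<^sup>2 * exp (p * x) - q\<^sup>2 * exp (- q * x)" for x
  define s where "s x = p * exp (p * x) + q * exp (- q * x)" for x
  have spos: "0 < s x" for x unfolding s_def using pq by (intro add_pos_pos mult_pos_pos) auto
  have "n x / s x < n y / s y"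
  proof (rule DERIV_pos_imp_increasing[OF assms(4)], intro exI conjI)
    fix z
    show "((\<lambda>x. n x / s x) has_real_derivative
        ((p\<^sup>2 * (p * exp (p * z)) + q\<^sup>2 * (q * exp (- q * z))) * s z - n z * n z) / (s z * s z)) (at z)"
      unfolding n_def s_def using spos[of z, unfolded s_def]
      by (auto intro!: derivative_eq_intros simp: power2_eq_square algebra_simps)
    have "(p\<^sup>2 * (p * exp (p * z)) + q\<^sup>2 * (q * exp (- q * z))) * s z - n z * n z
      = exp (p * z) * exp (- q * z) * (p * q * (p + q)\<^sup>2)"
      unfolding n_def s_def by (simp add: power2_eq_square algebra_simps)
    also have "\<dots> > 0" using pq by simp
    finally show "0 < ((p\<^sup>2 * (p * exp (p * z)) + q\<^sup>2 * (q * exp (- q * z))) * s z - n z * n z) / (s z * s z)"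
      using spos[of z] by simp
  qed
  then show ?thesis by (simp add: curvature_ratio_def slope_term_def p_def q_def n_def s_def)
qed

lemma curvature_ratio_0:
  assumes "0 < \<sigma>" "0 < \<mu>" "0 < d" shows "curvature_ratio \<mu> \<sigma> d 0 < 0"
proof -
  have "(theta3 \<mu> \<sigma> d)\<^sup>2 < (theta4 \<mu> \<sigma> d)\<^sup>2" using theta_roots[OF assms] by (intro power_strict_mono) auto
  then show ?thesis unfolding curvature_ratio_def using slope_term_pos[OF assms, of 0] by (simp add: divide_neg_pos)
qed

lemma curvature_ratio_eventually_pos:
  assumes "0 < \<sigma>" "0 < \<mu>" "0 < d"
  shows "\<exists>b. \<forall>x\<ge>b. 0 < curvature_ratio \<mu> \<sigma> d x"
proof -
  define p q where "p = theta3 \<mu> \<sigma> d" and "q = theta4 \<mu> \<sigma> d"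
  have pq: "0 < p" "0 < q" using theta_roots assms by (auto simp: p_def q_def)
  \<comment> \<open>The threshold comes from \<open>p * x < exp (p * x)\<close>: beyond it the first
    term of the numerator already exceeds \<open>q^2\<close>.\<close>
  have "0 < curvature_ratio \<mu> \<sigma> d x" if x: "q\<^sup>2 / p^3 \<le> x" "0 \<le> x" for x
  proof -
    have "q\<^sup>2 = p\<^sup>2 * (q\<^sup>2 / p^3 * p)" using pq by (simp add: field_simps power2_eq_square power3_eq_cube)
    also have "\<dots> \<le> p\<^sup>2 * (x * p)" by (intro mult_left_mono mult_right_mono) (use x pq in auto)
    also have "\<dots> = p\<^sup>2 * (p * x)" by simp
    also have "p * x < exp (p * x)" using exp_ge_add_one_self[of "p * x"] by linarith
    then have "p\<^sup>2 * (p * x) < p\<^sup>2 * exp (p * x)" using pq by (intro mult_strict_left_mono) auto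
    finally have "q\<^sup>2 < p\<^sup>2 * exp (p * x)" .
    moreover have "q\<^sup>2 * exp (- q * x) \<le> q\<^sup>2 * 1" using x pq by (intro mult_left_mono) auto
    ultimately show ?thesis
      unfolding curvature_ratio_def p_def[symmetric] q_def[symmetric] using slope_term_pos[OF assms, of x] by simp
  qed
  then show ?thesis by (intro exI[of _ "max 0 (q\<^sup>2 / p^3)"]) auto
qed

lemma curvature_ratio_continuous:
  assumes "0 < \<sigma>" "0 < \<mu>" "0 < d" shows "continuous_on S (curvature_ratio \<mu> \<sigma> d)"
  unfolding curvature_ratio_def using slope_term_pos[OF assms]
  by (auto simp: slope_term_def intro!: continuous_intros) (metis less_irrefl)

lemma sum_1_2: "(\<Sum>i=1..2. h i) = h (1::nat) + h 2" for h :: "nat \<Rightarrow> real"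
  by (simp add: eval_nat_numeral atLeastAtMostSuc_conv)

lemma barrier_equation_ratio:
  "barrier_equation \<mu> \<sigma> c w \<delta> x \<longleftrightarrow>
    c * (w 1 * curvature_ratio \<mu> \<sigma> (\<delta> 1) x + w 2 * curvature_ratio \<mu> \<sigma> (\<delta> 2) x) = 0"
proof -
  have "(\<Sum>i=1..2. w i * (- (c / slope_term \<mu> \<sigma> (\<delta> i) x) *
        ((theta3 \<mu> \<sigma> (\<delta> i))\<^sup>2 * exp (theta3 \<mu> \<sigma> (\<delta> i) * x)
         - (theta4 \<mu> \<sigma> (\<delta> i))\<^sup>2 * exp (- theta4 \<mu> \<sigma> (\<delta> i) * x))))
    = - (c * (w 1 * curvature_ratio \<mu> \<sigma> (\<delta> 1) x + w 2 * curvature_ratio \<mu> \<sigma> (\<delta> 2) x))"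
    unfolding sum_1_2 curvature_ratio_def by (simp add: algebra_simps diff_divide_distrib)
  then show ?thesis unfolding barrier_equation_def by simp
qed

text \<open>Both ratios increase strictly and continuously from negative values at 0 to positive
  ones, so their positive combination has exactly one positive zero; this makes the definite
  description of \<open>x2\<close> meaningful.\<close>

lemma barrier_unique:
  assumes "0 < \<sigma>" "0 < \<mu>" "0 < c" "0 < w 1" "0 < w (2::nat)" "0 < \<delta> 1" "0 < \<delta> 2"
  shows "\<exists>!x. 0 < x \<and> barrier_equation \<mu> \<sigma> c w \<delta> x"
proof -
  define h where "h x = w 1 * curvature_ratio \<mu> \<sigma> (\<delta> 1) x + w 2 * curvature_ratio \<mu> \<sigma> (\<delta> 2) x" for x
  have mono: "h x < h y" if "x < y" for x y
    unfolding h_def using curvature_ratio_strict_mono[OF assms(1,2) _ that] assms by (intro add_strict_mono mult_strict_left_mono) auto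
  have h0: "h 0 < 0"
    unfolding h_def using curvature_ratio_0[OF assms(1,2)] assms by (intro add_neg_neg mult_pos_neg) auto
  obtain b1 b2 where b: "\<And>x. b1 \<le> x \<Longrightarrow> 0 < curvature_ratio \<mu> \<sigma> (\<delta> 1) x" "\<And>x. b2 \<le> x \<Longrightarrow> 0 < curvature_ratio \<mu> \<sigma> (\<delta> 2) x"
    using curvature_ratio_eventually_pos[OF assms(1,2)] assms by metis
  define b where "b = max 0 (max b1 b2)"
  have hb: "0 < h b" unfolding h_def b_def using b assms by (intro add_pos_pos mult_pos_pos) auto
  have "continuous_on {0..b} h"
    unfolding h_def using assms by (intro continuous_intros curvature_ratio_continuous)
  then obtain x where x: "0 \<le> x" "x \<le> b" "h x = 0"
    using IVT'[of h 0 0 b] h0 hb unfolding b_def by fastforce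
  have x0: "0 < x" using x h0 by (cases "x = 0") auto
  have iff: "barrier_equation \<mu> \<sigma> c w \<delta> y \<longleftrightarrow> h y = 0" for y
    using assms(3) by (simp add: barrier_equation_ratio h_def)
  show ?thesis
  proof (rule ex1I[of _ x])
    show "0 < x \<and> barrier_equation \<mu> \<sigma> c w \<delta> x" using x0 x iff by simp
    fix y assume "0 < y \<and> barrier_equation \<mu> \<sigma> c w \<delta> y"
    then show "y = x" using mono[of x y] mono[of y x] x iff by (cases x y rule: linorder_cases) auto
  qed
qed

section \<open>Smooth fit, convexity and the HJB system\<close>

locale barrier_model =
  fixes \<mu> \<sigma> M c x2 :: real and w \<delta> :: "nat \<Rightarrow> real"
  assumes \<mu>_pos: "0 < \<mu>" and \<sigma>_pos: "0 < \<sigma>" and M_pos: "0 < M" and c_pos: "0 < c"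
    and w_pos: "0 < w 1" "0 < w 2" and w_sum: "w 1 + w 2 = 1" and \<delta>_pos: "0 < \<delta> 1" "0 < \<delta> 2"
    and x2_pos: "0 < x2" and x2_eq: "barrier_equation \<mu> \<sigma> c w \<delta> x2"
    and c_le: "c * (\<Sum>i=1..2. w i * ((theta3 \<mu> \<sigma> (\<delta> i) + theta4 \<mu> \<sigma> (\<delta> i)) / slope_term \<mu> \<sigma> (\<delta> i) x2)) \<le> 1"
begin

abbreviation p :: "real \<Rightarrow> real" where "p d \<equiv> theta3 \<mu> \<sigma> d"
abbreviation q :: "real \<Rightarrow> real" where "q d \<equiv> theta4 \<mu> \<sigma> d"
abbreviation U :: "real \<Rightarrow> real \<Rightarrow> real" where "U d \<equiv> exponential_value \<mu> \<sigma> c x2 d"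

definition a :: "real \<Rightarrow> real" where "a d = c / slope_term \<mu> \<sigma> d x2"

definition U1 :: "real \<Rightarrow> real \<Rightarrow> real" where
  "U1 d x = (if x < x2 then - a d * (p d * exp (p d * x) + q d * exp (- q d * x)) else - c)"

text \<open>Not cut off at \<open>x2\<close>, unlike \<open>U1\<close>: the second derivative of a
  single \<open>U\<close> may jump there, and at \<open>x2\<close> the formula yields the value from
  the left.\<close>

definition U2 :: "real \<Rightarrow> real \<Rightarrow> real" where
  "U2 d x = - a d * ((p d)\<^sup>2 * exp (p d * x) - (q d)\<^sup>2 * exp (- q d * x))"

definition V :: "real \<Rightarrow> real" where "V x = w 1 * U (\<delta> 1) x + w 2 * U (\<delta> 2) x"
definition V1 :: "real \<Rightarrow> real" where "V1 x = w 1 * U1 (\<delta> 1) x + w 2 * U1 (\<delta> 2) x"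
definition V2 :: "real \<Rightarrow> real" where
  "V2 x = (if x < x2 then w 1 * U2 (\<delta> 1) x + w 2 * U2 (\<delta> 2) x else 0)"

text \<open>The derivative of \<open>f\<close> in its last argument on the diagonal
  \<open>s = t\<close>. It takes the place of a discount rate times the value, since the mixture has
  no single rate.\<close>

definition DV :: "real \<Rightarrow> real" where "DV x = w 1 * (\<delta> 1 * U (\<delta> 1) x) + w 2 * (\<delta> 2 * U (\<delta> 2) x)"

lemma pq_pos: "0 < d \<Longrightarrow> 0 < p d" "0 < d \<Longrightarrow> 0 < q d"
  using theta_roots[OF \<sigma>_pos \<mu>_pos] by auto

lemma a_pos: "0 < d \<Longrightarrow> 0 < a d"
  unfolding a_def using slope_term_pos[OF \<sigma>_pos \<mu>_pos] c_pos by simp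

lemma U_eq: "U d x = (if x < x2 then - a d * (exp (p d * x) - exp (- q d * x)) else - c * x + coeff5 \<mu> \<sigma> c x2 d)"
  by (simp add: exponential_value_def coeff4_def coeff3_def a_def algebra_simps)

lemma U_at_x2: "- a d * (exp (p d * x2) - exp (- q d * x2)) = - c * x2 + coeff5 \<mu> \<sigma> c x2 d"
  by (simp add: coeff5_def coeff4_def coeff3_def a_def algebra_simps)

lemma U_beyond: "x2 \<le> x \<Longrightarrow> U d x = - a d * (exp (p d * x2) - exp (- q d * x2)) - c * (x - x2)"
  unfolding U_eq U_at_x2 by (simp add: algebra_simps)

lemma a_slope: "0 < d \<Longrightarrow> a d * (p d * exp (p d * x2) + q d * exp (- q d * x2)) = c"
  using slope_term_pos[OF \<sigma>_pos \<mu>_pos, of d x2] by (simp add: a_def slope_term_def)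

lemma U_DERIV: assumes d: "0 < d" shows "(U d has_real_derivative U1 d x) (at x)"
proof -
  have "((\<lambda>x. if x < x2 then - a d * (exp (p d * x) - exp (- q d * x)) else - c * x + coeff5 \<mu> \<sigma> c x2 d)
    has_real_derivative (if x < x2 then - a d * (p d * exp (p d * x) + q d * exp (- q d * x)) else - c)) (at x)"
  proof (rule DERIV_piecewise[where k'="\<lambda>_. - c"])
    show "((\<lambda>x. - a d * (exp (p d * x) - exp (- q d * x))) has_real_derivative - a d * (p d * exp (p d * x) + q d * exp (- q d * x))) (at x)" for x
      by (auto intro!: derivative_eq_intros simp: algebra_simps)
    show "((\<lambda>x. - c * x + coeff5 \<mu> \<sigma> c x2 d) has_real_derivative - c) (at x)" for x
      by (auto intro!: derivative_eq_intros)
    show "- a d * (p d * exp (p d * x2) + q d * exp (- q d * x2)) = - c" using a_slope[OF d] by simp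
  qed (rule U_at_x2)
  then show ?thesis by (simp only: U_eq[symmetric, abs_def] U1_def)
qed

lemma U1_DERIV:
  assumes "0 < d" "x < x2" shows "(U1 d has_real_derivative U2 d x) (at x)"
proof (rule has_field_derivative_transform_within_open[of "\<lambda>x. - a d * (p d * exp (p d * x) + q d * exp (- q d * x))" _ _ "{..<x2}"])
  show "((\<lambda>x. - a d * (p d * exp (p d * x) + q d * exp (- q d * x))) has_real_derivative U2 d x) (at x)"
    unfolding U2_def by (auto intro!: derivative_eq_intros simp: algebra_simps power2_eq_square)
qed (use assms in \<open>auto simp: U1_def\<close>)

lemma U1_DERIV_beyond: "x2 < x \<Longrightarrow> (U1 d has_real_derivative 0) (at x)"
  by (rule has_field_derivative_transform_within_open[of "\<lambda>_. - c" _ _ "{x2<..}"]) (auto simp: U1_def)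

lemma U1_neg: assumes d: "0 < d" shows "U1 d x < 0"
proof (cases "x < x2")
  case True
  have "0 < p d * exp (p d * x) + q d * exp (- q d * x)" using pq_pos[OF d] by (intro add_pos_pos mult_pos_pos) auto
  then show ?thesis using True a_pos[OF d] by (simp add: U1_def mult_pos_pos)
qed (use c_pos in \<open>simp add: U1_def\<close>)

lemma U1_continuous: assumes d: "0 < d" shows "continuous_on UNIV (U1 d)"
proof -
  have "continuous_on ({..x2} \<union> {x2..}) (U1 d)"
  proof (rule continuous_on_closed_Un)
    have "continuous_on {..x2} (\<lambda>x. - a d * (p d * exp (p d * x) + q d * exp (- q d * x)))" by (intro continuous_intros)
    then show "continuous_on {..x2} (U1 d)"
      by (rule continuous_on_cong[THEN iffD1, rotated -1]) (use a_slope[OF d] in \<open>auto simp: U1_def not_less\<close>)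
    show "continuous_on {x2..} (U1 d)"
      by (rule continuous_on_cong[THEN iffD1, rotated -1, OF continuous_on_const[of _ "- c"]]) (auto simp: U1_def)
  qed auto
  moreover have "{..x2} \<union> {x2..} = (UNIV :: real set)" by auto
  ultimately show ?thesis by simp
qed

lemma U_continuous: "0 < d \<Longrightarrow> continuous_on S (U d)"
  by (rule DERIV_continuous_on) (rule has_field_derivative_at_within[OF U_DERIV])

lemma U_0: "U d 0 = 0"
  using x2_pos by (simp add: U_eq)

lemma U_antimono: assumes d: "0 < d" and xy: "x \<le> y" shows "U d y \<le> U d x"
  by (rule DERIV_nonpos_imp_nonincreasing[OF xy]) (use U_DERIV[OF d] U1_neg[OF d] in \<open>auto intro: less_imp_le\<close>)

lemma U_nonpos: "0 < d \<Longrightarrow> 0 \<le> x \<Longrightarrow> U d x \<le> 0"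
  using U_antimono[of d 0 x] U_0 by simp

lemma U1_below: "0 < d \<Longrightarrow> x \<le> x2 \<Longrightarrow> U1 d x = - a d * (p d * exp (p d * x) + q d * exp (- q d * x))"
  using a_slope[of d] by (cases "x = x2") (auto simp: U1_def)

lemma U_below: "x \<le> x2 \<Longrightarrow> U d x = - a d * (exp (p d * x) - exp (- q d * x))"
  using U_beyond[of x2 d] by (cases "x = x2") (auto simp: U_eq)

lemma U_generator:
  assumes d: "0 < d" and x: "x \<le> x2"
  shows "\<sigma>\<^sup>2 / 2 * U2 d x + \<mu> * U1 d x - d * U d x = 0"
proof -
  have "\<sigma>\<^sup>2 / 2 * U2 d x + \<mu> * U1 d x - d * U d x =
    - a d * ((\<sigma>\<^sup>2 * (p d)\<^sup>2 / 2 + \<mu> * p d - d) * exp (p d * x) - (\<sigma>\<^sup>2 * (q d)\<^sup>2 / 2 - \<mu> * q d - d) * exp (- q d * x))"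
    using x d by (simp add: U2_def U1_below U_below algebra_simps)
  then show ?thesis using theta_roots(3,4)[OF \<sigma>_pos \<mu>_pos d] by simp
qed

text \<open>The barrier equation is smooth fit of second order for the mixture, although its two
  summands need not fit individually.\<close>

lemma V2_at_x2: "w 1 * U2 (\<delta> 1) x2 + w 2 * U2 (\<delta> 2) x2 = 0"
  using x2_eq unfolding barrier_equation_def sum_1_2 U2_def a_def by simp

lemma V_DERIV: "(V has_real_derivative V1 x) (at x)"
  unfolding V_def[abs_def] V1_def using U_DERIV \<delta>_pos by (intro DERIV_add DERIV_cmult) auto

lemma V1_DERIV: "(V1 has_real_derivative V2 x) (at x)"
proof -
  let ?g = "\<lambda>x. w 1 * (- a (\<delta> 1) * (p (\<delta> 1) * exp (p (\<delta> 1) * x) + q (\<delta> 1) * exp (- q (\<delta> 1) * x)))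
    + w 2 * (- a (\<delta> 2) * (p (\<delta> 2) * exp (p (\<delta> 2) * x) + q (\<delta> 2) * exp (- q (\<delta> 2) * x)))"
  have V1: "V1 = (\<lambda>x. if x < x2 then ?g x else - c)"
  proof
    fix x
    have "w 1 * c + w 2 * c = c" using w_sum by (metis distrib_right mult_1)
    then show "V1 x = (if x < x2 then ?g x else - c)" by (simp add: V1_def U1_def)
  qed
  have "((\<lambda>x. if x < x2 then ?g x else - c) has_real_derivative
    (if x < x2 then w 1 * U2 (\<delta> 1) x + w 2 * U2 (\<delta> 2) x else 0)) (at x)"
  proof (rule DERIV_piecewise[where k'="\<lambda>_. 0"])
    show "(?g has_real_derivative w 1 * U2 (\<delta> 1) x + w 2 * U2 (\<delta> 2) x) (at x)" for x
      unfolding U2_def by (intro DERIV_add DERIV_cmult; auto intro!: derivative_eq_intros simp: algebra_simps power2_eq_square)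
    have "?g x2 = - (w 1 * c) - w 2 * c"
      using a_slope[OF \<delta>_pos(1)] a_slope[OF \<delta>_pos(2)] by simp
    also have "\<dots> = - c" using w_sum by (metis distrib_right mult_1 minus_add_distrib uminus_add_conv_diff minus_diff_commute)
    finally show "?g x2 = - c" .
  qed (use V2_at_x2 in simp_all)
  then show ?thesis unfolding V1 V2_def .
qed

lemma V1_beyond: "x2 \<le> x \<Longrightarrow> V1 x = - c"
proof -
  assume "x2 \<le> x"
  then have "V1 x = - ((w 1 + w 2) * c)" unfolding V1_def U1_def distrib_right by simp
  then show ?thesis by (simp add: w_sum del: One_nat_def)
qed

definition V3 :: "real \<Rightarrow> real" where
  "V3 x = - w 1 * a (\<delta> 1) * ((p (\<delta> 1))^3 * exp (p (\<delta> 1) * x) + (q (\<delta> 1))^3 * exp (- q (\<delta> 1) * x))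
    - w 2 * a (\<delta> 2) * ((p (\<delta> 2))^3 * exp (p (\<delta> 2) * x) + (q (\<delta> 2))^3 * exp (- q (\<delta> 2) * x))"

lemma V3_DERIV: "((\<lambda>x. w 1 * U2 (\<delta> 1) x + w 2 * U2 (\<delta> 2) x) has_real_derivative V3 x) (at x)"
  unfolding U2_def V3_def
  by (rule DERIV_add[THEN DERIV_cong], (rule DERIV_cmult, rule DERIV_cmult, rule DERIV_diff; rule DERIV_cmult; rule DERIV_chain'[of _ _ _ _ exp, OF _ DERIV_exp, THEN DERIV_cong]; (rule DERIV_cmult_Id refl)?)+)
     (simp_all add: power2_eq_square power3_eq_cube algebra_simps)

lemma V3_neg: "V3 x < 0"
proof -
  have "0 < a d * ((p d)^3 * exp (p d * x) + (q d)^3 * exp (- q d * x))" if "0 < d" for d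
    using a_pos[OF that] pq_pos[OF that] by (intro mult_pos_pos add_pos_pos) auto
  from mult_pos_pos[OF w_pos(1) this[OF \<delta>_pos(1)]] mult_pos_pos[OF w_pos(2) this[OF \<delta>_pos(2)]]
  show ?thesis unfolding V3_def by (simp add: mult.assoc)
qed

text \<open>The third derivative is negative, so the second one decreases strictly to its value 0 at
  \<open>x2\<close>.\<close>

lemma V2_pos: assumes "x < x2" shows "0 < V2 x"
proof -
  have "w 1 * U2 (\<delta> 1) x2 + w 2 * U2 (\<delta> 2) x2 < w 1 * U2 (\<delta> 1) x + w 2 * U2 (\<delta> 2) x"
    by (rule DERIV_neg_imp_decreasing[OF assms]) (use V3_DERIV V3_neg in blast)
  then show ?thesis using V2_at_x2 assms by (simp add: V2_def)
qed

lemma V2_nonneg: "0 \<le> V2 x"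
  using V2_pos[of x] by (cases "x < x2") (auto simp: V2_def)

lemma V1_mono: assumes "x \<le> y" shows "V1 x \<le> V1 y"
proof (rule DERIV_nonneg_imp_nondecreasing[OF assms])
  fix z
  show "\<exists>d. (V1 has_real_derivative d) (at z) \<and> 0 \<le> d"
    using V1_DERIV[of z] V2_nonneg[of z] by (intro exI[of _ "V2 z"]) simp
qed

lemma V1_le: "V1 x \<le> - c"
  using V1_mono[of x "max x x2"] V1_beyond[of "max x x2"] by simp

lemma V1_less: assumes "x < x2" shows "V1 x < - c"
proof -
  define z where "z = (x + x2) / 2"
  have z: "x < z" "z < x2" using assms by (auto simp: z_def)
  have "V1 x < V1 z"
    by (rule DERIV_pos_imp_increasing[OF z(1)]) (use z V1_DERIV V2_pos in \<open>force intro: le_less_trans\<close>)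
  then show ?thesis using V1_le[of z] by simp
qed

text \<open>The upper bound on \<open>c\<close> says precisely that the slope at 0 is at least
  \<open>- 1\<close>, and convexity extends this to all \<open>x\<close>. So a unit of effort, which
  costs 1, never lowers the value by more than 1.\<close>

lemma V1_ge: assumes "0 \<le> x" shows "- 1 \<le> V1 x"
proof -
  have "V1 0 = - (c * (\<Sum>i=1..2. w i * ((theta3 \<mu> \<sigma> (\<delta> i) + theta4 \<mu> \<sigma> (\<delta> i)) / slope_term \<mu> \<sigma> (\<delta> i) x2)))"
    unfolding sum_1_2 V1_def U1_def a_def using x2_pos by (simp add: algebra_simps add_divide_distrib)
  then show ?thesis using c_le V1_mono[OF assms] by simp
qed

lemma V_convex: "V z + V1 z * (y - z) \<le> V y"
proof (cases y z rule: linorder_cases)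
  case less
  obtain k where k: "y < k" "k < z" "V z - V y = (z - y) * V1 k" using MVT2[OF less, of V V1] V_DERIV by blast
  have "(z - y) * V1 k \<le> (z - y) * V1 z" using less k V1_mono[of k z] by (intro mult_left_mono) auto
  then show ?thesis using k(3) by (simp add: algebra_simps)
next
  case greater
  obtain k where k: "z < k" "k < y" "V y - V z = (y - z) * V1 k" using MVT2[OF greater, of V V1] V_DERIV by blast
  have "(y - z) * V1 z \<le> (y - z) * V1 k" using greater k V1_mono[of z k] by (intro mult_left_mono) auto
  then show ?thesis using k(3) by (simp add: algebra_simps)
qed simp

lemma V_0: "V 0 = 0" by (simp add: V_def U_0)

lemma V_drop: assumes "y \<le> x" shows "V x + c * (x - y) \<le> V y"
proof -
  have "V x + V1 x * (y - x) \<le> V y" by (rule V_convex)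
  moreover have "V1 x * (y - x) \<ge> - c * (y - x)" using V1_le[of x] assms by (intro mult_right_mono_neg) auto
  ultimately show ?thesis by (simp add: algebra_simps)
qed

lemma V_generator_eq: assumes x: "x \<le> x2" shows "\<sigma>\<^sup>2 / 2 * V2 x + \<mu> * V1 x - DV x = 0"
proof -
  have "V2 x = w 1 * U2 (\<delta> 1) x + w 2 * U2 (\<delta> 2) x"
    using x V2_at_x2 by (cases "x = x2") (auto simp: V2_def)
  then have "\<sigma>\<^sup>2 / 2 * V2 x + \<mu> * V1 x - DV x = w 1 * (\<sigma>\<^sup>2 / 2 * U2 (\<delta> 1) x + \<mu> * U1 (\<delta> 1) x - \<delta> 1 * U (\<delta> 1) x)
      + w 2 * (\<sigma>\<^sup>2 / 2 * U2 (\<delta> 2) x + \<mu> * U1 (\<delta> 2) x - \<delta> 2 * U (\<delta> 2) x)"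
    by (simp add: V1_def DV_def algebra_simps)
  then show ?thesis using U_generator \<delta>_pos x by simp
qed

text \<open>Beyond \<open>x2\<close> the first two derivatives keep their values from
  \<open>x2\<close>, where the expression is 0, while \<open>DV\<close> decreases; so the expression
  can only grow.\<close>

lemma V_generator: "0 \<le> \<sigma>\<^sup>2 / 2 * V2 x + \<mu> * V1 x - DV x"
proof (cases "x \<le> x2")
  case False
  then have "DV x \<le> DV x2"
    unfolding DV_def using U_antimono[of _ x2 x] \<delta>_pos w_pos by (intro add_mono mult_left_mono) auto
  then show ?thesis using False V_generator_eq[of x2] V1_beyond[of x] V1_beyond[of x2] by (simp add: V2_def)
qed (use V_generator_eq in simp)

text \<open>The expansion has to reach across \<open>x2\<close>, where the third derivative jumps,
  and up to arbitrarily large \<open>y\<close>. For an estimate from below a one-sided Lipschitz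
  bound on \<open>V2\<close> is enough: to the left of \<open>z\<close> it is larger, to the right
  it falls at rate at most \<open>C\<close> until \<open>x2\<close> and then stays 0.\<close>

lemma V_Taylor:
  obtains C where "0 \<le> C"
    "\<And>y z. 0 \<le> y \<Longrightarrow> 0 \<le> z \<Longrightarrow> z < x2 \<Longrightarrow> V z + V1 z * (y - z) + V2 z / 2 * (y - z)\<^sup>2 - C * \<bar>y - z\<bar> ^ 3 \<le> V y"
proof -
  have "continuous_on {0..x2} V3" unfolding V3_def[abs_def] by (intro continuous_intros)
  then obtain C where C: "\<And>x. x \<in> {0..x2} \<Longrightarrow> \<bar>V3 x\<bar> \<le> C" using continuous_on_Icc_bounded by blast
  have C0: "0 \<le> C" using C[of 0] x2_pos by auto
  have V2_lower: "V2 z - C * \<bar>u - z\<bar> \<le> V2 u" if z: "0 \<le> z" "z < x2" and u: "0 \<le> u" for z u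
  proof -
    let ?H = "\<lambda>x. w 1 * U2 (\<delta> 1) x + w 2 * U2 (\<delta> 2) x"
    have H: "V2 x = ?H (min x x2)" for x using V2_at_x2 by (auto simp: V2_def min_def)
    show ?thesis
    proof (cases "u \<le> z")
      case True
      have "?H z \<le> ?H u" by (rule DERIV_nonpos_imp_nonincreasing[OF True]) (use V3_DERIV V3_neg in \<open>blast intro: less_imp_le\<close>)
      moreover have "0 \<le> C * \<bar>u - z\<bar>" using C0 by simp
      ultimately show ?thesis using z True by (simp add: V2_def)
    next
      case False
      let ?u = "min u x2"
      have zu: "z < ?u" using False z by simp
      obtain k where k: "z < k" "k < ?u" "?H ?u - ?H z = (?u - z) * V3 k"
        using MVT2[OF zu, of ?H V3] V3_DERIV by blast
      have "- C \<le> V3 k" using C[of k] k z by auto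
      then have "(?u - z) * - C \<le> (?u - z) * V3 k" using zu by (intro mult_left_mono) auto
      moreover have "(?u - z) * C \<le> \<bar>u - z\<bar> * C" using False C0 by (intro mult_right_mono) auto
      ultimately have "V2 z - C * \<bar>u - z\<bar> \<le> ?H ?u" using k(3) z by (simp add: V2_def algebra_simps)
      then show ?thesis by (simp add: H[of u])
    qed
  qed
  show thesis
  proof (rule that[OF C0])
    fix y z :: real assume y: "0 \<le> y" and z: "0 \<le> z" "z < x2"
    show "V z + V1 z * (y - z) + V2 z / 2 * (y - z)\<^sup>2 - C * \<bar>y - z\<bar> ^ 3 \<le> V y"
    proof (cases "y = z")
      case False
      define diff where "diff n = (if n = 0 then V else if n = 1 then V1 else V2)" for n :: nat
      have "\<exists>t. (if y < z then y < t \<and> t < z else z < t \<and> t < y) \<and>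
        V y = (\<Sum>m<2. diff m z / fact m * (y - z) ^ m) + diff 2 t / fact 2 * (y - z) ^ 2"
        by (rule Taylor[where a="min y z" and b="max y z"]) (use False V_DERIV V1_DERIV in \<open>auto simp: diff_def less_Suc_eq numeral_2_eq_2\<close>)
      then obtain t where t: "if y < z then y < t \<and> t < z else z < t \<and> t < y"
        "V y = V z + V1 z * (y - z) + V2 t / 2 * (y - z)\<^sup>2"
        by (auto simp: diff_def numeral_2_eq_2)
      have t0: "0 \<le> t" "\<bar>t - z\<bar> \<le> \<bar>y - z\<bar>" using t(1) y z by (auto split: if_splits)
      have "V2 z - C * \<bar>y - z\<bar> \<le> V2 z - C * \<bar>t - z\<bar>" using t0(2) C0 by (simp add: mult_left_mono)
      also have "\<dots> \<le> V2 t" by (rule V2_lower[OF z t0(1)])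
      finally have "(V2 z - C * \<bar>y - z\<bar>) * (y - z)\<^sup>2 \<le> V2 t * (y - z)\<^sup>2" by (intro mult_right_mono) auto
      moreover have "\<bar>y - z\<bar> ^ 3 = \<bar>y - z\<bar> * (y - z)\<^sup>2"
        by (simp only: power2_abs[of "y - z", symmetric] power3_eq_cube power2_eq_square mult.assoc)
      moreover have "0 \<le> C * (\<bar>y - z\<bar> * (y - z)\<^sup>2)" using C0 by simp
      ultimately show ?thesis using t(2) by (simp add: algebra_simps)
    qed (use C0 in simp)
  qed
qed

lemma V_strict_antimono: "strict_antimono_on {0..} V"
proof (rule monotone_onI)
  fix x y :: real assume xy: "x < y"
  show "V y < V x"
  proof (rule DERIV_neg_imp_decreasing[OF xy])
    fix z
    show "\<exists>d. (V has_real_derivative d) (at z) \<and> d < 0"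
      using V_DERIV[of z] V1_le[of z] c_pos by (intro exI[of _ "V1 z"]) simp
  qed
qed

lemma V_convex_on: "convex_on {0..} V"
proof (rule convex_on_realI[where f'=V1])
  show "connected {0::real..}" by simp
qed (use V_DERIV V1_mono in auto)

lemma V1_iff: "0 < - c - V1 x \<longleftrightarrow> x < x2" "- c - V1 x = 0 \<longleftrightarrow> x2 \<le> x"
  using V1_less[of x] V1_beyond[of x] by (cases "x < x2"; simp)+

lemma HJB_solution:
  assumes \<beta>: "\<beta> = (\<lambda>t. \<Sum>i=1..2. w i * exp (- \<delta> i * t))"
    and f: "f = (\<lambda>x t s. \<Sum>i=1..2. w i * exp (- \<delta> i * (t - s)) * U (\<delta> i) x)"
  shows "extended_HJB \<mu> \<sigma> M c \<beta> x2 (\<lambda>x t. 0) (\<lambda>x t. V x) f"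
proof -
  let ?e = "\<lambda>i t s. w i * exp (- \<delta> i * (t - s))"
  define ft where "ft x t s = - \<delta> 1 * ?e 1 t s * U (\<delta> 1) x - \<delta> 2 * ?e 2 t s * U (\<delta> 2) x" for x t s
  define fs where "fs x t s = \<delta> 1 * ?e 1 t s * U (\<delta> 1) x + \<delta> 2 * ?e 2 t s * U (\<delta> 2) x" for x t s
  define fx where "fx x t s = ?e 1 t s * U1 (\<delta> 1) x + ?e 2 t s * U1 (\<delta> 2) x" for x t s
  \<comment> \<open>\<open>x \<le> x2\<close> rather than \<open>x < x2\<close>: at the possible
    jump the value from the left is prescribed.\<close>
  define fxx where "fxx x t s = (if x \<le> x2 then ?e 1 t s * U2 (\<delta> 1) x + ?e 2 t s * U2 (\<delta> 2) x else 0)" for x t s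
  define D where "D = {(x::real, t::real, s::real). 0 \<le> x \<and> 0 \<le> s \<and> s \<le> t}"
  have f: "f x t s = ?e 1 t s * U (\<delta> 1) x + ?e 2 t s * U (\<delta> 2) x" for x t s
    unfolding f sum_1_2 by simp
  have dt: "((\<lambda>r. f x r s) has_real_derivative ft x t s) (at t within {s..})" for x t s
    unfolding f ft_def by (auto intro!: derivative_eq_intros simp: algebra_simps)
  have ds: "((\<lambda>r. f x t r) has_real_derivative fs x t s) (at s within {..t})" for x t s
    unfolding f fs_def by (auto intro!: derivative_eq_intros simp: algebra_simps)
  have dx: "((\<lambda>r. f r t s) has_real_derivative fx x t s) (at x within {0..})" for x t s
    unfolding f fx_def by (rule has_field_derivative_at_within) (intro DERIV_add DERIV_cmult U_DERIV \<delta>_pos)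
  have dxx: "((\<lambda>r. fx r t s) has_real_derivative fxx x t s) (at x within {0..})" if "x \<noteq> x2" for x t s
  proof (cases "x < x2")
    case True
    have "((\<lambda>r. fx r t s) has_real_derivative ?e 1 t s * U2 (\<delta> 1) x + ?e 2 t s * U2 (\<delta> 2) x) (at x within {0..})"
      unfolding fx_def by (rule has_field_derivative_at_within) (intro DERIV_add DERIV_cmult U1_DERIV \<delta>_pos True)
    then show ?thesis using True by (simp add: fxx_def)
  next
    case False
    then have "x2 < x" using that by simp
    have "((\<lambda>r. fx r t s) has_real_derivative ?e 1 t s * 0 + ?e 2 t s * 0) (at x within {0..})"
      unfolding fx_def by (rule has_field_derivative_at_within) (intro DERIV_add DERIV_cmult U1_DERIV_beyond \<open>x2 < x\<close>)
    then show ?thesis using \<open>x2 < x\<close> by (simp add: fxx_def)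
  qed
  have left: "((\<lambda>y. fxx y t s) \<longlongrightarrow> fxx x2 t s) (at_left x2)" for t s
  proof (rule Lim_transform_eventually)
    show "((\<lambda>x. ?e 1 t s * U2 (\<delta> 1) x + ?e 2 t s * U2 (\<delta> 2) x) \<longlongrightarrow> fxx x2 t s) (at_left x2)"
      unfolding U2_def fxx_def by (auto intro!: tendsto_eq_intros)
    show "\<forall>\<^sub>F x in at_left x2. ?e 1 t s * U2 (\<delta> 1) x + ?e 2 t s * U2 (\<delta> 2) x = fxx x t s"
      unfolding eventually_at_left_field fxx_def by (intro exI[of _ "x2 - 1"]) auto
  qed
  have cU: "continuous_on D (\<lambda>z. U d (fst z))" "continuous_on D (\<lambda>z. U1 d (fst z))" if "0 < d" for d
    using continuous_on_compose2[OF U_continuous[OF that] continuous_on_fst[OF continuous_on_id], of D UNIV]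
      continuous_on_compose2[OF U1_continuous[OF that] continuous_on_fst[OF continuous_on_id], of D] by auto
  have cont: "continuous_on D (\<lambda>(x, t, s). ft x t s)" "continuous_on D (\<lambda>(x, t, s). fx x t s)" "continuous_on D (\<lambda>(x, t, s). fs x t s)"
    unfolding ft_def fx_def fs_def split_beta by (intro continuous_intros cU \<delta>_pos)+
  have fsDV: "fs x t t = DV x" for x t by (simp add: fs_def DV_def)
  have W: "{(x, t) \<in> state_space. 0 < - c - V1 x} = {0..<x2} \<times> {0..}"
    unfolding V1_iff state_space_def by auto
  have P: "{(x, t) \<in> state_space. - c - V1 x = 0} = {x2..} \<times> {0..}"
    unfolding V1_iff state_space_def using x2_pos by auto
  have clW: "closure ({0..<x2} \<times> {0..}) = {0..x2} \<times> {0::real..}"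
    using x2_pos by (simp add: closure_Times)
  show ?thesis
    unfolding extended_HJB_def Let_def
  proof (rule exI[of _ "\<lambda>x t. 0"], rule exI[of _ "\<lambda>x t. V1 x"], rule exI[of _ "\<lambda>x t. V2 x"],
      rule exI[of _ ft], rule exI[of _ fx], rule exI[of _ fxx], rule exI[of _ fs],
      unfold W P clW D_def[symmetric], intro conjI)
    show "\<forall>(x, t)\<in>state_space. ((\<lambda>r. V x) has_real_derivative 0) (at t within {0..}) \<and>
      (V has_real_derivative V1 x) (at x within {0..}) \<and> (V1 has_real_derivative V2 x) (at x within {0..})"
      by (auto intro: has_field_derivative_at_within V_DERIV V1_DERIV)
    show "\<forall>(x, t, s)\<in>D. ((\<lambda>r. f x r s) has_real_derivative ft x t s) (at t within {s..}) \<and>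
      ((\<lambda>y. f y t s) has_real_derivative fx x t s) (at x within {0..}) \<and>
      ((\<lambda>q. f x t q) has_real_derivative fs x t s) (at s within {..t}) \<and>
      (x \<noteq> x2 \<longrightarrow> ((\<lambda>y. fx y t s) has_real_derivative fxx x t s) (at x within {0..})) \<and>
      ((\<lambda>y. fxx y t s) \<longlongrightarrow> fxx x2 t s) (at_left x2)"
      using dt dx ds dxx left by blast
    \<comment> \<open>The bracket is affine in \<open>u\<close> with slope \<open>1 + V1 x\<close>,
      which is nonnegative by \<open>V1_ge\<close>.\<close>
    show "\<forall>(x, t)\<in>state_space. is_arg_min (\<lambda>u. 0 + (\<mu> + u) * V1 x + 1 / 2 * \<sigma>\<^sup>2 * V2 x + u - fs x t t) (\<lambda>u. u \<in> {0..M}) 0"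
    proof (clarsimp simp: is_arg_min_def state_space_def M_pos less_imp_le not_less)
      fix x u :: real assume "0 \<le> x" "0 \<le> u"
      then have "0 \<le> u * (1 + V1 x)" using V1_ge[of x] by (intro mult_nonneg_nonneg) auto
      then show "\<mu> * V1 x \<le> (\<mu> + u) * V1 x + u" by (simp add: algebra_simps)
    qed
    \<comment> \<open>Left of \<open>x2\<close> the first entry is 0 and the second positive; from
      \<open>x2\<close> on the second is 0 and the first nonnegative.\<close>
    show "\<forall>(x, t)\<in>state_space. min (0 + (\<mu> + 0) * V1 x + 1 / 2 * \<sigma>\<^sup>2 * V2 x + 0 - fs x t t) (- c - V1 x) = 0"
    proof (clarify, unfold fsDV)
      fix x t :: real
      show "min (0 + (\<mu> + 0) * V1 x + 1 / 2 * \<sigma>\<^sup>2 * V2 x + 0 - DV x) (- c - V1 x) = 0"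
        using V_generator[of x] V_generator_eq[of x] V1_iff[of x] by (cases "x < x2") (auto simp: algebra_simps min_def)
    qed
    show "\<forall>t\<ge>0. V 0 = 0" by (simp add: V_0)
    show "\<forall>(x, t)\<in>{0..x2} \<times> {0..}. \<forall>s\<in>{0..t}. ft x t s + (\<mu> + 0) * fx x t s + 1 / 2 * \<sigma>\<^sup>2 * fxx x t s + \<beta> (t - s) * 0 = 0"
    proof clarify
      fix x t s :: real assume "x \<in> {0..x2}"
      then have x: "x \<le> x2" by simp
      have "ft x t s + (\<mu> + 0) * fx x t s + 1 / 2 * \<sigma>\<^sup>2 * fxx x t s + \<beta> (t - s) * 0 =
        ?e 1 t s * (\<sigma>\<^sup>2 / 2 * U2 (\<delta> 1) x + \<mu> * U1 (\<delta> 1) x - \<delta> 1 * U (\<delta> 1) x) +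
        ?e 2 t s * (\<sigma>\<^sup>2 / 2 * U2 (\<delta> 2) x + \<mu> * U1 (\<delta> 2) x - \<delta> 2 * U (\<delta> 2) x)"
        using x by (simp add: ft_def fx_def fxx_def algebra_simps)
      then show "ft x t s + (\<mu> + 0) * fx x t s + 1 / 2 * \<sigma>\<^sup>2 * fxx x t s + \<beta> (t - s) * 0 = 0"
        using U_generator[OF \<delta>_pos(1) x] U_generator[OF \<delta>_pos(2) x] by simp
    qed
    show "\<forall>(x, t)\<in>{x2..} \<times> {0..}. \<forall>s\<in>{0..t}. - \<beta> (t - s) * c - fx x t s = 0"
      unfolding \<beta> sum_1_2 fx_def by (auto simp: U1_def algebra_simps)
    show "\<forall>t\<ge>0. \<forall>s\<in>{0..t}. f 0 t s = 0" by (simp add: f U_0)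
  qed (rule cont)+
qed

end

section \<open>Expected payout over the whole lifetime\<close>

context effort_dividend
begin

lemma lifetime_integral_mono:
  assumes g: "dividend_path t g" and \<tau>: "ereal t \<le> \<tau>" and d: "0 \<le> d" and le: "N \<le> N'"
  shows "(LINT r:{t<..t + real N}|stieltjes t g. exp (- d * (r - t)) * indicator {r. ereal r \<le> \<tau>} r)
    \<le> (LINT r:{t<..t + real N'}|stieltjes t g. exp (- d * (r - t)) * indicator {r. ereal r \<le> \<tau>} r)"
  unfolding set_lebesgue_integral_def
proof (rule integral_mono)
  have "integrable (stieltjes t g) (\<lambda>r. indicator {t<..t + real K} r *\<^sub>R (exp (- d * (r - t)) * indicator {r. ereal r \<le> \<tau>} r) :: real)" for K
  proof (rule Bochner_Integration.integrable_bound)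
    show "integrable (stieltjes t g) (indicator {t<..t + real K} :: real \<Rightarrow> real)"
      using emeasure_stieltjes_Ioc[OF g, of t "t + real K"] by (intro integrable_real_indicator) auto
    show "AE r in stieltjes t g. norm (indicator {t<..t + real K} r *\<^sub>R (exp (- d * (r - t)) * indicator {r. ereal r \<le> \<tau>} r) :: real)
      \<le> norm (indicator {t<..t + real K} r :: real)"
      using d by (intro AE_I2) (auto simp: indicator_def)
  qed measurable
  then show "integrable (stieltjes t g) (\<lambda>r. indicator {t<..t + real N} r *\<^sub>R (exp (- d * (r - t)) * indicator {r. ereal r \<le> \<tau>} r) :: real)"
    "integrable (stieltjes t g) (\<lambda>r. indicator {t<..t + real N'} r *\<^sub>R (exp (- d * (r - t)) * indicator {r. ereal r \<le> \<tau>} r) :: real)" by blast+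
qed (use le in \<open>auto simp: indicator_def\<close>)

text \<open>Lets the horizon in \<open>barrier_dividends_until\<close> tend to infinity, where the
  error decays like \<open>exp (- d * N)\<close>; \<open>k\<close> is \<open>g'\<close> at the
  barrier. The term \<open>max 0 (y - b)\<close> is the initial lump payment, which the integrals
  over \<open>{T<..T + N}\<close> omit. Uniqueness replaces the explicit solution by an arbitrary
  one.\<close>

lemma expected_barrier_dividends:
  assumes b: "0 < b" and T: "0 \<le> T" and y: "y \<in> borel_measurable (F T)" "AE \<omega> in \<Omega>. 0 \<le> y \<omega>"
    and pq: "0 < p" "0 < q" "\<sigma>\<^sup>2 * p\<^sup>2 / 2 + \<mu> * p = d" "\<sigma>\<^sup>2 * q\<^sup>2 / 2 - \<mu> * q = d" and d: "0 < d"
    and \<mu>: "0 \<le> \<mu>" and \<sigma>: "0 \<le> \<sigma>"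
    and g: "g = (\<lambda>x. exp (p * x) - exp (- q * x))" and k: "k = p * exp (p * b) + q * exp (- q * b)"
    and R: "reflected_solution (barrier_strip b) y T (feedback (\<lambda>x t. 0) X) X \<xi>"
  shows "(\<integral>\<^sup>+\<omega>. (\<integral>\<^sup>+r\<in>lifetime T X \<omega>. ennreal (exp (- d * (r - T))) \<partial>stieltjes T (\<lambda>s. \<xi> s \<omega>)) \<partial>\<Omega>)
    = (\<integral>\<^sup>+\<omega>. ennreal (g (min (y \<omega>) b) / k + max 0 (y \<omega> - b)) \<partial>\<Omega>)"
proof -
  let ?X = "barrier_surplus b y T" and ?\<xi> = "barrier_dividend b y T"
  define I where "I N = (\<lambda>\<omega>. LINT r:{T<..T + real N}|stieltjes T (\<lambda>r. ?\<xi> r \<omega>).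
      exp (- d * (r - T)) * indicator {r. ereal r \<le> ruin_time T ?X \<omega>} r)" for N
  note I = barrier_dividends_until[OF b T y pq d \<mu> \<sigma> g refl I_def, folded k]
  have kpos: "0 < k" unfolding k using pq by (intro add_pos_pos mult_pos_pos) auto
  have ym: "y \<in> borel_measurable \<Omega>" using F_measurable[OF T y(1)] .
  have gc: "continuous_on UNIV g" unfolding g by (intro continuous_intros)
  have gm: "g \<in> borel_measurable borel" by (rule borel_measurable_continuous_onI[OF gc])
  have g_mono: "g x \<le> g z" if "x \<le> z" for x z
    unfolding g using that pq by (intro diff_mono) auto
  have g0: "g 0 = 0" by (simp add: g)
  have D: "AE \<omega> in \<Omega>. dividend_path T (\<lambda>r. \<xi> r \<omega>)"
    using R by (auto simp: reflected_solution_def dividend_process_def)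
  have dm: "(\<lambda>r. exp (- d * (r - T))) \<in> borel_measurable borel"
    by (intro borel_measurable_continuous_onI continuous_intros)
  have inner: "AE \<omega> in \<Omega>. (\<integral>\<^sup>+r\<in>lifetime T X \<omega>. ennreal (exp (- d * (r - T))) \<partial>stieltjes T (\<lambda>s. \<xi> s \<omega>))
    = ennreal (max 0 (y \<omega> - b)) + (SUP N. ennreal (I N \<omega>))"
    using reflected_solution_unique[OF b T R] D B_continuous
  proof eventually_elim
    case (elim \<omega>)
    have Z: "continuous_on {T..} (\<lambda>r. free_surplus y T r \<omega>)" by (rule free_surplus_continuous[OF elim(3) T])
    have \<xi>p: "dividend_path T (\<lambda>r. ?\<xi> r \<omega>)" unfolding barrier_dividend_def by (rule excess_dividend_path[OF Z])
    have "(\<integral>\<^sup>+r\<in>lifetime T X \<omega>. ennreal (exp (- d * (r - T))) \<partial>stieltjes T (\<lambda>s. \<xi> s \<omega>))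
      = (\<integral>\<^sup>+r\<in>lifetime T X \<omega>. ennreal (exp (- d * (r - T))) \<partial>stieltjes T (\<lambda>s. ?\<xi> s \<omega>))"
      unfolding lifetime_def
      by (rule nn_integral_stieltjes_cong_until[OF elim(2) \<xi>p]) (use elim(1) dm in \<open>auto simp: lifetime_def\<close>)
    also have "\<dots> = ennreal (exp (- d * (T - T)) * ?\<xi> T \<omega>) + (SUP N. ennreal (I N \<omega>))"
      unfolding lifetime_def I_def elim(1)[THEN conjunct1]
      by (rule stieltjes_integral_lifetime[OF \<xi>p ruin_time_ge dm, where C=1]) (use d in auto)
    also have "?\<xi> T \<omega> = max 0 (y \<omega> - b)" by (simp add: barrier_dividend_def excess_at_start free_surplus_def)
    finally show ?case by simp
  qed
  have Im: "(\<lambda>\<omega>. ennreal (I N \<omega>)) \<in> borel_measurable \<Omega>" for N using I(1)[of N] by simp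
  have mm: "(\<lambda>\<omega>. ennreal (max 0 (y \<omega> - b))) \<in> borel_measurable \<Omega>" using ym by measurable
  have Inn: "0 \<le> I N \<omega>" for N \<omega>
    unfolding I_def set_lebesgue_integral_def by (intro Bochner_Integration.integral_nonneg) (auto simp: indicator_def)
  have incI: "AE \<omega> in \<Omega>. \<forall>N N'. N \<le> N' \<longrightarrow> I N \<omega> \<le> I N' \<omega>"
    using B_continuous
  proof eventually_elim
    case (elim \<omega>)
    have g: "dividend_path T (\<lambda>r. ?\<xi> r \<omega>)"
      unfolding barrier_dividend_def by (rule excess_dividend_path[OF free_surplus_continuous[OF elim T]])
    show ?case unfolding I_def
      by (intro allI impI) (rule lifetime_integral_mono[OF g ruin_time_ge less_imp_le[OF d]])
  qed
  have Egi: "integrable \<Omega> (\<lambda>\<omega>. g (min (y \<omega>) b))"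
  proof (rule integrable_const_bound[of _ "g b"])
    show "AE \<omega> in \<Omega>. norm (g (min (y \<omega>) b)) \<le> g b"
      using y(2)
    proof eventually_elim
      case (elim \<omega>)
      then have "g 0 \<le> g (min (y \<omega>) b)" "g (min (y \<omega>) b) \<le> g b" using b by (auto intro!: g_mono)
      then show ?case using g0 by simp
    qed
    show "(\<lambda>\<omega>. g (min (y \<omega>) b)) \<in> borel_measurable \<Omega>" using ym gm by measurable
  qed
  have lim: "(\<lambda>N. expectation (I N)) \<longlonglongrightarrow> expectation (\<lambda>\<omega>. g (min (y \<omega>) b)) / k"
  proof -
    have "(\<lambda>N. k * expectation (I N) - expectation (\<lambda>\<omega>. g (min (y \<omega>) b))) \<longlonglongrightarrow> 0"
    proof (rule Lim_null_comparison)
      show "\<forall>\<^sub>F N in sequentially. norm (k * expectation (I N) - expectation (\<lambda>\<omega>. g (min (y \<omega>) b))) \<le> exp (- d) ^ N * g b"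
        using I(2) by (intro always_eventually allI) (simp add: exp_of_nat_mult[symmetric] mult.commute)
      have "(\<lambda>N. exp (- d) ^ N) \<longlonglongrightarrow> 0" using d by (intro LIMSEQ_power_zero) auto
      from tendsto_mult_left_zero[OF this] show "(\<lambda>N. exp (- d) ^ N * g b) \<longlonglongrightarrow> 0" .
    qed
    from tendsto_add[OF this tendsto_const[of "expectation (\<lambda>\<omega>. g (min (y \<omega>) b))"]]
    have "(\<lambda>N. k * expectation (I N)) \<longlonglongrightarrow> expectation (\<lambda>\<omega>. g (min (y \<omega>) b))" by simp
    from tendsto_divide[OF this tendsto_const, of k] show ?thesis using kpos by simp
  qed
  have nnI: "(\<integral>\<^sup>+\<omega>. ennreal (I N \<omega>) \<partial>\<Omega>) = ennreal (expectation (I N))" for N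
    by (rule nn_integral_eq_integral[OF I(1)]) (use Inn in auto)
  have EI_mono: "incseq (\<lambda>N. ennreal (expectation (I N)))"
  proof (rule incseq_SucI)
    fix N
    have "expectation (I N) \<le> expectation (I (Suc N))"
      by (rule integral_mono_AE[OF I(1) I(1)]) (use incI in \<open>auto elim!: eventually_mono\<close>)
    then show "ennreal (expectation (I N)) \<le> ennreal (expectation (I (Suc N)))" by (rule ennreal_leI)
  qed
  have "(\<integral>\<^sup>+\<omega>. (SUP N. ennreal (I N \<omega>)) \<partial>\<Omega>) = (SUP N. \<integral>\<^sup>+\<omega>. ennreal (I N \<omega>) \<partial>\<Omega>)"
    by (rule nn_integral_monotone_convergence_SUP_AE[OF _ Im]) (use incI in \<open>auto elim!: eventually_mono intro: ennreal_leI\<close>)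
  also have "\<dots> = (SUP N. ennreal (expectation (I N)))" unfolding nnI ..
  also have "\<dots> = ennreal (expectation (\<lambda>\<omega>. g (min (y \<omega>) b)) / k)"
    by (rule LIMSEQ_unique[OF LIMSEQ_SUP[OF EI_mono] tendsto_ennrealI[OF lim]])
  also have "\<dots> = ennreal (expectation (\<lambda>\<omega>. g (min (y \<omega>) b) / k))" by simp
  also have "\<dots> = (\<integral>\<^sup>+\<omega>. ennreal (g (min (y \<omega>) b) / k) \<partial>\<Omega>)"
  proof (rule nn_integral_eq_integral[symmetric])
    show "AE \<omega> in \<Omega>. 0 \<le> g (min (y \<omega>) b) / k"
      using y(2)
    proof eventually_elim
      case (elim \<omega>)
      then show ?case using g_mono[of 0 "min (y \<omega>) b"] g0 b kpos by simp
    qed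
  qed (use Egi in simp)
  finally have S: "(\<integral>\<^sup>+\<omega>. (SUP N. ennreal (I N \<omega>)) \<partial>\<Omega>) = (\<integral>\<^sup>+\<omega>. ennreal (g (min (y \<omega>) b) / k) \<partial>\<Omega>)" .
  have "(\<integral>\<^sup>+\<omega>. (\<integral>\<^sup>+r\<in>lifetime T X \<omega>. ennreal (exp (- d * (r - T))) \<partial>stieltjes T (\<lambda>s. \<xi> s \<omega>)) \<partial>\<Omega>)
    = (\<integral>\<^sup>+\<omega>. ennreal (max 0 (y \<omega> - b)) + (SUP N. ennreal (I N \<omega>)) \<partial>\<Omega>)"
    by (rule nn_integral_cong_AE[OF inner])
  also have "\<dots> = (\<integral>\<^sup>+\<omega>. ennreal (max 0 (y \<omega> - b)) \<partial>\<Omega>) + (\<integral>\<^sup>+\<omega>. ennreal (g (min (y \<omega>) b) / k) \<partial>\<Omega>)"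
    using Im mm by (subst nn_integral_add) (auto simp: S intro: borel_measurable_SUP)
  also have "\<dots> = (\<integral>\<^sup>+\<omega>. ennreal (max 0 (y \<omega> - b)) + ennreal (g (min (y \<omega>) b) / k) \<partial>\<Omega>)"
  proof (rule nn_integral_add[symmetric, OF mm])
    have "(\<lambda>\<omega>. g (min (y \<omega>) b) / k) \<in> borel_measurable \<Omega>" using Egi by simp
    then show "(\<lambda>\<omega>. ennreal (g (min (y \<omega>) b) / k)) \<in> borel_measurable \<Omega>" by measurable
  qed
  also have "\<dots> = (\<integral>\<^sup>+\<omega>. ennreal (g (min (y \<omega>) b) / k + max 0 (y \<omega> - b)) \<partial>\<Omega>)"
  proof (rule nn_integral_cong_AE)
    show "AE \<omega> in \<Omega>. ennreal (max 0 (y \<omega> - b)) + ennreal (g (min (y \<omega>) b) / k) = ennreal (g (min (y \<omega>) b) / k + max 0 (y \<omega> - b))"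
      using y(2)
    proof eventually_elim
      case (elim \<omega>)
      then have "0 \<le> g (min (y \<omega>) b) / k" using g_mono[of 0 "min (y \<omega>) b"] g0 b kpos by simp
      then show ?case by (subst ennreal_plus[symmetric]) (auto simp: add.commute)
    qed
  qed
  finally show ?thesis .
qed

end

text \<open>The two sides differ by \<open>3 * (u + v) * (u - v)^2\<close>.\<close>

lemma mult_cube_bound:
  fixes u v :: real assumes "0 \<le> u" "0 \<le> v" shows "(u + v) ^ 3 \<le> 4 * (u ^ 3 + v ^ 3)"
proof -
  have "0 \<le> 3 * (u + v) * (u - v)\<^sup>2" using assms by simp
  then show ?thesis by (simp add: power2_eq_square power3_eq_cube algebra_simps)
qed

section \<open>A pathwise lower bound for the value after a short time\<close>

context barrier_model
begin

text \<open>Linear growth, so that integrability of the restart surplus carries over to its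
  value.\<close>

lemma U_bound: assumes d: "0 < d" and z: "0 \<le> z" shows "- U d z \<le> - U d x2 + c * z"
proof (cases "z \<le> x2")
  case True
  then show ?thesis using U_antimono[OF d True] c_pos z mult_nonneg_nonneg[of c z] by linarith
next
  case False
  then have "- U d z = - U d x2 + c * (z - x2)" using U_beyond[of z d] U_beyond[of x2 d] by simp
  moreover have "c * (z - x2) \<le> c * z" using c_pos x2_pos by (intro mult_left_mono) auto
  ultimately show ?thesis by linarith
qed

lemma V1_measurable: "V1 \<in> borel_measurable borel"
  using DERIV_isCont[OF V1_DERIV] by (intro borel_measurable_continuous_onI continuous_at_imp_continuous_on) auto

lemma V2_measurable: "V2 \<in> borel_measurable borel"
proof -
  have "(\<lambda>x. w 1 * U2 (\<delta> 1) x + w 2 * U2 (\<delta> 2) x) \<in> borel_measurable borel"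
    unfolding U2_def by (intro borel_measurable_continuous_onI continuous_intros)
  then show ?thesis unfolding V2_def[abs_def] by measurable
qed

lemma V2_bounded: "\<exists>K\<ge>0. \<forall>z\<ge>0. V2 z \<le> K"
proof (intro exI conjI allI impI)
  show "0 \<le> V2 0" by (rule V2_nonneg)
  fix z :: real assume z: "0 \<le> z"
  show "V2 z \<le> V2 0"
  proof (cases "z < x2")
    case True
    have "w 1 * U2 (\<delta> 1) z + w 2 * U2 (\<delta> 2) z \<le> w 1 * U2 (\<delta> 1) 0 + w 2 * U2 (\<delta> 2) 0"
    proof (rule DERIV_nonpos_imp_nonincreasing[OF z])
      fix r
      show "\<exists>d. ((\<lambda>x. w 1 * U2 (\<delta> 1) x + w 2 * U2 (\<delta> 2) x) has_real_derivative d) (at r) \<and> d \<le> 0"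
        using V3_DERIV[of r] V3_neg[of r] by (intro exI[of _ "V3 r"]) simp
    qed
    then show ?thesis using True x2_pos by (simp add: V2_def)
  next
    case False
    then have "V2 z = 0" by (simp add: V2_def)
    then show ?thesis using V2_nonneg[of 0] by simp
  qed
qed

text \<open>\<open>z\<close> and \<open>Y\<close> stand for the surplus after the payment at
  \<open>t\<close> and the restart surplus, \<open>b\<close> for the full Brownian increment,
  \<open>A\<close> for the accumulated drift, \<open>\<Delta>\<close> for the payments in between.
  As \<open>b^2\<close> has mean \<open>h\<close> and \<open>b^4\<close> has mean
  \<open>3 * h^2\<close>, the last remainder is of order \<open>h * sqrt h\<close>. Off the good
  event the quadratic term is kept in form and taken back by \<open>C * b^2\<close>.\<close>

definition increment_bound :: "real \<Rightarrow> real \<Rightarrow> bool" where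
  "increment_bound C K \<longleftrightarrow> 0 \<le> C \<and> (\<forall>z Y b \<Delta> A h good. 0 < z \<longrightarrow> 0 \<le> Y \<longrightarrow> 0 \<le> \<Delta> \<longrightarrow> 0 < h \<longrightarrow> h \<le> 1 \<longrightarrow>
     0 \<le> A \<longrightarrow> A \<le> (\<mu> + M) * h \<longrightarrow> (good \<longrightarrow> Y = z + A + \<sigma> * b - \<Delta> \<and> \<Delta> \<le> K * h) \<longrightarrow>
     V z + V1 z * (Y - z) + \<sigma>\<^sup>2 / 2 * V2 z * b\<^sup>2 - (if good \<or> x2 \<le> z then 0 else C * b\<^sup>2)
       - C * (h * sqrt h + sqrt h * b\<^sup>2 + b ^ 4 / sqrt h) \<le> V Y)"

lemma increment_boundD:
  assumes "increment_bound C K"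
  shows "0 \<le> C" and "0 < z \<Longrightarrow> 0 \<le> y \<Longrightarrow> 0 \<le> \<Delta> \<Longrightarrow> 0 < h \<Longrightarrow> h \<le> 1 \<Longrightarrow> 0 \<le> A \<Longrightarrow> A \<le> (\<mu> + M) * h \<Longrightarrow>
      (good \<Longrightarrow> y = z + A + \<sigma> * b - \<Delta> \<and> \<Delta> \<le> K * h) \<Longrightarrow>
      V z + V1 z * (y - z) + \<sigma>\<^sup>2 / 2 * V2 z * b\<^sup>2 - (if good \<or> x2 \<le> z then 0 else C * b\<^sup>2)
        - C * (h * sqrt h + sqrt h * b\<^sup>2 + b ^ 4 / sqrt h) \<le> V y"
  using assms unfolding increment_bound_def by blast+

text \<open>The second order expansion is only used on the good event; elsewhere convexity suffices.\<close>

lemma increment_bound_exists: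
  assumes K: "0 \<le> K"
  obtains C where "increment_bound C K"
proof -
  obtain C1 where C1: "0 \<le> C1" "\<And>y z. 0 \<le> y \<Longrightarrow> 0 \<le> z \<Longrightarrow> z < x2 \<Longrightarrow> V z + V1 z * (y - z) + V2 z / 2 * (y - z)\<^sup>2 - C1 * \<bar>y - z\<bar> ^ 3 \<le> V y"
    using V_Taylor by blast
  obtain C2 where C2: "0 \<le> C2" "\<And>z. 0 \<le> z \<Longrightarrow> V2 z \<le> C2" using V2_bounded by blast
  define k where "k = \<mu> + M + K"
  have k0: "0 \<le> k" using \<mu>_pos M_pos K by (simp add: k_def)
  \<comment> \<open>The three summands pay for the quadratic term where only convexity is used, for
    the cross term of Brownian increment and drift, and for the cubic remainder of the
    expansion.\<close>
  define C where "C = \<sigma>\<^sup>2 * C2 + C2 * \<sigma> * k + 4 * C1 * (\<sigma> ^ 3 + k ^ 3)"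
  have parts: "0 \<le> \<sigma>\<^sup>2 * C2" "0 \<le> C2 * \<sigma> * k" "0 \<le> 4 * C1 * \<sigma> ^ 3" "0 \<le> 4 * C1 * k ^ 3"
    using C1(1) C2(1) \<sigma>_pos k0 by auto
  have C0: "0 \<le> C" unfolding C_def using parts by (simp add: distrib_left)
  have Cmult: "C * R = \<sigma>\<^sup>2 * C2 * R + C2 * (\<sigma> * k * R) + C1 * (4 * (\<sigma> ^ 3 + k ^ 3) * R)" for R
    by (simp add: C_def algebra_simps)
  show thesis
  proof (rule that, unfold increment_bound_def, intro conjI C0 allI impI)
    fix z Y b \<Delta> A h :: real and good
    assume z: "0 < z" and Y: "0 \<le> Y" and \<Delta>: "0 \<le> \<Delta>" and h: "0 < h" "h \<le> 1" and A: "0 \<le> A" "A \<le> (\<mu> + M) * h"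
      and "good \<longrightarrow> Y = z + A + \<sigma> * b - \<Delta> \<and> \<Delta> \<le> K * h"
    from this(8) have good: "good \<Longrightarrow> Y = z + A + \<sigma> * b - \<Delta> \<and> \<Delta> \<le> K * h" by blast
    let ?r = "h * sqrt h + sqrt h * b\<^sup>2 + b ^ 4 / sqrt h"
    have sh: "0 < sqrt h" using h by simp
    have r0: "0 \<le> h * sqrt h" "0 \<le> sqrt h * b\<^sup>2" "0 \<le> b ^ 4 / sqrt h" using h by auto
    have r: "0 \<le> ?r" using r0 by linarith
    have Cr: "0 \<le> C * ?r" using C0 r by simp
    have V2: "0 \<le> V2 z" "V2 z \<le> C2" using V2_nonneg C2 z by auto
    show "V z + V1 z * (Y - z) + \<sigma>\<^sup>2 / 2 * V2 z * b\<^sup>2 - (if good \<or> x2 \<le> z then 0 else C * b\<^sup>2) - C * ?r \<le> V Y"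
    proof (cases "x2 \<le> z")
      case True
      \<comment> \<open>From \<open>x2\<close> on the second derivative is 0, so the tangent line
        already contains the whole expansion.\<close>
      then show ?thesis using V_convex[of z Y] Cr by (simp add: V2_def)
    next
      case False
      show ?thesis
      proof (cases good)
        case False
        have "\<sigma>\<^sup>2 / 2 * V2 z \<le> \<sigma>\<^sup>2 * C2" using V2 C2(1) by (intro mult_mono) auto
        then have "\<sigma>\<^sup>2 / 2 * V2 z \<le> C" unfolding C_def using parts by (simp add: distrib_left)
        then have "\<sigma>\<^sup>2 / 2 * V2 z * b\<^sup>2 \<le> C * b\<^sup>2" by (rule mult_right_mono) simp
        then show ?thesis using V_convex[of z Y] Cr False \<open>\<not> x2 \<le> z\<close> by simp
      next
        case True
        define e where "e = A - \<Delta>"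
        have Yz: "Y - z = \<sigma> * b + e" using good[OF True] by (simp add: e_def)
        have "K * h \<ge> 0" "(\<mu> + M) * h \<ge> 0" using K h A by auto
        then have e: "\<bar>e\<bar> \<le> k * h" using good[OF True] A \<Delta> by (auto simp: e_def k_def abs_le_iff algebra_simps)
        \<comment> \<open>The odd absolute moment is traded for even ones with explicit
          expectations; the weight \<open>sqrt h\<close> is the typical size of \<open>b\<close> and
          keeps the order \<open>h * sqrt h\<close>.\<close>
        have cube: "\<bar>b\<bar> ^ 3 \<le> sqrt h * b\<^sup>2 + b ^ 4 / sqrt h"
        proof -
          have "0 \<le> (\<bar>b\<bar> - sqrt h)\<^sup>2 * b\<^sup>2" by simp
          also have "(\<bar>b\<bar> - sqrt h)\<^sup>2 * b\<^sup>2 = b ^ 4 - 2 * (\<bar>b\<bar> ^ 3 * sqrt h) + h * b\<^sup>2"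
          proof -
            have "b\<^sup>2 = \<bar>b\<bar>\<^sup>2" "b ^ 4 = \<bar>b\<bar> ^ 4" by simp_all
            moreover have "(sqrt h)\<^sup>2 = h" using h by simp
            ultimately show ?thesis by (simp add: power2_eq_square power3_eq_cube power4_eq_xxxx algebra_simps del: abs_mult_self_eq real_sqrt_mult_self)
          qed
          finally have "2 * (\<bar>b\<bar> ^ 3 * sqrt h) \<le> b ^ 4 + h * b\<^sup>2" by linarith
          moreover have "0 \<le> \<bar>b\<bar> ^ 3 * sqrt h" using h by simp
          ultimately have "\<bar>b\<bar> ^ 3 * sqrt h \<le> b ^ 4 + h * b\<^sup>2" by linarith
          then have "\<bar>b\<bar> ^ 3 \<le> (b ^ 4 + h * b\<^sup>2) / sqrt h" using sh by (simp add: pos_le_divide_eq)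
          also have "\<dots> = sqrt h * b\<^sup>2 + b ^ 4 / sqrt h"
          proof -
            have "(b ^ 4 + h * b\<^sup>2) / sqrt h = b ^ 4 / sqrt h + (h / sqrt h) * b\<^sup>2" by (simp add: add_divide_distrib)
            then show ?thesis using h by (simp only: real_div_sqrt less_imp_le add.commute)
          qed
          finally show ?thesis .
        qed
        have lin: "\<bar>b\<bar> * h \<le> h * sqrt h + sqrt h * b\<^sup>2"
        proof -
          have "0 \<le> (\<bar>b\<bar> - sqrt h)\<^sup>2" by simp
          then have "2 * (\<bar>b\<bar> * sqrt h) \<le> h + b\<^sup>2" using h by (simp add: power2_diff)
          moreover have "0 \<le> \<bar>b\<bar> * sqrt h" using h by simp
          ultimately have "\<bar>b\<bar> * sqrt h \<le> h + b\<^sup>2" by linarith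
          then have "sqrt h * (\<bar>b\<bar> * sqrt h) \<le> sqrt h * (h + b\<^sup>2)" using h by (intro mult_left_mono) auto
          moreover have "sqrt h * (\<bar>b\<bar> * sqrt h) = \<bar>b\<bar> * h" using h by simp
          ultimately show ?thesis using h by (simp add: algebra_simps)
        qed
        have h3: "h ^ 3 \<le> h * sqrt h"
        proof -
          have "h \<le> sqrt h" using h by (simp add: real_le_rsqrt power2_eq_square mult_left_le)
          moreover have "h ^ 3 \<le> h * h" using h by (simp add: power3_eq_cube mult_left_le mult_le_one)
          ultimately show ?thesis using h by (meson mult_left_mono order_trans less_imp_le)
        qed
        have sq: "\<sigma>\<^sup>2 * b\<^sup>2 - 2 * \<sigma> * k * (h * sqrt h + sqrt h * b\<^sup>2) \<le> (Y - z)\<^sup>2"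
        proof -
          have "(Y - z)\<^sup>2 = \<sigma>\<^sup>2 * b\<^sup>2 + 2 * \<sigma> * (b * e) + e\<^sup>2"
            unfolding Yz by (simp add: power2_eq_square algebra_simps)
          moreover have "- (k * (\<bar>b\<bar> * h)) \<le> b * e"
          proof -
            have "\<bar>b * e\<bar> \<le> \<bar>b\<bar> * (k * h)" unfolding abs_mult using e by (intro mult_left_mono) auto
            then show ?thesis by (simp add: abs_le_iff algebra_simps)
          qed
          moreover have "k * (\<bar>b\<bar> * h) \<le> k * (h * sqrt h + sqrt h * b\<^sup>2)" using lin k0 by (rule mult_left_mono)
          ultimately have "- (k * (h * sqrt h + sqrt h * b\<^sup>2)) \<le> b * e" by linarith
          then have "2 * \<sigma> * - (k * (h * sqrt h + sqrt h * b\<^sup>2)) \<le> 2 * \<sigma> * (b * e)" using \<sigma>_pos by (intro mult_left_mono) auto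
          moreover have "0 \<le> e\<^sup>2" by simp
          ultimately show ?thesis using \<open>(Y - z)\<^sup>2 = _\<close> unfolding mult.assoc mult_minus_right by linarith
        qed
        have cub: "\<bar>Y - z\<bar> ^ 3 \<le> 4 * (\<sigma> ^ 3 + k ^ 3) * ?r"
        proof -
          have "\<bar>Y - z\<bar> \<le> \<sigma> * \<bar>b\<bar> + k * h" unfolding Yz using e abs_triangle_ineq[of "\<sigma> * b" e] \<sigma>_pos by (simp add: abs_mult)
          then have "\<bar>Y - z\<bar> ^ 3 \<le> (\<sigma> * \<bar>b\<bar> + k * h) ^ 3" by (intro power_mono) auto
          also have "\<dots> \<le> 4 * ((\<sigma> * \<bar>b\<bar>) ^ 3 + (k * h) ^ 3)" using \<sigma>_pos k0 h by (intro mult_cube_bound) auto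
          also have "\<dots> = 4 * (\<sigma> ^ 3 * \<bar>b\<bar> ^ 3 + k ^ 3 * h ^ 3)" by (simp add: power_mult_distrib)
          also have "\<dots> \<le> 4 * (\<sigma> ^ 3 * ?r + k ^ 3 * ?r)"
            using cube h3 r0 \<sigma>_pos k0 by (intro mult_left_mono add_mono) auto
          finally show ?thesis by (simp add: algebra_simps)
        qed
        have "V z + V1 z * (Y - z) + V2 z / 2 * (Y - z)\<^sup>2 - C1 * \<bar>Y - z\<bar> ^ 3 \<le> V Y"
          using C1(2)[of Y z] Y z \<open>\<not> x2 \<le> z\<close> by simp
        moreover have "V2 z / 2 * (\<sigma>\<^sup>2 * b\<^sup>2 - 2 * \<sigma> * k * (h * sqrt h + sqrt h * b\<^sup>2)) \<le> V2 z / 2 * (Y - z)\<^sup>2"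
          using sq V2 by (intro mult_left_mono) auto
        moreover have "V2 z * (\<sigma> * k * (h * sqrt h + sqrt h * b\<^sup>2)) \<le> C2 * (\<sigma> * k * ?r)"
          using V2 C2(1) \<sigma>_pos k0 r0 by (intro mult_mono) (auto intro: mult_nonneg_nonneg add_nonneg_nonneg)
        moreover have "C1 * \<bar>Y - z\<bar> ^ 3 \<le> C1 * (4 * (\<sigma> ^ 3 + k ^ 3) * ?r)" using cub C1(1) by (rule mult_left_mono)
        moreover have "C * ?r = \<sigma>\<^sup>2 * C2 * ?r + C2 * (\<sigma> * k * ?r) + C1 * (4 * (\<sigma> ^ 3 + k ^ 3) * ?r)"
          by (rule Cmult)
        moreover have "0 \<le> \<sigma>\<^sup>2 * C2 * ?r" using parts r by simp
        moreover have "V2 z / 2 * (\<sigma>\<^sup>2 * b\<^sup>2 - 2 * \<sigma> * k * (h * sqrt h + sqrt h * b\<^sup>2))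
          = \<sigma>\<^sup>2 / 2 * V2 z * b\<^sup>2 - V2 z * (\<sigma> * k * (h * sqrt h + sqrt h * b\<^sup>2))" by (simp add: algebra_simps)
        ultimately show ?thesis using True by simp
      qed
    qed
  qed (rule C0)
qed

text \<open>Identifies the payout formula of \<open>expected_barrier_dividends\<close>, payments at
  the barrier plus the lump payment, with the closed form of the candidate.\<close>

lemma U_payout:
  assumes d: "0 < d" and x: "0 \<le> x"
  shows "(exp (p d * min x x2) - exp (- q d * min x x2)) / (p d * exp (p d * x2) + q d * exp (- q d * x2)) + max 0 (x - x2)
    = - U d x / c"
proof -
  define s where "s = p d * exp (p d * x2) + q d * exp (- q d * x2)"
  have s: "0 < s" unfolding s_def using pq_pos[OF d] by (intro add_pos_pos mult_pos_pos) auto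
  have a: "a d = c / s" by (simp add: a_def slope_term_def s_def)
  show ?thesis
  proof (cases "x \<le> x2")
    case True
    then show ?thesis using s c_pos unfolding s_def[symmetric] U_below[OF True] a by (simp add: field_simps)
  next
    case False
    then show ?thesis using s c_pos unfolding s_def[symmetric] U_beyond[of x2 x, OF less_imp_le] a
      using U_beyond[of x d] by (simp add: a min_def field_simps)
  qed
qed

end

lemma (in prob_space) expectation_enn2real:
  assumes K: "K \<in> borel_measurable M" and fin: "(\<integral>\<^sup>+\<omega>. K \<omega> \<partial>M) < \<infinity>"
  shows "integrable M (\<lambda>\<omega>. enn2real (K \<omega>))" "expectation (\<lambda>\<omega>. enn2real (K \<omega>)) = enn2real (\<integral>\<^sup>+\<omega>. K \<omega> \<partial>M)"
proof -
  have "AE \<omega> in M. K \<omega> \<noteq> \<infinity>" using fin by (intro nn_integral_PInf_AE K) auto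
  then have eq: "(\<integral>\<^sup>+\<omega>. ennreal (enn2real (K \<omega>)) \<partial>M) = (\<integral>\<^sup>+\<omega>. K \<omega> \<partial>M)"
    by (intro nn_integral_cong_AE) (auto simp: ennreal_enn2real_if)
  show "integrable M (\<lambda>\<omega>. enn2real (K \<omega>))"
    by (rule integrableI_nonneg) (use K fin eq in auto)
  show "expectation (\<lambda>\<omega>. enn2real (K \<omega>)) = enn2real (\<integral>\<^sup>+\<omega>. K \<omega> \<partial>M)"
    using K by (subst integral_eq_nn_integral) (auto simp: eq)
qed

text \<open>Holds without integrability: a divergent integral is 0 on the left by convention, and
  \<open>enn2real\<close> sends infinity to 0 on the right. So payoffs can be treated as extended
  nonnegative integrals until finiteness is known.\<close>

lemma LINT_eq_enn2real:
  assumes "sets M = sets borel" "L \<in> sets borel" "\<phi> \<in> borel_measurable borel" "\<And>r. 0 \<le> \<phi> r"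
  shows "(LINT r:L|M. \<phi> r :: real) = enn2real (\<integral>\<^sup>+r\<in>L. ennreal (\<phi> r) \<partial>M)"
proof -
  have "(\<lambda>r. indicator L r *\<^sub>R \<phi> r) \<in> borel_measurable borel" using assms by measurable
  then have "(\<lambda>r. indicator L r *\<^sub>R \<phi> r) \<in> borel_measurable M" by (simp add: measurable_cong_sets[OF assms(1) refl])
  then have "(LINT r:L|M. \<phi> r) = enn2real (\<integral>\<^sup>+r. ennreal (indicator L r *\<^sub>R \<phi> r) \<partial>M)"
    unfolding set_lebesgue_integral_def using assms(4) by (intro integral_eq_nn_integral) (auto simp: indicator_def)
  also have "(\<integral>\<^sup>+r. ennreal (indicator L r *\<^sub>R \<phi> r) \<partial>M) = (\<integral>\<^sup>+r\<in>L. ennreal (\<phi> r) \<partial>M)"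
    by (rule nn_integral_cong) (auto simp: indicator_def)
  finally show ?thesis .
qed

section \<open>Payoff and admissibility of the barrier law\<close>

locale barrier_problem =
  barrier_model \<mu> \<sigma> M c x2 w \<delta> +
  effort_dividend \<Omega> F B \<mu> \<sigma> M c "\<lambda>t. \<Sum>i=1..2. w i * exp (- \<delta> i * t)"
  for \<mu> \<sigma> M c x2 :: real and w \<delta> :: "nat \<Rightarrow> real"
    and \<Omega> :: "'w measure" and F :: "real \<Rightarrow> 'w measure" and B :: "'w process"
begin

abbreviation \<beta> :: "real \<Rightarrow> real" where "\<beta> t \<equiv> \<Sum>i=1..2. w i * exp (- \<delta> i * t)"
abbreviation Xi :: "(real \<times> real) set \<times> (real \<times> real) set" where "Xi \<equiv> barrier_strip x2"
abbreviation Phi :: "real \<Rightarrow> real \<Rightarrow> real" where "Phi \<equiv> \<lambda>x t. 0"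

lemma \<beta>_eq: "\<beta> t = w 1 * exp (- \<delta> 1 * t) + w 2 * exp (- \<delta> 2 * t)"
  by (rule sum_1_2)

lemma \<beta>_nonneg: "0 \<le> \<beta> t"
  unfolding \<beta>_eq using w_pos by (intro add_nonneg_nonneg mult_nonneg_nonneg) auto

lemma \<beta>_le_1: assumes "0 \<le> t" shows "\<beta> t \<le> 1"
proof -
  have "w 1 * exp (- \<delta> 1 * t) + w 2 * exp (- \<delta> 2 * t) \<le> w 1 * 1 + w 2 * 1"
    using assms w_pos \<delta>_pos by (intro add_mono mult_left_mono) auto
  then show ?thesis unfolding \<beta>_eq using w_sum by simp
qed

lemma \<beta>_ge: assumes "0 \<le> t" shows "1 - (\<delta> 1 + \<delta> 2) * t \<le> \<beta> t"
proof -
  have e: "1 - (\<delta> 1 + \<delta> 2) * t \<le> exp (- \<delta> 1 * t)" "1 - (\<delta> 1 + \<delta> 2) * t \<le> exp (- \<delta> 2 * t)"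
    using exp_ge_add_one_self[of "- \<delta> 1 * t"] exp_ge_add_one_self[of "- \<delta> 2 * t"] mult_nonneg_nonneg[OF less_imp_le[OF \<delta>_pos(1)] assms]
      mult_nonneg_nonneg[OF less_imp_le[OF \<delta>_pos(2)] assms] by (simp_all add: distrib_right)
  have "(w 1 + w 2) * (1 - (\<delta> 1 + \<delta> 2) * t) \<le> w 1 * exp (- \<delta> 1 * t) + w 2 * exp (- \<delta> 2 * t)"
    unfolding distrib_right[of "w 1"] using e w_pos by (intro add_mono mult_left_mono) auto
  then show ?thesis unfolding \<beta>_eq w_sum by simp
qed

lemma \<beta>_continuous: "continuous_on S (\<lambda>r. \<beta> (r - t))"
  by (intro continuous_intros)

lemma \<beta>_measurable: "(\<lambda>r. \<beta> (r - t)) \<in> borel_measurable borel"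
  by (rule borel_measurable_continuous_onI[OF \<beta>_continuous])

lemma lifetime_borel: "lifetime t X \<omega> \<in> sets borel"
  unfolding lifetime_def by measurable

lemma law_payout:
  assumes d: "0 < d" and T: "0 \<le> T" and y: "y \<in> borel_measurable (F T)" "AE \<omega> in \<Omega>. 0 \<le> y \<omega>"
    and R: "reflected_solution Xi y T (feedback Phi X) X \<xi>"
  shows "(\<integral>\<^sup>+\<omega>. (\<integral>\<^sup>+r\<in>lifetime T X \<omega>. ennreal (exp (- d * (r - T))) \<partial>stieltjes T (\<lambda>s. \<xi> s \<omega>)) \<partial>\<Omega>)
    = (\<integral>\<^sup>+\<omega>. ennreal (- U d (y \<omega>) / c) \<partial>\<Omega>)"
proof -
  note roots = theta_roots[OF \<sigma>_pos \<mu>_pos d]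
  note E = expected_barrier_dividends[OF x2_pos T y roots(1-4) d less_imp_le[OF \<mu>_pos] less_imp_le[OF \<sigma>_pos] refl refl R]
  have "(\<integral>\<^sup>+\<omega>. ennreal ((exp (p d * min (y \<omega>) x2) - exp (- q d * min (y \<omega>) x2)) / (p d * exp (p d * x2) + q d * exp (- q d * x2)) + max 0 (y \<omega> - x2)) \<partial>\<Omega>)
    = (\<integral>\<^sup>+\<omega>. ennreal (- U d (y \<omega>) / c) \<partial>\<Omega>)"
    by (rule nn_integral_cong_AE) (use y(2) U_payout[OF d] in \<open>auto elim!: eventually_mono\<close>)
  with E show ?thesis by simp
qed

text \<open>Payoffs are defined with \<open>surplus\<close>, the right-hand side of the equation,
  and not with the solution \<open>X\<close>. The two are only known to agree up to ruin, which is
  enough for their lifetimes to coincide.\<close>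

lemma reflected_surplus_ruin:
  assumes R: "reflected_solution Xi y T \<pi> X \<xi>"
  shows "AE \<omega> in \<Omega>. ruin_time T (surplus y T \<pi> \<xi>) \<omega> = ruin_time T X \<omega>"
proof -
  have "AE \<omega> in \<Omega>. cadlag_from T (\<lambda>r. X r \<omega>) \<and> (\<forall>r\<in>lifetime T X \<omega>. X r \<omega> = surplus y T \<pi> \<xi> r \<omega>)"
    using R by (simp add: reflected_solution_def strong_solution_def)
  then show ?thesis
    by eventually_elim (rule ruin_time_cong, auto simp: cadlag_from_def)
qed

lemma law_surplus_ruin:
  assumes T: "0 \<le> T" and y: "y \<in> borel_measurable (F T)" "AE \<omega> in \<Omega>. 0 \<le> y \<omega>"
  shows "AE \<omega> in \<Omega>. ruin_time T (surplus y T (law_effort Phi Xi y T) (law_dividend Phi Xi y T)) \<omega>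
      = ruin_time T (barrier_surplus x2 y T) \<omega>"
    and "AE \<omega> in \<Omega>. ruin_time T (surplus y T (law_effort Phi Xi y T) (law_dividend Phi Xi y T)) \<omega>
      = ruin_time T (fst (law_solution Phi Xi y T)) \<omega>"
proof -
  note R = law_solution_reflected[OF x2_pos T y]
  show 1: "AE \<omega> in \<Omega>. ruin_time T (surplus y T (law_effort Phi Xi y T) (law_dividend Phi Xi y T)) \<omega>
      = ruin_time T (fst (law_solution Phi Xi y T)) \<omega>"
    by (rule reflected_surplus_ruin[OF R])
  show "AE \<omega> in \<Omega>. ruin_time T (surplus y T (law_effort Phi Xi y T) (law_dividend Phi Xi y T)) \<omega>
      = ruin_time T (barrier_surplus x2 y T) \<omega>"
    using 1 reflected_solution_unique[OF x2_pos T R[unfolded law_effort_def]]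
    by eventually_elim simp
qed

lemma law_surplus_stop:
  assumes T: "0 \<le> T" "T \<le> r" and y: "y \<in> borel_measurable (F T)" "AE \<omega> in \<Omega>. 0 \<le> y \<omega>"
  shows "{\<omega> \<in> space \<Omega>. ereal r < ruin_time T (surplus y T (law_effort Phi Xi y T) (law_dividend Phi Xi y T)) \<omega>} \<in> sets \<Omega>"
proof (rule in_sets_AE)
  show "{\<omega> \<in> space \<Omega>. ereal r < ruin_time T (barrier_surplus x2 y T) \<omega>} \<in> sets \<Omega>"
    using F_sets[OF _ barrier_ruin_adapted[OF x2_pos T y]] T by simp
  show "AE \<omega> in \<Omega>. \<omega> \<in> {\<omega> \<in> space \<Omega>. ereal r < ruin_time T (barrier_surplus x2 y T) \<omega>} \<longleftrightarrow>
      \<omega> \<in> {\<omega> \<in> space \<Omega>. ereal r < ruin_time T (surplus y T (law_effort Phi Xi y T) (law_dividend Phi Xi y T)) \<omega>}"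
    using law_surplus_ruin(1)[OF T(1) y] by eventually_elim simp
qed auto

text \<open>Discounting from \<open>T\<close> back to \<open>t\<close> multiplies each weight by its
  own factor. In general the new weights are not proportional to the old ones, which is the source
  of time inconsistency.\<close>

lemma nn_integral_\<beta>:
  assumes [simp]: "sets N = sets borel" and L: "L \<in> sets borel"
  shows "(\<integral>\<^sup>+r\<in>L. ennreal (\<beta> (r - t)) \<partial>N) = ennreal (w 1 * exp (- \<delta> 1 * (T - t))) * (\<integral>\<^sup>+r\<in>L. ennreal (exp (- \<delta> 1 * (r - T))) \<partial>N)
    + ennreal (w 2 * exp (- \<delta> 2 * (T - t))) * (\<integral>\<^sup>+r\<in>L. ennreal (exp (- \<delta> 2 * (r - T))) \<partial>N)"
proof -
  have m: "(\<lambda>r. ennreal (exp (- d * (r - T))) * indicator L r) \<in> borel_measurable N" for d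
  proof -
    have "(\<lambda>r. exp (- d * (r - T))) \<in> borel_measurable borel" by (intro borel_measurable_continuous_onI continuous_intros)
    then have "(\<lambda>r. ennreal (exp (- d * (r - T))) * indicator L r) \<in> borel_measurable borel" using L by measurable
    then show ?thesis by (simp add: measurable_cong_sets[OF assms(1) refl])
  qed
  have e: "w i * exp (- \<delta> i * (r - t)) = w i * exp (- \<delta> i * (T - t)) * exp (- \<delta> i * (r - T))" for i r
    by (simp add: exp_add[symmetric] algebra_simps)
  have "ennreal (\<beta> (r - t)) * indicator L r = ennreal (w 1 * exp (- \<delta> 1 * (T - t))) * (ennreal (exp (- \<delta> 1 * (r - T))) * indicator L r)
     + ennreal (w 2 * exp (- \<delta> 2 * (T - t))) * (ennreal (exp (- \<delta> 2 * (r - T))) * indicator L r)" for r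
    unfolding \<beta>_eq e[of 1 r] e[of 2 r] using w_pos
    by (cases "r \<in> L") (simp_all add: ennreal_mult'[symmetric] ennreal_plus[symmetric] del: ennreal_plus One_nat_def)
  then have "(\<integral>\<^sup>+r\<in>L. ennreal (\<beta> (r - t)) \<partial>N) = (\<integral>\<^sup>+r. ennreal (w 1 * exp (- \<delta> 1 * (T - t))) * (ennreal (exp (- \<delta> 1 * (r - T))) * indicator L r)
     + ennreal (w 2 * exp (- \<delta> 2 * (T - t))) * (ennreal (exp (- \<delta> 2 * (r - T))) * indicator L r) \<partial>N)"
    by (rule nn_integral_cong)
  also have "\<dots> = (\<integral>\<^sup>+r. ennreal (w 1 * exp (- \<delta> 1 * (T - t))) * (ennreal (exp (- \<delta> 1 * (r - T))) * indicator L r) \<partial>N)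
     + (\<integral>\<^sup>+r. ennreal (w 2 * exp (- \<delta> 2 * (T - t))) * (ennreal (exp (- \<delta> 2 * (r - T))) * indicator L r) \<partial>N)"
    by (rule nn_integral_add) (rule borel_measurable_times_ennreal[OF borel_measurable_const m])+
  finally show ?thesis unfolding nn_integral_cmult[OF m] .
qed

lemma U_measurable: "0 < d \<Longrightarrow> U d \<in> borel_measurable borel"
  by (rule borel_measurable_continuous_onI[OF U_continuous])

text \<open>The dividends after a restart at \<open>T\<close> from a random level, valued at the
  earlier time \<open>t\<close>; only the two exponentially discounted payouts from \<open>T\<close>
  on have to be known.\<close>

lemma law_\<beta>_payout:
  assumes T: "0 \<le> T" and y: "y \<in> borel_measurable (F T)" "AE \<omega> in \<Omega>. 0 \<le> y \<omega>"
  defines "K \<equiv> \<lambda>t \<omega>. \<integral>\<^sup>+r\<in>lifetime T (surplus y T (law_effort Phi Xi y T) (law_dividend Phi Xi y T)) \<omega>. ennreal (\<beta> (r - t)) \<partial>stieltjes T (\<lambda>s. law_dividend Phi Xi y T s \<omega>)"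
  shows "t \<le> T \<Longrightarrow> K t \<in> borel_measurable \<Omega>"
    and "(\<integral>\<^sup>+\<omega>. K t \<omega> \<partial>\<Omega>) = ennreal (w 1 * exp (- \<delta> 1 * (T - t))) * (\<integral>\<^sup>+\<omega>. ennreal (- U (\<delta> 1) (y \<omega>) / c) \<partial>\<Omega>)
      + ennreal (w 2 * exp (- \<delta> 2 * (T - t))) * (\<integral>\<^sup>+\<omega>. ennreal (- U (\<delta> 2) (y \<omega>) / c) \<partial>\<Omega>)"
proof -
  let ?S = "surplus y T (law_effort Phi Xi y T) (law_dividend Phi Xi y T)"
  let ?D = "law_dividend Phi Xi y T" and ?X = "fst (law_solution Phi Xi y T)"
  note R = law_solution_reflected[OF x2_pos T y]
  have D: "dividend_process T ?D" using R by (simp add: reflected_solution_def)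
  have Dm: "?D r \<in> borel_measurable \<Omega>" if "T \<le> r" for r
    using D that T F_measurable[of r] by (auto simp: dividend_process_def adapted_from_def)
  have Dp: "AE \<omega> in \<Omega>. dividend_path T (\<lambda>r. ?D r \<omega>)" using D by (simp add: dividend_process_def)
  note meas = stieltjes_integral_measurable[where \<xi>="?D" and t=T and \<tau>="ruin_time T ?S", OF Dm Dp ruin_time_ge law_surplus_stop[OF T _ y], folded lifetime_def]
  show "K t \<in> borel_measurable \<Omega>" if "t \<le> T"
    unfolding K_def by (rule meas[where C=1]) (use \<beta>_continuous \<beta>_nonneg \<beta>_le_1 that in auto)
  have em: "(\<lambda>\<omega>. \<integral>\<^sup>+r\<in>lifetime T ?S \<omega>. ennreal (exp (- d * (r - T))) \<partial>stieltjes T (\<lambda>s. ?D s \<omega>)) \<in> borel_measurable \<Omega>" if "0 < d" for d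
    by (rule meas[where C=1]) (use that in \<open>auto intro!: continuous_intros\<close>)
  have eX: "(\<integral>\<^sup>+\<omega>. (\<integral>\<^sup>+r\<in>lifetime T ?S \<omega>. ennreal (exp (- d * (r - T))) \<partial>stieltjes T (\<lambda>s. ?D s \<omega>)) \<partial>\<Omega>) = (\<integral>\<^sup>+\<omega>. ennreal (- U d (y \<omega>) / c) \<partial>\<Omega>)" if "0 < d" for d
  proof -
    have "AE \<omega> in \<Omega>. lifetime T ?S \<omega> = lifetime T ?X \<omega>"
      using law_surplus_ruin(2)[OF T y] by eventually_elim (rule lifetime_cong)
    then have "(\<integral>\<^sup>+\<omega>. (\<integral>\<^sup>+r\<in>lifetime T ?S \<omega>. ennreal (exp (- d * (r - T))) \<partial>stieltjes T (\<lambda>s. ?D s \<omega>)) \<partial>\<Omega>)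
      = (\<integral>\<^sup>+\<omega>. (\<integral>\<^sup>+r\<in>lifetime T ?X \<omega>. ennreal (exp (- d * (r - T))) \<partial>stieltjes T (\<lambda>s. ?D s \<omega>)) \<partial>\<Omega>)"
      by (intro nn_integral_cong_AE) (auto elim!: eventually_mono)
    then show ?thesis using law_payout[OF that T y R[unfolded law_effort_def]] by simp
  qed
  show "(\<integral>\<^sup>+\<omega>. K t \<omega> \<partial>\<Omega>) = ennreal (w 1 * exp (- \<delta> 1 * (T - t))) * (\<integral>\<^sup>+\<omega>. ennreal (- U (\<delta> 1) (y \<omega>) / c) \<partial>\<Omega>)
      + ennreal (w 2 * exp (- \<delta> 2 * (T - t))) * (\<integral>\<^sup>+\<omega>. ennreal (- U (\<delta> 2) (y \<omega>) / c) \<partial>\<Omega>)"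
  proof -
    have "K t \<omega> = ennreal (w 1 * exp (- \<delta> 1 * (T - t))) * (\<integral>\<^sup>+r\<in>lifetime T ?S \<omega>. ennreal (exp (- \<delta> 1 * (r - T))) \<partial>stieltjes T (\<lambda>s. ?D s \<omega>))
      + ennreal (w 2 * exp (- \<delta> 2 * (T - t))) * (\<integral>\<^sup>+r\<in>lifetime T ?S \<omega>. ennreal (exp (- \<delta> 2 * (r - T))) \<partial>stieltjes T (\<lambda>s. ?D s \<omega>))" for \<omega>
      unfolding K_def by (rule nn_integral_\<beta>[OF sets_stieltjes lifetime_borel])
    then have "(\<integral>\<^sup>+\<omega>. K t \<omega> \<partial>\<Omega>) = (\<integral>\<^sup>+\<omega>. ennreal (w 1 * exp (- \<delta> 1 * (T - t))) * (\<integral>\<^sup>+r\<in>lifetime T ?S \<omega>. ennreal (exp (- \<delta> 1 * (r - T))) \<partial>stieltjes T (\<lambda>s. ?D s \<omega>))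
      + ennreal (w 2 * exp (- \<delta> 2 * (T - t))) * (\<integral>\<^sup>+r\<in>lifetime T ?S \<omega>. ennreal (exp (- \<delta> 2 * (r - T))) \<partial>stieltjes T (\<lambda>s. ?D s \<omega>)) \<partial>\<Omega>)"
      by simp
    also have "\<dots> = ennreal (w 1 * exp (- \<delta> 1 * (T - t))) * (\<integral>\<^sup>+\<omega>. (\<integral>\<^sup>+r\<in>lifetime T ?S \<omega>. ennreal (exp (- \<delta> 1 * (r - T))) \<partial>stieltjes T (\<lambda>s. ?D s \<omega>)) \<partial>\<Omega>)
      + ennreal (w 2 * exp (- \<delta> 2 * (T - t))) * (\<integral>\<^sup>+\<omega>. (\<integral>\<^sup>+r\<in>lifetime T ?S \<omega>. ennreal (exp (- \<delta> 2 * (r - T))) \<partial>stieltjes T (\<lambda>s. ?D s \<omega>)) \<partial>\<Omega>)"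
      using em[OF \<delta>_pos(1)] em[OF \<delta>_pos(2)]
      by (subst nn_integral_add) (intro borel_measurable_times_ennreal borel_measurable_const | simp only: nn_integral_cmult)+
    finally show ?thesis unfolding eX[OF \<delta>_pos(1)] eX[OF \<delta>_pos(2)] .
  qed
qed

lemma nn_integral_\<beta>_c:
  assumes N: "sets N = sets borel" and L: "L \<in> sets borel"
  shows "(\<integral>\<^sup>+r\<in>L. ennreal (\<beta> (r - t) * c) \<partial>N) = ennreal c * (\<integral>\<^sup>+r\<in>L. ennreal (\<beta> (r - t)) \<partial>N)"
proof -
  have "(\<lambda>r. ennreal (\<beta> (r - t)) * indicator L r) \<in> borel_measurable borel" using \<beta>_measurable[of t] L by measurable
  then have "(\<lambda>r. ennreal (\<beta> (r - t)) * indicator L r) \<in> borel_measurable N" by (simp add: measurable_cong_sets[OF N refl])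
  note this[THEN nn_integral_cmult, of "ennreal c", symmetric]
  moreover have "ennreal (\<beta> (r - t) * c) * indicator L r = ennreal c * (ennreal (\<beta> (r - t)) * indicator L r)" for r
    unfolding ennreal_mult[OF \<beta>_nonneg less_imp_le[OF c_pos]] by (simp only: ac_simps)
  ultimately show ?thesis by (simp only:)
qed

text \<open>The law spends no effort, so the objective is \<open>- c\<close> times an expected
  payout. One extended nonnegative integral gives both claims, by its value and by its
  finiteness.\<close>

lemma J_law_value:
  assumes x: "0 \<le> x" and t: "0 \<le> t"
  shows "J_law Phi Xi x t = V x"
    and "integrable_pair x t (law_effort Phi Xi (\<lambda>_. x) t) (law_dividend Phi Xi (\<lambda>_. x) t)"
proof -
  have y: "(\<lambda>_. x) \<in> borel_measurable (F t)" "AE \<omega> in \<Omega>. 0 \<le> x" using x by simp_all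
  let ?D = "law_dividend Phi Xi (\<lambda>_. x) t" and ?u = "law_effort Phi Xi (\<lambda>_. x) t"
  let ?L = "lifetime t (surplus (\<lambda>_. x) t ?u ?D)"
  define K where "K \<omega> = (\<integral>\<^sup>+r\<in>?L \<omega>. ennreal (\<beta> (r - t)) \<partial>stieltjes t (\<lambda>s. ?D s \<omega>))" for \<omega>
  note K = law_\<beta>_payout[OF t y, of t, folded K_def]
  have Un: "U (\<delta> 1) x \<le> 0" "U (\<delta> 2) x \<le> 0" using U_nonpos \<delta>_pos x by auto
  have "(\<integral>\<^sup>+\<omega>. K \<omega> \<partial>\<Omega>) = ennreal (w 1) * ennreal (- U (\<delta> 1) x / c) + ennreal (w 2) * ennreal (- U (\<delta> 2) x / c)"
    using K(2) by (simp add: emeasure_space_1)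
  also have "\<dots> = ennreal (- V x / c)"
  proof -
    have nn: "0 \<le> w 1 * (- U (\<delta> 1) x / c)" "0 \<le> w 2 * (- U (\<delta> 2) x / c)"
      using w_pos Un c_pos by (intro mult_nonneg_nonneg divide_nonneg_pos; simp)+
    have "ennreal (w 1) * ennreal (- U (\<delta> 1) x / c) + ennreal (w 2) * ennreal (- U (\<delta> 2) x / c)
      = ennreal (w 1 * (- U (\<delta> 1) x / c)) + ennreal (w 2 * (- U (\<delta> 2) x / c))"
      using w_pos by (simp only: ennreal_mult' less_imp_le)
    also have "\<dots> = ennreal (w 1 * (- U (\<delta> 1) x / c) + w 2 * (- U (\<delta> 2) x / c))"
      using nn by (rule ennreal_plus[symmetric])
    also have "w 1 * (- U (\<delta> 1) x / c) + w 2 * (- U (\<delta> 2) x / c) = - V x / c"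
      using c_pos by (simp add: V_def field_simps)
    finally show ?thesis .
  qed
  finally have EK: "(\<integral>\<^sup>+\<omega>. K \<omega> \<partial>\<Omega>) = ennreal (- V x / c)" .
  have Km: "K \<in> borel_measurable \<Omega>" using K(1) by simp
  have "0 \<le> c * x" using c_pos x by simp
  then have "V x \<le> 0" using V_drop[OF x] V_0 by simp
  then have Vn: "0 \<le> - V x / c" using c_pos by (intro divide_nonneg_pos) auto
  have "J_law Phi Xi x t = expectation (\<lambda>\<omega>. - c * enn2real (K \<omega>))"
    unfolding J_law_def J_def Let_def K_def LINT_eq_enn2real[OF sets_stieltjes lifetime_borel \<beta>_measurable \<beta>_nonneg]
    by (simp add: set_lebesgue_integral_def)
  also have "\<dots> = - c * expectation (\<lambda>\<omega>. enn2real (K \<omega>))" by simp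
  also have "\<dots> = - c * enn2real (ennreal (- V x / c))"
    by (subst expectation_enn2real(2)[OF Km]) (simp_all add: EK)
  also have "\<dots> = V x" using Vn c_pos by simp
  finally show "J_law Phi Xi x t = V x" .
  have "(\<integral>\<^sup>+\<omega>. (\<integral>\<^sup>+r\<in>?L \<omega>. ennreal (\<beta> (r - t) * c) \<partial>stieltjes t (\<lambda>s. ?D s \<omega>)) \<partial>\<Omega>) = ennreal c * (\<integral>\<^sup>+\<omega>. K \<omega> \<partial>\<Omega>)"
    unfolding nn_integral_\<beta>_c[OF sets_stieltjes lifetime_borel] K_def[symmetric] by (rule nn_integral_cmult[OF Km])
  also have "\<dots> < \<infinity>" by (simp add: EK ennreal_mult_less_top)
  finally show "integrable_pair x t ?u ?D" unfolding integrable_pair_def Let_def by simp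
qed

lemma law_admissible: "admissible_law Phi Xi"
  unfolding admissible_law_def
proof (intro conjI)
  show "borel_division Xi"
    unfolding borel_division_def state_space_def borel_prod[symmetric] using x2_pos by (auto intro!: pair_measureI)
  show "\<forall>(x, t)\<in>state_space. uniquely_solvable t (\<lambda>X \<xi>. reflected_solution Xi (\<lambda>_. x) t (feedback Phi X) X \<xi>) \<and>
        integrable_pair x t (law_effort Phi Xi (\<lambda>_. x) t) (law_dividend Phi Xi (\<lambda>_. x) t)"
    using law_uniquely_solvable[OF x2_pos] J_law_value(2) by (auto simp: state_space_def)
qed (use M_pos in auto)

end

section \<open>Perturbed controls\<close>

lemma tendsto_at_right_left_limit:
  assumes "cadlag_from t g" "t < r"
  shows "(g \<longlongrightarrow> left_lim g r) (at_left r)"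
proof -
  obtain l where "(g \<longlongrightarrow> l) (at_left r)" using assms by (auto simp: cadlag_from_def)
  then show ?thesis using left_lim_eq by metis
qed

lemma filterlim_left_sequence:
  assumes "0 < (e::real)" shows "filterlim (\<lambda>n. r - e / real (Suc n)) (at_left r) sequentially"
  unfolding filterlim_at
proof
  have "(\<lambda>n. r - e * inverse (real (Suc n))) \<longlonglongrightarrow> r - e * 0"
    by (intro tendsto_intros LIMSEQ_inverse_real_of_nat)
  then show "(\<lambda>n. r - e / real (Suc n)) \<longlonglongrightarrow> r" by (simp add: divide_inverse)
qed (use assms in auto)

section \<open>Accumulated drift of an effort process\<close>

context effort_dividend
begin

definition drift :: "real \<Rightarrow> 'w process \<Rightarrow> 'w process" where
  "drift t u r \<omega> = (LINT s:{t..r}|lborel. \<mu> + u s \<omega>)"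

definition controlled :: "real \<Rightarrow> real \<Rightarrow> 'w process \<Rightarrow> 'w process" where
  "controlled x t u r \<omega> = x + drift t u r \<omega> + \<sigma> * (B r \<omega> - B t \<omega>)"

lemma surplus_controlled: "surplus (\<lambda>_. x) t u \<eta> r \<omega> = controlled x t u r \<omega> - \<eta> r \<omega>"
  by (simp add: surplus_def controlled_def drift_def)

lemma effort_section:
  assumes u: "effort_process t u" and r: "t \<le> r" and \<omega>: "\<omega> \<in> space \<Omega>" and t: "0 \<le> t"
  shows "(\<lambda>s. indicator {t..r} s * u s \<omega>) \<in> borel_measurable borel"
proof -
  have "(\<lambda>(s, \<omega>). u s \<omega>) \<in> borel_measurable (restrict_space borel {t..r} \<Otimes>\<^sub>M F r)"
    using u r by (auto simp: effort_process_def progressive_from_def)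
  moreover have "(\<lambda>s. (s, \<omega>)) \<in> restrict_space borel {t..r} \<rightarrow>\<^sub>M restrict_space borel {t..r} \<Otimes>\<^sub>M F r"
    using \<omega> r t by (intro measurable_Pair2') simp
  ultimately have "(\<lambda>s. u s \<omega>) \<in> borel_measurable (restrict_space borel {t..r})"
    using measurable_compose[of "\<lambda>s. (s, \<omega>)" _ _ "\<lambda>(s, \<omega>). u s \<omega>"] by fastforce
  then show ?thesis by (subst (asm) borel_measurable_restrict_space_iff) auto
qed

lemma effort_bounds: "effort_process t u \<Longrightarrow> t \<le> r \<Longrightarrow> \<omega> \<in> space \<Omega> \<Longrightarrow> 0 \<le> u r \<omega> \<and> u r \<omega> \<le> M"
  by (auto simp: effort_process_def)

lemma effort_set_integrable:
  assumes u: "effort_process t u" and \<omega>: "\<omega> \<in> space \<Omega>" and t: "0 \<le> t" and r: "t \<le> r"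
    and \<phi>: "\<phi> \<in> borel_measurable borel" "\<And>s. t \<le> s \<Longrightarrow> s \<le> r \<Longrightarrow> \<bar>\<phi> s\<bar> \<le> C" and A: "A \<in> sets borel" "A \<subseteq> {t..r}"
  shows "set_integrable lborel A (\<lambda>s. \<phi> s * u s \<omega>)"
proof -
  have M: "0 \<le> M" using effort_bounds[OF u order_refl \<omega>] by linarith
  have C: "0 \<le> C" using \<phi>(2)[of t] r by auto
  have "(\<lambda>s. indicator A s * (\<phi> s * (indicator {t..r} s * u s \<omega>))) \<in> borel_measurable borel"
    using effort_section[OF u r \<omega> t] \<phi>(1) A(1) by measurable
  also have "(\<lambda>s. indicator A s * (\<phi> s * (indicator {t..r} s * u s \<omega>))) = (\<lambda>s. indicator A s *\<^sub>R (\<phi> s * u s \<omega>))"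
    using A(2) by (auto simp: fun_eq_iff indicator_def)
  finally have m: "(\<lambda>s. indicator A s *\<^sub>R (\<phi> s * u s \<omega>)) \<in> borel_measurable lborel" by simp
  show ?thesis
    unfolding set_integrable_def
  proof (rule Bochner_Integration.integrable_bound[OF _ m])
    show "integrable lborel (\<lambda>s. C * M * indicator {t..r} s)"
      using r by (intro integrable_mult_right integrable_real_indicator) auto
    show "AE s in lborel. norm (indicator A s *\<^sub>R (\<phi> s * u s \<omega>)) \<le> norm (C * M * indicator {t..r} s)"
    proof (rule AE_I2)
      fix s
      show "norm (indicator A s *\<^sub>R (\<phi> s * u s \<omega>)) \<le> norm (C * M * indicator {t..r} s)"
      proof (cases "s \<in> A")
        case True
        then have s: "t \<le> s" "s \<le> r" using A(2) by auto
        have "\<bar>\<phi> s\<bar> * \<bar>u s \<omega>\<bar> \<le> C * M" using effort_bounds[OF u s(1) \<omega>] \<phi>(2)[OF s] C by (intro mult_mono) auto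
        then show ?thesis using True s C M by (simp add: abs_mult)
      qed simp
    qed
  qed
qed

lemma effort_drift_integrable:
  assumes u: "effort_process t u" and \<omega>: "\<omega> \<in> space \<Omega>" and t: "0 \<le> t" and r: "t \<le> r" and A: "A \<in> sets borel" "A \<subseteq> {t..r}"
  shows "set_integrable lborel A (\<lambda>s. \<mu> + u s \<omega>)"
proof -
  have "set_integrable lborel A (\<lambda>s. 1 * u s \<omega>)"
    by (rule effort_set_integrable[OF u \<omega> t r _ _ A, of _ 1]) auto
  moreover have "set_integrable lborel A (\<lambda>s. \<mu>)"
    by (rule set_integrable_subset[of _ "{t..r}"]) (use A r in \<open>auto simp: set_integrable_def intro!: integrable_mult_left integrable_real_indicator\<close>)
  ultimately show ?thesis using set_integral_add(1) by fastforce
qed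

lemma drift_increment:
  assumes u: "effort_process t u" and \<omega>: "\<omega> \<in> space \<Omega>" and t: "0 \<le> t" and r: "t \<le> r" "r \<le> r'" and \<mu>: "0 \<le> \<mu>"
  shows "0 \<le> drift t u r' \<omega> - drift t u r \<omega>" "drift t u r' \<omega> - drift t u r \<omega> \<le> (\<mu> + M) * (r' - r)"
proof -
  have i: "set_integrable lborel {t..r} (\<lambda>s. \<mu> + u s \<omega>)" "set_integrable lborel {r<..r'} (\<lambda>s. \<mu> + u s \<omega>)"
    using r by (auto intro!: effort_drift_integrable[OF u \<omega> t, of r'])
  have "{t..r'} = {t..r} \<union> {r<..r'}" using r by auto
  then have "drift t u r' \<omega> = drift t u r \<omega> + (LINT s:{r<..r'}|lborel. \<mu> + u s \<omega>)"
    unfolding drift_def using set_integral_Un[OF _ i] by fastforce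
  moreover have "0 \<le> (LINT s:{r<..r'}|lborel. \<mu> + u s \<omega>)"
    unfolding set_lebesgue_integral_def
    by (intro Bochner_Integration.integral_nonneg) (use effort_bounds[OF u _ \<omega>] \<mu> r in \<open>auto simp: indicator_def\<close>)
  moreover have "(LINT s:{r<..r'}|lborel. \<mu> + u s \<omega>) \<le> (LINT s:{r<..r'}|lborel. \<mu> + M)"
    by (rule set_integral_mono[OF i(2)]) (use effort_bounds[OF u _ \<omega>] r in \<open>auto simp: set_integrable_def\<close>)
  moreover have "(LINT s:{r<..r'}|lborel. \<mu> + M) = (\<mu> + M) * (r' - r)"
    using r by (simp add: set_lebesgue_integral_def mult.commute)
  ultimately show "0 \<le> drift t u r' \<omega> - drift t u r \<omega>" "drift t u r' \<omega> - drift t u r \<omega> \<le> (\<mu> + M) * (r' - r)" by simp_all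
qed

lemma drift_start: "drift t u t \<omega> = 0"
proof -
  have "AE s in lborel. indicator {t..t} s *\<^sub>R (\<mu> + u s \<omega>) = 0"
    using AE_lborel_singleton[of t] by eventually_elim (auto simp: indicator_def)
  then show ?thesis unfolding drift_def set_lebesgue_integral_def by (rule integral_eq_zero_AE)
qed

lemma controlled_continuous:
  assumes u: "effort_process t u" and \<omega>: "\<omega> \<in> space \<Omega>" and t: "0 \<le> t" and \<mu>: "0 \<le> \<mu>"
    and B: "continuous_on {0..} (\<lambda>t. B t \<omega>)"
  shows "continuous_on {t..} (\<lambda>r. controlled x t u r \<omega>)"
proof -
  have M: "0 \<le> M" using effort_bounds[OF u order_refl \<omega>] by linarith
  have lip: "\<bar>drift t u r \<omega> - drift t u r' \<omega>\<bar> \<le> (\<mu> + M) * \<bar>r - r'\<bar>" if "t \<le> r" "t \<le> r'" for r r'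
    using drift_increment[OF u \<omega> t that(1) _ \<mu>, of r'] drift_increment[OF u \<omega> t that(2) _ \<mu>, of r]
    by (cases "r \<le> r'") auto
  have "continuous_on {t..} (\<lambda>r. drift t u r \<omega>)"
    unfolding continuous_on_iff
  proof (intro ballI allI impI)
    fix r e :: real assume r: "r \<in> {t..}" and e: "0 < e"
    show "\<exists>d>0. \<forall>r'\<in>{t..}. dist r' r < d \<longrightarrow> dist (drift t u r' \<omega>) (drift t u r \<omega>) < e"
    \<comment> \<open>The drift is Lipschitz with constant \<open>\<mu> + M\<close>; the added 1
      keeps the divisor positive if that constant is 0.\<close>
    proof (intro exI[of _ "e / (\<mu> + M + 1)"] conjI ballI impI)
      show "0 < e / (\<mu> + M + 1)" using e \<mu> M by simp
      fix r' assume r': "r' \<in> {t..}" and d: "dist r' r < e / (\<mu> + M + 1)"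
      have "\<bar>drift t u r' \<omega> - drift t u r \<omega>\<bar> \<le> (\<mu> + M) * \<bar>r' - r\<bar>" using lip r r' by auto
      also have "\<dots> \<le> (\<mu> + M + 1) * \<bar>r' - r\<bar>" by (intro mult_right_mono) auto
      also have "\<dots> < e" using d \<mu> M by (simp add: dist_real_def pos_less_divide_eq mult.commute)
      finally show "dist (drift t u r' \<omega>) (drift t u r \<omega>) < e" by (simp add: dist_real_def)
    qed
  qed
  moreover have "continuous_on {t..} (\<lambda>t. B t \<omega>)" using t by (intro continuous_on_subset[OF B]) auto
  ultimately show ?thesis unfolding controlled_def by (intro continuous_intros)
qed

text \<open>Progressive measurability makes the integrand jointly measurable, and Fubini does the
  rest. The constant \<open>k\<close> and the weight \<open>\<phi>\<close> let one statement serve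
  both the accumulated drift and the discounted effort, each cut at a random time.\<close>

lemma effort_integral_measurable:
  assumes u: "effort_process t u" and t: "0 \<le> t" "t \<le> r" and \<phi>: "\<phi> \<in> borel_measurable borel" and s: "s \<in> borel_measurable (F r)"
  shows "(\<lambda>\<omega>. LINT l:{t..r}|lborel. (k + \<phi> l * u l \<omega>) * indicator {..s \<omega>} l) \<in> borel_measurable (F r)"
proof -
  let ?R = "restrict_space lborel {t..r}"
  have sets: "sets ?R = sets (restrict_space borel {t..r})" by (rule sets_restrict_space_cong) simp
  interpret R: sigma_finite_measure ?R
    by (rule sigma_finite_measure_restrict_space) (auto intro: sigma_finite_lborel)
  have "(\<lambda>(s, \<omega>). u s \<omega>) \<in> borel_measurable (restrict_space borel {t..r} \<Otimes>\<^sub>M F r)"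
    using u t by (auto simp: effort_process_def progressive_from_def)
  then have "(\<lambda>(s, \<omega>). u s \<omega>) \<in> borel_measurable (?R \<Otimes>\<^sub>M F r)"
    by (simp add: measurable_cong_sets[OF sets_pair_measure_cong[OF sets refl] refl])
  from measurable_compose[OF measurable_pair_swap' this]
  have um[measurable]: "(\<lambda>z. u (snd z) (fst z)) \<in> borel_measurable (F r \<Otimes>\<^sub>M ?R)" by (simp add: split_beta)
  have id: "(\<lambda>l. l) \<in> borel_measurable ?R" by (rule measurable_restrict_space1) simp
  have sm[measurable]: "(\<lambda>z. snd z) \<in> borel_measurable (F r \<Otimes>\<^sub>M ?R)" by (rule measurable_compose[OF measurable_snd id])
  have fm[measurable]: "(\<lambda>z. s (fst z)) \<in> borel_measurable (F r \<Otimes>\<^sub>M ?R)" by (rule measurable_compose[OF measurable_fst s])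
  have pm[measurable]: "(\<lambda>z. \<phi> (snd z)) \<in> borel_measurable (F r \<Otimes>\<^sub>M ?R)" by (rule measurable_compose[OF sm \<phi>])
  have im: "(\<lambda>z. indicator {..s (fst z)} (snd z) :: real) \<in> borel_measurable (F r \<Otimes>\<^sub>M ?R)"
  proof -
    have "{z \<in> space (F r \<Otimes>\<^sub>M ?R). snd z \<le> s (fst z)} \<in> sets (F r \<Otimes>\<^sub>M ?R)" by measurable
    then have "(indicator {z \<in> space (F r \<Otimes>\<^sub>M ?R). snd z \<le> s (fst z)} :: _ \<Rightarrow> real) \<in> borel_measurable (F r \<Otimes>\<^sub>M ?R)" by simp
    then show ?thesis by (rule measurable_cong[THEN iffD1, rotated]) (auto simp: indicator_def)
  qed
  have "(\<lambda>(\<omega>, l). (k + \<phi> l * u l \<omega>) * indicator {..s \<omega>} l) \<in> borel_measurable (F r \<Otimes>\<^sub>M ?R)"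
    unfolding split_beta using um pm im by (intro borel_measurable_times borel_measurable_add borel_measurable_const)
  from R.borel_measurable_lebesgue_integral[OF this]
  show ?thesis by (simp add: set_lebesgue_integral_def integral_restrict_space)
qed

lemma drift_adapted:
  assumes u: "effort_process t u" and t: "0 \<le> t" "t \<le> r"
  shows "drift t u r \<in> borel_measurable (F r)"
proof -
  have "(\<lambda>\<omega>. LINT l:{t..r}|lborel. (\<mu> + 1 * u l \<omega>) * indicator {..r} l) \<in> borel_measurable (F r)"
    by (rule effort_integral_measurable[OF u t]) simp_all
  moreover have "(LINT l:{t..r}|lborel. (\<mu> + 1 * u l \<omega>) * indicator {..r} l) = drift t u r \<omega>" for \<omega>
    unfolding drift_def set_lebesgue_integral_def by (rule Bochner_Integration.integral_cong) (auto simp: indicator_def)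
  ultimately show ?thesis by simp
qed

lemma controlled_adapted:
  assumes u: "effort_process t u" and t: "0 \<le> t" "t \<le> r"
  shows "controlled x t u r \<in> borel_measurable (F r)"
proof -
  have [measurable]: "drift t u r \<in> borel_measurable (F r)" "B r \<in> borel_measurable (F r)" "B t \<in> borel_measurable (F r)"
    using drift_adapted[OF assms] B_F_measurable t by auto
  show ?thesis unfolding controlled_def by measurable
qed

end

text \<open>The properties shared by the deviations in the three equilibrium conditions.\<close>

locale deviation = barrier_problem \<mu> \<sigma> M c x2 w \<delta> \<Omega> F B
  for \<mu> \<sigma> M c x2 :: real and w \<delta> :: "nat \<Rightarrow> real"
    and \<Omega> :: "'w measure" and F :: "real \<Rightarrow> 'w measure" and B :: "'w process" +
  fixes x t :: real and u \<eta> S :: "'w process"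
  assumes x_nonneg: "0 \<le> x" and t_nonneg: "0 \<le> t" and effort: "effort_process t u"
    and dividend: "dividend_process t \<eta>" and S_def: "S = surplus (\<lambda>_. x) t u \<eta>"
    and S_nonneg: "AE \<omega> in \<Omega>. \<forall>r\<in>lifetime t S \<omega>. 0 \<le> S r \<omega>"
begin

lemma dividend_AE: "AE \<omega> in \<Omega>. dividend_path t (\<lambda>r. \<eta> r \<omega>)"
  using dividend by (simp add: dividend_process_def)

lemmas dev_facts = x_nonneg t_nonneg effort dividend dividend_AE S_nonneg

lemma S_eq: "S r \<omega> = controlled x t u r \<omega> - \<eta> r \<omega>"
  unfolding S_def by (rule surplus_controlled)

lemma S_adapted: "t \<le> r \<Longrightarrow> S r \<in> borel_measurable (F r)"
proof -
  assume r: "t \<le> r"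
  have "\<eta> r \<in> borel_measurable (F r)" using dev_facts(4) r by (auto simp: dividend_process_def adapted_from_def)
  moreover have "controlled x t u r \<in> borel_measurable (F r)" by (rule controlled_adapted[OF dev_facts(3,2) r])
  ultimately show ?thesis unfolding S_eq[abs_def] by (intro borel_measurable_diff)
qed

text \<open>Collects path properties that hold almost surely, so that the estimates below can be
  made for one path at a time.\<close>

definition good_path :: "'w \<Rightarrow> bool" where
  "good_path \<omega> \<longleftrightarrow> \<omega> \<in> space \<Omega> \<and> continuous_on {t..} (\<lambda>r. controlled x t u r \<omega>) \<and>
     dividend_path t (\<lambda>r. \<eta> r \<omega>) \<and> (\<forall>r\<in>lifetime t S \<omega>. 0 \<le> S r \<omega>)"

lemma AE_good_path: "AE \<omega> in \<Omega>. good_path \<omega>"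
  using B_continuous dev_facts(5,6) AE_space
  by eventually_elim (simp add: good_path_def controlled_continuous[OF dev_facts(3) _ dev_facts(2) less_imp_le[OF \<mu>_pos]])

lemma good_down_cadlag: assumes "good_path \<omega>" shows "down_cadlag t (\<lambda>r. S r \<omega>)"
proof -
  have "continuous_on {t..} (\<lambda>r. controlled x t u r \<omega>)" "dividend_path t (\<lambda>r. \<eta> r \<omega>)"
    using assms by (auto simp: good_path_def)
  from down_cadlag_diff[OF this] show ?thesis unfolding S_eq .
qed

lemma S_stop: "t \<le> r \<Longrightarrow> {\<omega> \<in> space \<Omega>. ereal r < ruin_time t S \<omega>} \<in> sets (F r)"
proof (rule ruin_time_adapted[OF dev_facts(2) _ S_adapted])
  show "AE \<omega> in \<Omega>. down_cadlag t (\<lambda>r. S r \<omega>) \<and> (\<forall>r\<in>lifetime t S \<omega>. 0 \<le> S r \<omega>)"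
    using AE_good_path by eventually_elim (auto simp: good_down_cadlag good_path_def)
qed

lemma ruined_before_eq: "ruined_before x t u \<eta> h \<omega> \<longleftrightarrow> ruin_time t S \<omega> < ereal (t + h)"
  by (simp add: ruined_before_def S_def)

text \<open>\<open>S_stop\<close> decides whether ruin comes after a given time; ruin strictly
  before \<open>t + h\<close> is a union over times increasing to \<open>t + h\<close>.\<close>

lemma ruined_measurable:
  assumes h: "0 < h"
  shows "{\<omega> \<in> space \<Omega>. ruined_before x t u \<eta> h \<omega>} \<in> sets (F (t + h))"
proof -
  have t0: "0 \<le> t + h" using dev_facts(2) h by simp
  have ge: "t \<le> t + h - h / real (Suc n)" for n using h by (simp add: field_simps)
  have "{\<omega> \<in> space \<Omega>. ruined_before x t u \<eta> h \<omega>} = (\<Union>n. space \<Omega> - {\<omega> \<in> space \<Omega>. ereal (t + h - h / real (Suc n)) < ruin_time t S \<omega>})"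
  proof (intro set_eqI iffI)
    fix \<omega> assume "\<omega> \<in> {\<omega> \<in> space \<Omega>. ruined_before x t u \<eta> h \<omega>}"
    then have \<omega>: "\<omega> \<in> space \<Omega>" and lt: "ruin_time t S \<omega> < ereal (t + h)" by (auto simp: ruined_before_eq)
    then obtain \<tau> where \<tau>: "ruin_time t S \<omega> = ereal \<tau>" using ruin_time_ge[of t S \<omega>] by (cases "ruin_time t S \<omega>") auto
    have "\<forall>\<^sub>F r in at_left (t + h). \<tau> < r" unfolding eventually_at_left_field using lt \<tau> by (intro exI[of _ \<tau>]) auto
    from eventually_compose_filterlim[OF this filterlim_left_sequence[OF h, of "t + h"]]
    obtain n where "\<tau> < t + h - h / real (Suc n)" by (auto dest: eventually_happens)
    then show "\<omega> \<in> (\<Union>n. space \<Omega> - {\<omega> \<in> space \<Omega>. ereal (t + h - h / real (Suc n)) < ruin_time t S \<omega>})"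
      using \<omega> \<tau> by (auto simp: not_less intro!: exI[of _ n])
  next
    fix \<omega> assume "\<omega> \<in> (\<Union>n. space \<Omega> - {\<omega> \<in> space \<Omega>. ereal (t + h - h / real (Suc n)) < ruin_time t S \<omega>})"
    then obtain n where \<omega>: "\<omega> \<in> space \<Omega>" and le: "ruin_time t S \<omega> \<le> ereal (t + h - h / real (Suc n))" by (auto simp: not_less)
    have "ereal (t + h - h / real (Suc n)) < ereal (t + h)" using h by simp
    with le have "ruin_time t S \<omega> < ereal (t + h)" by (rule le_less_trans)
    then show "\<omega> \<in> {\<omega> \<in> space \<Omega>. ruined_before x t u \<eta> h \<omega>}" using \<omega> by (simp add: ruined_before_eq)
  qed
  moreover have "space \<Omega> - {\<omega> \<in> space \<Omega>. ereal (t + h - h / real (Suc n)) < ruin_time t S \<omega>} \<in> sets (F (t + h))" for n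
  proof -
    have "{\<omega> \<in> space \<Omega>. ereal (t + h - h / real (Suc n)) < ruin_time t S \<omega>} \<in> sets (F (t + h))"
      using S_stop[OF ge, of n] F_mono[of "t + h - h / real (Suc n)" "t + h"] ge[of n] dev_facts(2) h by auto
    then show ?thesis using sets.compl_sets[of _ "F (t + h)"] t0 by simp
  qed
  ultimately show ?thesis by (simp only:) (rule sets.countable_UN, auto)
qed

lemma capped_measurable:
  assumes h: "0 \<le> h" shows "capped_ruin t h S \<in> borel_measurable (F (t + h))"
  unfolding borel_measurable_iff_greater
proof
  fix q
  have t0: "0 \<le> t" "0 \<le> t + h" using dev_facts(2) h by auto
  show "{\<omega> \<in> space (F (t + h)). q < capped_ruin t h S \<omega>} \<in> sets (F (t + h))"
  proof (cases "q < t")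
    case True
    then have "{\<omega> \<in> space (F (t + h)). q < capped_ruin t h S \<omega>} = space (F (t + h))"
      using capped_ruin_bounds(1)[OF h, of t S] by (auto intro: less_le_trans)
    then show ?thesis by (simp only:) simp
  next
    case False
    show ?thesis
    proof (cases "q < t + h")
      case True
      have "{\<omega> \<in> space (F (t + h)). q < capped_ruin t h S \<omega>} = {\<omega> \<in> space \<Omega>. ereal q < ruin_time t S \<omega>}"
        using True t0 by (simp add: capped_ruin_iff[OF h])
      then show ?thesis using S_stop[of q] F_mono[of q "t + h"] False True t0 by auto
    next
      case False
      then have "{\<omega> \<in> space (F (t + h)). q < capped_ruin t h S \<omega>} = {}" by (auto simp: capped_ruin_iff[OF h])
      then show ?thesis by (simp only:) simp
    qed
  qed
qed

lemma restart_measurable: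
  assumes h: "0 < h" shows "restart_surplus x t u \<eta> h \<in> borel_measurable (F (t + h))"
proof -
  have t0: "0 \<le> t" "0 \<le> t + h" using dev_facts(2) h by auto
  let ?q = "\<lambda>n. t + h - h / real (Suc n)"
  have ge: "t \<le> ?q n" for n using h by (simp add: field_simps)
  have Sm: "S (?q n) \<in> borel_measurable (F (t + h))" for n
    using F_measurable_mono[OF _ _ S_adapted[OF ge], of n "t + h"] ge[of n] t0 h by auto
  have "(\<lambda>\<omega>. left_lim (\<lambda>r. S r \<omega>) (t + h)) \<in> borel_measurable (F (t + h))"
  proof (rule F_measurable_AE_cong[OF t0(2)])
    show "(\<lambda>\<omega>. lim (\<lambda>n. S (?q n) \<omega>)) \<in> borel_measurable (F (t + h))" using Sm by (rule borel_measurable_lim_metric)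
    show "AE \<omega> in \<Omega>. lim (\<lambda>n. S (?q n) \<omega>) = left_lim (\<lambda>r. S r \<omega>) (t + h)"
      using AE_good_path
    proof eventually_elim
      case (elim \<omega>)
      have "t < t + h" using h by simp
      then have "\<exists>l. ((\<lambda>r. S r \<omega>) \<longlongrightarrow> l) (at_left (t + h))"
        using good_down_cadlag[OF elim] unfolding down_cadlag_def by blast
      then have "((\<lambda>r. S r \<omega>) \<longlongrightarrow> left_lim (\<lambda>r. S r \<omega>) (t + h)) (at_left (t + h))" using left_lim_eq by metis
      from filterlim_compose[OF this filterlim_left_sequence[OF h]] show ?case by (rule limI)
    qed
  qed
  moreover have "{\<omega> \<in> space (F (t + h)). ruined_before x t u \<eta> h \<omega>} \<in> sets (F (t + h))"
    using ruined_measurable[OF h] t0 by simp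
  ultimately have "(\<lambda>\<omega>. if ruined_before x t u \<eta> h \<omega> then 0 else left_lim (\<lambda>r. S r \<omega>) (t + h)) \<in> borel_measurable (F (t + h))"
    by (intro measurable_If) auto
  then show ?thesis unfolding restart_surplus_def[abs_def] S_def .
qed

lemma good_start: assumes "good_path \<omega>" shows "0 \<le> \<eta> t \<omega>" "S t \<omega> = x - \<eta> t \<omega>" "0 \<le> S t \<omega>" "S t \<omega> \<le> x"
proof -
  show 1: "0 \<le> \<eta> t \<omega>" using assms by (auto simp: good_path_def dividend_path_def)
  show 2: "S t \<omega> = x - \<eta> t \<omega>" by (simp add: S_eq controlled_def drift_start)
  show "0 \<le> S t \<omega>" using assms start_in_lifetime[of t S \<omega>] by (auto simp: good_path_def)
  show "S t \<omega> \<le> x" using 1 2 by simp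
qed

lemma good_not_ruined:
  assumes g: "good_path \<omega>" and h: "0 < h" and nr: "\<not> ruined_before x t u \<eta> h \<omega>"
  shows "capped_ruin t h S \<omega> = t + h"
    and "((\<lambda>r. \<eta> r \<omega>) \<longlongrightarrow> left_lim (\<lambda>r. \<eta> r \<omega>) (t + h)) (at_left (t + h))"
    and "restart_surplus x t u \<eta> h \<omega> = controlled x t u (t + h) \<omega> - left_lim (\<lambda>r. \<eta> r \<omega>) (t + h)"
    and "0 \<le> restart_surplus x t u \<eta> h \<omega>"
    and "((\<lambda>r. S r \<omega>) \<longlongrightarrow> restart_surplus x t u \<eta> h \<omega>) (at_left (t + h))"
    and "\<And>r. t \<le> r \<Longrightarrow> r < t + h \<Longrightarrow> r \<in> lifetime t S \<omega> \<and> S r \<omega> \<noteq> 0"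
proof -
  have \<tau>: "ereal (t + h) \<le> ruin_time t S \<omega>" using nr by (simp add: ruined_before_eq)
  show "capped_ruin t h S \<omega> = t + h" using nr by (simp add: capped_ruin_def ruined_before_eq)
  show \<eta>l: "((\<lambda>r. \<eta> r \<omega>) \<longlongrightarrow> left_lim (\<lambda>r. \<eta> r \<omega>) (t + h)) (at_left (t + h))"
    by (rule tendsto_at_right_left_limit) (use g h in \<open>auto simp: good_path_def dividend_path_def\<close>)
  have "((\<lambda>r. controlled x t u r \<omega>) \<longlongrightarrow> controlled x t u (t + h) \<omega>) (at_left (t + h))"
    by (rule continuous_on_atLeast_at_left) (use g h in \<open>auto simp: good_path_def\<close>)
  from tendsto_diff[OF this \<eta>l]
  have Sl: "((\<lambda>r. S r \<omega>) \<longlongrightarrow> controlled x t u (t + h) \<omega> - left_lim (\<lambda>r. \<eta> r \<omega>) (t + h)) (at_left (t + h))"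
    unfolding S_eq .
  show Y: "restart_surplus x t u \<eta> h \<omega> = controlled x t u (t + h) \<omega> - left_lim (\<lambda>r. \<eta> r \<omega>) (t + h)"
    using nr left_lim_eq[OF Sl] by (simp add: restart_surplus_def S_def)
  show "((\<lambda>r. S r \<omega>) \<longlongrightarrow> restart_surplus x t u \<eta> h \<omega>) (at_left (t + h))" using Sl Y by simp
  show life: "r \<in> lifetime t S \<omega> \<and> S r \<omega> \<noteq> 0" if "t \<le> r" "r < t + h" for r
  proof -
    have lt: "ereal r < ruin_time t S \<omega>" using that \<tau> by (auto intro: less_le_trans[of "ereal r" "ereal (t + h)"])
    then show ?thesis using that before_ruin_nonzero[OF that(1) lt] by (auto simp: lifetime_def)
  qed
  have "\<forall>\<^sub>F r in at_left (t + h). 0 \<le> S r \<omega>"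
    unfolding eventually_at_left_field using life g h by (intro exI[of _ t]) (auto simp: good_path_def)
  then show "0 \<le> restart_surplus x t u \<eta> h \<omega>" unfolding Y by (rule tendsto_lowerbound[OF Sl _ trivial_limit_at_left_real])
qed

lemma good_ruined:
  assumes g: "good_path \<omega>" and h: "0 < h" and r: "ruined_before x t u \<eta> h \<omega>"
  obtains \<tau> where "ruin_time t S \<omega> = ereal \<tau>" "t \<le> \<tau>" "\<tau> < t + h" "S \<tau> \<omega> = 0" "capped_ruin t h S \<omega> = \<tau>"
    "restart_surplus x t u \<eta> h \<omega> = 0"
proof -
  have lt: "ruin_time t S \<omega> < ereal (t + h)" using r by (simp add: ruined_before_eq)
  then obtain \<tau> where \<tau>: "ruin_time t S \<omega> = ereal \<tau>" using ruin_time_ge[of t S \<omega>] by (cases "ruin_time t S \<omega>") auto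
  have "t \<le> \<tau>" "S \<tau> \<omega> = 0"
    using ruin_time_attained[OF _ \<tau>] good_down_cadlag[OF g] by (auto simp: down_cadlag_def)
  then show thesis using that[OF \<tau>] lt \<tau> r by (simp add: capped_ruin_def restart_surplus_def)
qed

text \<open>Dividends paid after time \<open>t\<close>, until ruin or just before \<open>t + h\<close>.\<close>

definition paid :: "real \<Rightarrow> 'w \<Rightarrow> real" where
  "paid h \<omega> = controlled x t u (capped_ruin t h S \<omega>) \<omega> - \<eta> t \<omega> - restart_surplus x t u \<eta> h \<omega>"

lemma paid_ruined:
  assumes "good_path \<omega>" "0 < h" "ruined_before x t u \<eta> h \<omega>"
  shows "paid h \<omega> = \<eta> (capped_ruin t h S \<omega>) \<omega> - \<eta> t \<omega>" "0 \<le> paid h \<omega>"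
proof -
  obtain \<tau> where \<tau>: "ruin_time t S \<omega> = ereal \<tau>" "t \<le> \<tau>" "\<tau> < t + h" "S \<tau> \<omega> = 0" "capped_ruin t h S \<omega> = \<tau>"
    "restart_surplus x t u \<eta> h \<omega> = 0" using good_ruined[OF assms] .
  then show 1: "paid h \<omega> = \<eta> (capped_ruin t h S \<omega>) \<omega> - \<eta> t \<omega>" by (simp add: paid_def S_eq)
  show "0 \<le> paid h \<omega>" unfolding 1 using \<tau> dividend_path_mono[of t "\<lambda>r. \<eta> r \<omega>" t \<tau>] assms(1) by (auto simp: good_path_def)
qed

lemma paid_not_ruined:
  assumes "good_path \<omega>" "0 < h" "\<not> ruined_before x t u \<eta> h \<omega>"
  shows "paid h \<omega> = left_lim (\<lambda>r. \<eta> r \<omega>) (t + h) - \<eta> t \<omega>" "0 \<le> paid h \<omega>"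
proof -
  note nr = good_not_ruined[OF assms]
  show 1: "paid h \<omega> = left_lim (\<lambda>r. \<eta> r \<omega>) (t + h) - \<eta> t \<omega>" by (simp add: paid_def nr(1,3))
  have "\<forall>\<^sub>F r in at_left (t + h). \<eta> t \<omega> \<le> \<eta> r \<omega>"
    unfolding eventually_at_left_field
    by (intro exI[of _ t]) (use assms dividend_path_mono[of t "\<lambda>r. \<eta> r \<omega>" t] in \<open>auto simp: good_path_def\<close>)
  then show "0 \<le> paid h \<omega>" unfolding 1 using tendsto_lowerbound[OF nr(2)] by simp
qed

lemma restart_nonneg: "0 < h \<Longrightarrow> AE \<omega> in \<Omega>. 0 \<le> restart_surplus x t u \<eta> h \<omega>"
  using AE_good_path
  by eventually_elim (use good_not_ruined(4) in \<open>force simp: restart_surplus_def\<close>)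

end

lemma (in prob_space) expectation_cong_AE_complete:
  fixes f g :: "'a \<Rightarrow> real"
  assumes "complete_measure M" "g \<in> borel_measurable M" "AE \<omega> in M. f \<omega> = g \<omega>"
  shows "expectation f = expectation g"
proof (rule integral_cong_AE)
  show "f \<in> borel_measurable M"
    by (rule complete_measure.borel_measurable_AE_cong[OF assms(1,2)]) (use assms(3) in \<open>auto elim!: eventually_mono\<close>)
qed (use assms in auto)

section \<open>Objective of the perturbed pair\<close>

context deviation
begin

abbreviation Y :: "real \<Rightarrow> 'w \<Rightarrow> real" where "Y h \<equiv> restart_surplus x t u \<eta> h"
abbreviation ruined :: "real \<Rightarrow> 'w \<Rightarrow> bool" where "ruined h \<equiv> ruined_before x t u \<eta> h"
abbreviation uh :: "real \<Rightarrow> 'w process" where "uh h \<equiv> perturbed_effort Phi Xi x t u \<eta> h"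
abbreviation \<xi>h :: "real \<Rightarrow> 'w process" where "\<xi>h h \<equiv> perturbed_dividend Phi Xi x t u \<eta> h"
abbreviation Sh :: "real \<Rightarrow> 'w process" where "Sh h \<equiv> surplus (\<lambda>_. x) t (uh h) (\<xi>h h)"
abbreviation D :: "real \<Rightarrow> 'w process" where "D h \<equiv> law_dividend Phi Xi (Y h) (t + h)"
abbreviation S' :: "real \<Rightarrow> 'w process" where
  "S' h \<equiv> surplus (Y h) (t + h) (law_effort Phi Xi (Y h) (t + h)) (D h)"
abbreviation stop :: "real \<Rightarrow> 'w \<Rightarrow> real" where "stop h \<equiv> capped_ruin t h S"

lemma uh_eq: "uh h r \<omega> = (if ruined h \<omega> \<or> r < t + h then u r \<omega> else 0)"
  by (simp add: perturbed_effort_def)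

lemma \<xi>h_eq: "\<xi>h h r \<omega> = (if ruined h \<omega> \<or> r < t + h then \<eta> r \<omega> else left_lim (\<lambda>s. \<eta> s \<omega>) (t + h) + D h r \<omega>)"
  by (simp add: perturbed_dividend_def)

lemma Sh_before:
  assumes r: "ruined h \<omega> \<or> r < t + h"
  shows "Sh h r \<omega> = S r \<omega>"
proof -
  have "(LINT s:{t..r}|lborel. \<mu> + uh h s \<omega>) = (LINT s:{t..r}|lborel. \<mu> + u s \<omega>)"
    unfolding set_lebesgue_integral_def
    by (rule Bochner_Integration.integral_cong) (use r in \<open>auto simp: uh_eq indicator_def\<close>)
  then show ?thesis using r by (simp add: surplus_def S_def \<xi>h_eq)
qed

text \<open>Everything before \<open>t + h\<close> is absorbed in the restart surplus and no effort
  is spent afterwards, so the concatenated equation becomes the one of the restarted law.\<close>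

lemma Sh_after:
  assumes g: "good_path \<omega>" and h: "0 < h" and nr: "\<not> ruined h \<omega>" and r: "t + h \<le> r"
  shows "Sh h r \<omega> = S' h r \<omega>"
proof -
  have \<omega>: "\<omega> \<in> space \<Omega>" using g by (simp add: good_path_def)
  have tr: "t \<le> r" using h r by simp
  have i1: "set_integrable lborel A (\<lambda>s. \<mu> + u s \<omega>)" if "A \<in> sets borel" "A \<subseteq> {t..r}" for A
    by (rule effort_drift_integrable[OF effort \<omega> t_nonneg tr that])
  have sub: "{t..<t + h} \<subseteq> {t..r}" using r by (intro subsetI) auto
  have "set_integrable lborel {t..<t + h} (\<lambda>s. \<mu> + uh h s \<omega>) \<longleftrightarrow> set_integrable lborel {t..<t + h} (\<lambda>s. \<mu> + u s \<omega>)"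
    by (rule set_integrable_cong) (auto simp: uh_eq)
  then have i2: "set_integrable lborel {t..<t + h} (\<lambda>s. \<mu> + uh h s \<omega>)" using i1[of "{t..<t + h}"] sub by simp
  have "set_integrable lborel {t + h..r} (\<lambda>s. \<mu> + uh h s \<omega>) \<longleftrightarrow> set_integrable lborel {t + h..r} (\<lambda>s. \<mu>)"
    by (rule set_integrable_cong) (use nr in \<open>auto simp: uh_eq\<close>)
  moreover have "set_integrable lborel {t + h..r} (\<lambda>s. \<mu>)"
    using r by (auto simp: set_integrable_def intro!: integrable_mult_left integrable_real_indicator)
  ultimately have i3: "set_integrable lborel {t + h..r} (\<lambda>s. \<mu> + uh h s \<omega>)" by simp
  have un: "{t..r} = {t..<t + h} \<union> {t + h..r}" "{t..<t + h} \<inter> {t + h..r} = {}" using h r by auto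
  have "(LINT s:{t..r}|lborel. \<mu> + uh h s \<omega>) = (LINT s:{t..<t + h}|lborel. \<mu> + uh h s \<omega>) + (LINT s:{t + h..r}|lborel. \<mu> + uh h s \<omega>)"
    unfolding un(1) by (rule set_integral_Un[OF un(2) i2 i3])
  also have "(LINT s:{t..<t + h}|lborel. \<mu> + uh h s \<omega>) = (LINT s:{t..<t + h}|lborel. \<mu> + u s \<omega>)"
    unfolding set_lebesgue_integral_def by (rule Bochner_Integration.integral_cong) (auto simp: uh_eq indicator_def)
  also have "\<dots> = drift t u (t + h) \<omega>"
  proof -
    have un': "{t..t + h} = {t..<t + h} \<union> {t + h..t + h}" "{t..<t + h} \<inter> {t + h..t + h} = {}" using h by auto
    have "drift t u (t + h) \<omega> = (LINT s:{t..<t + h}|lborel. \<mu> + u s \<omega>) + (LINT s:{t + h..t + h}|lborel. \<mu> + u s \<omega>)"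
      unfolding drift_def un'(1) by (rule set_integral_Un[OF un'(2)]; rule i1) (use r h in auto)
    moreover have "(LINT s:{t + h..t + h}|lborel. \<mu> + u s \<omega>) = 0"
      using drift_start[of "t + h" u \<omega>] by (simp add: drift_def)
    ultimately show ?thesis by simp
  qed
  also have "(LINT s:{t + h..r}|lborel. \<mu> + uh h s \<omega>) = (LINT s:{t + h..r}|lborel. \<mu>)"
    unfolding set_lebesgue_integral_def by (rule Bochner_Integration.integral_cong) (use nr in \<open>auto simp: uh_eq indicator_def\<close>)
  finally have "Sh h r \<omega> = x + drift t u (t + h) \<omega> + (LINT s:{t + h..r}|lborel. \<mu>) + \<sigma> * (B r \<omega> - B t \<omega>) - (left_lim (\<lambda>s. \<eta> s \<omega>) (t + h) + D h r \<omega>)"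
    using nr r by (simp add: surplus_def \<xi>h_eq)
  then show ?thesis
    using good_not_ruined(3)[OF g h nr] by (simp add: surplus_def controlled_def algebra_simps)
qed

text \<open>Without ruin before \<open>t + h\<close> the surplus has no zero there, so every zero of
  the concatenated surplus, including one at \<open>t + h\<close> itself, is a zero of the restarted
  one.\<close>

lemma ruin_Sh:
  assumes g: "good_path \<omega>" and h: "0 < h"
  shows "ruined h \<omega> \<Longrightarrow> ruin_time t (Sh h) \<omega> = ruin_time t S \<omega>"
    and "\<not> ruined h \<omega> \<Longrightarrow> ruin_time t (Sh h) \<omega> = ruin_time (t + h) (S' h) \<omega>"
proof -
  show "ruined h \<omega> \<Longrightarrow> ruin_time t (Sh h) \<omega> = ruin_time t S \<omega>" by (simp add: ruin_time_def Sh_before)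
  assume nr: "\<not> ruined h \<omega>"
  have "{r. t \<le> r \<and> Sh h r \<omega> = 0} = {r. t + h \<le> r \<and> S' h r \<omega> = 0}"
  proof (intro set_eqI)
    fix r
    show "r \<in> {r. t \<le> r \<and> Sh h r \<omega> = 0} \<longleftrightarrow> r \<in> {r. t + h \<le> r \<and> S' h r \<omega> = 0}"
    proof (cases "r < t + h")
      case True
      then show ?thesis using good_not_ruined(6)[OF g h nr, of r] by (simp add: Sh_before)
    next
      case False
      then show ?thesis using Sh_after[OF g h nr, of r] h by simp
    qed
  qed
  then show "ruin_time t (Sh h) \<omega> = ruin_time (t + h) (S' h) \<omega>" by (simp only: ruin_time_def)
qed

lemma restart_facts:
  assumes h: "0 < h"
  shows "0 \<le> t + h" "Y h \<in> borel_measurable (F (t + h))" "AE \<omega> in \<Omega>. 0 \<le> Y h \<omega>"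
  using t_nonneg h restart_measurable[OF h] restart_nonneg[OF h] by auto

lemma D_facts:
  assumes h: "0 < h"
  shows "AE \<omega> in \<Omega>. dividend_path (t + h) (\<lambda>r. D h r \<omega>)" "\<And>r. t + h \<le> r \<Longrightarrow> D h r \<in> borel_measurable \<Omega>"
proof -
  have "dividend_process (t + h) (D h)"
    using law_solution_reflected[OF x2_pos restart_facts[OF h]] by (simp add: reflected_solution_def)
  then have *: "AE \<omega> in \<Omega>. dividend_path (t + h) (\<lambda>r. D h r \<omega>)" "\<And>r. t + h \<le> r \<Longrightarrow> D h r \<in> borel_measurable (F r)"
    by (auto simp: dividend_process_def adapted_from_def)
  show "AE \<omega> in \<Omega>. dividend_path (t + h) (\<lambda>r. D h r \<omega>)" by (rule *(1))
  show "D h r \<in> borel_measurable \<Omega>" if "t + h \<le> r" for r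
    using *(2)[OF that] by (rule F_measurable[rotated]) (use that restart_facts(1)[OF h] in simp)
qed

lemma \<xi>h_path:
  assumes g: "good_path \<omega>" and h: "0 < h" and D: "dividend_path (t + h) (\<lambda>r. D h r \<omega>)"
  shows "dividend_path t (\<lambda>r. \<xi>h h r \<omega>)"
proof (cases "ruined h \<omega>")
  case True
  then show ?thesis using g by (simp add: \<xi>h_eq good_path_def)
next
  case False
  let ?l = "left_lim (\<lambda>s. \<eta> s \<omega>) (t + h)"
  have eq: "\<xi>h h r \<omega> = (if r < t + h then \<eta> r \<omega> else ?l + D h r \<omega>)" for r using False by (simp add: \<xi>h_eq)
  have \<eta>: "dividend_path t (\<lambda>r. \<eta> r \<omega>)" using g by (simp add: good_path_def)
  note lim = good_not_ruined(2)[OF g h False]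
  have \<eta>l: "\<eta> r \<omega> \<le> ?l" if r: "t \<le> r" "r < t + h" for r
  proof (rule tendsto_lowerbound[OF lim _ trivial_limit_at_left_real])
    show "\<forall>\<^sub>F s in at_left (t + h). \<eta> r \<omega> \<le> \<eta> s \<omega>"
      unfolding eventually_at_left_field using r dividend_path_mono[OF \<eta> r(1)] by (intro exI[of _ r]) auto
  qed
  have mono: "mono_on {t..} (\<lambda>r. \<xi>h h r \<omega>)"
  proof (rule mono_onI)
    fix r s assume rs: "r \<in> {t..}" "s \<in> {t..}" "r \<le> s"
    show "\<xi>h h r \<omega> \<le> \<xi>h h s \<omega>"
      unfolding eq using rs \<eta>l[of r] dividend_path_mono[OF \<eta>, of r s] dividend_path_mono[OF D, of r s] dividend_path_nonneg[OF D, of s]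
      by (auto simp: not_less)
  qed
  show ?thesis
    unfolding dividend_path_def cadlag_from_def
  proof (intro conjI allI impI mono)
    show "0 \<le> \<xi>h h t \<omega>" using dividend_path_nonneg[OF \<eta> order_refl] h by (simp add: eq)
    show "\<exists>l. ((\<lambda>r. \<xi>h h r \<omega>) \<longlongrightarrow> l) (at_left r)" if "t < r" for r by (rule mono_on_left_limit[OF mono that])
    fix r assume r: "t \<le> r"
    show "((\<lambda>r. \<xi>h h r \<omega>) \<longlongrightarrow> \<xi>h h r \<omega>) (at_right r)"
    proof (cases "r < t + h")
      case True
      have "((\<lambda>r. \<eta> r \<omega>) \<longlongrightarrow> \<eta> r \<omega>) (at_right r)" using \<eta> r by (auto simp: dividend_path_def cadlag_from_def)
      moreover have "\<forall>\<^sub>F s in at_right r. \<eta> s \<omega> = \<xi>h h s \<omega>"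
        unfolding eventually_at_right_field using True by (intro exI[of _ "t + h"]) (auto simp: eq)
      ultimately have "((\<lambda>r. \<xi>h h r \<omega>) \<longlongrightarrow> \<eta> r \<omega>) (at_right r)" by (rule Lim_transform_eventually)
      then show ?thesis using True by (simp add: eq)
    next
      case False
      have "((\<lambda>r. D h r \<omega>) \<longlongrightarrow> D h r \<omega>) (at_right r)" using D False by (auto simp: dividend_path_def cadlag_from_def)
      then have "((\<lambda>r. ?l + D h r \<omega>) \<longlongrightarrow> ?l + D h r \<omega>) (at_right r)" by (intro tendsto_intros)
      moreover have "\<forall>\<^sub>F s in at_right r. ?l + D h s \<omega> = \<xi>h h s \<omega>"
        unfolding eventually_at_right_field using False by (intro exI[of _ "r + 1"]) (auto simp: eq)
      ultimately have "((\<lambda>r. \<xi>h h r \<omega>) \<longlongrightarrow> ?l + D h r \<omega>) (at_right r)" by (rule Lim_transform_eventually)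
      then show ?thesis using False by (simp add: eq)
    qed
  qed
qed

definition payout :: "real \<Rightarrow> 'w \<Rightarrow> ennreal" where
  "payout h \<omega> = (\<integral>\<^sup>+r\<in>lifetime t (Sh h) \<omega>. ennreal (\<beta> (r - t)) \<partial>stieltjes t (\<lambda>s. \<xi>h h s \<omega>))"

definition later_payout :: "real \<Rightarrow> 'w \<Rightarrow> ennreal" where
  "later_payout h \<omega> = (\<integral>\<^sup>+r\<in>lifetime (t + h) (S' h) \<omega>. ennreal (\<beta> (r - t)) \<partial>stieltjes (t + h) (\<lambda>s. D h s \<omega>))"

lemma nn_integral_\<beta>_le:
  assumes g: "dividend_path t k" and A: "A \<in> sets borel"
  shows "(\<integral>\<^sup>+r\<in>A. ennreal (\<beta> (r - t)) \<partial>stieltjes t k) \<le> emeasure (stieltjes t k) A"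
proof -
  have "(\<integral>\<^sup>+r\<in>A. ennreal (\<beta> (r - t)) \<partial>stieltjes t k) \<le> (\<integral>\<^sup>+r. indicator A r \<partial>stieltjes t k)"
  proof (rule nn_integral_mono_AE)
    show "AE r in stieltjes t k. ennreal (\<beta> (r - t)) * indicator A r \<le> indicator A r"
      using AE_stieltjes_ge[OF g]
    proof eventually_elim
      case (elim r)
      have "ennreal (\<beta> (r - t)) \<le> ennreal 1" using \<beta>_le_1[of "r - t"] elim by (intro ennreal_leI) simp
      then show ?case by (auto simp: indicator_def)
    qed
  qed
  then show ?thesis using A by simp
qed

text \<open>Payments before \<open>t + h\<close> are bounded by their undiscounted total, since
  \<open>\<beta> \<le> 1\<close>. This overstates the payout, hence understates the objective, which
  is the direction needed. Without earlier ruin the payments from \<open>t + h\<close> on are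
  exactly those of the restarted law.\<close>

lemma payout_le:
  assumes g: "good_path \<omega>" and h: "0 < h" and D: "dividend_path (t + h) (\<lambda>r. D h r \<omega>)"
  shows "payout h \<omega> \<le> ennreal (\<eta> t \<omega> + paid h \<omega>) + later_payout h \<omega>"
proof (cases "ruined h \<omega>")
  case True
  obtain \<tau> where \<tau>: "ruin_time t S \<omega> = ereal \<tau>" "t \<le> \<tau>" "\<tau> < t + h" "S \<tau> \<omega> = 0" "stop h \<omega> = \<tau>" "Y h \<omega> = 0"
    using good_ruined[OF g h True] .
  have \<eta>: "dividend_path t (\<lambda>r. \<eta> r \<omega>)" using g by (simp add: good_path_def)
  have \<xi>: "(\<lambda>s. \<xi>h h s \<omega>) = (\<lambda>s. \<eta> s \<omega>)" using True by (simp add: \<xi>h_eq)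
  have L: "lifetime t (Sh h) \<omega> = {t..\<tau>}" using ruin_Sh(1)[OF g h True] \<tau>(1) by (auto simp: lifetime_def)
  have "payout h \<omega> \<le> emeasure (stieltjes t (\<lambda>s. \<eta> s \<omega>)) {t..\<tau>}"
    unfolding payout_def \<xi> L by (rule nn_integral_\<beta>_le[OF \<eta>]) simp
  also have "\<dots> \<le> emeasure (stieltjes t (\<lambda>s. \<eta> s \<omega>)) {..\<tau>}" by (rule emeasure_mono) auto
  also have "\<dots> = ennreal (\<eta> \<tau> \<omega>)" using \<tau>(2) by (simp add: emeasure_stieltjes_atMost[OF \<eta>])
  also have "\<eta> \<tau> \<omega> = \<eta> t \<omega> + paid h \<omega>" using paid_ruined(1)[OF g h True] \<tau>(5) by simp
  finally show ?thesis by (rule order_trans) simp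
next
  case False
  let ?l = "left_lim (\<lambda>s. \<eta> s \<omega>) (t + h)"
  let ?M = "stieltjes t (\<lambda>s. \<xi>h h s \<omega>)" and ?N = "stieltjes (t + h) (\<lambda>s. D h s \<omega>)"
  let ?L = "lifetime t (Sh h) \<omega>" and ?L' = "lifetime (t + h) (S' h) \<omega>"
  have eq: "\<xi>h h r \<omega> = (if r < t + h then \<eta> r \<omega> else ?l + D h r \<omega>)" for r using False by (simp add: \<xi>h_eq)
  note \<xi> = \<xi>h_path[OF g h D]
  have tt: "t < t + h" using h by simp
  have left: "((\<lambda>r. \<xi>h h r \<omega>) \<longlongrightarrow> ?l) (at_left (t + h))"
    by (rule Lim_transform_eventually[OF good_not_ruined(2)[OF g h False]])
       (use h in \<open>auto simp: eventually_at_left_field eq intro!: exI[of _ t]\<close>)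
  \<comment> \<open>The left limit, because a jump of \<open>\<eta>\<close> at \<open>t + h\<close>
    is not carried out: the law has taken over by then.\<close>
  have Ml: "emeasure ?M {..<t + h} = ennreal ?l" by (rule emeasure_stieltjes_lessThan_eq[OF \<xi> left tt])
  have l0: "0 \<le> ?l" using paid_not_ruined[OF g h False] good_start(1)[OF g] by simp
  have split: "?L = (?L \<inter> {..<t + h}) \<union> ?L'"
  proof -
    have "ereal (t + h) \<le> ruin_time (t + h) (S' h) \<omega>" by (rule ruin_time_ge)
    then show ?thesis using h unfolding lifetime_def ruin_Sh(2)[OF g h False] by auto
  qed
  have bL: "?L \<in> sets borel" "?L' \<in> sets borel" by (rule lifetime_borel)+
  have \<beta>m: "(\<lambda>r. ennreal (\<beta> (r - t)) * indicator A r) \<in> borel_measurable ?M" if "A \<in> sets borel" for A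
  proof -
    have "(\<lambda>r. ennreal (\<beta> (r - t)) * indicator A r) \<in> borel_measurable borel" using \<beta>_measurable[of t] that by measurable
    then show ?thesis by (simp add: measurable_cong_sets[OF sets_stieltjes refl])
  qed
  have "payout h \<omega> \<le> (\<integral>\<^sup>+r. ennreal (\<beta> (r - t)) * indicator (?L \<inter> {..<t + h}) r + ennreal (\<beta> (r - t)) * indicator ?L' r \<partial>?M)"
    unfolding payout_def by (rule nn_integral_mono, subst split) (auto simp: indicator_def)
  also have "\<dots> = (\<integral>\<^sup>+r\<in>?L \<inter> {..<t + h}. ennreal (\<beta> (r - t)) \<partial>?M) + (\<integral>\<^sup>+r\<in>?L'. ennreal (\<beta> (r - t)) \<partial>?M)"
    using bL by (intro nn_integral_add \<beta>m) auto
  also have "(\<integral>\<^sup>+r\<in>?L'. ennreal (\<beta> (r - t)) \<partial>?M) = later_payout h \<omega>"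
    unfolding later_payout_def
  proof (rule nn_integral_stieltjes_cong[OF \<xi> D bL(2)])
    show "(\<lambda>r. ennreal (\<beta> (r - t))) \<in> borel_measurable borel" using \<beta>_measurable[of t] by measurable
    fix a b :: real assume ab: "a \<le> b"
    have H: "{a<..b} \<inter> ?L' = {a<..b} \<inter> {t + h..} \<inter> {r. ereal r \<le> ruin_time (t + h) (S' h) \<omega>}" by (auto simp: lifetime_def)
    \<comment> \<open>Intervals closed at \<open>t + h\<close> are needed besides half-open ones,
      since both measures have an atom there: the first payment of the restarted law.\<close>
    have atMost: "emeasure ?M {t + h..e} = emeasure ?N {t + h..e}" if e: "t + h \<le> e" for e
    proof -
      have "emeasure ?M {t + h..e} = emeasure ?M ({..e} - {..<t + h})" by (rule arg_cong[where f="emeasure ?M"]) auto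
      also have "\<dots> = emeasure ?M {..e} - emeasure ?M {..<t + h}"
        using e by (intro emeasure_Diff) (auto simp: Ml)
      also have "\<dots> = ennreal (?l + D h e \<omega>) - ennreal ?l"
        using e h unfolding Ml emeasure_stieltjes_atMost[OF \<xi>] by (simp add: eq)
      also have "\<dots> = ennreal (D h e \<omega>)" using l0 dividend_path_nonneg[OF D e] by (simp add: ennreal_minus)
      also have "\<dots> = emeasure ?N {..e}" using e by (simp add: emeasure_stieltjes_atMost[OF D])
      also have "\<dots> = emeasure ?N {t + h..e}" by (rule emeasure_eq_AE) (use AE_stieltjes_ge[OF D] in auto)
      finally show ?thesis .
    qed
    have Ioc: "emeasure ?M {d<..e} = emeasure ?N {d<..e}" if "t + h \<le> d" "d \<le> e" for d e
      using that h unfolding emeasure_stieltjes_Ioc[OF \<xi> that(2)] emeasure_stieltjes_Ioc[OF D that(2)] by (simp add: eq)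
    define e where "e = (if ereal b \<le> ruin_time (t + h) (S' h) \<omega> then b else real_of_ereal (ruin_time (t + h) (S' h) \<omega>))"
    have e: "{a<..b} \<inter> {r. ereal r \<le> ruin_time (t + h) (S' h) \<omega>} = {a<..e}"
      using ruin_time_ge[of "t + h" "S' h" \<omega>] unfolding e_def by (cases "ruin_time (t + h) (S' h) \<omega>"; auto)
    have H': "{a<..b} \<inter> ?L' = {a<..e} \<inter> {t + h..}" unfolding H using e by auto
    show "emeasure ?M ({a<..b} \<inter> ?L') = emeasure ?N ({a<..b} \<inter> ?L')"
      unfolding H'
    proof (cases "a < t + h")
      case True
      show "emeasure ?M ({a<..e} \<inter> {t + h..}) = emeasure ?N ({a<..e} \<inter> {t + h..})"
      proof (cases "t + h \<le> e")
        case e: True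
        have "{a<..e} \<inter> {t + h..} = {t + h..e}" using True by auto
        then show ?thesis using atMost[OF e] by simp
      next
        case False
        then have "{a<..e} \<inter> {t + h..} = {}" by auto
        then show ?thesis by simp
      qed
    next
      case False
      show "emeasure ?M ({a<..e} \<inter> {t + h..}) = emeasure ?N ({a<..e} \<inter> {t + h..})"
      proof (cases "a \<le> e")
        case True
        have "{a<..e} \<inter> {t + h..} = {a<..e}" using False by auto
        then show ?thesis using Ioc[of a e] True False by simp
      next
        case False
        then have "{a<..e} \<inter> {t + h..} = {}" by auto
        then show ?thesis by simp
      qed
    qed
  qed
  also have "(\<integral>\<^sup>+r\<in>?L \<inter> {..<t + h}. ennreal (\<beta> (r - t)) \<partial>?M) \<le> emeasure ?M (?L \<inter> {..<t + h})"
    using bL by (intro nn_integral_\<beta>_le[OF \<xi>]) auto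
  also have "\<dots> \<le> emeasure ?M {..<t + h}" by (rule emeasure_mono) auto
  also have "\<dots> = ennreal (\<eta> t \<omega> + paid h \<omega>)" using paid_not_ruined(1)[OF g h False] by (simp add: Ml)
  finally show ?thesis by (simp add: add_right_mono)
qed

lemma \<eta>_measurable: "t \<le> r \<Longrightarrow> \<eta> r \<in> borel_measurable \<Omega>"
  using dividend F_measurable[of r] t_nonneg by (auto simp: dividend_process_def adapted_from_def)

lemma ruined_sets: "0 < h \<Longrightarrow> {\<omega> \<in> space \<Omega>. ruined h \<omega>} \<in> sets \<Omega>"
  using F_sets[OF _ ruined_measurable] t_nonneg by simp

lemma Y_measurable: "0 < h \<Longrightarrow> Y h \<in> borel_measurable \<Omega>"
  using F_measurable[OF restart_facts(1,2)] .

lemma payout_measurable: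
  assumes h: "0 < h" shows "payout h \<in> borel_measurable \<Omega>"
  unfolding payout_def[abs_def] lifetime_def
proof (rule stieltjes_integral_measurable[where C=1])
  have t0: "0 \<le> t + h" using t_nonneg h by simp
  show "AE \<omega> in \<Omega>. dividend_path t (\<lambda>r. \<xi>h h r \<omega>)"
    using AE_good_path D_facts(1)[OF h] by eventually_elim (rule \<xi>h_path[OF _ h])
  show "\<xi>h h r \<in> borel_measurable \<Omega>" if r: "t \<le> r" for r
  proof (cases "r < t + h")
    case True
    then show ?thesis using \<eta>_measurable[OF r] by (simp add: \<xi>h_eq[abs_def])
  next
    case False
    have c: "controlled x t u (t + h) \<in> borel_measurable \<Omega>"
      using F_measurable[OF t0 controlled_adapted[OF effort t_nonneg]] h by simp
    show ?thesis
    proof (rule borel_measurable_AE_cong)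
      \<comment> \<open>The left limit of \<open>\<eta>\<close> is expressed through
        \<open>controlled\<close> and \<open>Y\<close>, whose measurability is already
        known.\<close>
      show "(\<lambda>\<omega>. if ruined h \<omega> then \<eta> r \<omega> else controlled x t u (t + h) \<omega> - Y h \<omega> + D h r \<omega>) \<in> borel_measurable \<Omega>"
        using c Y_measurable[OF h] D_facts(2)[OF h, of r] False \<eta>_measurable[OF r] ruined_sets[OF h]
        by (intro measurable_If borel_measurable_add borel_measurable_diff) auto
      show "AE \<omega> in \<Omega>. (if ruined h \<omega> then \<eta> r \<omega> else controlled x t u (t + h) \<omega> - Y h \<omega> + D h r \<omega>) = \<xi>h h r \<omega>"
        using AE_good_path by eventually_elim (use False good_not_ruined(3)[OF _ h] in \<open>auto simp: \<xi>h_eq\<close>)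
    qed
  qed
  show "{\<omega> \<in> space \<Omega>. ereal r < ruin_time t (Sh h) \<omega>} \<in> sets \<Omega>" if r: "t \<le> r" for r
  proof (cases "r < t + h")
    case True
    show ?thesis
    proof (rule in_sets_AE)
      show "{\<omega> \<in> space \<Omega>. ereal r < ruin_time t S \<omega>} \<in> sets \<Omega>" using F_sets[OF _ S_stop[OF r]] t_nonneg r by simp
      show "AE \<omega> in \<Omega>. \<omega> \<in> {\<omega> \<in> space \<Omega>. ereal r < ruin_time t S \<omega>} \<longleftrightarrow> \<omega> \<in> {\<omega> \<in> space \<Omega>. ereal r < ruin_time t (Sh h) \<omega>}"
        using AE_good_path
      proof eventually_elim
        case (elim \<omega>)
        show ?case
        proof (cases "ruined h \<omega>")
          case nr: False
          have "ereal r < ereal (t + h)" using True by simp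
          moreover have "ereal (t + h) \<le> ruin_time t S \<omega>" using nr by (simp add: ruined_before_eq)
          moreover have "ereal (t + h) \<le> ruin_time t (Sh h) \<omega>"
            unfolding ruin_Sh(2)[OF elim h nr] by (rule ruin_time_ge)
          ultimately have "ereal r < ruin_time t S \<omega>" "ereal r < ruin_time t (Sh h) \<omega>"
            using less_le_trans by blast+
          then show ?thesis by simp
        qed (simp add: ruin_Sh(1)[OF elim h])
      qed
    qed auto
  next
    case False
    show ?thesis
    proof (rule in_sets_AE)
      show "{\<omega> \<in> space \<Omega>. ereal r < ruin_time (t + h) (S' h) \<omega>} - {\<omega> \<in> space \<Omega>. ruined h \<omega>} \<in> sets \<Omega>"
        using law_surplus_stop[OF t0 _ restart_facts(2,3)[OF h], of r] False ruined_sets[OF h] by auto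
      show "AE \<omega> in \<Omega>. \<omega> \<in> {\<omega> \<in> space \<Omega>. ereal r < ruin_time (t + h) (S' h) \<omega>} - {\<omega> \<in> space \<Omega>. ruined h \<omega>} \<longleftrightarrow>
        \<omega> \<in> {\<omega> \<in> space \<Omega>. ereal r < ruin_time t (Sh h) \<omega>}"
        using AE_good_path
      proof eventually_elim
        case (elim \<omega>)
        show ?case
        proof (cases "ruined h \<omega>")
          case True
          have "ereal (t + h) \<le> ereal r" using False by simp
          then have "\<not> ereal r < ruin_time t S \<omega>"
            using True by (auto simp: ruined_before_eq not_less intro: order_trans[of _ "ereal (t + h)"] dest: less_imp_le)
          then show ?thesis using True ruin_Sh(1)[OF elim h True] by simp
        next
          case nr: False
          then show ?thesis by (simp add: ruin_Sh(2)[OF elim h nr])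
        qed
      qed
    qed auto
  qed
qed (use ruin_time_ge \<beta>_continuous \<beta>_nonneg \<beta>_le_1 in auto)

text \<open>The fixed interval with an indicator, and the summand 0, bring the stopped integral into
  the form of \<open>effort_integral_measurable\<close>.\<close>

definition effort_cost :: "real \<Rightarrow> 'w \<Rightarrow> real" where
  "effort_cost h \<omega> = (LINT s:{t..t + h}|lborel. (0 + \<beta> (s - t) * u s \<omega>) * indicator {..stop h \<omega>} s)"

lemma stop_bounds: "0 < h \<Longrightarrow> t \<le> stop h \<omega>" "0 < h \<Longrightarrow> stop h \<omega> \<le> t + h"
  using capped_ruin_bounds(1,2)[of h t S \<omega>] by auto

lemma effort_cost_eq:
  assumes \<omega>: "\<omega> \<in> space \<Omega>" and h: "0 < h"
  shows "effort_cost h \<omega> = (LINT s:{t..stop h \<omega>}|lborel. \<beta> (s - t) * u s \<omega>)"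
  unfolding effort_cost_def set_lebesgue_integral_def
  by (rule Bochner_Integration.integral_cong) (use stop_bounds[OF h, of \<omega>] in \<open>auto simp: indicator_def\<close>)

text \<open>The law spends no effort from \<open>t + h\<close> on, so the integral ends at ruin or
  \<open>t + h\<close>, whichever is earlier; the end point \<open>t + h\<close> is a null
  set.\<close>

lemma perturbed_effort_integral:
  assumes g: "good_path \<omega>" and h: "0 < h"
  shows "(LINT r:lifetime t (Sh h) \<omega>|lborel. \<beta> (r - t) * uh h r \<omega>) = effort_cost h \<omega>"
proof -
  have \<omega>: "\<omega> \<in> space \<Omega>" using g by (simp add: good_path_def)
  let ?A = "{t..<t + h} \<inter> {..stop h \<omega>}"
  have si: "set_integrable lborel A (\<lambda>s. \<beta> (s - t) * u s \<omega>)" if "A \<in> sets borel" "A \<subseteq> {t..t + h}" for A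
    by (rule effort_set_integrable[where C=1 and r="t + h", OF effort \<omega> t_nonneg _ \<beta>_measurable _ that])
       (use h \<beta>_nonneg \<beta>_le_1 in auto)
  have stop_le: "r \<le> stop h \<omega> \<longleftrightarrow> ereal r \<le> ruin_time t S \<omega>" if "r < t + h" for r
  proof -
    show ?thesis
    proof
      assume "r \<le> stop h \<omega>"
      then show "ereal r \<le> ruin_time t S \<omega>"
        using capped_ruin_bounds(3)[of h t S \<omega>] h by (auto intro: order_trans[of "ereal r" "ereal (stop h \<omega>)"])
    next
      assume *: "ereal r \<le> ruin_time t S \<omega>"
      show "r \<le> stop h \<omega>"
      proof (rule ccontr)
        assume "\<not> r \<le> stop h \<omega>"
        then have "stop h \<omega> < t + h \<and> ereal (stop h \<omega>) < ruin_time t S \<omega>"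
          using * that by (auto intro: less_le_trans[of "ereal (stop h \<omega>)" "ereal r"])
        then show False using capped_ruin_iff[of h "stop h \<omega>" t S \<omega>] h by simp
      qed
    qed
  qed
  have "(LINT r:lifetime t (Sh h) \<omega>|lborel. \<beta> (r - t) * uh h r \<omega>) = (LINT s:?A|lborel. \<beta> (s - t) * u s \<omega>)"
    unfolding set_lebesgue_integral_def
  proof (rule Bochner_Integration.integral_cong[OF refl])
    fix r
    show "indicator (lifetime t (Sh h) \<omega>) r *\<^sub>R (\<beta> (r - t) * uh h r \<omega>) = indicator ?A r *\<^sub>R (\<beta> (r - t) * u r \<omega>)"
    proof (cases "ruined h \<omega>")
      case True
      then have "ruin_time t S \<omega> < ereal (t + h)" by (simp add: ruined_before_eq)
      then have "r < t + h" if "ereal r \<le> ruin_time t S \<omega>" using that by (metis ereal_less_eq(3) leD le_less_trans less_imp_le not_le_imp_less)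
      then show ?thesis using True stop_le[of r] ruin_Sh(1)[OF g h True] by (auto simp: lifetime_def uh_eq indicator_def)
    next
      case False
      then show ?thesis
      proof (cases "r < t + h")
        case True
        have "ereal r \<le> ruin_time (t + h) (S' h) \<omega>" using True ruin_time_ge[of "t + h" "S' h" \<omega>] by (auto intro: order_trans[of _ "ereal (t + h)"])
        moreover have "r \<le> stop h \<omega>" using True good_not_ruined(1)[OF g h False] by simp
        ultimately show ?thesis using True ruin_Sh(2)[OF g h False] by (auto simp: lifetime_def uh_eq indicator_def)
      qed (simp add: uh_eq indicator_def)
    qed
  qed
  also have "\<dots> = (LINT s:{t..stop h \<omega>}|lborel. \<beta> (s - t) * u s \<omega>)"
    unfolding set_lebesgue_integral_def
  proof (rule integral_cong_AE)
    show "(\<lambda>s. indicator ?A s *\<^sub>R (\<beta> (s - t) * u s \<omega>)) \<in> borel_measurable lborel"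
    proof -
      have "?A \<subseteq> {t..t + h}" by (intro subsetI) auto
      then have "set_integrable lborel ?A (\<lambda>s. \<beta> (s - t) * u s \<omega>)" by (intro si) auto
      then show ?thesis unfolding set_integrable_def by (rule borel_measurable_integrable)
    qed
    show "(\<lambda>s. indicator {t..stop h \<omega>} s *\<^sub>R (\<beta> (s - t) * u s \<omega>)) \<in> borel_measurable lborel"
    proof -
      have "{t..stop h \<omega>} \<subseteq> {t..t + h}" using stop_bounds[OF h, of \<omega>] by (intro subsetI) auto
      then have "set_integrable lborel {t..stop h \<omega>} (\<lambda>s. \<beta> (s - t) * u s \<omega>)" by (intro si) auto
      then show ?thesis unfolding set_integrable_def by (rule borel_measurable_integrable)
    qed
    show "AE s in lborel. indicator ?A s *\<^sub>R (\<beta> (s - t) * u s \<omega>) = indicator {t..stop h \<omega>} s *\<^sub>R (\<beta> (s - t) * u s \<omega>)"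
      using AE_lborel_singleton[of "t + h"]
      by eventually_elim (use stop_bounds[OF h, of \<omega>] in \<open>auto simp: indicator_def\<close>)
  qed
  finally show ?thesis using effort_cost_eq[OF \<omega> h] by simp
qed

end

lemma (in prob_space) bounded_convergence_at_right:
  fixes f :: "real \<Rightarrow> 'a \<Rightarrow> real"
  assumes f: "\<And>h. 0 < h \<Longrightarrow> h < 1 \<Longrightarrow> f h \<in> borel_measurable M" and g: "g \<in> borel_measurable M"
    and lim: "AE \<omega> in M. ((\<lambda>h. f h \<omega>) \<longlongrightarrow> g \<omega>) (at_right 0)"
    and C: "\<And>h. 0 < h \<Longrightarrow> h < 1 \<Longrightarrow> AE \<omega> in M. \<bar>f h \<omega>\<bar> \<le> C"
  shows "((\<lambda>h. expectation (f h)) \<longlongrightarrow> expectation g) (at_right 0)"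
proof (rule tendsto_at_right_sequentially[of 0 1])
  fix s :: "nat \<Rightarrow> real" assume s: "\<And>n. 0 < s n" "\<And>n. s n < 1" "s \<longlonglongrightarrow> 0"
  have fl: "filterlim s (at_right 0) sequentially"
  proof -
    have "s n \<in> {0<..} \<and> s n \<noteq> 0" for n using s(1)[of n] by simp
    then have "\<forall>\<^sub>F n in sequentially. s n \<in> {0<..} \<and> s n \<noteq> 0" by simp
    then show ?thesis unfolding filterlim_at using s(3) by simp
  qed
  show "(\<lambda>n. expectation (f (s n))) \<longlonglongrightarrow> expectation g"
  proof (rule integral_dominated_convergence[where w="\<lambda>_. C"])
    show "AE \<omega> in M. (\<lambda>n. f (s n) \<omega>) \<longlonglongrightarrow> g \<omega>"
      using lim by eventually_elim (rule filterlim_compose[OF _ fl])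
    show "AE \<omega> in M. norm (f (s n) \<omega>) \<le> C" for n using C[OF s(1,2)] by simp
  qed (use f g s in auto)
qed simp

lemma exp_quotient_tendsto: "((\<lambda>h. (1 - exp (- d * h)) / h) \<longlongrightarrow> d) (at_right (0::real))"
proof -
  have "((\<lambda>h. exp (- d * h)) has_real_derivative - d) (at 0)" by (auto intro!: derivative_eq_intros)
  then have "((\<lambda>h. (exp (- d * h) - 1) / h) \<longlongrightarrow> - d) (at 0)" by (simp add: has_field_derivative_iff)
  then have "((\<lambda>h. - ((exp (- d * h) - 1) / h)) \<longlongrightarrow> - (- d)) (at 0)" by (rule tendsto_minus)
  then have "((\<lambda>h. (1 - exp (- d * h)) / h) \<longlongrightarrow> d) (at 0)" by (simp add: minus_divide_left)
  then show ?thesis by (rule filterlim_at_split[THEN iffD1, THEN conjunct2])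
qed

section \<open>First order expansion of the perturbed objective\<close>

context deviation
begin

text \<open>The bracket is \<open>f (Y h \<omega>) (t + h) t\<close>, the continuation cost valued
  at \<open>t\<close>. Together with the effort cost and undiscounted early dividends it gives, in
  expectation, a lower bound for the perturbed objective.\<close>

definition gain :: "real \<Rightarrow> 'w \<Rightarrow> real" where
  "gain h \<omega> = effort_cost h \<omega> - c * (\<eta> t \<omega> + paid h \<omega>) +
     (w 1 * exp (- \<delta> 1 * h) * U (\<delta> 1) (Y h \<omega>) + w 2 * exp (- \<delta> 2 * h) * U (\<delta> 2) (Y h \<omega>))"

lemma M_nonneg: "0 \<le> M" using M_pos by simp

lemma effort_cost_measurable: assumes h: "0 < h" shows "effort_cost h \<in> borel_measurable \<Omega>"
proof -
  have "effort_cost h \<in> borel_measurable (F (t + h))"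
    unfolding effort_cost_def[abs_def]
    by (rule effort_integral_measurable[OF effort t_nonneg _ \<beta>_measurable capped_measurable]) (use h in auto)
  then show ?thesis using F_measurable restart_facts(1)[OF h] by blast
qed

text \<open>\<open>E\<close> is the undiscounted effort up to the stopping time. It is of order
  \<open>h\<close>, and \<open>\<beta>\<close> drops below 1 at most at rate
  \<open>\<delta> 1 + \<delta> 2\<close>, so discounting it costs only an amount of order
  \<open>h^2\<close>.\<close>

lemma effort_part:
  assumes \<omega>: "\<omega> \<in> space \<Omega>" and h: "0 < h"
  defines "E \<equiv> drift t u (stop h \<omega>) \<omega> - \<mu> * (stop h \<omega> - t)"
  shows "0 \<le> E" "E \<le> M * h" "(1 - (\<delta> 1 + \<delta> 2) * h) * E \<le> effort_cost h \<omega>" "effort_cost h \<omega> \<le> M * h" "0 \<le> effort_cost h \<omega>"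
    "0 \<le> drift t u (stop h \<omega>) \<omega>" "drift t u (stop h \<omega>) \<omega> \<le> (\<mu> + M) * h"
proof -
  let ?s = "stop h \<omega>"
  note s = stop_bounds[OF h, of \<omega>]
  have i1: "set_integrable lborel {t..?s} (\<lambda>s. \<phi> s * u s \<omega>)" if "\<phi> \<in> borel_measurable borel" "\<And>s. t \<le> s \<Longrightarrow> s \<le> ?s \<Longrightarrow> \<bar>\<phi> s\<bar> \<le> C" for \<phi> C
    by (rule effort_set_integrable[OF effort \<omega> t_nonneg s(1) that]) auto
  have iu: "set_integrable lborel {t..?s} (\<lambda>s. u s \<omega>)" using i1[of "\<lambda>_. 1" 1] by simp
  have i\<mu>: "set_integrable lborel {t..?s} (\<lambda>s. k::real)" for k
    using s by (auto simp: set_integrable_def intro!: integrable_mult_left integrable_real_indicator)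
  have i\<beta>: "set_integrable lborel {t..?s} (\<lambda>s. \<beta> (s - t) * u s \<omega>)"
  proof (rule i1[OF measurable_compose[OF _ \<beta>_measurable]])
    show "\<bar>\<beta> (r - t)\<bar> \<le> 1" if "t \<le> r" "r \<le> ?s" for r using \<beta>_nonneg[of "r - t"] \<beta>_le_1[of "r - t"] that by simp
  qed simp
  have ik: "set_integrable lborel {t..?s} (\<lambda>s. (1 - (\<delta> 1 + \<delta> 2) * h) * u s \<omega>)" using iu by (rule set_integrable_mult_right)
  have const: "(LINT s:{t..?s}|lborel. k) = k * (?s - t)" for k :: real
    using s by (simp add: set_lebesgue_integral_def mult.commute)
  have "drift t u ?s \<omega> = (LINT s:{t..?s}|lborel. \<mu>) + (LINT s:{t..?s}|lborel. u s \<omega>)"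
    unfolding drift_def by (rule set_integral_add(2)[OF i\<mu> iu])
  then have E: "E = (LINT s:{t..?s}|lborel. u s \<omega>)" by (simp add: E_def const)
  have ub: "0 \<le> u s \<omega> \<and> u s \<omega> \<le> M" if "t \<le> s" for s using effort_bounds[OF effort that \<omega>] .
  show E0: "0 \<le> E" unfolding E set_lebesgue_integral_def
    by (intro Bochner_Integration.integral_nonneg) (use ub in \<open>auto simp: indicator_def\<close>)
  have Mh: "M * (?s - t) \<le> M * h" using s M_nonneg by (intro mult_left_mono) auto
  have "E \<le> (LINT s:{t..?s}|lborel. M)" unfolding E by (rule set_integral_mono[OF iu i\<mu>]) (use ub in auto)
  then show E1: "E \<le> M * h" using Mh by (simp add: const)
  have "(1 - (\<delta> 1 + \<delta> 2) * h) * E = (LINT s:{t..?s}|lborel. (1 - (\<delta> 1 + \<delta> 2) * h) * u s \<omega>)" unfolding E by simp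
  also have "\<dots> \<le> (LINT s:{t..?s}|lborel. \<beta> (s - t) * u s \<omega>)"
  proof (rule set_integral_mono[OF ik i\<beta>])
    fix r assume r: "r \<in> {t..?s}"
    have "(\<delta> 1 + \<delta> 2) * (r - t) \<le> (\<delta> 1 + \<delta> 2) * h" using \<delta>_pos r s by (intro mult_left_mono) auto
    then have "1 - (\<delta> 1 + \<delta> 2) * h \<le> \<beta> (r - t)" using \<beta>_ge[of "r - t"] r by simp
    then show "(1 - (\<delta> 1 + \<delta> 2) * h) * u r \<omega> \<le> \<beta> (r - t) * u r \<omega>" using ub r by (intro mult_right_mono) auto
  qed
  also have "\<dots> = effort_cost h \<omega>" using effort_cost_eq[OF \<omega> h] by simp
  finally show "(1 - (\<delta> 1 + \<delta> 2) * h) * E \<le> effort_cost h \<omega>" .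
  have "effort_cost h \<omega> \<le> (LINT s:{t..?s}|lborel. u s \<omega>)"
    unfolding effort_cost_eq[OF \<omega> h]
  proof (rule set_integral_mono[OF i\<beta> iu])
    fix r assume r: "r \<in> {t..?s}"
    have "\<beta> (r - t) * u r \<omega> \<le> 1 * u r \<omega>" using \<beta>_le_1[of "r - t"] ub r by (intro mult_right_mono) auto
    then show "\<beta> (r - t) * u r \<omega> \<le> u r \<omega>" by simp
  qed
  then show "effort_cost h \<omega> \<le> M * h" using E1 E by simp
  show "0 \<le> effort_cost h \<omega>" unfolding effort_cost_eq[OF \<omega> h] set_lebesgue_integral_def
    by (intro Bochner_Integration.integral_nonneg) (use ub \<beta>_nonneg in \<open>auto simp: indicator_def intro!: mult_nonneg_nonneg\<close>)
  show "0 \<le> drift t u ?s \<omega>" "drift t u ?s \<omega> \<le> (\<mu> + M) * h"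
  proof -
    note d = drift_increment[OF effort \<omega> t_nonneg order_refl s(1) less_imp_le[OF \<mu>_pos], unfolded drift_start]
    show "0 \<le> drift t u ?s \<omega>" using d(1) by simp
    have "(\<mu> + M) * (?s - t) \<le> (\<mu> + M) * h" using s \<mu>_pos M_nonneg by (intro mult_left_mono) auto
    then show "drift t u ?s \<omega> \<le> (\<mu> + M) * h" using d(2) by simp
  qed
qed

lemma drift_stop_measurable: assumes h: "0 < h" shows "(\<lambda>\<omega>. drift t u (stop h \<omega>) \<omega>) \<in> borel_measurable \<Omega>"
proof -
  have "(\<lambda>\<omega>. LINT l:{t..t + h}|lborel. (\<mu> + 1 * u l \<omega>) * indicator {..stop h \<omega>} l) \<in> borel_measurable (F (t + h))"
    by (rule effort_integral_measurable[OF effort t_nonneg _ _ capped_measurable]) (use h in auto)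
  moreover have "(LINT l:{t..t + h}|lborel. (\<mu> + 1 * u l \<omega>) * indicator {..stop h \<omega>} l) = drift t u (stop h \<omega>) \<omega>" for \<omega>
    unfolding drift_def set_lebesgue_integral_def
    by (rule Bochner_Integration.integral_cong) (use stop_bounds[OF h, of \<omega>] in \<open>auto simp: indicator_def\<close>)
  ultimately show ?thesis using F_measurable restart_facts(1)[OF h] by simp
qed

lemma stopped_B:
  assumes h: "0 < h" "h \<le> 1" and Z: "Z \<in> borel_measurable (F t)" "\<And>\<omega>. \<omega> \<in> space \<Omega> \<Longrightarrow> \<bar>Z \<omega>\<bar> \<le> K"
  shows "integrable \<Omega> (\<lambda>\<omega>. Z \<omega> * (B (stop h \<omega>) \<omega> - B t \<omega>))" "expectation (\<lambda>\<omega>. Z \<omega> * (B (stop h \<omega>) \<omega> - B t \<omega>)) = 0"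
proof -
  have s: "t \<le> stop h \<omega> \<and> stop h \<omega> \<le> t + real 1" for \<omega> using stop_bounds[OF h(1), of \<omega>] h(2) by auto
  have st: "{\<omega> \<in> space \<Omega>. r < stop h \<omega>} \<in> sets (F r)" if "t \<le> r" for r
    by (rule capped_ruin_adapted[OF less_imp_le[OF h(1)] t_nonneg that S_stop[OF that]])
  show "integrable \<Omega> (\<lambda>\<omega>. Z \<omega> * (B (stop h \<omega>) \<omega> - B t \<omega>))" "expectation (\<lambda>\<omega>. Z \<omega> * (B (stop h \<omega>) \<omega> - B t \<omega>)) = 0"
    using stopped_increment_expectation[OF t_nonneg Z s st] by auto
qed

lemma Y_paid: "Y h \<omega> = x + drift t u (stop h \<omega>) \<omega> + \<sigma> * (B (stop h \<omega>) \<omega> - B t \<omega>) - \<eta> t \<omega> - paid h \<omega>"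
  by (simp add: paid_def controlled_def)

lemma paid_nonneg: "0 < h \<Longrightarrow> good_path \<omega> \<Longrightarrow> 0 \<le> paid h \<omega>"
  using paid_ruined(2) paid_not_ruined(2) by blast

lemma Y_nonneg: "0 < h \<Longrightarrow> good_path \<omega> \<Longrightarrow> 0 \<le> Y h \<omega>"
  using good_not_ruined(4) by (cases "ruined h \<omega>") (auto simp: restart_surplus_def)

text \<open>The dividends have no a priori bound here. But they and the restart surplus are
  nonnegative and add up to the surplus without dividends, which is integrable: its Brownian part by
  optional stopping, its drift by boundedness.\<close>

lemma integrable_parts:
  assumes h: "0 < h" "h \<le> 1"
  shows "integrable \<Omega> (\<eta> t)" "integrable \<Omega> (Y h)" "integrable \<Omega> (paid h)" "integrable \<Omega> (effort_cost h)"
    "\<And>d. 0 < d \<Longrightarrow> integrable \<Omega> (\<lambda>\<omega>. U d (Y h \<omega>))"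
proof -
  show i\<eta>: "integrable \<Omega> (\<eta> t)"
  proof (rule integrable_const_bound[of _ x])
    show "AE \<omega> in \<Omega>. norm (\<eta> t \<omega>) \<le> x"
      using AE_good_path
    proof eventually_elim
      case (elim \<omega>)
      show ?case using good_start[OF elim] by simp
    qed
  qed (simp add: \<eta>_measurable)
  have iB: "integrable \<Omega> (\<lambda>\<omega>. B (stop h \<omega>) \<omega> - B t \<omega>)"
    using stopped_B(1)[OF h, of "\<lambda>_. 1" 1] by simp
  have id: "integrable \<Omega> (\<lambda>\<omega>. drift t u (stop h \<omega>) \<omega>)"
    by (rule integrable_const_bound[of _ "(\<mu> + M) * h", OF _ drift_stop_measurable[OF h(1)]])
       (use effort_part(6,7)[OF _ h(1)] in \<open>auto intro!: AE_I2\<close>)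
  have ic: "integrable \<Omega> (\<lambda>\<omega>. x + drift t u (stop h \<omega>) \<omega> + \<sigma> * (B (stop h \<omega>) \<omega> - B t \<omega>))"
    using iB id by (intro Bochner_Integration.integrable_add integrable_mult_right) auto
  show iY: "integrable \<Omega> (Y h)"
  proof (rule Bochner_Integration.integrable_bound[OF ic Y_measurable[OF h(1)]])
    show "AE \<omega> in \<Omega>. norm (Y h \<omega>) \<le> norm (x + drift t u (stop h \<omega>) \<omega> + \<sigma> * (B (stop h \<omega>) \<omega> - B t \<omega>))"
      using AE_good_path
    proof eventually_elim
      case (elim \<omega>)
      show ?case using Y_nonneg[OF h(1) elim] paid_nonneg[OF h(1) elim] good_start(1)[OF elim] Y_paid[of h \<omega>] by simp
    qed
  qed
  have "integrable \<Omega> (\<lambda>\<omega>. x + drift t u (stop h \<omega>) \<omega> + \<sigma> * (B (stop h \<omega>) \<omega> - B t \<omega>) - \<eta> t \<omega> - Y h \<omega>)"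
    using ic i\<eta> iY by (intro Bochner_Integration.integrable_diff)
  then show "integrable \<Omega> (paid h)" by (simp add: paid_def[abs_def] controlled_def)
  show "integrable \<Omega> (effort_cost h)"
    by (rule integrable_const_bound[of _ "M * h", OF _ effort_cost_measurable[OF h(1)]])
       (use effort_part(4,5)[OF _ h(1)] in \<open>auto intro!: AE_I2\<close>)
  fix d :: real assume d: "0 < d"
  have ib: "integrable \<Omega> (\<lambda>\<omega>. - U d x2 + c * Y h \<omega>)" using iY by simp
  show "integrable \<Omega> (\<lambda>\<omega>. U d (Y h \<omega>))"
  proof (rule Bochner_Integration.integrable_bound[OF ib measurable_compose[OF Y_measurable[OF h(1)] U_measurable[OF d]]])
    show "AE \<omega> in \<Omega>. norm (U d (Y h \<omega>)) \<le> norm (- U d x2 + c * Y h \<omega>)"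
      using AE_good_path
    proof eventually_elim
      case (elim \<omega>)
      show ?case using U_bound[OF d Y_nonneg[OF h(1) elim]] U_nonpos[OF d Y_nonneg[OF h(1) elim]] by simp
    qed
  qed
qed

lemma gain_integrable: assumes h: "0 < h" "h \<le> 1" shows "integrable \<Omega> (gain h)"
  unfolding gain_def[abs_def] using integrable_parts(1,3,4)[OF h] integrable_parts(5)[OF h] \<delta>_pos
  by (intro Bochner_Integration.integrable_add Bochner_Integration.integrable_diff integrable_mult_right) auto

text \<open>The integrability condition makes the expected payout finite, so the objective splits
  into effort and dividends. Dividends enter with a negative sign, so the upper bounds
  \<open>payout_le\<close> and \<open>law_\<beta>_payout\<close> at the random restart level give a
  lower bound.\<close>

lemma J_ge_gain:
  assumes h: "0 < h" "h \<le> 1" and int: "perturbed_integrable Phi Xi x t u \<eta> h"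
  shows "expectation (gain h) \<le> J x t (uh h) (\<xi>h h)"
proof -
  note i = integrable_parts[OF h]
  have Lb: "lifetime t (Sh h) \<omega> \<in> sets borel" for \<omega> by (rule lifetime_borel)
  have Km: "payout h \<in> borel_measurable \<Omega>" by (rule payout_measurable[OF h(1)])
  have "(\<integral>\<^sup>+\<omega>. ennreal c * payout h \<omega> \<partial>\<Omega>) < \<infinity>"
    using int unfolding perturbed_integrable_def integrable_pair_def Let_def payout_def nn_integral_\<beta>_c[OF sets_stieltjes lifetime_borel] by simp
  then have "ennreal c * (\<integral>\<^sup>+\<omega>. payout h \<omega> \<partial>\<Omega>) < \<infinity>" by (simp only: nn_integral_cmult[OF Km])
  then have fin: "(\<integral>\<^sup>+\<omega>. payout h \<omega> \<partial>\<Omega>) < \<infinity>" using c_pos by (auto simp: ennreal_mult_less_top)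
  have J: "J x t (uh h) (\<xi>h h) = expectation (\<lambda>\<omega>. effort_cost h \<omega> - c * enn2real (payout h \<omega>))"
    unfolding J_def Let_def LINT_eq_enn2real[OF sets_stieltjes lifetime_borel \<beta>_measurable \<beta>_nonneg] payout_def[symmetric]
  proof (rule expectation_cong_AE_complete[OF complete_measure_axioms])
    show "(\<lambda>\<omega>. effort_cost h \<omega> - c * enn2real (payout h \<omega>)) \<in> borel_measurable \<Omega>"
      using effort_cost_measurable[OF h(1)] Km by measurable
    show "AE \<omega> in \<Omega>. (LINT r:lifetime t (Sh h) \<omega>|lborel. \<beta> (r - t) * uh h r \<omega>) - c * enn2real (payout h \<omega>)
      = effort_cost h \<omega> - c * enn2real (payout h \<omega>)"
      using AE_good_path by eventually_elim (simp only: perturbed_effort_integral[OF _ h(1)])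
  qed
  note K = expectation_enn2real[OF Km fin]
  define R where "R = expectation (\<lambda>\<omega>. \<eta> t \<omega> + paid h \<omega>) +
    (w 1 * exp (- \<delta> 1 * h) * expectation (\<lambda>\<omega>. - U (\<delta> 1) (Y h \<omega>) / c) + w 2 * exp (- \<delta> 2 * h) * expectation (\<lambda>\<omega>. - U (\<delta> 2) (Y h \<omega>) / c))"
  have Unn: "AE \<omega> in \<Omega>. 0 \<le> - U d (Y h \<omega>) / c" if "0 < d" for d
    using AE_good_path
  proof eventually_elim
    case (elim \<omega>)
    show ?case using U_nonpos[OF that Y_nonneg[OF h(1) elim]] c_pos by (intro divide_nonneg_pos) auto
  qed
  have Ui: "integrable \<Omega> (\<lambda>\<omega>. - U d (Y h \<omega>) / c)" if "0 < d" for d using i(5)[OF that] by simp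
  have En: "(\<integral>\<^sup>+\<omega>. ennreal (- U d (Y h \<omega>) / c) \<partial>\<Omega>) = ennreal (expectation (\<lambda>\<omega>. - U d (Y h \<omega>) / c))" if "0 < d" for d
    by (rule nn_integral_eq_integral[OF Ui[OF that] Unn[OF that]])
  have E0: "0 \<le> expectation (\<lambda>\<omega>. - U d (Y h \<omega>) / c)" if "0 < d" for d by (rule integral_nonneg_AE[OF Unn[OF that]])
  have p0: "AE \<omega> in \<Omega>. 0 \<le> \<eta> t \<omega> + paid h \<omega>"
    using AE_good_path
  proof eventually_elim
    case (elim \<omega>)
    show ?case using good_start(1)[OF elim] paid_nonneg[OF h(1) elim] by simp
  qed
  have pi: "integrable \<Omega> (\<lambda>\<omega>. \<eta> t \<omega> + paid h \<omega>)" using i(1,3) by simp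
  have pe: "0 \<le> expectation (\<lambda>\<omega>. \<eta> t \<omega> + paid h \<omega>)" by (rule integral_nonneg_AE[OF p0])
  have nn: "0 \<le> w 1 * exp (- \<delta> 1 * h)" "0 \<le> w 2 * exp (- \<delta> 2 * h)" using w_pos by auto
  have m: "0 \<le> w 1 * exp (- \<delta> 1 * h) * expectation (\<lambda>\<omega>. - U (\<delta> 1) (Y h \<omega>) / c)"
    "0 \<le> w 2 * exp (- \<delta> 2 * h) * expectation (\<lambda>\<omega>. - U (\<delta> 2) (Y h \<omega>) / c)"
    by (rule mult_nonneg_nonneg[OF nn(1) E0[OF \<delta>_pos(1)]], rule mult_nonneg_nonneg[OF nn(2) E0[OF \<delta>_pos(2)]])
  have lm: "later_payout h \<in> borel_measurable \<Omega>" and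
    le: "(\<integral>\<^sup>+\<omega>. later_payout h \<omega> \<partial>\<Omega>) = ennreal (w 1 * exp (- \<delta> 1 * (t + h - t))) * (\<integral>\<^sup>+\<omega>. ennreal (- U (\<delta> 1) (Y h \<omega>) / c) \<partial>\<Omega>)
      + ennreal (w 2 * exp (- \<delta> 2 * (t + h - t))) * (\<integral>\<^sup>+\<omega>. ennreal (- U (\<delta> 2) (Y h \<omega>) / c) \<partial>\<Omega>)"
    using law_\<beta>_payout[OF restart_facts[OF h(1)], of t] h(1) unfolding later_payout_def[abs_def] by auto
  have "(\<integral>\<^sup>+\<omega>. payout h \<omega> \<partial>\<Omega>) \<le> (\<integral>\<^sup>+\<omega>. ennreal (\<eta> t \<omega> + paid h \<omega>) + later_payout h \<omega> \<partial>\<Omega>)"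
  proof (rule nn_integral_mono_AE)
    show "AE \<omega> in \<Omega>. payout h \<omega> \<le> ennreal (\<eta> t \<omega> + paid h \<omega>) + later_payout h \<omega>"
      using AE_good_path D_facts(1)[OF h(1)] by eventually_elim (rule payout_le[OF _ h(1)])
  qed
  also have "\<dots> = (\<integral>\<^sup>+\<omega>. ennreal (\<eta> t \<omega> + paid h \<omega>) \<partial>\<Omega>) + (\<integral>\<^sup>+\<omega>. later_payout h \<omega> \<partial>\<Omega>)"
    by (rule nn_integral_add[OF _ lm]) (use borel_measurable_integrable[OF pi] in measurable)
  also have "(\<integral>\<^sup>+\<omega>. ennreal (\<eta> t \<omega> + paid h \<omega>) \<partial>\<Omega>) = ennreal (expectation (\<lambda>\<omega>. \<eta> t \<omega> + paid h \<omega>))"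
    by (rule nn_integral_eq_integral[OF pi p0])
  also have "ennreal (expectation (\<lambda>\<omega>. \<eta> t \<omega> + paid h \<omega>)) + (\<integral>\<^sup>+\<omega>. later_payout h \<omega> \<partial>\<Omega>) = ennreal R"
  proof -
    have hh: "t + h - t = h" by simp
    show ?thesis
      unfolding le hh En[OF \<delta>_pos(1)] En[OF \<delta>_pos(2)] R_def ennreal_plus[OF pe add_nonneg_nonneg[OF m]] ennreal_plus[OF m]
        ennreal_mult''[OF E0[OF \<delta>_pos(1)]] ennreal_mult''[OF E0[OF \<delta>_pos(2)]] ..
  qed
  finally have "enn2real (\<integral>\<^sup>+\<omega>. payout h \<omega> \<partial>\<Omega>) \<le> R"
    unfolding R_def by (intro enn2real_leI add_nonneg_nonneg pe m)
  then have "c * expectation (\<lambda>\<omega>. enn2real (payout h \<omega>)) \<le> c * R" using c_pos unfolding K(2) by (intro mult_left_mono) auto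
  moreover have "J x t (uh h) (\<xi>h h) = expectation (effort_cost h) - c * expectation (\<lambda>\<omega>. enn2real (payout h \<omega>))"
    unfolding J using i(4) K(1) by simp
  moreover have "expectation (gain h) = expectation (effort_cost h) - c * R"
  proof -
    have "expectation (gain h) = expectation (effort_cost h) - c * expectation (\<lambda>\<omega>. \<eta> t \<omega> + paid h \<omega>)
      + (w 1 * exp (- \<delta> 1 * h) * expectation (\<lambda>\<omega>. U (\<delta> 1) (Y h \<omega>)) + w 2 * exp (- \<delta> 2 * h) * expectation (\<lambda>\<omega>. U (\<delta> 2) (Y h \<omega>)))"
    proof -
      note ia = integrable_mult_right[OF i(5)[OF \<delta>_pos(1)], of "w 1 * exp (- \<delta> 1 * h)"]
      note ib = integrable_mult_right[OF i(5)[OF \<delta>_pos(2)], of "w 2 * exp (- \<delta> 2 * h)"]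
      note ic = integrable_mult_right[OF pi, of c]
      show ?thesis
        unfolding gain_def[abs_def] Bochner_Integration.integral_add[OF Bochner_Integration.integrable_diff[OF i(4) ic] Bochner_Integration.integrable_add[OF ia ib]]
          Bochner_Integration.integral_add[OF ia ib] Bochner_Integration.integral_diff[OF i(4) ic] integral_mult_right_zero ..
    qed
    moreover have "c * (k * expectation (\<lambda>\<omega>. - U d (Y h \<omega>) / c)) = - (k * expectation (\<lambda>\<omega>. U d (Y h \<omega>)))" for k d using c_pos by simp
    ultimately show ?thesis unfolding R_def distrib_left[of c] using c_pos by simp
  qed
  ultimately show ?thesis by linarith
qed

text \<open>If \<open>z = 0\<close>, ruin is immediate and the Brownian term on the left vanishes;
  it is written only to have one shape in both cases. If \<open>z > 0\<close>,
  \<open>increment_bound\<close> is combined with three comparisons: \<open>p1\<close> for early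
  dividends by \<open>V1 \<le> - c\<close>, \<open>p2\<close> for effort by
  \<open>- 1 \<le> V1\<close>, and \<open>p3\<close> for the discounting of the continuation
  value.\<close>

lemma gain_lower:
  assumes C: "increment_bound C K"
    and g: "good_path \<omega>" and h: "0 < h" "h \<le> 1"
  defines "z \<equiv> S t \<omega>" and "b \<equiv> B (t + h) \<omega> - B t \<omega>" and "G \<equiv> \<not> ruined h \<omega> \<and> paid h \<omega> \<le> K * h"
  shows "z = 0 \<Longrightarrow> \<sigma> * V1 z * (B (stop h \<omega>) \<omega> - B t \<omega>) \<le> gain h \<omega> - V x"
    and "0 < z \<Longrightarrow> \<sigma> * V1 z * (B (stop h \<omega>) \<omega> - B t \<omega>) + \<mu> * V1 z * h - (\<delta> 1 + \<delta> 2) * M * h\<^sup>2 + \<sigma>\<^sup>2 / 2 * V2 z * b\<^sup>2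
      - (if G \<or> x2 \<le> z then 0 else C * b\<^sup>2) - C * (h * sqrt h + sqrt h * b\<^sup>2 + b ^ 4 / sqrt h)
      + (w 1 * (1 - exp (- \<delta> 1 * h)) * - U (\<delta> 1) (min (Y h \<omega>) z) + w 2 * (1 - exp (- \<delta> 2 * h)) * - U (\<delta> 2) (min (Y h \<omega>) z))
      \<le> gain h \<omega> - V x"
proof -
  have \<omega>: "\<omega> \<in> space \<Omega>" using g by (simp add: good_path_def)
  note z = good_start[OF g, folded z_def]
  have drop: "- c * \<eta> t \<omega> - V x \<ge> - V z"
  proof -
    have "x - z = \<eta> t \<omega>" using z(2) by simp
    moreover have "z \<le> x" using z(1,2) by simp
    ultimately show ?thesis using V_drop[of z x] z(3) by simp
  qed
  note E = effort_part[OF \<omega> h(1)]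
  show "\<sigma> * V1 z * (B (stop h \<omega>) \<omega> - B t \<omega>) \<le> gain h \<omega> - V x" if z0: "z = 0"
  proof -
    have "ruin_time t S \<omega> \<le> ereal t" using ruin_time_le[of t t S \<omega>] z0 by (simp add: z_def)
    then have \<tau>: "ruin_time t S \<omega> = ereal t" using ruin_time_ge[of t S \<omega>] by (rule antisym)
    then have r: "ruined h \<omega>" using h by (simp add: ruined_before_eq)
    have s: "stop h \<omega> = t" using \<tau> h by (simp add: capped_ruin_def)
    have "Y h \<omega> = 0" using r by (simp add: restart_surplus_def)
    moreover have "paid h \<omega> = 0" using paid_ruined(1)[OF g h(1) r] s by simp
    ultimately have "gain h \<omega> = effort_cost h \<omega> - c * \<eta> t \<omega>" by (simp add: gain_def U_0)
    then show ?thesis using drop E(5) V_0 z0 s by simp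
  qed
  assume zp: "0 < z"
  let ?A = "drift t u (stop h \<omega>) \<omega>" and ?\<Delta> = "paid h \<omega>" and ?W = "B (stop h \<omega>) \<omega> - B t \<omega>" and ?s = "stop h \<omega>"
  let ?Q = "\<sigma>\<^sup>2 / 2 * V2 z * b\<^sup>2 - (if G \<or> x2 \<le> z then 0 else C * b\<^sup>2) - C * (h * sqrt h + sqrt h * b\<^sup>2 + b ^ 4 / sqrt h)"
  have Y0: "0 \<le> Y h \<omega>" and \<Delta>0: "0 \<le> ?\<Delta>" using Y_nonneg[OF h(1) g] paid_nonneg[OF h(1) g] by auto
  have Yz: "Y h \<omega> - z = ?A + \<sigma> * ?W - ?\<Delta>" using Y_paid[of h \<omega>] z(2) by simp
  have inc: "V z + V1 z * (Y h \<omega> - z) + ?Q \<le> V (Y h \<omega>)"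
  proof -
    have "Y h \<omega> = z + ?A + \<sigma> * b - ?\<Delta> \<and> ?\<Delta> \<le> K * h" if G
    proof -
      have "?s = t + h" using that good_not_ruined(1)[OF g h(1)] by (simp add: G_def)
      then show ?thesis using Yz that by (simp add: G_def b_def)
    qed
    from increment_boundD(2)[OF C, of z "Y h \<omega>" ?\<Delta> h ?A G b, OF zp Y0 \<Delta>0 h E(6,7) this] show ?thesis by simp
  qed
  have V1z: "V1 z \<le> - c" "- 1 \<le> V1 z" using V1_le V1_ge zp by auto
  have p1: "V1 z * ?A + \<sigma> * V1 z * ?W \<le> V1 z * (Y h \<omega> - z) - c * ?\<Delta>"
  proof -
    have "0 \<le> (- V1 z - c) * ?\<Delta>" using V1z \<Delta>0 by (intro mult_nonneg_nonneg) auto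
    then show ?thesis unfolding Yz by (simp add: algebra_simps)
  qed
  have p2: "\<mu> * V1 z * h - (\<delta> 1 + \<delta> 2) * M * h\<^sup>2 \<le> V1 z * ?A + effort_cost h \<omega>"
  proof -
    define e where "e = ?A - \<mu> * (?s - t)"
    note e = E(1,2,3)[folded e_def]
    \<comment> \<open>\<open>V1 z\<close> is negative and the drift acts for at most
      \<open>h\<close>, so putting the full length \<open>h\<close> only lowers the bound.\<close>
    have "V1 z * (\<mu> * h) \<le> V1 z * (\<mu> * (?s - t))"
      using V1z c_pos stop_bounds[OF h(1), of \<omega>] \<mu>_pos by (intro mult_left_mono_neg mult_left_mono) auto
    moreover have "0 \<le> (V1 z + 1) * e" using V1z e(1) by (intro mult_nonneg_nonneg) auto
    moreover have "(\<delta> 1 + \<delta> 2) * h * e \<le> (\<delta> 1 + \<delta> 2) * h * (M * h)" using e(2) \<delta>_pos h by (intro mult_left_mono) auto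
    moreover have "V1 z * ?A = V1 z * (\<mu> * (?s - t)) + V1 z * e" by (simp add: e_def algebra_simps)
    moreover have "(V1 z + 1) * e = V1 z * e + e" "(\<delta> 1 + \<delta> 2) * h * (M * h) = (\<delta> 1 + \<delta> 2) * M * h\<^sup>2"
      "(1 - (\<delta> 1 + \<delta> 2) * h) * e = e - (\<delta> 1 + \<delta> 2) * h * e" "\<mu> * V1 z * h = V1 z * (\<mu> * h)"
      by (simp_all add: algebra_simps power2_eq_square)
    ultimately show ?thesis using e(3) by linarith
  qed
  \<comment> \<open>\<open>U\<close> is unbounded for large surplus. Replacing \<open>Y\<close> by
    its minimum with \<open>z\<close> weakens the bound by monotonicity, but keeps the term bounded
    for the passage to the limit.\<close>
  have p3: "V (Y h \<omega>) + (w 1 * (1 - exp (- \<delta> 1 * h)) * - U (\<delta> 1) (min (Y h \<omega>) z) + w 2 * (1 - exp (- \<delta> 2 * h)) * - U (\<delta> 2) (min (Y h \<omega>) z))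
    \<le> w 1 * exp (- \<delta> 1 * h) * U (\<delta> 1) (Y h \<omega>) + w 2 * exp (- \<delta> 2 * h) * U (\<delta> 2) (Y h \<omega>)"
  proof -
    have "w' * (1 - exp (- d * h)) * - U d (min (Y h \<omega>) z) \<le> w' * (1 - exp (- d * h)) * - U d (Y h \<omega>)" if "0 < w'" "0 < d" for w' d
      using that h U_antimono[OF that(2), of "min (Y h \<omega>) z" "Y h \<omega>"] by (intro mult_left_mono mult_nonneg_nonneg) auto
    from this[OF w_pos(1) \<delta>_pos(1)] this[OF w_pos(2) \<delta>_pos(2)]
    show ?thesis unfolding V_def by (simp add: algebra_simps)
  qed
  show "\<sigma> * V1 z * ?W + \<mu> * V1 z * h - (\<delta> 1 + \<delta> 2) * M * h\<^sup>2 + \<sigma>\<^sup>2 / 2 * V2 z * b\<^sup>2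
      - (if G \<or> x2 \<le> z then 0 else C * b\<^sup>2) - C * (h * sqrt h + sqrt h * b\<^sup>2 + b ^ 4 / sqrt h)
      + (w 1 * (1 - exp (- \<delta> 1 * h)) * - U (\<delta> 1) (min (Y h \<omega>) z) + w 2 * (1 - exp (- \<delta> 2 * h)) * - U (\<delta> 2) (min (Y h \<omega>) z))
      \<le> gain h \<omega> - V x"
    using inc p1 p2 p3 drop unfolding gain_def distrib_left by linarith
qed

lemma S_start_measurable: "S t \<in> borel_measurable (F t)"
  by (rule S_adapted) simp

text \<open>A surplus that is positive after the payment at \<open>t\<close> stays positive for a
  while by right continuity; the left limits of \<open>\<eta>\<close> at \<open>t + h\<close> are
  squeezed between \<open>\<eta> t\<close> and \<open>\<eta> (t + h)\<close>.\<close>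

lemma restart_tendsto:
  assumes g: "good_path \<omega>" and z: "0 < S t \<omega>"
  shows "\<forall>\<^sub>F h in at_right 0. \<not> ruined h \<omega>" "((\<lambda>h. Y h \<omega>) \<longlongrightarrow> S t \<omega>) (at_right 0)"
proof -
  have rc: "((\<lambda>r. S r \<omega>) \<longlongrightarrow> S t \<omega>) (at_right t)" using good_down_cadlag[OF g] by (auto simp: down_cadlag_def)
  obtain e where e: "t < e" "\<And>r. t < r \<Longrightarrow> r < e \<Longrightarrow> 0 < S r \<omega>"
    using order_tendstoD(1)[OF rc z] unfolding eventually_at_right_field by auto
  have "ereal e \<le> ruin_time t S \<omega>"
  proof (rule ruin_time_greatest)
    fix r assume "t \<le> r" "S r \<omega> = 0"
    then show "e \<le> r" using e(2)[of r] z by (cases "r = t") (auto simp: not_less[symmetric])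
  qed
  then have nr': "\<not> ruined h \<omega>" if "h < e - t" for h
  proof -
    have "ereal (t + h) \<le> ereal e" using that by simp
    then have "ereal (t + h) \<le> ruin_time t S \<omega>" using \<open>ereal e \<le> _\<close> by (rule order_trans)
    then show ?thesis by (simp add: ruined_before_eq not_less)
  qed
  show nr: "\<forall>\<^sub>F h in at_right 0. \<not> ruined h \<omega>"
    unfolding eventually_at_right_field using e(1) nr' by (intro exI[of _ "e - t"]) auto
  have shift: "((\<lambda>h. f (t + h)) \<longlongrightarrow> l) (at_right 0)" if "(f \<longlongrightarrow> l) (at_right t)" for f :: "real \<Rightarrow> real" and l
    using that filterlim_at_right_to_0[of f "nhds l" t] by (simp add: add.commute)
  have \<eta>: "dividend_path t (\<lambda>r. \<eta> r \<omega>)" using g by (simp add: good_path_def)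
  have \<eta>r: "((\<lambda>h. \<eta> (t + h) \<omega>) \<longlongrightarrow> \<eta> t \<omega>) (at_right 0)"
    by (rule shift) (use \<eta> in \<open>auto simp: dividend_path_def cadlag_from_def\<close>)
  have cr: "((\<lambda>h. controlled x t u (t + h) \<omega>) \<longlongrightarrow> controlled x t u t \<omega>) (at_right 0)"
    by (rule shift, rule continuous_on_atLeast_at_right) (use g in \<open>auto simp: good_path_def\<close>)
  have ev: "\<forall>\<^sub>F h in at_right 0. 0 < h \<and> \<not> ruined h \<omega>"
    using nr eventually_at_right_less[of 0] by eventually_elim simp
  have ll: "((\<lambda>h. left_lim (\<lambda>r. \<eta> r \<omega>) (t + h)) \<longlongrightarrow> \<eta> t \<omega>) (at_right 0)"
  proof (rule real_tendsto_sandwich[OF _ _ tendsto_const \<eta>r])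
    show "\<forall>\<^sub>F h in at_right 0. \<eta> t \<omega> \<le> left_lim (\<lambda>r. \<eta> r \<omega>) (t + h)"
      using ev by eventually_elim (use paid_not_ruined[OF g] in force)
    show "\<forall>\<^sub>F h in at_right 0. left_lim (\<lambda>r. \<eta> r \<omega>) (t + h) \<le> \<eta> (t + h) \<omega>"
      using ev
    proof eventually_elim
      case (elim h)
      show ?case
      proof (rule tendsto_upperbound[OF good_not_ruined(2)[OF g] _ trivial_limit_at_left_real])
        show "\<forall>\<^sub>F r in at_left (t + h). \<eta> r \<omega> \<le> \<eta> (t + h) \<omega>"
          unfolding eventually_at_left_field using elim dividend_path_mono[OF \<eta>, of _ "t + h"] by (intro exI[of _ t]) auto
      qed (use elim in auto)
    qed
  qed
  have "((\<lambda>h. controlled x t u (t + h) \<omega> - left_lim (\<lambda>r. \<eta> r \<omega>) (t + h)) \<longlongrightarrow> S t \<omega>) (at_right 0)"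
    unfolding S_eq by (rule tendsto_diff[OF cr ll])
  moreover have "\<forall>\<^sub>F h in at_right 0. controlled x t u (t + h) \<omega> - left_lim (\<lambda>r. \<eta> r \<omega>) (t + h) = Y h \<omega>"
    using ev by eventually_elim (use good_not_ruined(3)[OF g] in simp)
  ultimately show "((\<lambda>h. Y h \<omega>) \<longlongrightarrow> S t \<omega>) (at_right 0)" by (rule Lim_transform_eventually)
qed

text \<open>The failure of the good event, restricted to starting points where
  \<open>increment_bound\<close> charges for it. Like the next three quantities it is 0 if
  \<open>S t \<omega> = 0\<close>, where the process ends at once.\<close>

definition bad :: "real \<Rightarrow> real \<Rightarrow> 'w \<Rightarrow> real" where
  "bad K h \<omega> = (if 0 < S t \<omega> \<and> S t \<omega> < x2 \<and> \<not> (\<not> ruined h \<omega> \<and> paid h \<omega> \<le> K * h) then 1 else 0)"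

definition discounting :: "real \<Rightarrow> 'w \<Rightarrow> real" where
  "discounting h \<omega> = (if 0 < S t \<omega> then
     w 1 * ((1 - exp (- \<delta> 1 * h)) / h) * - U (\<delta> 1) (min (Y h \<omega>) (S t \<omega>)) +
     w 2 * ((1 - exp (- \<delta> 2 * h)) / h) * - U (\<delta> 2) (min (Y h \<omega>) (S t \<omega>)) else 0)"

definition drift_rate :: "'w \<Rightarrow> real" where
  "drift_rate \<omega> = (if 0 < S t \<omega> then \<mu> * V1 (S t \<omega>) else 0)"

definition curvature :: "'w \<Rightarrow> real" where
  "curvature \<omega> = (if 0 < S t \<omega> then \<sigma>\<^sup>2 / 2 * V2 (S t \<omega>) else 0)"

lemma S_start_measurable': "S t \<in> borel_measurable \<Omega>"
  using S_start_measurable F_measurable t_nonneg by blast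

lemma rates_measurable:
  "drift_rate \<in> borel_measurable (F t)" "curvature \<in> borel_measurable (F t)"
  using S_start_measurable V1_measurable V2_measurable unfolding drift_rate_def[abs_def] curvature_def[abs_def] by measurable

lemma bad_measurable: assumes h: "0 < h" "h \<le> 1" shows "bad K h \<in> borel_measurable \<Omega>"
proof -
  have [measurable]: "S t \<in> borel_measurable \<Omega>" "paid h \<in> borel_measurable \<Omega>"
    using S_start_measurable' integrable_parts(3)[OF h] by auto
  have [measurable]: "Measurable.pred \<Omega> (ruined h)" using ruined_sets[OF h(1)] by (simp add: pred_def)
  show ?thesis unfolding bad_def[abs_def] by measurable
qed

lemma discounting_measurable: assumes h: "0 < h" shows "discounting h \<in> borel_measurable \<Omega>"
proof -
  have [measurable]: "S t \<in> borel_measurable \<Omega>" "Y h \<in> borel_measurable \<Omega>" "U (\<delta> 1) \<in> borel_measurable borel" "U (\<delta> 2) \<in> borel_measurable borel"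
    using S_start_measurable' Y_measurable[OF h] U_measurable \<delta>_pos by auto
  show ?thesis unfolding discounting_def[abs_def] by measurable
qed

lemma AE_start: "AE \<omega> in \<Omega>. 0 \<le> S t \<omega> \<and> S t \<omega> \<le> x"
  using AE_good_path
proof eventually_elim
  case (elim \<omega>)
  show ?case using good_start[OF elim] by simp
qed

text \<open>\<open>act\<close> provides a threshold for \<open>h\<close> that depends on the path;
  bounded convergence needs no uniformity to make the probability of the bad event vanish.\<close>

lemma bad_tendsto:
  assumes act: "AE \<omega> in \<Omega>. 0 < S t \<omega> \<and> S t \<omega> < x2 \<longrightarrow> (\<forall>\<^sub>F h in at_right 0. left_lim (\<lambda>r. \<eta> r \<omega>) (t + h) - \<eta> t \<omega> \<le> K * h)"
  shows "((\<lambda>h. expectation (bad K h)) \<longlongrightarrow> 0) (at_right 0)"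
proof -
  have "((\<lambda>h. expectation (bad K h)) \<longlongrightarrow> expectation (\<lambda>_. 0)) (at_right 0)"
  proof (rule bounded_convergence_at_right[where C=1])
    show "AE \<omega> in \<Omega>. ((\<lambda>h. bad K h \<omega>) \<longlongrightarrow> 0) (at_right 0)"
      using AE_good_path act
    proof eventually_elim
      case (elim \<omega>)
      have "\<forall>\<^sub>F h in at_right 0. bad K h \<omega> = 0"
      proof (cases "0 < S t \<omega> \<and> S t \<omega> < x2")
        case True
        then have "\<forall>\<^sub>F h in at_right 0. left_lim (\<lambda>r. \<eta> r \<omega>) (t + h) - \<eta> t \<omega> \<le> K * h" using elim(2) by simp
        with restart_tendsto(1)[OF elim(1)] True eventually_at_right_less[of 0]
        have "\<forall>\<^sub>F h in at_right 0. left_lim (\<lambda>r. \<eta> r \<omega>) (t + h) - \<eta> t \<omega> \<le> K * h \<and> \<not> ruined h \<omega> \<and> 0 < h"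
          by (auto intro: eventually_conj)
        then show ?thesis by eventually_elim (simp add: bad_def paid_not_ruined(1)[OF elim(1)])
      qed (auto simp: bad_def)
      then show ?case by (rule tendsto_eventually)
    qed
  qed (auto simp: bad_measurable bad_def)
  then show ?thesis by simp
qed

lemma discounting_tendsto:
  "((\<lambda>h. expectation (discounting h)) \<longlongrightarrow> expectation (\<lambda>\<omega>. if 0 < S t \<omega> then - DV (S t \<omega>) else 0)) (at_right 0)"
proof (rule bounded_convergence_at_right[where C="w 1 * \<delta> 1 * - U (\<delta> 1) x + w 2 * \<delta> 2 * - U (\<delta> 2) x"])
  have [measurable]: "S t \<in> borel_measurable \<Omega>" "U (\<delta> 1) \<in> borel_measurable borel" "U (\<delta> 2) \<in> borel_measurable borel"
    using S_start_measurable' U_measurable \<delta>_pos by auto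
  show "(\<lambda>\<omega>. if 0 < S t \<omega> then - DV (S t \<omega>) else 0) \<in> borel_measurable \<Omega>"
    unfolding DV_def by measurable
  show "AE \<omega> in \<Omega>. ((\<lambda>h. discounting h \<omega>) \<longlongrightarrow> (if 0 < S t \<omega> then - DV (S t \<omega>) else 0)) (at_right 0)"
    using AE_good_path
  proof eventually_elim
    case (elim \<omega>)
    show ?case
    proof (cases "0 < S t \<omega>")
      case True
      have "((\<lambda>h. min (Y h \<omega>) (S t \<omega>)) \<longlongrightarrow> min (S t \<omega>) (S t \<omega>)) (at_right 0)"
        by (intro tendsto_min restart_tendsto(2)[OF elim True] tendsto_const)
      then have m: "((\<lambda>h. min (Y h \<omega>) (S t \<omega>)) \<longlongrightarrow> S t \<omega>) (at_right 0)" by simp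
      have Ut: "((\<lambda>h. U d (min (Y h \<omega>) (S t \<omega>))) \<longlongrightarrow> U d (S t \<omega>)) (at_right 0)" if "0 < d" for d
        by (rule isCont_tendsto_compose[OF DERIV_isCont[OF U_DERIV[OF that]] m])
      have "((\<lambda>h. w 1 * ((1 - exp (- \<delta> 1 * h)) / h) * - U (\<delta> 1) (min (Y h \<omega>) (S t \<omega>)) +
         w 2 * ((1 - exp (- \<delta> 2 * h)) / h) * - U (\<delta> 2) (min (Y h \<omega>) (S t \<omega>))) \<longlongrightarrow>
         w 1 * \<delta> 1 * - U (\<delta> 1) (S t \<omega>) + w 2 * \<delta> 2 * - U (\<delta> 2) (S t \<omega>)) (at_right 0)"
        by (intro tendsto_add tendsto_mult tendsto_minus tendsto_const exp_quotient_tendsto Ut \<delta>_pos)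
      moreover have "w 1 * \<delta> 1 * - U (\<delta> 1) (S t \<omega>) + w 2 * \<delta> 2 * - U (\<delta> 2) (S t \<omega>) = - DV (S t \<omega>)"
        by (simp add: DV_def)
      ultimately show ?thesis using True by (simp add: discounting_def)
    qed (simp add: discounting_def)
  qed
  fix h :: real assume h: "0 < h" "h < 1"
  show "discounting h \<in> borel_measurable \<Omega>" by (rule discounting_measurable[OF h(1)])
  have qb: "0 \<le> (1 - exp (- d * h)) / h" "(1 - exp (- d * h)) / h \<le> d" if "0 < d" for d
    using exp_ge_add_one_self[of "- d * h"] that h by (auto simp: pos_divide_le_eq)
  show "AE \<omega> in \<Omega>. \<bar>discounting h \<omega>\<bar> \<le> w 1 * \<delta> 1 * - U (\<delta> 1) x + w 2 * \<delta> 2 * - U (\<delta> 2) x"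
    using AE_good_path
  proof eventually_elim
    case (elim \<omega>)
    let ?m = "min (Y h \<omega>) (S t \<omega>)"
    have m: "0 \<le> ?m" "?m \<le> x" using Y_nonneg[OF h(1) elim] good_start[OF elim] by auto
    have b: "0 \<le> w' * ((1 - exp (- d * h)) / h) * - U d ?m \<and> w' * ((1 - exp (- d * h)) / h) * - U d ?m \<le> w' * d * - U d x" if "0 < w'" "0 < d" for w' d
    proof -
      have U: "0 \<le> - U d ?m" "- U d ?m \<le> - U d x" using U_nonpos[OF that(2) m(1)] U_antimono[OF that(2) m(2)] by auto
      have "w' * ((1 - exp (- d * h)) / h) \<le> w' * d" using qb[OF that(2)] that by (intro mult_left_mono) auto
      moreover have "0 \<le> w' * ((1 - exp (- d * h)) / h)" using qb[OF that(2)] that by (intro mult_nonneg_nonneg) auto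
      moreover have "0 \<le> w' * d" using that by simp
      ultimately show ?thesis by (intro conjI mult_nonneg_nonneg[OF _ U(1)] mult_mono[OF _ U(2) _ U(1)])
    qed
    have "0 \<le> w' * d * - U d x" if "0 < w'" "0 < d" for w' d using b[OF that] by linarith
    then show ?case
      using b[OF w_pos(1) \<delta>_pos(1)] b[OF w_pos(2) \<delta>_pos(2)] w_pos \<delta>_pos unfolding discounting_def by (auto simp del: One_nat_def)
  qed
qed

text \<open>This is \<open>V_generator\<close> averaged over the random surplus left after the
  payment at \<open>t\<close>.\<close>

lemma generator_nonneg:
  "0 \<le> expectation drift_rate + expectation curvature + expectation (\<lambda>\<omega>. if 0 < S t \<omega> then - DV (S t \<omega>) else 0)"
  and rates_integrable: "integrable \<Omega> drift_rate" "integrable \<Omega> curvature"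
proof -
  obtain C2 where C2: "0 \<le> C2" "\<And>z. 0 \<le> z \<Longrightarrow> V2 z \<le> C2" using V2_bounded by blast
  show i1: "integrable \<Omega> drift_rate"
  proof (rule integrable_const_bound[of _ \<mu>])
    have "\<bar>drift_rate \<omega>\<bar> \<le> \<mu>" for \<omega>
    proof (cases "0 < S t \<omega>")
      case True
      have "\<bar>V1 (S t \<omega>)\<bar> \<le> 1" using V1_ge[of "S t \<omega>"] V1_le[of "S t \<omega>"] c_pos True by (simp add: abs_le_iff)
      then show ?thesis using \<mu>_pos True by (simp add: drift_rate_def abs_mult mult_left_le)
    qed (use \<mu>_pos in \<open>simp add: drift_rate_def\<close>)
    then show "AE \<omega> in \<Omega>. norm (drift_rate \<omega>) \<le> \<mu>" by simp
  qed (use rates_measurable(1) F_measurable t_nonneg in blast)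
  show i2: "integrable \<Omega> curvature"
  proof (rule integrable_const_bound[of _ "\<sigma>\<^sup>2 / 2 * C2"])
    show "AE \<omega> in \<Omega>. norm (curvature \<omega>) \<le> \<sigma>\<^sup>2 / 2 * C2"
      using V2_nonneg C2 by (intro AE_I2) (auto simp: curvature_def abs_mult intro!: mult_left_mono mult_nonneg_nonneg)
  qed (use rates_measurable(2) F_measurable t_nonneg in blast)
  have [measurable]: "S t \<in> borel_measurable \<Omega>" "U (\<delta> 1) \<in> borel_measurable borel" "U (\<delta> 2) \<in> borel_measurable borel"
    using S_start_measurable' U_measurable \<delta>_pos by auto
  have i3: "integrable \<Omega> (\<lambda>\<omega>. if 0 < S t \<omega> then - DV (S t \<omega>) else 0)"
  proof (rule integrable_const_bound[of _ "- DV x"])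
    show "(\<lambda>\<omega>. if 0 < S t \<omega> then - DV (S t \<omega>) else 0) \<in> borel_measurable \<Omega>" unfolding DV_def by measurable
    show "AE \<omega> in \<Omega>. norm (if 0 < S t \<omega> then - DV (S t \<omega>) else 0) \<le> - DV x"
      using AE_start
    proof eventually_elim
      case (elim \<omega>)
      have "DV x \<le> DV (S t \<omega>)" "DV (S t \<omega>) \<le> 0" "DV x \<le> 0"
        unfolding DV_def using U_antimono[of _ "S t \<omega>" x] U_nonpos[of _ "S t \<omega>"] U_nonpos[of _ x] elim \<delta>_pos w_pos x_nonneg
        by (auto intro!: add_mono mult_left_mono add_nonpos_nonpos mult_nonneg_nonpos simp del: One_nat_def)
      then show ?case by simp
    qed
  qed
  have "0 \<le> expectation (\<lambda>\<omega>. drift_rate \<omega> + curvature \<omega> + (if 0 < S t \<omega> then - DV (S t \<omega>) else 0))"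
  proof (rule Bochner_Integration.integral_nonneg)
    fix \<omega>
    show "0 \<le> drift_rate \<omega> + curvature \<omega> + (if 0 < S t \<omega> then - DV (S t \<omega>) else 0)"
      using V_generator[of "S t \<omega>"] by (simp add: drift_rate_def curvature_def)
  qed
  also have "\<dots> = expectation drift_rate + expectation curvature + expectation (\<lambda>\<omega>. if 0 < S t \<omega> then - DV (S t \<omega>) else 0)"
    using i1 i2 i3 by simp
  finally show "0 \<le> expectation drift_rate + expectation curvature + expectation (\<lambda>\<omega>. if 0 < S t \<omega> then - DV (S t \<omega>) else 0)" .
qed

text \<open>The bad event depends on the increment, so its small probability alone does not control
  \<open>b^2\<close> on it. Young's inequality bounds \<open>b^2\<close> there by
  \<open>l * h + b^4 / (l * h)\<close>: the first part carries the factor \<open>bad\<close>, the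
  second has mean \<open>3 * h / l\<close> and yields \<open>3 * C / l\<close> after division by
  \<open>h\<close>. The 5 is 1 + 1 + 3, from the three remainders in
  \<open>increment_bound\<close>.\<close>

lemma expected_gain_lower:
  assumes C: "increment_bound C K"
    and h: "0 < h" "h < 1" and l: "0 < l"
  shows "expectation drift_rate + expectation curvature + expectation (discounting h)
    - C * l * expectation (bad K h) - 3 * C / l - ((\<delta> 1 + \<delta> 2) * M * h + 5 * C * sqrt h) \<le> (expectation (gain h) - V x) / h"
proof -
  let ?b = "\<lambda>\<omega>. B (t + h) \<omega> - B t \<omega>"
  let ?W = "\<lambda>\<omega>. B (stop h \<omega>) \<omega> - B t \<omega>"
  have h1: "h \<le> 1" using h by simp
  have tt: "t < t + h" using h by simp
  \<comment> \<open>Truncation of the slope: optional stopping wants a bound at every point, whereas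
    \<open>V1\<close> at the surplus is known to lie in \<open>[- 1, - c]\<close> on good paths
    only; there \<open>Z\<close> equals it.\<close>
  define Z where "Z \<omega> = max (- 1) (min 0 (V1 (S t \<omega>)))" for \<omega>
  have Zm: "Z \<in> borel_measurable (F t)" using S_start_measurable V1_measurable unfolding Z_def by measurable
  have Zb: "\<bar>Z \<omega>\<bar> \<le> 1" for \<omega> by (auto simp: Z_def)
  note W = stopped_B[OF h(1) h1 Zm Zb]
  note mom = increment_moments[OF t_nonneg tt]
  \<comment> \<open>Here the full Brownian increment is used instead of the stopped one: it is
    independent of \<open>F t\<close>, which gives the second moment against the curvature.\<close>
  have cu: "integrable \<Omega> (\<lambda>\<omega>. curvature \<omega> * (?b \<omega>)\<^sup>2)" "expectation (\<lambda>\<omega>. curvature \<omega> * (?b \<omega>)\<^sup>2) = expectation curvature * h"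
    using increment_expectation[OF t_nonneg tt rates_measurable(2) rates_integrable(2) _ normal_moment_2] h by auto
  have ib: "integrable \<Omega> (bad K h)"
    by (rule integrable_const_bound[of _ 1, OF _ bad_measurable[OF h(1) h1]]) (simp add: bad_def)
  have id: "integrable \<Omega> (discounting h)"
  proof -
    have "AE \<omega> in \<Omega>. \<bar>h * discounting h \<omega>\<bar> \<le> \<bar>w 1 * - U (\<delta> 1) x\<bar> + \<bar>w 2 * - U (\<delta> 2) x\<bar>"
      using AE_good_path
    proof eventually_elim
      case (elim \<omega>)
      let ?m = "min (Y h \<omega>) (S t \<omega>)"
      have m: "0 \<le> ?m" "?m \<le> x" using Y_nonneg[OF h(1) elim] good_start[OF elim] by auto
      have b: "\<bar>w' * (1 - exp (- d * h)) * - U d ?m\<bar> \<le> \<bar>w' * - U d x\<bar>" if "0 < w'" "0 < d" for w' d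
      proof -
        have U: "0 \<le> - U d ?m" "- U d ?m \<le> - U d x" using U_nonpos[OF that(2) m(1)] U_antimono[OF that(2) m(2)] by auto
        have e: "0 \<le> 1 - exp (- d * h)" "1 - exp (- d * h) \<le> 1" using that h by auto
        have "(1 - exp (- d * h)) * - U d ?m \<le> 1 * - U d x" using U e by (intro mult_mono) auto
        moreover have "0 \<le> (1 - exp (- d * h)) * - U d ?m" using U e by (intro mult_nonneg_nonneg)
        ultimately have "\<bar>(1 - exp (- d * h)) * - U d ?m\<bar> \<le> \<bar>- U d x\<bar>" by simp
        then have "\<bar>w'\<bar> * \<bar>(1 - exp (- d * h)) * - U d ?m\<bar> \<le> \<bar>w'\<bar> * \<bar>- U d x\<bar>" by (intro mult_left_mono) auto
        then show ?thesis by (simp add: abs_mult mult.assoc)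
      qed
      have "h * discounting h \<omega> = (if 0 < S t \<omega> then w 1 * (1 - exp (- \<delta> 1 * h)) * - U (\<delta> 1) ?m + w 2 * (1 - exp (- \<delta> 2 * h)) * - U (\<delta> 2) ?m else 0)"
        using h by (simp add: discounting_def field_simps)
      then show ?case using b[OF w_pos(1) \<delta>_pos(1)] b[OF w_pos(2) \<delta>_pos(2)]
        by (cases "0 < S t \<omega>") (simp_all only: if_True if_False, linarith+)
    qed
    then have "integrable \<Omega> (\<lambda>\<omega>. h * discounting h \<omega>)"
      using discounting_measurable[OF h(1)] by (intro integrable_const_bound[of _ "\<bar>w 1 * - U (\<delta> 1) x\<bar> + \<bar>w 2 * - U (\<delta> 2) x\<bar>"]) auto
    then have "integrable \<Omega> (\<lambda>\<omega>. inverse h * (h * discounting h \<omega>))" by (rule integrable_mult_right)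
    then show ?thesis using h by simp
  qed
  define \<Theta> where "\<Theta> \<omega> = \<sigma> * (Z \<omega> * ?W \<omega>) + h * drift_rate \<omega> - (\<delta> 1 + \<delta> 2) * M * h\<^sup>2 + curvature \<omega> * (?b \<omega>)\<^sup>2
      - C * (l * h * bad K h \<omega>) - C / (l * h) * (?b \<omega>) ^ 4 - C * (h * sqrt h) - C * sqrt h * (?b \<omega>)\<^sup>2 - C / sqrt h * (?b \<omega>) ^ 4
      + h * discounting h \<omega>" for \<omega>
  have i\<Theta>: "integrable \<Omega> \<Theta>"
    unfolding \<Theta>_def
    by (intro Bochner_Integration.integrable_add Bochner_Integration.integrable_diff integrable_mult_right W(1) rates_integrable cu(1) ib id mom(2,3) integrable_const)
  have E\<Theta>: "expectation \<Theta> = h * expectation drift_rate - (\<delta> 1 + \<delta> 2) * M * h\<^sup>2 + expectation curvature * h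
      - C * (l * h * expectation (bad K h)) - C / (l * h) * (3 * h\<^sup>2) - C * (h * sqrt h) - C * sqrt h * h - C / sqrt h * (3 * h\<^sup>2)
      + h * expectation (discounting h)"
    unfolding \<Theta>_def using W(1) rates_integrable cu(1) ib id mom(2,3)
    by (simp add: W(2) cu(2) mom(4,5) prob_space)
  have le: "AE \<omega> in \<Omega>. \<Theta> \<omega> \<le> gain h \<omega> - V x"
    using AE_good_path
  proof eventually_elim
    case (elim \<omega>)
    note z = good_start[OF elim]
    note gl = gain_lower[OF C elim h(1) h1]
    let ?b' = "?b \<omega>" and ?r = "h * sqrt h + sqrt h * (?b \<omega>)\<^sup>2 + (?b \<omega>) ^ 4 / sqrt h"
    have r0: "0 \<le> C * ?r" using increment_boundD(1)[OF C] h by simp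
    have Zeq: "Z \<omega> = V1 (S t \<omega>)" using V1_le[of "S t \<omega>"] V1_ge[OF z(3)] c_pos by (simp add: Z_def)
    have dh: "0 \<le> (\<delta> 1 + \<delta> 2) * M * h\<^sup>2" using \<delta>_pos M_nonneg by simp
    have l4: "0 \<le> C / (l * h) * ?b' ^ 4" using increment_boundD(1)[OF C] l h by simp
    have \<Theta>eq: "\<Theta> \<omega> = \<sigma> * V1 (S t \<omega>) * ?W \<omega> + h * drift_rate \<omega> - (\<delta> 1 + \<delta> 2) * M * h\<^sup>2 + curvature \<omega> * ?b'\<^sup>2
      - (C * (l * h * bad K h \<omega>) + C / (l * h) * ?b' ^ 4) - C * ?r + h * discounting h \<omega>"
      unfolding \<Theta>_def Zeq by (simp add: algebra_simps)
    show ?case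
    proof (cases "0 < S t \<omega>")
      case False
      then have z0: "S t \<omega> = 0" using z(3) by simp
      have "\<Theta> \<omega> \<le> \<sigma> * V1 (S t \<omega>) * ?W \<omega>"
        unfolding \<Theta>eq using False dh l4 r0 by (simp add: drift_rate_def curvature_def bad_def discounting_def)
      also have "\<dots> \<le> gain h \<omega> - V x" by (rule gl(1)[OF z0])
      finally show ?thesis .
    next
      case True
      let ?G = "\<not> ruined h \<omega> \<and> paid h \<omega> \<le> K * h"
      have young: "(if ?G \<or> x2 \<le> S t \<omega> then 0 else C * ?b'\<^sup>2) \<le> C * (l * h * bad K h \<omega>) + C / (l * h) * ?b' ^ 4"
      proof (cases "?G \<or> x2 \<le> S t \<omega>")
        case bad: False
        then have "bad K h \<omega> = 1" using True by (simp add: bad_def)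
        moreover have "?b'\<^sup>2 \<le> l * h + ?b' ^ 4 / (l * h)"
        proof -
          have lh: "0 < l * h" using l h by simp
          have "0 \<le> (l * h - ?b'\<^sup>2)\<^sup>2" by simp
          then have "2 * (?b'\<^sup>2 * (l * h)) \<le> (l * h) * (l * h) + ?b' ^ 4" by (simp add: power2_diff power2_eq_square power4_eq_xxxx algebra_simps)
          moreover have "0 \<le> ?b'\<^sup>2 * (l * h)" using lh by simp
          ultimately have "?b'\<^sup>2 * (l * h) \<le> (l * h) * (l * h) + ?b' ^ 4" by linarith
          then have "?b'\<^sup>2 \<le> ((l * h) * (l * h) + ?b' ^ 4) / (l * h)" using lh by (simp only: pos_le_divide_eq)
          also have "\<dots> = l * h + ?b' ^ 4 / (l * h)" using lh by (simp add: add_divide_distrib)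
          finally show ?thesis .
        qed
        then have "C * ?b'\<^sup>2 \<le> C * (l * h + ?b' ^ 4 / (l * h))" using increment_boundD(1)[OF C] by (rule mult_left_mono)
        ultimately show ?thesis unfolding if_not_P[OF bad] by (simp add: distrib_left)
      next
        case good: True
        have "0 \<le> C * (l * h * bad K h \<omega>)" using increment_boundD(1)[OF C] l h by (simp add: bad_def)
        then show ?thesis using l4 good by simp
      qed
      have d: "h * discounting h \<omega> = w 1 * (1 - exp (- \<delta> 1 * h)) * - U (\<delta> 1) (min (Y h \<omega>) (S t \<omega>)) + w 2 * (1 - exp (- \<delta> 2 * h)) * - U (\<delta> 2) (min (Y h \<omega>) (S t \<omega>))"
        using True h by (simp add: discounting_def field_simps)
      have dr: "h * drift_rate \<omega> = \<mu> * V1 (S t \<omega>) * h" "curvature \<omega> = \<sigma>\<^sup>2 / 2 * V2 (S t \<omega>)"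
        using True by (simp_all add: drift_rate_def curvature_def)
      show ?thesis using gl(2)[OF True] young unfolding \<Theta>eq d dr by linarith
    qed
  qed
  have "expectation \<Theta> \<le> expectation (\<lambda>\<omega>. gain h \<omega> - V x)"
    by (rule integral_mono_AE[OF i\<Theta> _ le]) (use gain_integrable[OF h(1) h1] in simp)
  also have "\<dots> = expectation (gain h) - V x" using gain_integrable[OF h(1) h1] by (simp add: prob_space)
  finally have fin: "expectation \<Theta> \<le> expectation (gain h) - V x" .
  have sq: "sqrt h * sqrt h = h" "h\<^sup>2 / sqrt h = h * sqrt h"
  proof -
    show s: "sqrt h * sqrt h = h" using h by simp
    have "h\<^sup>2 / sqrt h = h * (h / sqrt h)" by (simp add: power2_eq_square)
    then show "h\<^sup>2 / sqrt h = h * sqrt h" using h by (simp only: real_div_sqrt less_imp_le)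
  qed
  have "expectation \<Theta> = h * (expectation drift_rate + expectation curvature + expectation (discounting h)
    - C * l * expectation (bad K h) - 3 * C / l - ((\<delta> 1 + \<delta> 2) * M * h + 5 * C * sqrt h))"
  proof -
    have "C / (l * h) * (3 * h\<^sup>2) = h * (3 * C / l)" using h by (simp add: field_simps power2_eq_square)
    moreover have "C / sqrt h * (3 * h\<^sup>2) = 3 * C * (h * sqrt h)" proof -
      have "C / sqrt h * (3 * h\<^sup>2) = 3 * C * (h\<^sup>2 / sqrt h)" by simp
      then show ?thesis by (simp only: sq(2))
    qed
    ultimately show ?thesis unfolding E\<Theta> by (simp add: algebra_simps power2_eq_square)
  qed
  then show ?thesis using fin h by (simp add: pos_le_divide_eq mult.commute)
qed

text \<open>For fixed large \<open>l\<close> the errors other than \<open>3 * C / l\<close> vanish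
  as \<open>h\<close> tends to 0, and \<open>generator_nonneg\<close> bounds the limit of the rest.
  The hypothesis \<open>act\<close> is pathwise and eventual in \<open>h\<close>, so that it covers
  a growth bound on \<open>\<eta>\<close> as well as reflection, where payments begin only once the
  barrier is reached.\<close>

lemma no_gain:
  assumes ev: "\<forall>\<^sub>F h in at_right 0. perturbed_integrable Phi Xi x t u \<eta> h"
    and K: "0 \<le> K"
    and act: "AE \<omega> in \<Omega>. 0 < S t \<omega> \<and> S t \<omega> < x2 \<longrightarrow> (\<forall>\<^sub>F h in at_right 0. left_lim (\<lambda>r. \<eta> r \<omega>) (t + h) - \<eta> t \<omega> \<le> K * h)"
  shows "no_first_order_gain Phi Xi x t u \<eta>"
proof -
  obtain C where C: "increment_bound C K" using increment_bound_exists[OF K] by blast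
  have main: "\<forall>\<^sub>F h in at_right 0. - e < (J x t (uh h) (\<xi>h h) - J_law Phi Xi x t) / h" if e: "0 < e" for e
  proof -
    \<comment> \<open>Chosen to make \<open>3 * C / l\<close> at most \<open>e / 2\<close>; the
      added 1 keeps \<open>l\<close> positive when \<open>C = 0\<close>.\<close>
    define l where "l = 6 * C / e + 1"
    have l: "0 < l" using increment_boundD(1)[OF C] e by (auto simp: l_def intro!: add_nonneg_pos)
    have "6 * C / e \<le> l" by (simp add: l_def)
    then have l2: "3 * C / l \<le> e / 2" using l e by (simp add: field_simps)
    let ?R = "\<lambda>h. expectation drift_rate + expectation curvature + expectation (discounting h)
      - C * l * expectation (bad K h) - 3 * C / l - ((\<delta> 1 + \<delta> 2) * M * h + 5 * C * sqrt h)"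
    let ?L = "expectation drift_rate + expectation curvature + expectation (\<lambda>\<omega>. if 0 < S t \<omega> then - DV (S t \<omega>) else 0)
      - C * l * 0 - 3 * C / l - ((\<delta> 1 + \<delta> 2) * M * 0 + 5 * C * sqrt 0)"
    have "(?R \<longlongrightarrow> ?L) (at_right 0)"
      by (intro tendsto_intros discounting_tendsto bad_tendsto[OF act])
    moreover have "- e < ?L" using generator_nonneg l2 e by simp
    ultimately have "\<forall>\<^sub>F h in at_right 0. - e < ?R h" by (rule order_tendstoD(1))
    moreover have "\<forall>\<^sub>F h in at_right (0::real). 0 < h \<and> h < 1"
      unfolding eventually_at_right_field by (intro exI[of _ 1]) auto
    ultimately show ?thesis using ev
    proof eventually_elim
      case (elim h)
      have h: "0 < h" "h < 1" using elim by auto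
      have "?R h \<le> (expectation (gain h) - V x) / h" by (rule expected_gain_lower[OF C h l])
      also have "\<dots> \<le> (J x t (uh h) (\<xi>h h) - J_law Phi Xi x t) / h"
        unfolding J_law_value(1)[OF x_nonneg t_nonneg] using J_ge_gain[OF h(1) less_imp_le[OF h(2)] elim(3)] h
        by (intro divide_right_mono) auto
      finally show ?case using elim(1) by simp
    qed
  qed
  show ?thesis
    unfolding no_first_order_gain_def le_Liminf_iff
  proof (intro allI impI)
    fix y :: ereal assume y: "y < 0"
    obtain e where e: "0 < e" "y \<le> ereal (- e)"
    proof (cases y)
      case (real r)
      then show ?thesis using y that[of "- r"] by simp
    next
      case MInf
      then show ?thesis using that[of 1] by simp
    qed (use y in simp)
    show "\<forall>\<^sub>F h in at_right 0. y < ereal ((J x t (uh h) (\<xi>h h) - J_law Phi Xi x t) / h)"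
      using main[OF e(1)] by eventually_elim (use e(2) in \<open>auto intro: le_less_trans\<close>)
  qed
qed

end

section \<open>Equilibria\<close>

lemma left_lim_mono:
  assumes g: "dividend_path t g" and ab: "t < a" "a < b"
  shows "left_lim g a \<le> left_lim g b"
proof -
  have mono: "mono_on {t..} g" and cl: "cadlag_from t g" using g by (auto simp: dividend_path_def)
  have "left_lim g a \<le> g a"
  proof (rule tendsto_upperbound[OF tendsto_at_right_left_limit[OF cl ab(1)]])
    show "\<forall>\<^sub>F r in at_left a. g r \<le> g a"
      unfolding eventually_at_left_field using mono ab by (intro exI[of _ t]) (auto simp: mono_on_def)
  qed simp
  also have "g a \<le> left_lim g b"
  proof (rule tendsto_lowerbound[OF tendsto_at_right_left_limit[OF cl]])
    show "t < b" using ab by simp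
    show "\<forall>\<^sub>F r in at_left b. g a \<le> g r"
      unfolding eventually_at_left_field using mono ab by (intro exI[of _ a]) (auto simp: mono_on_def)
  qed simp
  finally show ?thesis .
qed

context barrier_problem
begin

lemma surplus_left_limit:
  assumes Z: "continuous_on {t..} (\<lambda>r. controlled x t u r \<omega>)" and \<eta>: "dividend_path t (\<lambda>r. \<eta> r \<omega>)"
  shows "cadlag_from t (\<lambda>r. surplus (\<lambda>_. x) t u \<eta> r \<omega>)"
    and "t < r \<Longrightarrow> left_lim (\<lambda>r. surplus (\<lambda>_. x) t u \<eta> r \<omega>) r = controlled x t u r \<omega> - left_lim (\<lambda>r. \<eta> r \<omega>) r"
proof -
  have cl: "cadlag_from t (\<lambda>r. \<eta> r \<omega>)" using \<eta> by (simp add: dividend_path_def)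
  note zr = continuous_on_atLeast_at_right[OF Z] and zl = continuous_on_atLeast_at_left[OF Z]
  have l: "((\<lambda>r. surplus (\<lambda>_. x) t u \<eta> r \<omega>) \<longlongrightarrow> controlled x t u r \<omega> - left_lim (\<lambda>r. \<eta> r \<omega>) r) (at_left r)" if "t < r" for r
    unfolding surplus_controlled by (rule tendsto_diff[OF zl[OF that] tendsto_at_right_left_limit[OF cl that]])
  show "cadlag_from t (\<lambda>r. surplus (\<lambda>_. x) t u \<eta> r \<omega>)"
    unfolding cadlag_from_def
  proof (intro conjI allI impI)
    fix r assume r: "t \<le> r"
    have e: "((\<lambda>r. \<eta> r \<omega>) \<longlongrightarrow> \<eta> r \<omega>) (at_right r)" using cl r by (simp add: cadlag_from_def)
    show "((\<lambda>r. surplus (\<lambda>_. x) t u \<eta> r \<omega>) \<longlongrightarrow> surplus (\<lambda>_. x) t u \<eta> r \<omega>) (at_right r)"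
      unfolding surplus_controlled by (rule tendsto_diff[OF zr[OF r] e])
  next
    fix r assume "t < r"
    then show "\<exists>l. ((\<lambda>r. surplus (\<lambda>_. x) t u \<eta> r \<omega>) \<longlongrightarrow> l) (at_left r)" using l by blast
  qed
  show "left_lim (\<lambda>r. surplus (\<lambda>_. x) t u \<eta> r \<omega>) r = controlled x t u r \<omega> - left_lim (\<lambda>r. \<eta> r \<omega>) r" if "t < r"
    by (rule left_lim_eq[OF l[OF that]])
qed

text \<open>A payment not exceeding the surplus just before it cannot carry the path across 0, which
  is the jump condition of \<open>nonneg_before_exit\<close>; reaching 0 otherwise is ruin.\<close>

lemma covered_surplus_nonneg:
  assumes t: "0 \<le> t" and u: "effort_process t u" and \<eta>: "dividend_process t \<eta>"
    and jumps: "jumps_covered x t (surplus (\<lambda>_. x) t u \<eta>) \<eta>"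
  shows "AE \<omega> in \<Omega>. \<forall>r\<in>lifetime t (surplus (\<lambda>_. x) t u \<eta>) \<omega>. 0 \<le> surplus (\<lambda>_. x) t u \<eta> r \<omega>"
proof -
  let ?S = "surplus (\<lambda>_. x) t u \<eta>"
  have AE\<eta>: "AE \<omega> in \<Omega>. dividend_path t (\<lambda>r. \<eta> r \<omega>)" using \<eta> by (simp add: dividend_process_def)
  show ?thesis
    using AE\<eta> B_continuous AE_space jumps[unfolded jumps_covered_def]
  proof eventually_elim
    case (elim \<omega>)
    have Z: "continuous_on {t..} (\<lambda>r. controlled x t u r \<omega>)"
      by (rule controlled_continuous[OF u elim(3) t less_imp_le[OF \<mu>_pos] elim(2)])
    note S = surplus_left_limit[of t x u \<omega> \<eta>, OF Z elim(1)]
    show ?case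
    proof
      fix b assume b: "b \<in> lifetime t ?S \<omega>"
      then have tb: "t \<le> b" by (simp add: lifetime_def)
      have "\<forall>r\<in>{t..b}. 0 \<le> ?S r \<omega>"
      proof (rule nonneg_before_exit[OF S(1) _ _ _ tb])
        show "0 \<le> ?S t \<omega>" using elim(4) by (simp add: surplus_controlled controlled_def drift_start)
        show "?S r \<omega> \<noteq> 0" if "t \<le> r" "r < b" for r
        proof (rule before_ruin_nonzero[of t r ?S \<omega>, OF that(1)])
          have "ereal r < ereal b" using that by simp
          also have "\<dots> \<le> ruin_time t ?S \<omega>" using b by (simp add: lifetime_def)
          finally show "ereal r < ruin_time t ?S \<omega>" .
        qed
        fix r assume r: "t < r" "r \<le> b"
        have "ereal r \<le> ereal b" using r by simp
        also have "\<dots> \<le> ruin_time t ?S \<omega>" using b by (simp add: lifetime_def)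
        finally have "r \<in> lifetime t ?S \<omega>" using r by (simp add: lifetime_def)
        then have "\<eta> r \<omega> - left_lim (\<lambda>s. \<eta> s \<omega>) r \<le> left_lim (\<lambda>s. ?S s \<omega>) r" using elim(4) r by blast
        then show "0 \<le> ?S r \<omega>" unfolding S(2)[OF r(1)] by (simp add: surplus_controlled)
      qed
      then show "0 \<le> ?S b \<omega>" using tb by simp
    qed
  qed
qed

text \<open>The bound is given almost surely for each \<open>h\<close> separately, with uncountably
  many null sets. Only rational \<open>h\<close> are used; a violation at some \<open>h\<close>
  would persist at a slightly larger rational, as left limits are monotone and the inequality is
  strict.\<close>

lemma growth_bounded_pathwise:
  assumes \<eta>: "dividend_process t \<eta>" and h0: "0 < h0" and K: "0 < K" and g: "\<forall>h\<in>{0<..<h0}. growth_bounded t \<eta> K h"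
  shows "AE \<omega> in \<Omega>. \<forall>\<^sub>F h in at_right 0. left_lim (\<lambda>r. \<eta> r \<omega>) (t + h) - \<eta> t \<omega> \<le> K * h"
proof -
  have "AE \<omega> in \<Omega>. \<forall>q::rat. of_rat q \<in> {0<..<h0} \<longrightarrow> left_lim (\<lambda>r. \<eta> r \<omega>) (t + of_rat q) - \<eta> t \<omega> \<le> K * of_rat q"
    unfolding AE_all_countable using g by (auto simp: growth_bounded_def)
  moreover have "AE \<omega> in \<Omega>. dividend_path t (\<lambda>r. \<eta> r \<omega>)" using \<eta> by (simp add: dividend_process_def)
  ultimately show ?thesis
  proof eventually_elim
    case (elim \<omega>)
    have "left_lim (\<lambda>r. \<eta> r \<omega>) (t + h) - \<eta> t \<omega> \<le> K * h" if h: "0 < h" "h < h0" for h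
    proof (rule ccontr)
      let ?d = "left_lim (\<lambda>r. \<eta> r \<omega>) (t + h) - \<eta> t \<omega>"
      assume "\<not> ?d \<le> K * h"
      then have "h < ?d / K" using K by (simp add: pos_less_divide_eq mult.commute)
      then obtain q :: rat where q: "h < of_rat q" "of_rat q < min h0 (?d / K)"
        using of_rat_dense[of h "min h0 (?d / K)"] h by auto
      have "?d \<le> left_lim (\<lambda>r. \<eta> r \<omega>) (t + of_rat q) - \<eta> t \<omega>"
        using left_lim_mono[OF elim(2), of "t + h" "t + of_rat q"] h q by simp
      also have "\<dots> \<le> K * of_rat q"
      proof -
        have "0 < real_of_rat q" using h q by linarith
        then have "real_of_rat q \<in> {0<..<h0}" using q unfolding greaterThanLessThan_iff by linarith
        then show ?thesis using elim(1) by blast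
      qed
      also have "\<dots> < ?d" using q(2) K by (simp add: pos_less_divide_eq mult.commute)
      finally show False by simp
    qed
    then show ?case unfolding eventually_at_right_field using h0 by auto
  qed
qed

lemma deviationI:
  assumes "0 \<le> x" "0 \<le> t" "effort_process t u" "dividend_process t \<eta>"
    and "AE \<omega> in \<Omega>. \<forall>r\<in>lifetime t (surplus (\<lambda>_. x) t u \<eta>) \<omega>. 0 \<le> surplus (\<lambda>_. x) t u \<eta> r \<omega>"
  shows "deviation \<mu> \<sigma> M c x2 w \<delta> \<Omega> F B x t u \<eta> (surplus (\<lambda>_. x) t u \<eta>)"
  using assms by (intro deviation.intro deviation_axioms.intro barrier_problem_axioms) auto

lemma covered_no_gain:
  assumes x: "0 \<le> x" and t: "0 \<le> t" and u: "effort_process t u" and \<eta>: "dividend_process t \<eta>"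
    and jumps: "jumps_covered x t (surplus (\<lambda>_. x) t u \<eta>) \<eta>"
    and g: "0 < h0" "0 < K" "\<forall>h\<in>{0<..<h0}. growth_bounded t \<eta> K h"
    and int: "\<forall>\<^sub>F h in at_right 0. perturbed_integrable Phi Xi x t u \<eta> h"
  shows "no_first_order_gain Phi Xi x t u \<eta>"
  by (rule deviation.no_gain[OF deviationI[OF x t u \<eta> covered_surplus_nonneg[OF t u \<eta> jumps]] int less_imp_le[OF g(2)]])
     (use growth_bounded_pathwise[OF \<eta> g] in eventually_elim, simp)

lemma law_equilibrium: "equilibrium_law Phi Xi"
  unfolding equilibrium_law_def
proof (intro conjI law_admissible ballI, clarify)
  fix x t u \<eta> assume xt: "(x, t) \<in> state_space" and p: "(u, \<eta>) \<in> perturbation_pairs Phi Xi x t"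
  obtain h0 K where hK: "0 < h0" "0 < K" "\<forall>h\<in>{0<..<h0}. growth_bounded t \<eta> K h \<and> perturbed_integrable Phi Xi x t u \<eta> h"
    using p unfolding perturbation_pairs_def by blast
  have a: "effort_process t u" "dividend_process t \<eta>" "jumps_covered x t (surplus (\<lambda>_. x) t u \<eta>) \<eta>"
    using p unfolding perturbation_pairs_def admissible_pairs_def by blast+
  have "\<forall>\<^sub>F h in at_right 0. perturbed_integrable Phi Xi x t u \<eta> h"
    unfolding eventually_at_right_field using hK by auto
  then show "no_first_order_gain Phi Xi x t u \<eta>"
    using covered_no_gain[OF _ _ a hK(1,2)] xt hK(3) by (simp add: state_space_def)
qed

text \<open>No growth bound is available here. Instead, from a start strictly between 0 and
  \<open>x2\<close> the path stays below the barrier for a while and the reflecting dividend is 0,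
  so \<open>K = 0\<close> works. At the barrier itself \<open>no_gain\<close> asks for
  nothing.\<close>

lemma reflected_no_gain:
  assumes x: "0 \<le> x" and t: "0 \<le> t" and u: "effort_process t u" and R: "reflected_solution Xi (\<lambda>_. x) t u X \<eta>"
    and int: "\<forall>\<^sub>F h in at_right 0. perturbed_integrable Phi Xi x t u \<eta> h"
  shows "no_first_order_gain Phi Xi x t u \<eta>"
proof -
  let ?S = "surplus (\<lambda>_. x) t u \<eta>"
  have \<eta>: "dividend_process t \<eta>" using R by (simp add: reflected_solution_def)
  have sol: "AE \<omega> in \<Omega>. cadlag_from t (\<lambda>r. X r \<omega>) \<and> (\<forall>r\<in>lifetime t X \<omega>. X r \<omega> = ?S r \<omega>)"
    using R by (simp add: reflected_solution_def strong_solution_def)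
  have refl: "AE \<omega> in \<Omega>. \<forall>r\<in>lifetime t X \<omega>. (X r \<omega>, r) \<in> closure (fst Xi) \<and>
      \<eta> r \<omega> = (LINT l:{t..r}|stieltjes t (\<lambda>s. \<eta> s \<omega>). indicator (snd Xi) (X l \<omega>, l))"
    using R by (simp add: reflected_solution_def)
  have nn: "AE \<omega> in \<Omega>. \<forall>r\<in>lifetime t ?S \<omega>. 0 \<le> ?S r \<omega>"
    using sol refl reflected_surplus_ruin[OF R]
  proof eventually_elim
    case (elim \<omega>)
    have L: "lifetime t ?S \<omega> = lifetime t X \<omega>" by (rule lifetime_cong[OF elim(3)])
    show ?case
    proof
      fix r assume "r \<in> lifetime t ?S \<omega>"
      then have r: "r \<in> lifetime t X \<omega>" unfolding L .
      then have "(X r \<omega>, r) \<in> {0..x2} \<times> {0..}" using elim(2) unfolding closure_barrier_strip[OF x2_pos] by blast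
      then show "0 \<le> ?S r \<omega>" using elim(1) r by auto
    qed
  qed
  have "AE \<omega> in \<Omega>. 0 < ?S t \<omega> \<and> ?S t \<omega> < x2 \<longrightarrow> (\<forall>\<^sub>F h in at_right 0. left_lim (\<lambda>r. \<eta> r \<omega>) (t + h) - \<eta> t \<omega> \<le> 0 * h)"
    using sol refl
  proof eventually_elim
    case (elim \<omega>)
    show ?case
    proof
      assume z: "0 < ?S t \<omega> \<and> ?S t \<omega> < x2"
      have Xt: "X t \<omega> = ?S t \<omega>" by (rule bspec[OF conjunct2[OF elim(1)] start_in_lifetime])
      have rc: "((\<lambda>r. X r \<omega>) \<longlongrightarrow> X t \<omega>) (at_right t)" using elim(1) by (simp add: cadlag_from_def)
      have "\<forall>\<^sub>F r in at_right t. 0 < X r \<omega> \<and> X r \<omega> < x2"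
        using order_tendstoD[OF rc] z unfolding Xt by (intro eventually_conj) simp_all
      then obtain e where e: "t < e" "\<And>r. t < r \<Longrightarrow> r < e \<Longrightarrow> 0 < X r \<omega> \<and> X r \<omega> < x2"
        unfolding eventually_at_right_field by auto
      have X: "0 < X r \<omega> \<and> X r \<omega> < x2" if "t \<le> r" "r < e" for r
        using e(2)[of r] z Xt that by (cases "r = t") auto
      have life: "r \<in> lifetime t X \<omega>" if "t \<le> r" "r < e" for r
      proof -
        have "ereal r \<le> ruin_time t X \<omega>"
        proof (rule ruin_time_greatest)
          fix s assume "t \<le> s" "X s \<omega> = 0"
          then show "r \<le> s" using X[of s] that by (cases "s < e") auto
        qed
        then show ?thesis using that by (simp add: lifetime_def)
      qed
      have \<eta>0: "\<eta> r \<omega> = 0" if "t \<le> r" "r < e" for r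
      proof -
        have "\<eta> r \<omega> = (LINT l:{t..r}|stieltjes t (\<lambda>s. \<eta> s \<omega>). indicator (snd Xi) (X l \<omega>, l))"
          using elim(2) life[OF that] by blast
        also have "\<dots> = (LINT l|stieltjes t (\<lambda>s. \<eta> s \<omega>). 0)"
          unfolding set_lebesgue_integral_def
        proof (rule Bochner_Integration.integral_cong[OF HOL.refl])
          fix l show "indicator {t..r} l *\<^sub>R indicator (snd Xi) (X l \<omega>, l) = (0::real)"
            using X[of l] that by (auto simp: indicator_def)
        qed
        finally show ?thesis by simp
      qed
      have "left_lim (\<lambda>r. \<eta> r \<omega>) (t + h) = 0" if "0 < h" "h < e - t" for h
      proof (rule left_lim_eq)
        have "\<forall>\<^sub>F r in at_left (t + h). \<eta> r \<omega> = 0"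
          unfolding eventually_at_left_field using \<eta>0 that by (intro exI[of _ t]) auto
        then show "((\<lambda>r. \<eta> r \<omega>) \<longlongrightarrow> 0) (at_left (t + h))" by (rule tendsto_eventually)
      qed
      then show "\<forall>\<^sub>F h in at_right 0. left_lim (\<lambda>r. \<eta> r \<omega>) (t + h) - \<eta> t \<omega> \<le> 0 * h"
        unfolding eventually_at_right_field using e(1) \<eta>0[of t] by (intro exI[of _ "e - t"]) auto
    qed
  qed
  then show ?thesis
    by (rule deviation.no_gain[OF deviationI[OF x t u \<eta> nn] int order_refl])
qed

text \<open>Zero effort is an admissible effort process, so this reduces to
  \<open>covered_no_gain\<close> once the jump condition is moved from the solution \<open>X\<close>
  to \<open>surplus\<close>; their left limits agree because the two coincide up to ruin.\<close>

lemma solution_no_gain: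
  assumes x: "0 \<le> x" and t: "0 \<le> t" and \<eta>: "dividend_process t \<eta>"
    and g: "0 < h0" "0 < K" "\<forall>h\<in>{0<..<h0}. growth_bounded t \<eta> K h"
    and sol: "strong_solution (\<lambda>_. x) t (feedback Phi X) \<eta> X" and jumps: "jumps_covered x t X \<eta>"
    and int: "\<forall>\<^sub>F h in at_right 0. perturbed_integrable Phi Xi x t (feedback Phi X) \<eta> h"
  shows "no_first_order_gain Phi Xi x t (feedback Phi X) \<eta>"
proof (rule covered_no_gain[OF x t _ \<eta> _ g int])
  let ?S = "surplus (\<lambda>_. x) t (feedback Phi X) \<eta>"
  show "effort_process t (feedback Phi X)"
    using M_pos by (simp add: effort_process_def progressive_from_def feedback_def case_prod_beta)
  have "AE \<omega> in \<Omega>. cadlag_from t (\<lambda>r. X r \<omega>) \<and> (\<forall>r\<in>lifetime t X \<omega>. X r \<omega> = ?S r \<omega>)"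
    using sol by (simp add: strong_solution_def)
  then show "jumps_covered x t ?S \<eta>"
    using jumps unfolding jumps_covered_def
  proof eventually_elim
    case (elim \<omega>)
    have "ruin_time t ?S \<omega> = ruin_time t X \<omega>"
      by (rule ruin_time_cong) (use elim(1) in \<open>auto simp: cadlag_from_def\<close>)
    then have L: "lifetime t ?S \<omega> = lifetime t X \<omega>" by (rule lifetime_cong)
    have "left_lim (\<lambda>s. ?S s \<omega>) r = left_lim (\<lambda>s. X s \<omega>) r" if r: "r \<in> lifetime t X \<omega>" "t < r" for r
    proof (rule left_lim_eq)
      have "X s \<omega> = ?S s \<omega>" if s: "t < s" "s < r" for s
      proof -
        have "ereal s \<le> ereal r" using s by simp
        also have "\<dots> \<le> ruin_time t X \<omega>" using r by (simp add: lifetime_def)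
        finally show ?thesis using elim(1) s by (simp add: lifetime_def)
      qed
      then have "\<forall>\<^sub>F s in at_left r. X s \<omega> = ?S s \<omega>"
        unfolding eventually_at_left_field using r by (intro exI[of _ t]) auto
      then show "((\<lambda>s. ?S s \<omega>) \<longlongrightarrow> left_lim (\<lambda>s. X s \<omega>) r) (at_left r)"
        by (rule tendsto_cong[THEN iffD1, OF _ tendsto_at_right_left_limit[OF conjunct1[OF elim(1)] r(2)]])
    qed
    then show ?case using elim(2) unfolding L by simp
  qed
qed

lemma law_mild_equilibrium: "mild_equilibrium_law Phi Xi"
  unfolding mild_equilibrium_law_def
proof (intro conjI law_admissible ballI, clarify, intro conjI allI impI)
  fix x t u X \<eta> assume "(x, t) \<in> state_space" "effort_process t u" "reflected_solution Xi (\<lambda>_. x) t u X \<eta>"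
    "\<forall>\<^sub>F h in at_right 0. perturbed_integrable Phi Xi x t u \<eta> h"
  then show "no_first_order_gain Phi Xi x t u \<eta>" by (intro reflected_no_gain) (auto simp: state_space_def)
next
  fix x t \<eta> X assume a: "(x, t) \<in> state_space" "dividend_process t \<eta>" and g: "\<exists>h0>0. \<exists>K>0. \<forall>h\<in>{0<..<h0}. growth_bounded t \<eta> K h"
    and b: "strong_solution (\<lambda>_. x) t (feedback Phi X) \<eta> X" "jumps_covered x t X \<eta>"
    "\<forall>\<^sub>F h in at_right 0. perturbed_integrable Phi Xi x t (feedback Phi X) \<eta> h"
  from g obtain h0 K where hK: "0 < h0" "0 < K" "\<forall>h\<in>{0<..<h0}. growth_bounded t \<eta> K h" by blast
  have "0 \<le> x" "0 \<le> t" using a(1) by (simp_all add: state_space_def)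
  then show "no_first_order_gain Phi Xi x t (feedback Phi X) \<eta>" by (rule solution_no_gain[OF _ _ a(2) hK b])
qed

end

theorem proposition5p5:
  fixes \<Omega> :: "'w measure" and F :: "real \<Rightarrow> 'w measure" and B :: "real \<Rightarrow> 'w \<Rightarrow> real"
    and \<mu> \<sigma> M c x2 :: real and w \<delta> :: "nat \<Rightarrow> real"
    and \<beta> V :: "real \<Rightarrow> real" and f :: "real \<Rightarrow> real \<Rightarrow> real \<Rightarrow> real"
    and \<Phi> :: "real \<Rightarrow> real \<Rightarrow> real" and \<Xi> :: "(real \<times> real) set \<times> (real \<times> real) set"
  assumes space: "brownian_filtered_space \<Omega> F B"
    and "\<mu> > 0" and "\<sigma> > 0" and "M > 0" and "0 < c" and "c < 1"
    and "w 1 > 0" and "w 2 > 0" and "w 1 + w 2 = 1"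
    and "0 < \<delta> 1" and "\<delta> 1 < \<delta> 2"
    and beta: "\<beta> = (\<lambda>t. \<Sum>i=1..2. w i * exp (- \<delta> i * t))"
    and x2: "x2 = (THE x. 0 < x \<and> barrier_equation \<mu> \<sigma> c w \<delta> x)"
    and c_le: "c \<le> 1 / (\<Sum>i=1..2. w i *
                 ((theta3 \<mu> \<sigma> (\<delta> i) + theta4 \<mu> \<sigma> (\<delta> i)) / slope_term \<mu> \<sigma> (\<delta> i) x2))"
    and f: "f = (\<lambda>x t s. \<Sum>i=1..2. w i * exp (- \<delta> i * (t - s)) *
                   exponential_value \<mu> \<sigma> c x2 (\<delta> i) x)"
    and V: "V = (\<lambda>x. \<Sum>i=1..2. w i * exponential_value \<mu> \<sigma> c x2 (\<delta> i) x)"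
    and Phi: "\<Phi> = (\<lambda>x t. 0)"
    and Xi: "\<Xi> = ({0..<x2} \<times> {0..}, {x2..} \<times> {0..})"
  shows "(\<exists>!x. 0 < x \<and> barrier_equation \<mu> \<sigma> c w \<delta> x) \<and>
    extended_HJB \<mu> \<sigma> M c \<beta> x2 \<Phi> (\<lambda>x t. V x) f \<and>
    strict_antimono_on {0..} V \<and> convex_on {0..} V \<and>
    effort_dividend.equilibrium_law \<Omega> F B \<mu> \<sigma> M c \<beta> \<Phi> \<Xi> \<and>
    (\<forall>x\<ge>0. \<forall>t\<ge>0. V x = effort_dividend.J_law \<Omega> F B \<mu> \<sigma> c \<beta> \<Phi> \<Xi> x t) \<and>
    effort_dividend.mild_equilibrium_law \<Omega> F B \<mu> \<sigma> M c \<beta> \<Phi> \<Xi>"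
proof -
  have pos: "0 < \<sigma>" "0 < \<mu>" "0 < c" "0 < w 1" "0 < w 2" "0 < \<delta> 1" "0 < \<delta> 2" using assms by auto
  note ex = barrier_unique[of \<sigma> \<mu> c w \<delta>, OF pos]
  have z: "0 < x2 \<and> barrier_equation \<mu> \<sigma> c w \<delta> x2" unfolding x2 by (rule theI'[OF ex])
  let ?s = "\<Sum>i=1..2. w i * ((theta3 \<mu> \<sigma> (\<delta> i) + theta4 \<mu> \<sigma> (\<delta> i)) / slope_term \<mu> \<sigma> (\<delta> i) x2)"
  \<comment> \<open>Clearing the denominator in \<open>c_le\<close> needs a positive sum; for a
    nonpositive one the product is at most 0 anyway.\<close>
  have "c * ?s \<le> 1"
  proof (cases "0 < ?s")
    case True
    then show ?thesis using c_le by (simp only: pos_le_divide_eq)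
  next
    case False
    then have "c * ?s \<le> 0" using pos(3) by (intro mult_nonneg_nonpos) auto
    then show ?thesis by linarith
  qed
  then have "barrier_model \<mu> \<sigma> M c x2 w \<delta>" using assms pos z by (intro barrier_model.intro) auto
  then interpret barrier_problem \<mu> \<sigma> M c x2 w \<delta> \<Omega> F B
    by (rule barrier_problem.intro[OF _ effort_dividend.intro[OF space]])
  have V': "V = barrier_model.V \<mu> \<sigma> c x2 w \<delta>" unfolding V V_def sum_1_2 ..
  show ?thesis
    unfolding Phi Xi beta
    using ex HJB_solution[OF HOL.refl f] V_strict_antimono V_convex_on law_equilibrium law_mild_equilibrium J_law_value(1)
    unfolding V' by simp
qed

end
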